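(* Let $(\mathcal{R},\partial,\mathrm{Q})$ be a commutative quasi-integro-differential ring with ring of constants $\mathcal{C}$, and let $\mathrm{IDR}(\mathcal{R})$, $\mathrm{IDR}_{\mathrm{Q}}(\mathcal{R})$, their maps $\partial,\int$, and the maps $\iota$ from $\mathcal{R}$ into each of them be as defined in the context. Then: 1. $(\mathrm{IDR}_{\mathrm{Q}}(\mathcal{R}),\partial,\int)$ is a commutative integro-differential ring. 2. $\iota:\mathcal{R}\to\mathrm{IDR}_{\mathrm{Q}}(\mathcal{R})$, $\iota(f)=f\otimes1\otimes1\otimes1_{\mathcal{T}}$, is an injective differential ring homomorphism such that $\int\iota(f)=\iota(\mathrm{Q}f)$ holds for all $f\in\partial\mathcal{R}$. 3. Let $J_1\subseteq\mathrm{IDR}(\mathcal{R})$ be the integro-differential ideal generated by $\mathcal{C}\otimes\varepsilon(\mathrm{Q}\partial\mathcal{R})\otimes\mathcal{C}\otimes\mathcal{C}1_{\mathcal{T}}$. Then there is a unique bijective integro-differential ring homomorphism $\psi:\mathrm{IDR}(\mathcal{R})/J_1\to\mathrm{IDR}_{\mathrm{Q}}(\mathcal{R})$ such that $\psi(\pi(\iota(f)))=\iota(f)$ for all $f\in\mathcal{R}$, where $\pi:\mathrm{IDR}(\mathcal{R})\to\mathrm{IDR}(\mathcal{R})/J_1$ is the canonical projection.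
   Context: Rings and algebras have a unit, homomorphisms preserve it. A differential ring is a ring with an additive map $\partial$ satisfying the Leibniz rule; its ring of constants is $\ker\partial$. An integro-differential ring $(\mathcal{S},\partial,\int)$ is a differential ring with a $\ker(\partial)$-linear map $\int:\mathcal{S}\to\mathcal{S}$ such that $\partial\int=\mathrm{id}$. Differential (integro-differential) ring homomorphisms are ring homomorphisms commuting with $\partial$ (with $\partial$ and $\int$). An integro-differential ideal is an ideal closed under $\partial$ and $\int$; quotients by such ideals are again integro-differential rings. A commutative quasi-integro-differential ring $(\mathcal{R},\partial,\mathrm{Q})$ is a commutative differential ring with constants $\mathcal{C}=\ker\partial$ and a $\mathcal{C}$-linear $\mathrm{Q}:\mathcal{R}\to\mathcal{R}$ (a quasi-integration) with $\partial\mathrm{Q}\partial=\partial$ and $\mathrm{Q}\partial\mathrm{Q}=\mathrm{Q}$. All tensor and symmetric products are over $\mathcal{C}$. Put $\mathcal{R}_{\mathrm{J}}=\mathrm{Q}\mathcal{R}=\mathrm{Q}\partial\mathcal{R}$ and $\mathcal{R}_{\mathrm{T}}=\ker\mathrm{Q}$, so $\mathcal{R}=\mathcal{C}\oplus\mathcal{R}_{\mathrm{J}}=(\partial\mathcal{R})\oplus\mathcal{R}_{\mathrm{T}}$. Tensors: $\mathcal{T}=\bigoplus_{n\ge0}\mathcal{R}_{\mathrm{T}}^{\otimes n}$ with empty tensor $1_{\mathcal{T}}$; $\widetilde{\mathcal{T}}=\bigoplus_{n\ge1}\mathcal{R}_{\mathrm{T}}^{\otimes n}$. The shuffle product $\sqcup\!\sqcup$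 on $\mathcal{T}$ is the $\mathcal{C}$-bilinear product with $t\sqcup\!\sqcup s=t\otimes s$ if $t$ or $s$ has length $0$ and $t\sqcup\!\sqcup s=t_1\otimes((t_2\otimes\dots\otimes t_n)\sqcup\!\sqcup s)+s_1\otimes(t\sqcup\!\sqcup(s_2\otimes\dots\otimes s_m))$ for pure tensors of lengths $n,m\ge1$. For a pure tensor $f=f_1\otimes\dots\otimes f_n$, $f_i^j:=f_i\otimes\dots\otimes f_j$, and $f_i^j=1_{\mathcal{T}}$ if $i=j+1$. Constants: $M_1=\mathcal{R}_{\mathrm{J}}\otimes\mathcal{T}$, $\widetilde{M}_1=\mathcal{R}_{\mathrm{J}}\otimes\widetilde{\mathcal{T}}\subseteq M_1$, $M_2=\widetilde{\mathcal{T}}^{\odot2}$ (symmetric square). $\varepsilon(\cdot)$ denotes isomorphic copies of these modules, with isomorphisms $\varepsilon$; for $r\in\mathcal{R}_{\mathrm{J}}$, $\varepsilon(r)$ means $\varepsilon(r\otimes1_{\mathcal{T}})\in\varepsilon(M_1)$. $\mathcal{C}_1=\mathrm{Sym}(\varepsilon(M_1))$, $\widetilde{\mathcal{C}}_1=\mathrm{Sym}(\varepsilon(\widetilde{M}_1))$ and $\mathcal{C}_2=\mathrm{Sym}(\varepsilon(M_2))/J_2$ (unital symmetric $\mathcal{C}$-algebras), where $J_2$ is the ideal generated by all $$\varepsilon((f\sqcup\!\sqcup g)\odot h)-\varepsilon(f\odot(g\sqcup\!\sqcup h))+\sum_{j=0}^{m-1}\Big(\sum_{i=\max(0,1-j)}^{n-1}\varepsilon(f_{i+1}^n\odot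 g_{j+1}^m)\cdot\varepsilon((f_1^i\sqcup\!\sqcup g_1^j)\odot h)-\sum_{k=\max(0,1-j)}^{l-1}\varepsilon(f\odot(g_1^j\sqcup\!\sqcup h_1^k))\cdot\varepsilon(g_{j+1}^m\odot h_{k+1}^l)\Big)$$ for $n,m,l\ge1$ and pure tensors $f\in\mathcal{R}_{\mathrm{T}}^{\otimes n}$, $g\in\mathcal{R}_{\mathrm{T}}^{\otimes m}$, $h\in\mathcal{R}_{\mathrm{T}}^{\otimes l}$. Elements $\varepsilon(\cdot)$ of $\mathcal{C}_2$ denote classes. Product on $\mathcal{C}_2\otimes\mathcal{T}$: the $\mathcal{C}$-bilinear map with, for $c,d\in\mathcal{C}_2$ and pure tensors $f,g$ of lengths $n,m\ge0$, $$(c\otimes f)\cdot(d\otimes g)=(c\cdot d)\otimes(f\sqcup\!\sqcup g)+\sum_{i=0}^{n-1}\sum_{j=0}^{m-1}\big(c\cdot d\cdot\varepsilon(f_{i+1}^n\odot g_{j+1}^m)\big)\otimes(f_1^i\sqcup\!\sqcup g_1^j);$$ this makes $\mathcal{C}_2\otimes\mathcal{T}$ a commutative $\mathcal{C}$-algebra with unit $1\otimes1_{\mathcal{T}}$. $\mathrm{IDR}(\mathcal{R}):=\mathcal{R}\otimes\mathcal{C}_1\otimes\mathcal{C}_2\otimes\mathcal{T}$ and $\mathrm{IDR}_{\mathrm{Q}}(\mathcal{R}):=\mathcal{R}\otimes\widetilde{\mathcal{C}}_1\otimes\mathcal{C}_2\otimes\mathcal{T}$ are the tensor products of the commutative $\mathcal{C}$-algebras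 $\mathcal{R}$, $\mathcal{C}_1$ (resp. $\widetilde{\mathcal{C}}_1$) and $\mathcal{C}_2\otimes\mathcal{T}$; in both, $\iota(f)=f\otimes1\otimes1\otimes1_{\mathcal{T}}$ for $f\in\mathcal{R}$. Let $f_0\in\mathcal{R}$, $c=c_1\otimes c_2$ with $c_2\in\mathcal{C}_2$ and $c_1\in\mathcal{C}_1$ (resp. $c_1\in\widetilde{\mathcal{C}}_1$), and $f\in\mathcal{R}_{\mathrm{T}}^{\otimes n}$ a pure tensor. In both algebras $\partial$ is the $\mathcal{C}$-linear map with $\partial(f_0\otimes c\otimes f)=(\partial f_0)\otimes c\otimes f$ if $n=0$ and $(\partial f_0)\otimes c\otimes f+(f_0f_1)\otimes c\otimes f_2^n$ if $n>0$. In both algebras $\int$ is the $\mathcal{C}$-linear map given for $n>0$ recursively by $\int(f_0\otimes c\otimes f)=(\mathrm{Q}f_0)\otimes c\otimes f-1\otimes(c_1\cdot\varepsilon((\mathrm{Q}f_0)\otimes f))\otimes c_2\otimes1_{\mathcal{T}}-\int(((\mathrm{Q}f_0)f_1)\otimes c\otimes f_2^n)+1\otimes c\otimes((f_0-\partial\mathrm{Q}f_0)\otimes f)$, and for $n=0$ by: in $\mathrm{IDR}(\mathcal{R})$, $\int(f_0\otimes c\otimes f)=(\mathrm{Q}f_0)\otimes c\otimes f-1\otimes(c_1\cdot\varepsilon(\mathrm{Q}f_0))\otimes c_2\otimes f+1\otimes c\otimes((f_0-\partial\mathrm{Q}f_0)\otimes f)$; in $\mathrm{IDR}_{\mathrm{Q}}(\mathcal{R})$,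 $\int(f_0\otimes c\otimes f)=(\mathrm{Q}f_0)\otimes c\otimes f+1\otimes c\otimes((f_0-\partial\mathrm{Q}f_0)\otimes f)$. $\mathrm{IDR}(\mathcal{R})$ with these maps is a commutative integro-differential ring. *)

theory Defs
  imports "HOL-Algebra.QuotRing" "HOL-Algebra.Module"
begin

section \<open>Commutative (quasi-)integro-differential rings\<close>

locale comm_differential_ring = cring R for R (structure) +
  fixes der :: "'a \<Rightarrow> 'a"
  assumes der_closed: "x \<in> carrier R \<Longrightarrow> der x \<in> carrier R"
    and der_add: "\<lbrakk>x \<in> carrier R; y \<in> carrier R\<rbrakk> \<Longrightarrow> der (x \<oplus> y) = der x \<oplus> der y"
    and der_mult: "\<lbrakk>x \<in> carrier R; y \<in> carrier R\<rbrakk>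
      \<Longrightarrow> der (x \<otimes> y) = der x \<otimes> y \<oplus> x \<otimes> der y"

definition constants :: "('a, 'e) ring_scheme \<Rightarrow> ('a \<Rightarrow> 'a) \<Rightarrow> 'a set" where
  "constants R der = {c \<in> carrier R. der c = \<zero>\<^bsub>R\<^esub>}"

locale comm_integro_differential_ring = comm_differential_ring R der for R (structure) and der +
  fixes itg :: "'a \<Rightarrow> 'a"
  assumes itg_closed: "x \<in> carrier R \<Longrightarrow> itg x \<in> carrier R"
    and itg_add: "\<lbrakk>x \<in> carrier R; y \<in> carrier R\<rbrakk> \<Longrightarrow> itg (x \<oplus> y) = itg x \<oplus> itg y"
    and itg_const: "\<lbrakk>c \<in> constants R der; x \<in> carrier R\<rbrakk> \<Longrightarrow> itg (c \<otimes> x) = c \<otimes> itg x"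
    and der_itg: "x \<in> carrier R \<Longrightarrow> der (itg x) = x"

locale comm_quasi_integro_differential_ring = comm_differential_ring R der
  for R (structure) and der +
  fixes Q :: "'a \<Rightarrow> 'a"
  assumes Q_closed: "x \<in> carrier R \<Longrightarrow> Q x \<in> carrier R"
    and Q_add: "\<lbrakk>x \<in> carrier R; y \<in> carrier R\<rbrakk> \<Longrightarrow> Q (x \<oplus> y) = Q x \<oplus> Q y"
    and Q_const: "\<lbrakk>c \<in> constants R der; x \<in> carrier R\<rbrakk> \<Longrightarrow> Q (c \<otimes> x) = c \<otimes> Q x"
    and der_Q_der: "x \<in> carrier R \<Longrightarrow> der (Q (der x)) = der x"
    and Q_der_Q: "x \<in> carrier R \<Longrightarrow> Q (der (Q x)) = Q x"

definition differential_hom ::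
    "('a, 'e) ring_scheme \<Rightarrow> ('a \<Rightarrow> 'a) \<Rightarrow> ('b, 'f) ring_scheme \<Rightarrow> ('b \<Rightarrow> 'b) \<Rightarrow> ('a \<Rightarrow> 'b) \<Rightarrow> bool" where
  "differential_hom R der S der' h \<longleftrightarrow>
     h \<in> ring_hom R S \<and> (\<forall>x\<in>carrier R. h (der x) = der' (h x))"

definition integro_differential_hom ::
    "('a, 'e) ring_scheme \<Rightarrow> ('a \<Rightarrow> 'a) \<Rightarrow> ('a \<Rightarrow> 'a) \<Rightarrow>
     ('b, 'f) ring_scheme \<Rightarrow> ('b \<Rightarrow> 'b) \<Rightarrow> ('b \<Rightarrow> 'b) \<Rightarrow> ('a \<Rightarrow> 'b) \<Rightarrow> bool" where
  "integro_differential_hom R der itg S der' itg' h \<longleftrightarrow>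
     differential_hom R der S der' h \<and> (\<forall>x\<in>carrier R. h (itg x) = itg' (h x))"

definition integro_differential_ideal ::
    "'a set \<Rightarrow> ('a, 'e) ring_scheme \<Rightarrow> ('a \<Rightarrow> 'a) \<Rightarrow> ('a \<Rightarrow> 'a) \<Rightarrow> bool" where
  "integro_differential_ideal I R der itg \<longleftrightarrow>
     ideal I R \<and> (\<forall>x\<in>I. der x \<in> I) \<and> (\<forall>x\<in>I. itg x \<in> I)"

definition integro_differential_ideal_gen ::
    "('a, 'e) ring_scheme \<Rightarrow> ('a \<Rightarrow> 'a) \<Rightarrow> ('a \<Rightarrow> 'a) \<Rightarrow> 'a set \<Rightarrow> 'a set" where
  "integro_differential_ideal_gen R der itg A =
     \<Inter>{I. integro_differential_ideal I R der itg \<and> A \<subseteq> I}"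

text \<open>
  Meaningful when \<open>h\<close> is additive and preserves \<open>I\<close>; then the coset of \<open>x\<close> goes to that of \<open>h x\<close>.
\<close>

definition induced_map :: "('a, 'e) ring_scheme \<Rightarrow> 'a set \<Rightarrow> ('a \<Rightarrow> 'a) \<Rightarrow> 'a set \<Rightarrow> 'a set" where
  "induced_map R I h X = (\<Union>x\<in>X. I +>\<^bsub>R\<^esub> h x)"


section \<open>Multilinear algebra over a commutative ring\<close>

definition mod_hom ::
    "('c, 'e) ring_scheme \<Rightarrow> ('c, 'm) module \<Rightarrow> ('c, 'p) module \<Rightarrow> ('m \<Rightarrow> 'p) set" where
  "mod_hom C M P = {h \<in> carrier M \<rightarrow> carrier P.
     (\<forall>x\<in>carrier M. \<forall>y\<in>carrier M. h (x \<oplus>\<^bsub>M\<^esub> y) = h x \<oplus>\<^bsub>P\<^esub> h y) \<and>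
     (\<forall>c\<in>carrier C. \<forall>x\<in>carrier M. h (c \<odot>\<^bsub>M\<^esub> x) = c \<odot>\<^bsub>P\<^esub> h x)}"

definition mod_bihom ::
    "('c, 'e) ring_scheme \<Rightarrow> ('c, 'm) module \<Rightarrow> ('c, 'n) module \<Rightarrow> ('c, 'p) module \<Rightarrow>
     ('m \<Rightarrow> 'n \<Rightarrow> 'p) set" where
  "mod_bihom C M N P = {h.
     (\<forall>x\<in>carrier M. h x \<in> mod_hom C N P) \<and>
     (\<forall>y\<in>carrier N. (\<lambda>x. h x y) \<in> mod_hom C M P)}"

definition submodule_gen :: "('c, 'e) ring_scheme \<Rightarrow> ('c, 'm) module \<Rightarrow> 'm set \<Rightarrow> 'm set" where
  "submodule_gen C M A = \<Inter>{H. submodule H C M \<and> A \<subseteq> H}"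

text \<open>
  Only the module structure of a free module is used; its ring multiplication is left unspecified.
\<close>

definition free_mod :: "('c, 'e) ring_scheme \<Rightarrow> 's set \<Rightarrow> ('c, 's \<Rightarrow> 'c) module" where
  "free_mod C S =
     \<lparr>carrier = {f. (\<forall>s. f s \<in> carrier C) \<and> (\<forall>s. s \<notin> S \<longrightarrow> f s = \<zero>\<^bsub>C\<^esub>)
                    \<and> finite {s. f s \<noteq> \<zero>\<^bsub>C\<^esub>}},
      mult = undefined, one = undefined,
      zero = (\<lambda>s. \<zero>\<^bsub>C\<^esub>), add = (\<lambda>f g s. f s \<oplus>\<^bsub>C\<^esub> g s),
      smult = (\<lambda>c f s. c \<otimes>\<^bsub>C\<^esub> f s)\<rparr>"

definition free_gen :: "('c, 'e) ring_scheme \<Rightarrow> 's \<Rightarrow> 's \<Rightarrow> 'c" where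
  "free_gen C s = (\<lambda>t. if t = s then \<one>\<^bsub>C\<^esub> else \<zero>\<^bsub>C\<^esub>)"

text \<open>
  One construction serves for the quotient of a module by a submodule and for the quotient of an
  algebra by an ideal: apart from \<open>smult\<close>, the fields are those of \<open>M Quot N\<close>. In the former case
  the ring multiplication is irrelevant.
\<close>

definition quot_mod :: "('c, 'm) module \<Rightarrow> 'm set \<Rightarrow> ('c, 'm set) module" where
  "quot_mod M N =
     \<lparr>carrier = a_rcosets\<^bsub>M\<^esub> N, mult = rcoset_mult M N, one = N +>\<^bsub>M\<^esub> \<one>\<^bsub>M\<^esub>,
      zero = N, add = set_add M, smult = (\<lambda>c X. \<Union>x\<in>X. N +>\<^bsub>M\<^esub> (c \<odot>\<^bsub>M\<^esub> x))\<rparr>"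


subsection \<open>Tensor product of two modules\<close>

definition tensor_rel ::
    "('c, 'e) ring_scheme \<Rightarrow> ('c, 'm) module \<Rightarrow> ('c, 'n) module \<Rightarrow> ('m \<times> 'n \<Rightarrow> 'c) set" where
  "tensor_rel C M N =
    (let F = free_mod C (carrier M \<times> carrier N); \<delta> = (\<lambda>x y. free_gen C (x, y)) in
     submodule_gen C F
      ({\<delta> (x \<oplus>\<^bsub>M\<^esub> x') y \<ominus>\<^bsub>F\<^esub> (\<delta> x y \<oplus>\<^bsub>F\<^esub> \<delta> x' y) |x x' y.
          x \<in> carrier M \<and> x' \<in> carrier M \<and> y \<in> carrier N} \<union>
       {\<delta> x (y \<oplus>\<^bsub>N\<^esub> y') \<ominus>\<^bsub>F\<^esub> (\<delta> x y \<oplus>\<^bsub>F\<^esub> \<delta> x y') |x y y'.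
          x \<in> carrier M \<and> y \<in> carrier N \<and> y' \<in> carrier N} \<union>
       {\<delta> (c \<odot>\<^bsub>M\<^esub> x) y \<ominus>\<^bsub>F\<^esub> c \<odot>\<^bsub>F\<^esub> \<delta> x y |c x y.
          c \<in> carrier C \<and> x \<in> carrier M \<and> y \<in> carrier N} \<union>
       {\<delta> x (c \<odot>\<^bsub>N\<^esub> y) \<ominus>\<^bsub>F\<^esub> c \<odot>\<^bsub>F\<^esub> \<delta> x y |c x y.
          c \<in> carrier C \<and> x \<in> carrier M \<and> y \<in> carrier N}))"

definition tensor ::
    "('c, 'e) ring_scheme \<Rightarrow> ('c, 'm) module \<Rightarrow> ('c, 'n) module \<Rightarrow>
     ('c, ('m \<times> 'n \<Rightarrow> 'c) set) module" where
  "tensor C M N = quot_mod (free_mod C (carrier M \<times> carrier N)) (tensor_rel C M N)"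

definition tens ::
    "('c, 'e) ring_scheme \<Rightarrow> ('c, 'm) module \<Rightarrow> ('c, 'n) module \<Rightarrow> 'm \<Rightarrow> 'n \<Rightarrow>
     ('m \<times> 'n \<Rightarrow> 'c) set" where
  "tens C M N x y =
     tensor_rel C M N +>\<^bsub>free_mod C (carrier M \<times> carrier N)\<^esub> free_gen C (x, y)"

text \<open>
  Here and below, a linear or bilinear map prescribed on pure tensors is introduced as a choice among
  the (bi)linear maps with the prescribed values. The pure tensors generate the modules, so any two
  such maps agree on the carriers; values outside the carriers are immaterial.
\<close>

definition tensor_alg ::
    "('c, 'e) ring_scheme \<Rightarrow> ('c, 'm) module \<Rightarrow> ('c, 'n) module \<Rightarrow>
     ('c, ('m \<times> 'n \<Rightarrow> 'c) set) module" where
  "tensor_alg C A B = (tensor C A B)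
     \<lparr>mult := SOME p. p \<in> mod_bihom C (tensor C A B) (tensor C A B) (tensor C A B) \<and>
        (\<forall>a\<in>carrier A. \<forall>b\<in>carrier B. \<forall>a'\<in>carrier A. \<forall>b'\<in>carrier B.
           p (tens C A B a b) (tens C A B a' b') = tens C A B (a \<otimes>\<^bsub>A\<^esub> a') (b \<otimes>\<^bsub>B\<^esub> b')),
      one := tens C A B \<one>\<^bsub>A\<^esub> \<one>\<^bsub>B\<^esub>\<rparr>"


subsection \<open>Tensor algebra, symmetric algebra, symmetric square\<close>

text \<open>
  The direct sum of all tensor powers of \<open>M\<close>: the free module on all words over \<open>M\<close> modulo
  multilinearity. The relations are homogeneous in the word length, so this is the direct sum over
  \<open>n\<close> of the quotients for words of length \<open>n\<close>, and the empty word spans a copy of \<open>C\<close>.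
\<close>

definition tpower_rel :: "('c, 'e) ring_scheme \<Rightarrow> ('c, 'm) module \<Rightarrow> ('m list \<Rightarrow> 'c) set" where
  "tpower_rel C M =
    (let F = free_mod C (lists (carrier M)); \<delta> = free_gen C in
     submodule_gen C F
      ({\<delta> (u @ (x \<oplus>\<^bsub>M\<^esub> y) # v) \<ominus>\<^bsub>F\<^esub> (\<delta> (u @ x # v) \<oplus>\<^bsub>F\<^esub> \<delta> (u @ y # v)) |u v x y.
          u \<in> lists (carrier M) \<and> v \<in> lists (carrier M) \<and> x \<in> carrier M \<and> y \<in> carrier M} \<union>
       {\<delta> (u @ (c \<odot>\<^bsub>M\<^esub> x) # v) \<ominus>\<^bsub>F\<^esub> c \<odot>\<^bsub>F\<^esub> \<delta> (u @ x # v) |u v c x.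
          u \<in> lists (carrier M) \<and> v \<in> lists (carrier M) \<and> c \<in> carrier C \<and> x \<in> carrier M}))"

definition tpowers :: "('c, 'e) ring_scheme \<Rightarrow> ('c, 'm) module \<Rightarrow> ('c, ('m list \<Rightarrow> 'c) set) module" where
  "tpowers C M = quot_mod (free_mod C (lists (carrier M))) (tpower_rel C M)"

definition pure :: "('c, 'e) ring_scheme \<Rightarrow> ('c, 'm) module \<Rightarrow> 'm list \<Rightarrow> ('m list \<Rightarrow> 'c) set" where
  "pure C M w = tpower_rel C M +>\<^bsub>free_mod C (lists (carrier M))\<^esub> free_gen C w"

definition tensor_algebra ::
    "('c, 'e) ring_scheme \<Rightarrow> ('c, 'm) module \<Rightarrow> ('c, ('m list \<Rightarrow> 'c) set) module" where
  "tensor_algebra C M = (tpowers C M)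
     \<lparr>mult := SOME p. p \<in> mod_bihom C (tpowers C M) (tpowers C M) (tpowers C M) \<and>
        (\<forall>u\<in>lists (carrier M). \<forall>v\<in>lists (carrier M).
           p (pure C M u) (pure C M v) = pure C M (u @ v)),
      one := pure C M []\<rparr>"

definition tpowers_pos ::
    "('c, 'e) ring_scheme \<Rightarrow> ('c, 'm) module \<Rightarrow> ('c, ('m list \<Rightarrow> 'c) set) module" where
  "tpowers_pos C M = (tpowers C M)
     \<lparr>carrier := submodule_gen C (tpowers C M)
        {pure C M w |w. w \<in> lists (carrier M) \<and> w \<noteq> []}\<rparr>"

definition sym_ideal :: "('c, 'e) ring_scheme \<Rightarrow> ('c, 'm) module \<Rightarrow> ('m list \<Rightarrow> 'c) set set" where
  "sym_ideal C M =
    (let T = tensor_algebra C M in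
     Idl\<^bsub>T\<^esub> {pure C M [x] \<otimes>\<^bsub>T\<^esub> pure C M [y] \<ominus>\<^bsub>T\<^esub> pure C M [y] \<otimes>\<^bsub>T\<^esub> pure C M [x] |x y.
            x \<in> carrier M \<and> y \<in> carrier M})"

definition Sym ::
    "('c, 'e) ring_scheme \<Rightarrow> ('c, 'm) module \<Rightarrow> ('c, ('m list \<Rightarrow> 'c) set set) module" where
  "Sym C M = quot_mod (tensor_algebra C M) (sym_ideal C M)"

text \<open>
  The image of \<open>M\<close> under this embedding plays the role of the isomorphic copy \<open>\<epsilon>(M)\<close>, so no separate
  copy of \<open>M\<close> is introduced.
\<close>

definition sym_emb ::
    "('c, 'e) ring_scheme \<Rightarrow> ('c, 'm) module \<Rightarrow> 'm \<Rightarrow> ('m list \<Rightarrow> 'c) set set" where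
  "sym_emb C M x = sym_ideal C M +>\<^bsub>tensor_algebra C M\<^esub> pure C M [x]"

definition sym_square_rel ::
    "('c, 'e) ring_scheme \<Rightarrow> ('c, 'm) module \<Rightarrow> ('m \<times> 'm \<Rightarrow> 'c) set set" where
  "sym_square_rel C M =
     submodule_gen C (tensor C M M)
       {tens C M M x y \<ominus>\<^bsub>tensor C M M\<^esub> tens C M M y x |x y. x \<in> carrier M \<and> y \<in> carrier M}"

definition sym_square ::
    "('c, 'e) ring_scheme \<Rightarrow> ('c, 'm) module \<Rightarrow> ('c, ('m \<times> 'm \<Rightarrow> 'c) set set) module" where
  "sym_square C M = quot_mod (tensor C M M) (sym_square_rel C M)"

definition sym_tens ::
    "('c, 'e) ring_scheme \<Rightarrow> ('c, 'm) module \<Rightarrow> 'm \<Rightarrow> 'm \<Rightarrow> ('m \<times> 'm \<Rightarrow> 'c) set set" where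
  "sym_tens C M x y = sym_square_rel C M +>\<^bsub>tensor C M M\<^esub> tens C M M x y"


subsection \<open>Shuffle product\<close>

definition shuffle ::
    "('c, 'e) ring_scheme \<Rightarrow> ('c, 'm) module \<Rightarrow>
     ('m list \<Rightarrow> 'c) set \<Rightarrow> ('m list \<Rightarrow> 'c) set \<Rightarrow> ('m list \<Rightarrow> 'c) set" where
  "shuffle C M = (let T = tensor_algebra C M; p = pure C M in
     SOME s. s \<in> mod_bihom C T T T \<and>
       (\<forall>u\<in>lists (carrier M). s (p u) (p []) = p u \<otimes>\<^bsub>T\<^esub> p [] \<and> s (p []) (p u) = p [] \<otimes>\<^bsub>T\<^esub> p u) \<and>
       (\<forall>x\<in>carrier M. \<forall>u\<in>lists (carrier M). \<forall>y\<in>carrier M. \<forall>v\<in>lists (carrier M).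
          s (p (x # u)) (p (y # v)) =
            p [x] \<otimes>\<^bsub>T\<^esub> s (p u) (p (y # v)) \<oplus>\<^bsub>T\<^esub> p [y] \<otimes>\<^bsub>T\<^esub> s (p (x # u)) (p v)))"


section \<open>The integro-differential closures of a quasi-integro-differential ring\<close>

context
  fixes R :: "('a, 'e) ring_scheme" and der :: "'a \<Rightarrow> 'a" and Q :: "'a \<Rightarrow> 'a"
begin

definition const_ring :: "('a, 'e) ring_scheme" where
  "const_ring = R\<lparr>carrier := constants R der\<rparr>"

definition self_alg :: "('a, 'a) module" where
  "self_alg = \<lparr>carrier = carrier R, mult = mult R, one = \<one>\<^bsub>R\<^esub>, zero = \<zero>\<^bsub>R\<^esub>, add = add R,
               smult = mult R\<rparr>"

definition RJ :: "('a, 'a) module" where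
  "RJ = self_alg\<lparr>carrier := Q ` carrier R\<rparr>"

definition RT :: "('a, 'a) module" where
  "RT = self_alg\<lparr>carrier := {x \<in> carrier R. Q x = \<zero>\<^bsub>R\<^esub>}\<rparr>"

definition Tens :: "('a, ('a list \<Rightarrow> 'a) set) module" where
  "Tens = tpowers const_ring RT"

definition Tens_pos :: "('a, ('a list \<Rightarrow> 'a) set) module" where
  "Tens_pos = tpowers_pos const_ring RT"

abbreviation pt :: "'a list \<Rightarrow> ('a list \<Rightarrow> 'a) set" where
  "pt \<equiv> pure const_ring RT"

abbreviation sh :: "('a list \<Rightarrow> 'a) set \<Rightarrow> ('a list \<Rightarrow> 'a) set \<Rightarrow> ('a list \<Rightarrow> 'a) set" where
  "sh \<equiv> shuffle const_ring RT"


subsection \<open>Algebras of constants\<close>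

definition C1 :: "('a, (('a \<times> ('a list \<Rightarrow> 'a) set \<Rightarrow> 'a) set list \<Rightarrow> 'a) set set) module" where
  "C1 = Sym const_ring (tensor const_ring RJ Tens)"

definition eps1 ::
    "'a \<Rightarrow> ('a list \<Rightarrow> 'a) set \<Rightarrow> (('a \<times> ('a list \<Rightarrow> 'a) set \<Rightarrow> 'a) set list \<Rightarrow> 'a) set set" where
  "eps1 r t = sym_emb const_ring (tensor const_ring RJ Tens) (tens const_ring RJ Tens r t)"

definition C1Q :: "('a, (('a \<times> ('a list \<Rightarrow> 'a) set \<Rightarrow> 'a) set list \<Rightarrow> 'a) set set) module" where
  "C1Q = Sym const_ring (tensor const_ring RJ Tens_pos)"

definition eps1Q ::
    "'a \<Rightarrow> ('a list \<Rightarrow> 'a) set \<Rightarrow> (('a \<times> ('a list \<Rightarrow> 'a) set \<Rightarrow> 'a) set list \<Rightarrow> 'a) set set" where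
  "eps1Q r t = sym_emb const_ring (tensor const_ring RJ Tens_pos) (tens const_ring RJ Tens_pos r t)"

definition SymM2 ::
    "('a, ((('a list \<Rightarrow> 'a) set \<times> ('a list \<Rightarrow> 'a) set \<Rightarrow> 'a) set set list \<Rightarrow> 'a) set set) module" where
  "SymM2 = Sym const_ring (sym_square const_ring Tens_pos)"

definition eps2_free ::
    "('a list \<Rightarrow> 'a) set \<Rightarrow> ('a list \<Rightarrow> 'a) set \<Rightarrow>
     ((('a list \<Rightarrow> 'a) set \<times> ('a list \<Rightarrow> 'a) set \<Rightarrow> 'a) set set list \<Rightarrow> 'a) set set" where
  "eps2_free s t = sym_emb const_ring (sym_square const_ring Tens_pos) (sym_tens const_ring Tens_pos s t)"

text \<open>
  For a word \<open>f\<close> of length \<open>n\<close>, the tensors \<open>f\<^sub>1 \<otimes> \<dots> \<otimes> f\<^sub>i\<close> and \<open>f\<^sub>i\<^sub>+\<^sub>1 \<otimes> \<dots> \<otimes> f\<^sub>n\<close> are given by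
  \<open>take i f\<close> and \<open>drop i f\<close>. Truncated subtraction makes \<open>1 - j\<close> the lower bound \<open>max 0 (1 - j)\<close>.
\<close>

definition J2_generator ::
    "'a list \<Rightarrow> 'a list \<Rightarrow> 'a list \<Rightarrow>
     ((('a list \<Rightarrow> 'a) set \<times> ('a list \<Rightarrow> 'a) set \<Rightarrow> 'a) set set list \<Rightarrow> 'a) set set" where
  "J2_generator f g h =
     (eps2_free (sh (pt f) (pt g)) (pt h) \<ominus>\<^bsub>SymM2\<^esub> eps2_free (pt f) (sh (pt g) (pt h))) \<oplus>\<^bsub>SymM2\<^esub>
     (\<Oplus>\<^bsub>SymM2\<^esub>j\<in>{0..<length g}.
        (\<Oplus>\<^bsub>SymM2\<^esub>i\<in>{1 - j..<length f}.
           eps2_free (pt (drop i f)) (pt (drop j g)) \<otimes>\<^bsub>SymM2\<^esub>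
           eps2_free (sh (pt (take i f)) (pt (take j g))) (pt h)) \<ominus>\<^bsub>SymM2\<^esub>
        (\<Oplus>\<^bsub>SymM2\<^esub>k\<in>{1 - j..<length h}.
           eps2_free (pt f) (sh (pt (take j g)) (pt (take k h))) \<otimes>\<^bsub>SymM2\<^esub>
           eps2_free (pt (drop j g)) (pt (drop k h))))"

definition J2 ::
    "((('a list \<Rightarrow> 'a) set \<times> ('a list \<Rightarrow> 'a) set \<Rightarrow> 'a) set set list \<Rightarrow> 'a) set set set" where
  "J2 = Idl\<^bsub>SymM2\<^esub> {J2_generator f g h |f g h.
          f \<in> lists (carrier RT) \<and> g \<in> lists (carrier RT) \<and> h \<in> lists (carrier RT) \<and>
          f \<noteq> [] \<and> g \<noteq> [] \<and> h \<noteq> []}"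

definition C2 ::
    "('a, ((('a list \<Rightarrow> 'a) set \<times> ('a list \<Rightarrow> 'a) set \<Rightarrow> 'a) set set list \<Rightarrow> 'a) set set set) module" where
  "C2 = quot_mod SymM2 J2"

definition eps2 ::
    "('a list \<Rightarrow> 'a) set \<Rightarrow> ('a list \<Rightarrow> 'a) set \<Rightarrow>
     ((('a list \<Rightarrow> 'a) set \<times> ('a list \<Rightarrow> 'a) set \<Rightarrow> 'a) set set list \<Rightarrow> 'a) set set set" where
  "eps2 s t = J2 +>\<^bsub>SymM2\<^esub> eps2_free s t"


subsection \<open>The algebra of nested integrals with its deformed shuffle product\<close>

definition C2T where
  "C2T = (let N = tensor const_ring C2 Tens; tn = tens const_ring C2 Tens in
     N\<lparr>mult := SOME p. p \<in> mod_bihom const_ring N N N \<and>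
         (\<forall>c\<in>carrier C2. \<forall>d\<in>carrier C2. \<forall>f\<in>lists (carrier RT). \<forall>g\<in>lists (carrier RT).
            p (tn c (pt f)) (tn d (pt g)) =
              tn (c \<otimes>\<^bsub>C2\<^esub> d) (sh (pt f) (pt g)) \<oplus>\<^bsub>N\<^esub>
              (\<Oplus>\<^bsub>N\<^esub>i\<in>{0..<length f}. \<Oplus>\<^bsub>N\<^esub>j\<in>{0..<length g}.
                 tn (c \<otimes>\<^bsub>C2\<^esub> d \<otimes>\<^bsub>C2\<^esub> eps2 (pt (drop i f)) (pt (drop j g)))
                    (sh (pt (take i f)) (pt (take j g))))),
       one := tn \<one>\<^bsub>C2\<^esub> (pt [])\<rparr>)"


text \<open>
  The two closures differ in the first algebra of constants \<open>A\<close>, which is \<open>C1\<close> or \<open>C1Q\<close>, and in the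
  integral.
\<close>

definition closure_alg where
  "closure_alg A = tensor_alg const_ring self_alg (tensor_alg const_ring A C2T)"

definition closure_tens where
  "closure_tens A f0 c1 c2 t =
     tens const_ring self_alg (tensor_alg const_ring A C2T) f0
       (tens const_ring A C2T c1 (tens const_ring C2 Tens c2 t))"

definition closure_iota where
  "closure_iota A f = closure_tens A f \<one>\<^bsub>A\<^esub> \<one>\<^bsub>C2\<^esub> (pt [])"

definition closure_der where
  "closure_der A = (let S = closure_alg A; ct = closure_tens A in
     SOME D. D \<in> mod_hom const_ring S S \<and>
       (\<forall>f0\<in>carrier R. \<forall>c1\<in>carrier A. \<forall>c2\<in>carrier C2.
          D (ct f0 c1 c2 (pt [])) = ct (der f0) c1 c2 (pt []) \<and>
          (\<forall>x\<in>carrier RT. \<forall>f\<in>lists (carrier RT).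
             D (ct f0 c1 c2 (pt (x # f))) =
               ct (der f0) c1 c2 (pt (x # f)) \<oplus>\<^bsub>S\<^esub> ct (f0 \<otimes>\<^bsub>R\<^esub> x) c1 c2 (pt f))))"

definition IDR where
  "IDR = closure_alg C1"

definition IDR_iota where
  "IDR_iota = closure_iota C1"

definition IDR_der where
  "IDR_der = closure_der C1"

definition IDR_int where
  "IDR_int = (let ct = closure_tens C1 in
     SOME I. I \<in> mod_hom const_ring IDR IDR \<and>
       (\<forall>f0\<in>carrier R. \<forall>c1\<in>carrier C1. \<forall>c2\<in>carrier C2.
          I (ct f0 c1 c2 (pt [])) =
            ct (Q f0) c1 c2 (pt [])
            \<ominus>\<^bsub>IDR\<^esub> ct \<one>\<^bsub>R\<^esub> (c1 \<otimes>\<^bsub>C1\<^esub> eps1 (Q f0) (pt [])) c2 (pt [])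
            \<oplus>\<^bsub>IDR\<^esub> ct \<one>\<^bsub>R\<^esub> c1 c2 (pt [f0 \<ominus>\<^bsub>R\<^esub> der (Q f0)]) \<and>
          (\<forall>x\<in>carrier RT. \<forall>f\<in>lists (carrier RT).
             I (ct f0 c1 c2 (pt (x # f))) =
               ct (Q f0) c1 c2 (pt (x # f))
               \<ominus>\<^bsub>IDR\<^esub> ct \<one>\<^bsub>R\<^esub> (c1 \<otimes>\<^bsub>C1\<^esub> eps1 (Q f0) (pt (x # f))) c2 (pt [])
               \<ominus>\<^bsub>IDR\<^esub> I (ct (Q f0 \<otimes>\<^bsub>R\<^esub> x) c1 c2 (pt f))
               \<oplus>\<^bsub>IDR\<^esub> ct \<one>\<^bsub>R\<^esub> c1 c2 (pt ((f0 \<ominus>\<^bsub>R\<^esub> der (Q f0)) # x # f)))))"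

definition IDRQ where
  "IDRQ = closure_alg C1Q"

definition IDRQ_iota where
  "IDRQ_iota = closure_iota C1Q"

definition IDRQ_der where
  "IDRQ_der = closure_der C1Q"

definition IDRQ_int where
  "IDRQ_int = (let ct = closure_tens C1Q in
     SOME I. I \<in> mod_hom const_ring IDRQ IDRQ \<and>
       (\<forall>f0\<in>carrier R. \<forall>c1\<in>carrier C1Q. \<forall>c2\<in>carrier C2.
          I (ct f0 c1 c2 (pt [])) =
            ct (Q f0) c1 c2 (pt [])
            \<oplus>\<^bsub>IDRQ\<^esub> ct \<one>\<^bsub>R\<^esub> c1 c2 (pt [f0 \<ominus>\<^bsub>R\<^esub> der (Q f0)]) \<and>
          (\<forall>x\<in>carrier RT. \<forall>f\<in>lists (carrier RT).
             I (ct f0 c1 c2 (pt (x # f))) =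
               ct (Q f0) c1 c2 (pt (x # f))
               \<ominus>\<^bsub>IDRQ\<^esub> ct \<one>\<^bsub>R\<^esub> (c1 \<otimes>\<^bsub>C1Q\<^esub> eps1Q (Q f0) (pt (x # f))) c2 (pt [])
               \<ominus>\<^bsub>IDRQ\<^esub> I (ct (Q f0 \<otimes>\<^bsub>R\<^esub> x) c1 c2 (pt f))
               \<oplus>\<^bsub>IDRQ\<^esub> ct \<one>\<^bsub>R\<^esub> c1 c2 (pt ((f0 \<ominus>\<^bsub>R\<^esub> der (Q f0)) # x # f)))))"

text \<open>
  The submodule \<open>C \<otimes> \<epsilon>(Q\<partial>R) \<otimes> C \<otimes> C1\<^sub>T\<close> of \<open>IDR\<close>; the two middle occurrences of \<open>C\<close> stand for the
  multiples of the units of \<open>C2\<close> and of the tensor module.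
\<close>

definition J1_generators where
  "J1_generators = submodule_gen const_ring IDR
     {closure_tens C1 c (eps1 (Q (der r)) (pt [])) (c' \<odot>\<^bsub>C2\<^esub> \<one>\<^bsub>C2\<^esub>) (c'' \<odot>\<^bsub>Tens\<^esub> pt []) |c r c' c''.
        c \<in> constants R der \<and> r \<in> carrier R \<and> c' \<in> constants R der \<and> c'' \<in> constants R der}"

definition J1 where
  "J1 = integro_differential_ideal_gen IDR IDR_der IDR_int J1_generators"

end

end

(* The two closures differ only in the first algebra of constants A and in a bilinear pairing e of R_J and
   T with values in A: for IDR_Q it is the pairing of IDR followed by the projection that kills the empty
   tensor. So both are instances of one construction, with A and e arbitrary.

   Writing x.u for the operation that prefixes the letter x, the product of C_2 (x) T satisfies
     xf * yg = x.(f * yg) + y.(xf * g) + eps(xf, yg).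
   Expanding (xf * yg) * zh with it gives x.((f * yg) * zh) + y.((xf * g) * zh) + z.((xf * yg) * h) and a
   constant whose symmetry in xf and zh is the relation J_2; associativity follows by induction.

   The integral is linear over A and C_2, and 1 - int der maps everything into the set of elements over
   which the integral is linear; hence it is linear over all constants.

   The algebra map C_1 -> C_1~ that kills eps(r (x) 1) and the inclusion C_1~ -> C_1 induce
   phi : IDR -> IDR_Q and a section sigma. The kernel of phi is J_1 because u - sigma (phi u) always lies in
   J_1. Uniqueness holds because IDR is generated by iota(R) under the ring operations and the integral. *)
theory Submission
  imports Defs
begin

section \<open>Linear maps and spanning sets\<close>

text \<open>Every product, derivation and integral in the statement is a choice among linear or
  bilinear maps with prescribed values on pure tensors, so nothing is known about it before such a
  map has been constructed. This shapes each layer: a universal property yields a witness, the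
  specification follows, and identities are then compared on a spanning set. The ring
  \<open>C\<close> is an arbitrary commutative ring; no bases are available, and a tensor factor
  need not embed. Injectivity of \<iota> therefore comes from augmentations of the other factors,
  which give \<iota> a left inverse. The constants of a closure are never determined explicitly,
  hence the detour through 1 - \<integral>\<partial> for linearity over them. The pairings
  \<epsilon> exist on tensors of positive length only and are extended by zero to the empty tensor.
  This turns the truncated sums of J_2 into sums over full rectangles of indices, and it gives the
  integral of IDR_Q in the case n = 0 the shape of the one in IDR, with a correction term that
  vanishes.\<close>

lemma mod_homI:
  assumes "\<And>x. x \<in> carrier M \<Longrightarrow> h x \<in> carrier P"
    and "\<And>x y. \<lbrakk>x \<in> carrier M; y \<in> carrier M\<rbrakk> \<Longrightarrow> h (x \<oplus>\<^bsub>M\<^esub> y) = h x \<oplus>\<^bsub>P\<^esub> h y"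
    and "\<And>c x. \<lbrakk>c \<in> carrier C; x \<in> carrier M\<rbrakk> \<Longrightarrow> h (c \<odot>\<^bsub>M\<^esub> x) = c \<odot>\<^bsub>P\<^esub> h x"
  shows "h \<in> mod_hom C M P"
  using assms unfolding mod_hom_def by auto

lemma mod_hom_closed: "\<lbrakk>h \<in> mod_hom C M P; x \<in> carrier M\<rbrakk> \<Longrightarrow> h x \<in> carrier P"
  unfolding mod_hom_def by auto

lemma mod_hom_add:
  "\<lbrakk>h \<in> mod_hom C M P; x \<in> carrier M; y \<in> carrier M\<rbrakk> \<Longrightarrow> h (x \<oplus>\<^bsub>M\<^esub> y) = h x \<oplus>\<^bsub>P\<^esub> h y"
  unfolding mod_hom_def by auto

lemma mod_hom_smult:
  "\<lbrakk>h \<in> mod_hom C M P; c \<in> carrier C; x \<in> carrier M\<rbrakk> \<Longrightarrow> h (c \<odot>\<^bsub>M\<^esub> x) = c \<odot>\<^bsub>P\<^esub> h x"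
  unfolding mod_hom_def by auto

lemma mod_hom_zero:
  assumes "module C M" "module C P" "h \<in> mod_hom C M P"
  shows "h \<zero>\<^bsub>M\<^esub> = \<zero>\<^bsub>P\<^esub>"
proof -
  interpret M: module C M by fact
  interpret P: module C P by fact
  show ?thesis
    using mod_hom_smult[OF assms(3) M.R.zero_closed M.M.zero_closed] mod_hom_closed[OF assms(3) M.M.zero_closed]
    by simp
qed

lemma (in module) minus_eq_smult: "x \<in> carrier M \<Longrightarrow> \<ominus>\<^bsub>M\<^esub> x = (\<ominus> \<one>) \<odot>\<^bsub>M\<^esub> x"
  by (simp add: smult_l_minus)

text \<open>Closure under negation follows from closure under scalars, as -x = (-1) x.\<close>

lemma (in module) submoduleI_smult:
  assumes "H \<subseteq> carrier M" "\<zero>\<^bsub>M\<^esub> \<in> H"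
    and "\<And>a b. \<lbrakk>a \<in> H; b \<in> H\<rbrakk> \<Longrightarrow> a \<oplus>\<^bsub>M\<^esub> b \<in> H"
    and "\<And>a x. \<lbrakk>a \<in> carrier R; x \<in> H\<rbrakk> \<Longrightarrow> a \<odot>\<^bsub>M\<^esub> x \<in> H"
  shows "submodule H R M"
proof (rule submoduleI[OF assms(1,2) _ assms(3,4)])
  show "\<ominus>\<^bsub>M\<^esub> a \<in> H" if "a \<in> H" for a
    using assms(1,4) that by (subst minus_eq_smult) auto
qed

lemma mod_hom_uminus:
  assumes "module C M" "module C P" "h \<in> mod_hom C M P" "x \<in> carrier M"
  shows "h (\<ominus>\<^bsub>M\<^esub> x) = \<ominus>\<^bsub>P\<^esub> h x"
proof -
  interpret M: module C M by fact
  interpret P: module C P by fact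
  show ?thesis
    using assms(3,4) by (simp add: M.minus_eq_smult P.minus_eq_smult mod_hom_smult mod_hom_closed)
qed

lemma mod_hom_minus:
  assumes "module C M" "module C P" "h \<in> mod_hom C M P" "x \<in> carrier M" "y \<in> carrier M"
  shows "h (x \<ominus>\<^bsub>M\<^esub> y) = h x \<ominus>\<^bsub>P\<^esub> h y"
proof -
  interpret M: module C M by fact
  show ?thesis
    using assms by (simp add: a_minus_def mod_hom_add mod_hom_uminus)
qed

lemma mod_hom_finsum:
  assumes "module C M" "module C P" "h \<in> mod_hom C M P" "finite A" "g \<in> A \<rightarrow> carrier M"
  shows "h (finsum M g A) = (\<Oplus>\<^bsub>P\<^esub>a\<in>A. h (g a))"
proof -
  interpret M: module C M by fact
  interpret P: module C P by fact
  show ?thesis using assms(4,5)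
  proof (induction A rule: finite_induct)
    case empty then show ?case using mod_hom_zero[OF assms(1-3)] by simp
  next
    case (insert x F)
    then show ?case
      using assms(3) by (subst M.M.finsum_insert P.M.finsum_insert; auto simp: mod_hom_add mod_hom_closed Pi_def)+
  qed
qed

lemma mod_hom_id: "(\<lambda>x. x) \<in> mod_hom C M M"
  by (rule mod_homI) auto

lemma mod_hom_comp:
  "\<lbrakk>h \<in> mod_hom C P N; (\<lambda>x. g x) \<in> mod_hom C M P\<rbrakk> \<Longrightarrow> (\<lambda>x. h (g x)) \<in> mod_hom C M N"
  unfolding mod_hom_def by (auto simp: Pi_def)

lemma mod_hom_addf:
  assumes "module C P" "(\<lambda>x. f x) \<in> mod_hom C M P" "(\<lambda>x. g x) \<in> mod_hom C M P"
  shows "(\<lambda>x. f x \<oplus>\<^bsub>P\<^esub> g x) \<in> mod_hom C M P"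
proof -
  interpret P: module C P by fact
  show ?thesis
    by (rule mod_homI)
      (simp_all add: mod_hom_closed[OF assms(2)] mod_hom_closed[OF assms(3)]
        mod_hom_add[OF assms(2)] mod_hom_add[OF assms(3)] mod_hom_smult[OF assms(2)]
        mod_hom_smult[OF assms(3)] P.smult_r_distr P.M.a_ac)
qed

lemma mod_hom_smultf:
  assumes "module C P" "c \<in> carrier C" "(\<lambda>x. f x) \<in> mod_hom C M P"
  shows "(\<lambda>x. c \<odot>\<^bsub>P\<^esub> f x) \<in> mod_hom C M P"
proof -
  interpret P: module C P by fact
  show ?thesis
    by (rule mod_homI)
      (simp_all add: mod_hom_closed[OF assms(3)] mod_hom_add[OF assms(3)] mod_hom_smult[OF assms(3)]
        P.smult_r_distr assms(2) P.R.m_comm flip: P.smult_assoc1)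
qed

lemma mod_hom_uminusf:
  assumes "module C P" "(\<lambda>x. f x) \<in> mod_hom C M P"
  shows "(\<lambda>x. \<ominus>\<^bsub>P\<^esub> f x) \<in> mod_hom C M P"
proof -
  interpret P: module C P by fact
  show ?thesis
    by (rule mod_homI)
      (simp_all add: mod_hom_closed[OF assms(2)] mod_hom_add[OF assms(2)] mod_hom_smult[OF assms(2)]
        P.smult_r_minus P.M.minus_add P.M.a_ac)
qed

lemma mod_hom_minusf:
  assumes "module C P" "(\<lambda>x. f x) \<in> mod_hom C M P" "(\<lambda>x. g x) \<in> mod_hom C M P"
  shows "(\<lambda>x. f x \<ominus>\<^bsub>P\<^esub> g x) \<in> mod_hom C M P"
  unfolding a_minus_def using assms by (intro mod_hom_addf mod_hom_uminusf)

lemma mod_hom_const_zero: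
  assumes "module C P" shows "(\<lambda>x. \<zero>\<^bsub>P\<^esub>) \<in> mod_hom C M P"
proof -
  interpret P: module C P by fact
  show ?thesis by (rule mod_homI) simp_all
qed

lemma mod_hom_finsumf:
  assumes "module C P" "finite A" "\<And>i. i \<in> A \<Longrightarrow> (\<lambda>x. f i x) \<in> mod_hom C M P"
  shows "(\<lambda>x. \<Oplus>\<^bsub>P\<^esub>i\<in>A. f i x) \<in> mod_hom C M P"
proof -
  interpret P: module C P by fact
  note h = mod_hom_closed[OF assms(3)] mod_hom_add[OF assms(3)] mod_hom_smult[OF assms(3)]
  show ?thesis
  proof (rule mod_homI)
    show "(\<Oplus>\<^bsub>P\<^esub>i\<in>A. f i x) \<in> carrier P" if "x \<in> carrier M" for x
      using h that by (intro P.M.finsum_closed) auto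
    show "(\<Oplus>\<^bsub>P\<^esub>i\<in>A. f i (x \<oplus>\<^bsub>M\<^esub> y)) = (\<Oplus>\<^bsub>P\<^esub>i\<in>A. f i x) \<oplus>\<^bsub>P\<^esub> (\<Oplus>\<^bsub>P\<^esub>i\<in>A. f i y)"
      if "x \<in> carrier M" "y \<in> carrier M" for x y
    proof -
      have "(\<Oplus>\<^bsub>P\<^esub>i\<in>A. f i (x \<oplus>\<^bsub>M\<^esub> y)) = (\<Oplus>\<^bsub>P\<^esub>i\<in>A. f i x \<oplus>\<^bsub>P\<^esub> f i y)"
        using h that by (intro P.M.finsum_cong') auto
      then show ?thesis using h that by (simp add: P.M.finsum_addf Pi_def)
    qed
    show "(\<Oplus>\<^bsub>P\<^esub>i\<in>A. f i (c \<odot>\<^bsub>M\<^esub> x)) = c \<odot>\<^bsub>P\<^esub> (\<Oplus>\<^bsub>P\<^esub>i\<in>A. f i x)"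
      if "c \<in> carrier C" "x \<in> carrier M" for c x
      using h that assms(2) by (subst P.finsum_smult_ldistr) (auto intro!: P.M.finsum_cong')
  qed
qed

lemma mod_hom_multl:
  assumes "algebra C S" "a \<in> carrier S" "(\<lambda>x. f x) \<in> mod_hom C M S"
  shows "(\<lambda>x. a \<otimes>\<^bsub>S\<^esub> f x) \<in> mod_hom C M S"
proof -
  interpret S: algebra C S by fact
  show ?thesis
    by (rule mod_homI)
      (simp_all add: mod_hom_closed[OF assms(3)] mod_hom_add[OF assms(3)] mod_hom_smult[OF assms(3)]
        assms(2) S.r_distr S.m_comm[of a] S.smult_assoc2)
qed

lemma mod_hom_multr:
  assumes "algebra C S" "a \<in> carrier S" "(\<lambda>x. f x) \<in> mod_hom C M S"
  shows "(\<lambda>x. f x \<otimes>\<^bsub>S\<^esub> a) \<in> mod_hom C M S"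
proof -
  interpret S: algebra C S by fact
  show ?thesis
    by (rule mod_homI)
      (simp_all add: mod_hom_closed[OF assms(3)] mod_hom_add[OF assms(3)] mod_hom_smult[OF assms(3)]
        assms(2) S.l_distr S.smult_assoc2)
qed

lemma mod_bihomI:
  assumes "\<And>x. x \<in> carrier M \<Longrightarrow> (\<lambda>y. h x y) \<in> mod_hom C N P"
    and "\<And>y. y \<in> carrier N \<Longrightarrow> (\<lambda>x. h x y) \<in> mod_hom C M P"
  shows "h \<in> mod_bihom C M N P"
  using assms unfolding mod_bihom_def by auto

lemma mod_bihom_left: "\<lbrakk>h \<in> mod_bihom C M N P; y \<in> carrier N\<rbrakk> \<Longrightarrow> (\<lambda>x. h x y) \<in> mod_hom C M P"
  and mod_bihom_right: "\<lbrakk>h \<in> mod_bihom C M N P; x \<in> carrier M\<rbrakk> \<Longrightarrow> (\<lambda>y. h x y) \<in> mod_hom C N P"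
  unfolding mod_bihom_def by auto

lemma mod_bihom_closed:
  "\<lbrakk>h \<in> mod_bihom C M N P; x \<in> carrier M; y \<in> carrier N\<rbrakk> \<Longrightarrow> h x y \<in> carrier P"
  by (rule mod_hom_closed[OF mod_bihom_right])

section \<open>Generated submodules and spanning sets\<close>

lemma submodule_gen_superset: "A \<subseteq> submodule_gen C M A"
  unfolding submodule_gen_def by blast

lemma submodule_gen_least: "\<lbrakk>submodule H C M; A \<subseteq> H\<rbrakk> \<Longrightarrow> submodule_gen C M A \<subseteq> H"
  unfolding submodule_gen_def by blast

lemma submodule_gen_submodule:
  assumes "module C M" "A \<subseteq> carrier M"
  shows "submodule (submodule_gen C M A) C M"
proof -
  interpret M: module C M by fact
  \<comment> \<open>The intersection over an empty family would be the whole type; the carrier is a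
    member of the family.\<close>
  have "carrier M \<in> {H. submodule H C M \<and> A \<subseteq> H}"
    using assms(2) M.carrier_is_submodule by blast
  then show ?thesis unfolding submodule_gen_def
    by (intro M.submoduleI) (use M.submoduleE in \<open>auto simp: submodule_def dest: subgroup.one_closed\<close>)
qed

lemma submodule_zero: "submodule N C M \<Longrightarrow> \<zero>\<^bsub>M\<^esub> \<in> N"
  unfolding submodule_def by (auto dest: subgroup.one_closed)

definition spans :: "('c, 'e) ring_scheme \<Rightarrow> ('c, 'm) module \<Rightarrow> 'm set \<Rightarrow> bool" where
  "spans C M G \<longleftrightarrow> G \<subseteq> carrier M \<and> submodule_gen C M G = carrier M"

lemma spans_induct [consumes 3, case_names zero smult add]:
  assumes "module C M" "spans C M G" "x \<in> carrier M"
    and zero: "P \<zero>\<^bsub>M\<^esub>"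
    and smult: "\<And>c g. \<lbrakk>c \<in> carrier C; g \<in> G\<rbrakk> \<Longrightarrow> P (c \<odot>\<^bsub>M\<^esub> g)"
    and add: "\<And>x y. \<lbrakk>x \<in> carrier M; y \<in> carrier M; P x; P y\<rbrakk> \<Longrightarrow> P (x \<oplus>\<^bsub>M\<^esub> y)"
  shows "P x"
proof -
  interpret M: module C M by fact
  \<comment> \<open>The predicate \<open>P\<close> need not be stable under scalars. Quantifying
    over all multiples makes \<open>H\<close> a submodule, and the multiple by one gives back
    \<open>P x\<close>.\<close>
  define H where "H = {x \<in> carrier M. \<forall>c\<in>carrier C. P (c \<odot>\<^bsub>M\<^esub> x)}"
  have "submodule H C M"
  proof (rule M.submoduleI)
    show "\<ominus>\<^bsub>M\<^esub> a \<in> H" if "a \<in> H" for a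
      using that unfolding H_def by (auto simp: M.minus_eq_smult simp flip: M.smult_assoc1)
  qed (auto simp: H_def zero add M.smult_r_distr simp flip: M.smult_assoc1)
  moreover have "G \<subseteq> H"
    using assms(2) smult unfolding H_def spans_def by auto
  ultimately have "carrier M \<subseteq> H"
    using assms(2) submodule_gen_least unfolding spans_def by blast
  then have "P (\<one>\<^bsub>C\<^esub> \<odot>\<^bsub>M\<^esub> x)" using assms(3) unfolding H_def by blast
  then show ?thesis using assms(3) by simp
qed

lemma spansI:
  assumes "module C M" "G \<subseteq> carrier M"
    and "\<And>H x. \<lbrakk>submodule H C M; G \<subseteq> H; x \<in> carrier M\<rbrakk> \<Longrightarrow> x \<in> H"
  shows "spans C M G"
  unfolding spans_def submodule_gen_def using assms module.carrier_is_submodule[OF assms(1)] by blast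

lemma spans_carrier: "module C M \<Longrightarrow> spans C M (carrier M)"
  by (rule spansI) auto

text \<open>The restricted module shares its operations with \<open>M\<close>, so a submodule of it
  is one of \<open>M\<close> and contains all that \<open>G\<close> generates there.\<close>

lemma spans_submodule_gen:
  assumes "module C M" "G \<subseteq> carrier M"
  shows "spans C (M\<lparr>carrier := submodule_gen C M G\<rparr>) G"
proof (rule spansI)
  interpret M: module C M by fact
  have sub: "submodule (submodule_gen C M G) C M" by (rule submodule_gen_submodule) fact+
  show mod: "module C (M\<lparr>carrier := submodule_gen C M G\<rparr>)"
    by (rule submodule.submodule_is_module[OF sub]) fact
  show "G \<subseteq> carrier (M\<lparr>carrier := submodule_gen C M G\<rparr>)"
    using submodule_gen_superset[of G C M] by simp
  fix H x assume H: "submodule H C (M\<lparr>carrier := submodule_gen C M G\<rparr>)" "G \<subseteq> H"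
    and x: "x \<in> carrier (M\<lparr>carrier := submodule_gen C M G\<rparr>)"
  have HG: "H \<subseteq> submodule_gen C M G" using module.submoduleE(1)[OF mod H(1)] by simp
  have "submodule H C M"
  proof (rule M.submoduleI)
    show "H \<subseteq> carrier M" using HG M.submoduleE(1)[OF sub] by blast
    show z: "\<zero>\<^bsub>M\<^esub> \<in> H" using submodule_zero[OF H(1)] by simp
    show smult: "c \<odot>\<^bsub>M\<^esub> a \<in> H" if "c \<in> carrier C" "a \<in> H" for a c
      using module.submoduleE(4)[OF mod H(1) that] by simp
    show "\<ominus>\<^bsub>M\<^esub> a \<in> H" if "a \<in> H" for a
    proof -
      have "a \<in> carrier M" using that HG M.submoduleE(1)[OF sub] by blast
      then show ?thesis using smult[OF _ that, of "\<ominus>\<^bsub>C\<^esub> \<one>\<^bsub>C\<^esub>"] by (simp add: M.minus_eq_smult)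
    qed
    show "a \<oplus>\<^bsub>M\<^esub> b \<in> H" if "a \<in> H" "b \<in> H" for a b
      using module.submoduleE(5)[OF mod H(1) that] by simp
  qed
  from submodule_gen_least[OF this H(2)] x show "x \<in> H" by auto
qed

lemma mod_hom_eqI:
  assumes "module C M" "module C P" "spans C M G" "f \<in> mod_hom C M P" "g \<in> mod_hom C M P"
    and "\<And>x. x \<in> G \<Longrightarrow> f x = g x" "x \<in> carrier M"
  shows "f x = g x"
  using assms(1,3,7)
proof (induction rule: spans_induct)
  case zero then show ?case using assms mod_hom_zero by metis
next
  case (smult c y)
  then have "y \<in> carrier M" using assms(3) unfolding spans_def by blast
  then show ?case using smult assms by (simp add: mod_hom_smult)
next
  case (add x y) then show ?case using assms by (simp add: mod_hom_add)
qed

lemma mod_hom_submodule: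
  assumes "module C M" "module C P" "spans C M G" "f \<in> mod_hom C M P" "submodule H C P"
    and "\<And>x. x \<in> G \<Longrightarrow> f x \<in> H" "x \<in> carrier M"
  shows "f x \<in> H"
  using assms(1,3,7)
proof (induction rule: spans_induct)
  case zero then show ?case using assms mod_hom_zero submodule_zero by metis
next
  case (smult c y)
  then have "y \<in> carrier M" using assms(3) unfolding spans_def by blast
  then show ?case using smult assms module.submoduleE(4)[OF assms(2,5)] by (simp add: mod_hom_smult)
next
  case (add x y) then show ?case using assms module.submoduleE(5)[OF assms(2,5)] by (simp add: mod_hom_add)
qed

text \<open>The laws for the first argument are, for fixed \<open>x\<close>, \<open>x'\<close> and
  \<open>c\<close>, equations between linear maps of \<open>y\<close>; it suffices to know them for
  \<open>y\<close> in a spanning set.\<close>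

lemma mod_bihom_spanI:
  assumes "module C M" "module C N" "module C P" "spans C N G"
    and r: "\<And>x. x \<in> carrier M \<Longrightarrow> (\<lambda>y. h x y) \<in> mod_hom C N P"
    and l: "\<And>y. y \<in> G \<Longrightarrow> (\<lambda>x. h x y) \<in> mod_hom C M P"
  shows "h \<in> mod_bihom C M N P"
proof (rule mod_bihomI)
  interpret M: module C M by fact
  fix y assume y: "y \<in> carrier N"
  show "(\<lambda>x. h x y) \<in> mod_hom C M P"
  proof (rule mod_homI)
    show "h x y \<in> carrier P" if "x \<in> carrier M" for x by (rule mod_hom_closed[OF r[OF that] y])
    show "h (x \<oplus>\<^bsub>M\<^esub> x') y = h x y \<oplus>\<^bsub>P\<^esub> h x' y" if "x \<in> carrier M" "x' \<in> carrier M" for x x'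
      by (rule mod_hom_eqI[OF assms(2,3,4) r mod_hom_addf[OF assms(3) r r] _ y])
        (use that mod_hom_add[OF l] in simp_all)
    show "h (c \<odot>\<^bsub>M\<^esub> x) y = c \<odot>\<^bsub>P\<^esub> h x y" if "c \<in> carrier C" "x \<in> carrier M" for c x
      by (rule mod_hom_eqI[OF assms(2,3,4) r mod_hom_smultf[OF assms(3) _ r] _ y])
        (use that mod_hom_smult[OF l] in simp_all)
  qed
qed (rule r)

text \<open>Both sides are linear in each argument. The three applications of
  \<open>mod_hom_eqI\<close> free one argument after another from \<open>G\<close>, the last factor
  first.\<close>

lemma mod_bihom_assoc:
  assumes "module C M" "spans C M G" "p \<in> mod_bihom C M M M"
    and "\<And>x y z. \<lbrakk>x \<in> G; y \<in> G; z \<in> G\<rbrakk> \<Longrightarrow> p (p x y) z = p x (p y z)"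
    and "x \<in> carrier M" "y \<in> carrier M" "z \<in> carrier M"
  shows "p (p x y) z = p x (p y z)"
proof -
  have G: "\<And>x. x \<in> G \<Longrightarrow> x \<in> carrier M" using assms(2) unfolding spans_def by blast
  note pl = mod_bihom_left[OF assms(3)] and pr = mod_bihom_right[OF assms(3)]
  note cl = mod_bihom_closed[OF assms(3)] and eqI = mod_hom_eqI[OF assms(1,1,2)]
  have 1: "p (p x y) z = p x (p y z)" if "x \<in> G" "y \<in> G" "z \<in> carrier M" for x y z
    by (rule eqI[OF pr mod_hom_comp[OF pr pr] assms(4) that(3)]) (use that G cl in auto)
  have 2: "p (p x y) z = p x (p y z)" if "x \<in> G" "y \<in> carrier M" "z \<in> carrier M" for x y z
    by (rule eqI[OF mod_hom_comp[OF pl pr] mod_hom_comp[OF pr pl] _ that(2)]) (use that G cl 1 in auto)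
  show ?thesis
    by (rule eqI[OF mod_hom_comp[OF pl pl] pl _ assms(5)]) (use assms(6,7) G cl 2 in auto)
qed

lemma mod_bihom_commute:
  assumes "module C M" "module C P" "spans C M G" "p \<in> mod_bihom C M M P"
    and "\<And>x y. \<lbrakk>x \<in> G; y \<in> G\<rbrakk> \<Longrightarrow> p x y = p y x"
    and "x \<in> carrier M" "y \<in> carrier M"
  shows "p x y = p y x"
proof -
  have G: "\<And>x. x \<in> G \<Longrightarrow> x \<in> carrier M" using assms(3) unfolding spans_def by blast
  note intros = mod_bihom_left[OF assms(4)] mod_bihom_right[OF assms(4)]
  note eqI = mod_hom_eqI[OF assms(1,2,3)]
  have 1: "p x y = p y x" if "x \<in> G" "y \<in> carrier M" for x y
    by (rule eqI[OF _ _ assms(5) that(2)]) (use that G in \<open>auto intro!: intros\<close>)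
  show ?thesis
    by (rule eqI[OF _ _ _ assms(6), of "\<lambda>x. p x y" "\<lambda>x. p y x"])
      (use assms(7) G 1 in \<open>auto intro!: intros\<close>)
qed

lemma mod_bihom_eqI:
  assumes "module C M" "module C N" "module C P" "spans C M G" "spans C N H"
    and "p \<in> mod_bihom C M N P" "q \<in> mod_bihom C M N P"
    and "\<And>x y. \<lbrakk>x \<in> G; y \<in> H\<rbrakk> \<Longrightarrow> p x y = q x y"
    and "x \<in> carrier M" "y \<in> carrier N"
  shows "p x y = q x y"
proof -
  have G: "\<And>x. x \<in> G \<Longrightarrow> x \<in> carrier M" using assms(4) unfolding spans_def by blast
  have 1: "p x y = q x y" if "x \<in> G" "y \<in> carrier N" for x y
    by (rule mod_hom_eqI[OF assms(2,3,5) _ _ _ that(2), of "\<lambda>y. p x y" "\<lambda>y. q x y"])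
      (use that G assms(6,7,8) in \<open>auto intro!: mod_bihom_right\<close>)
  show ?thesis
    by (rule mod_hom_eqI[OF assms(1,3,4) _ _ _ assms(9), of "\<lambda>x. p x y" "\<lambda>x. q x y"])
      (use assms(6,7,10) G 1 in \<open>auto intro!: mod_bihom_left\<close>)
qed

text \<open>Distributivity is bilinearity, and the remaining laws compare multilinear maps, so
  generators suffice. Kept apart from the commutative version for the sake of the tensor
  algebra.\<close>

lemma ring_of_bihom:
  assumes "module C M" "spans C M G" "mult M \<in> mod_bihom C M M M" "\<one>\<^bsub>M\<^esub> \<in> carrier M"
    and assoc: "\<And>x y z. \<lbrakk>x \<in> G; y \<in> G; z \<in> G\<rbrakk> \<Longrightarrow> (x \<otimes>\<^bsub>M\<^esub> y) \<otimes>\<^bsub>M\<^esub> z = x \<otimes>\<^bsub>M\<^esub> (y \<otimes>\<^bsub>M\<^esub> z)"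
    and one: "\<And>x. x \<in> G \<Longrightarrow> \<one>\<^bsub>M\<^esub> \<otimes>\<^bsub>M\<^esub> x = x" "\<And>x. x \<in> G \<Longrightarrow> x \<otimes>\<^bsub>M\<^esub> \<one>\<^bsub>M\<^esub> = x"
  shows "ring M"
proof -
  interpret M: module C M by fact
  note pl = mod_bihom_left[OF assms(3)] and pr = mod_bihom_right[OF assms(3)]
  show ?thesis
  proof (rule ringI)
    show "Group.monoid M"
    proof (rule monoidI)
      show "(x \<otimes>\<^bsub>M\<^esub> y) \<otimes>\<^bsub>M\<^esub> z = x \<otimes>\<^bsub>M\<^esub> (y \<otimes>\<^bsub>M\<^esub> z)"
        if "x \<in> carrier M" "y \<in> carrier M" "z \<in> carrier M" for x y z
        using mod_bihom_assoc[OF assms(1-3) assoc that] .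
      show "\<one>\<^bsub>M\<^esub> \<otimes>\<^bsub>M\<^esub> x = x" if "x \<in> carrier M" for x
        by (rule mod_hom_eqI[OF assms(1,1,2) _ mod_hom_id _ that]) (auto intro: pr assms one)
      show "x \<otimes>\<^bsub>M\<^esub> \<one>\<^bsub>M\<^esub> = x" if "x \<in> carrier M" for x
        by (rule mod_hom_eqI[OF assms(1,1,2) _ mod_hom_id _ that]) (auto intro: pl assms one)
    qed (auto intro: assms mod_bihom_closed[OF assms(3)])
  qed (use mod_hom_add[OF pl] mod_hom_add[OF pr] M.abelian_group_axioms in auto)
qed

lemma algebra_of_bihom:
  assumes "module C M" "spans C M G" "mult M \<in> mod_bihom C M M M" "\<one>\<^bsub>M\<^esub> \<in> carrier M"
    and assoc: "\<And>x y z. \<lbrakk>x \<in> G; y \<in> G; z \<in> G\<rbrakk> \<Longrightarrow> (x \<otimes>\<^bsub>M\<^esub> y) \<otimes>\<^bsub>M\<^esub> z = x \<otimes>\<^bsub>M\<^esub> (y \<otimes>\<^bsub>M\<^esub> z)"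
    and comm: "\<And>x y. \<lbrakk>x \<in> G; y \<in> G\<rbrakk> \<Longrightarrow> x \<otimes>\<^bsub>M\<^esub> y = y \<otimes>\<^bsub>M\<^esub> x"
    and one: "\<And>x. x \<in> G \<Longrightarrow> \<one>\<^bsub>M\<^esub> \<otimes>\<^bsub>M\<^esub> x = x"
  shows "algebra C M"
proof -
  interpret M: module C M by fact
  have c: "x \<otimes>\<^bsub>M\<^esub> y = y \<otimes>\<^bsub>M\<^esub> x" if "x \<in> carrier M" "y \<in> carrier M" for x y
    by (rule mod_bihom_commute[OF assms(1,1,2,3) comm that])
  have "x \<otimes>\<^bsub>M\<^esub> \<one>\<^bsub>M\<^esub> = x" if "x \<in> G" for x
    using c[of x "\<one>\<^bsub>M\<^esub>"] one[OF that] assms(2,4) that unfolding spans_def by auto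
  then interpret ring M by (intro ring_of_bihom[OF assms(1-4) assoc one])
  show ?thesis
    by (intro algebra.intro cring.intro comm_monoid.intro comm_monoid_axioms.intro algebra_axioms.intro
        assms(1) ring_axioms monoid_axioms c)
      (use mod_bihom_left[OF assms(3)] in \<open>auto dest: mod_hom_smult\<close>)
qed

text \<open>The image of a product and the product of the images are both bilinear in the two
  factors.\<close>

lemma ring_hom_of_mod_hom:
  assumes "module C M" "module C S" "spans C M G" "mult M \<in> mod_bihom C M M M" "mult S \<in> mod_bihom C S S S"
    and "h \<in> mod_hom C M S"
    and "\<And>x y. \<lbrakk>x \<in> G; y \<in> G\<rbrakk> \<Longrightarrow> h (x \<otimes>\<^bsub>M\<^esub> y) = h x \<otimes>\<^bsub>S\<^esub> h y"
    and "h \<one>\<^bsub>M\<^esub> = \<one>\<^bsub>S\<^esub>"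
  shows "h \<in> ring_hom M S"
proof (rule ring_hom_memI)
  fix x y assume xy: "x \<in> carrier M" "y \<in> carrier M"
  note h = mod_hom_closed[OF assms(6)]
  show "h (x \<otimes>\<^bsub>M\<^esub> y) = h x \<otimes>\<^bsub>S\<^esub> h y"
  proof (rule mod_bihom_eqI[OF assms(1,1,2,3,3) _ _ assms(7) xy])
    show "(\<lambda>x y. h (x \<otimes>\<^bsub>M\<^esub> y)) \<in> mod_bihom C M M S"
      by (intro mod_bihomI mod_hom_comp[OF assms(6) mod_bihom_left[OF assms(4)]]
          mod_hom_comp[OF assms(6) mod_bihom_right[OF assms(4)]])
    show "(\<lambda>x y. h x \<otimes>\<^bsub>S\<^esub> h y) \<in> mod_bihom C M M S"
    proof (rule mod_bihomI)
      show "(\<lambda>y. h x \<otimes>\<^bsub>S\<^esub> h y) \<in> mod_hom C M S" if "x \<in> carrier M" for x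
        using mod_hom_comp[OF mod_bihom_right[OF assms(5) h[OF that]] assms(6)] .
      show "(\<lambda>x. h x \<otimes>\<^bsub>S\<^esub> h y) \<in> mod_hom C M S" if "y \<in> carrier M" for y
        using mod_hom_comp[OF mod_bihom_left[OF assms(5) h[OF that]] assms(6)] .
    qed
  qed
qed (use assms(8) mod_hom_closed[OF assms(6)] mod_hom_add[OF assms(6)] in auto)

lemma algebra_bihom:
  assumes "algebra C S" shows "mult S \<in> mod_bihom C S S S"
  by (rule mod_bihomI) (rule mod_hom_multl[OF assms _ mod_hom_id] mod_hom_multr[OF assms _ mod_hom_id]; assumption)+

section \<open>Free modules and quotients\<close>

lemma free_mod_sel:
  "zero (free_mod C S) = (\<lambda>s. \<zero>\<^bsub>C\<^esub>)" "add (free_mod C S) = (\<lambda>f g s. f s \<oplus>\<^bsub>C\<^esub> g s)"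
  "smult (free_mod C S) = (\<lambda>c f s. c \<otimes>\<^bsub>C\<^esub> f s)"
  by (simp_all add: free_mod_def)

lemma free_mod_carrier:
  "f \<in> carrier (free_mod C S) \<longleftrightarrow>
    (\<forall>s. f s \<in> carrier C) \<and> (\<forall>s. s \<notin> S \<longrightarrow> f s = \<zero>\<^bsub>C\<^esub>) \<and> finite {s. f s \<noteq> \<zero>\<^bsub>C\<^esub>}"
  by (simp add: free_mod_def)

lemma module_free_mod:
  assumes "cring C" shows "module C (free_mod C S)"
proof -
  interpret C: cring C by fact
  have ab: "abelian_group (free_mod C S)"
  proof (rule abelian_groupI)
    fix f g assume fg: "f \<in> carrier (free_mod C S)" "g \<in> carrier (free_mod C S)"
    have "{s. f s \<oplus>\<^bsub>C\<^esub> g s \<noteq> \<zero>\<^bsub>C\<^esub>} \<subseteq> {s. f s \<noteq> \<zero>\<^bsub>C\<^esub>} \<union> {s. g s \<noteq> \<zero>\<^bsub>C\<^esub>}"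
      using fg by (auto simp: free_mod_sel free_mod_carrier)
    then have "finite {s. f s \<oplus>\<^bsub>C\<^esub> g s \<noteq> \<zero>\<^bsub>C\<^esub>}"
      by (rule finite_subset) (use fg in \<open>auto simp: free_mod_sel free_mod_carrier\<close>)
    then show "f \<oplus>\<^bsub>free_mod C S\<^esub> g \<in> carrier (free_mod C S)"
      using fg by (auto simp: free_mod_sel free_mod_carrier)
  next
    fix f assume f: "f \<in> carrier (free_mod C S)"
    have "{s. \<ominus>\<^bsub>C\<^esub> f s \<noteq> \<zero>\<^bsub>C\<^esub>} \<subseteq> {s. f s \<noteq> \<zero>\<^bsub>C\<^esub>}"
      using f by (auto simp: free_mod_sel free_mod_carrier)
    then have "finite {s. \<ominus>\<^bsub>C\<^esub> f s \<noteq> \<zero>\<^bsub>C\<^esub>}"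
      by (rule finite_subset) (use f in \<open>auto simp: free_mod_sel free_mod_carrier\<close>)
    then show "\<exists>g\<in>carrier (free_mod C S). g \<oplus>\<^bsub>free_mod C S\<^esub> f = \<zero>\<^bsub>free_mod C S\<^esub>"
      using f by (intro bexI[of _ "\<lambda>s. \<ominus>\<^bsub>C\<^esub> f s"]) (auto simp: free_mod_sel free_mod_carrier C.l_neg)
  qed (auto simp: free_mod_sel free_mod_carrier C.a_ac)
  show ?thesis
  proof (rule moduleI[OF assms ab])
    fix c f assume cf: "c \<in> carrier C" "f \<in> carrier (free_mod C S)"
    have "{s. c \<otimes>\<^bsub>C\<^esub> f s \<noteq> \<zero>\<^bsub>C\<^esub>} \<subseteq> {s. f s \<noteq> \<zero>\<^bsub>C\<^esub>}"
      using cf by auto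
    then have "finite {s. c \<otimes>\<^bsub>C\<^esub> f s \<noteq> \<zero>\<^bsub>C\<^esub>}"
      by (rule finite_subset) (use cf in \<open>auto simp: free_mod_sel free_mod_carrier\<close>)
    then show "c \<odot>\<^bsub>free_mod C S\<^esub> f \<in> carrier (free_mod C S)"
      using cf by (auto simp: free_mod_sel free_mod_carrier)
  qed (auto simp: free_mod_sel free_mod_carrier C.l_distr C.r_distr C.m_assoc)
qed

lemma free_gen_closed:
  assumes "cring C" "s \<in> S" shows "free_gen C s \<in> carrier (free_mod C S)"
proof -
  interpret C: cring C by fact
  have "{t. free_gen C s t \<noteq> \<zero>\<^bsub>C\<^esub>} \<subseteq> {s}" by (auto simp: free_gen_def)
  then have "finite {t. free_gen C s t \<noteq> \<zero>\<^bsub>C\<^esub>}" by (rule finite_subset) simp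
  then show ?thesis using assms(2) by (auto simp: free_mod_sel free_mod_carrier free_gen_def)
qed

text \<open>Induction on a finite set containing the support: clearing the value at one point
  \<open>a\<close> subtracts a multiple of the generator at \<open>a\<close>.\<close>

lemma spans_free_mod:
  assumes "cring C" shows "spans C (free_mod C S) (free_gen C ` S)"
proof (rule spansI)
  interpret C: cring C by fact
  interpret F: module C "free_mod C S" by (rule module_free_mod) fact
  fix H f assume H: "submodule H C (free_mod C S)" "free_gen C ` S \<subseteq> H" and f: "f \<in> carrier (free_mod C S)"
  have "finite {s. f s \<noteq> \<zero>\<^bsub>C\<^esub>}" using f by (simp add: free_mod_carrier)
  moreover have "f \<in> H" if "finite A" "f \<in> carrier (free_mod C S)" "{s. f s \<noteq> \<zero>\<^bsub>C\<^esub>} \<subseteq> A" for A f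
    using that
  proof (induction A arbitrary: f rule: finite_induct)
    case empty
    then have "f = \<zero>\<^bsub>free_mod C S\<^esub>" by (auto simp: free_mod_sel fun_eq_iff)
    then show ?case using submodule_zero[OF H(1)] by simp
  next
    case (insert a A)
    define g where "g = f(a := \<zero>\<^bsub>C\<^esub>)"
    have sub: "{s. g s \<noteq> \<zero>\<^bsub>C\<^esub>} \<subseteq> {s. f s \<noteq> \<zero>\<^bsub>C\<^esub>}" by (auto simp: g_def)
    have g: "g \<in> carrier (free_mod C S)"
      using insert.prems(1) finite_subset[OF sub] by (auto simp: free_mod_sel free_mod_carrier g_def)
    have gH: "g \<in> H" by (rule insert.IH[OF g]) (use insert.prems(2) in \<open>auto simp: g_def\<close>)
    show ?case
    proof (cases "a \<in> S")
      case True
      have fa: "f a \<in> carrier C" using insert.prems(1) by (simp add: free_mod_carrier)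
      have "f = g \<oplus>\<^bsub>free_mod C S\<^esub> (f a \<odot>\<^bsub>free_mod C S\<^esub> free_gen C a)"
        using insert.prems(1) by (auto simp: free_mod_sel fun_eq_iff g_def free_gen_def free_mod_carrier)
      moreover have "f a \<odot>\<^bsub>free_mod C S\<^esub> free_gen C a \<in> H"
        using True H(2) by (intro F.submoduleE(4)[OF H(1) fa]) auto
      ultimately show ?thesis using F.submoduleE(5)[OF H(1) gH] by metis
    next
      \<comment> \<open>Outside \<open>S\<close> the function vanishes already, so clearing the
        value changes nothing.\<close>
      case False
      then have "f a = \<zero>\<^bsub>C\<^esub>" using insert.prems(1) by (simp add: free_mod_carrier)
      then have "g = f" by (auto simp: g_def fun_eq_iff)
      then show ?thesis using gH by simp
    qed
  qed
  ultimately show "f \<in> H" using f by blast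
qed (use assms free_gen_closed module_free_mod in \<open>auto\<close>)

section \<open>Universal property of free modules\<close>

definition free_lift where
  "free_lift C P \<phi> f = (\<Oplus>\<^bsub>P\<^esub>s\<in>{s. f s \<noteq> \<zero>\<^bsub>C\<^esub>}. f s \<odot>\<^bsub>P\<^esub> \<phi> s)"

text \<open>Additional indices contribute zero terms. The sums for functions with different supports
  can thus be taken over one common set.\<close>

lemma free_lift_superset:
  assumes "module C P" "\<phi> \<in> S \<rightarrow> carrier P" "f \<in> carrier (free_mod C S)"
    and "finite A" "A \<subseteq> S" "{s. f s \<noteq> \<zero>\<^bsub>C\<^esub>} \<subseteq> A"
  shows "free_lift C P \<phi> f = (\<Oplus>\<^bsub>P\<^esub>s\<in>A. f s \<odot>\<^bsub>P\<^esub> \<phi> s)"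
proof -
  interpret P: module C P by fact
  have fs: "f s \<in> carrier C" for s using assms(3) by (simp add: free_mod_carrier)
  have ps: "\<phi> s \<in> carrier P" if "s \<in> A" for s using assms(2,5) that by auto
  show ?thesis unfolding free_lift_def
    by (rule P.M.add.finprod_mono_neutral_cong_left) (use assms(4-6) fs ps in auto)
qed

lemma free_lift_hom:
  assumes "module C P" "\<phi> \<in> S \<rightarrow> carrier P"
  shows "free_lift C P \<phi> \<in> mod_hom C (free_mod C S) P"
proof (rule mod_homI)
  interpret P: module C P by fact
  interpret F: module C "free_mod C S" by (rule module_free_mod) (rule P.R.is_cring)
  have car: "f s \<in> carrier C" and supp: "f s \<noteq> \<zero>\<^bsub>C\<^esub> \<Longrightarrow> s \<in> S" and fin: "finite {s. f s \<noteq> \<zero>\<^bsub>C\<^esub>}"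
    if "f \<in> carrier (free_mod C S)" for f s
    using that by (auto simp: free_mod_carrier)
  note sup = free_lift_superset[OF assms]
  fix f assume f: "f \<in> carrier (free_mod C S)"
  show "free_lift C P \<phi> f \<in> carrier P"
    unfolding free_lift_def using assms(2) car[OF f] supp[OF f] by (intro P.M.finsum_closed) auto
  {
    fix g assume g: "g \<in> carrier (free_mod C S)"
    \<comment> \<open>Both functions and their sum are supported in this set.\<close>
    define A where "A = {s. f s \<noteq> \<zero>\<^bsub>C\<^esub>} \<union> {s. g s \<noteq> \<zero>\<^bsub>C\<^esub>}"
    have A: "finite A" "A \<subseteq> S" using fin f g supp by (auto simp: A_def)
    have \<phi>: "\<phi> s \<in> carrier P" if "s \<in> A" for s using that A assms(2) by auto
    have "free_lift C P \<phi> (f \<oplus>\<^bsub>free_mod C S\<^esub> g) = (\<Oplus>\<^bsub>P\<^esub>s\<in>A. (f s \<oplus>\<^bsub>C\<^esub> g s) \<odot>\<^bsub>P\<^esub> \<phi> s)"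
      by (subst sup[OF F.M.a_closed[OF f g] A]) (auto simp: A_def free_mod_sel)
    also have "\<dots> = (\<Oplus>\<^bsub>P\<^esub>s\<in>A. f s \<odot>\<^bsub>P\<^esub> \<phi> s \<oplus>\<^bsub>P\<^esub> g s \<odot>\<^bsub>P\<^esub> \<phi> s)"
      using car f g \<phi> by (intro P.M.finsum_cong') (auto simp: P.smult_l_distr)
    also have "\<dots> = (\<Oplus>\<^bsub>P\<^esub>s\<in>A. f s \<odot>\<^bsub>P\<^esub> \<phi> s) \<oplus>\<^bsub>P\<^esub> (\<Oplus>\<^bsub>P\<^esub>s\<in>A. g s \<odot>\<^bsub>P\<^esub> \<phi> s)"
      using car f g \<phi> by (intro P.M.finsum_addf) auto
    also have "\<dots> = free_lift C P \<phi> f \<oplus>\<^bsub>P\<^esub> free_lift C P \<phi> g"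
      by (subst (1 2) sup[OF _ A]) (auto simp: A_def f g)
    finally show "free_lift C P \<phi> (f \<oplus>\<^bsub>free_mod C S\<^esub> g) = free_lift C P \<phi> f \<oplus>\<^bsub>P\<^esub> free_lift C P \<phi> g" .
  }
  {
    fix c assume c: "c \<in> carrier C"
    define A where "A = {s. f s \<noteq> \<zero>\<^bsub>C\<^esub>}"
    have A: "finite A" "A \<subseteq> S" using fin f supp by (auto simp: A_def)
    have \<phi>: "\<phi> s \<in> carrier P" if "s \<in> A" for s using that A assms(2) by auto
    have "free_lift C P \<phi> (c \<odot>\<^bsub>free_mod C S\<^esub> f) = (\<Oplus>\<^bsub>P\<^esub>s\<in>A. (c \<otimes>\<^bsub>C\<^esub> f s) \<odot>\<^bsub>P\<^esub> \<phi> s)"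
      by (subst sup[OF F.smult_closed[OF c f] A]) (use c in \<open>auto simp: A_def free_mod_sel\<close>)
    also have "\<dots> = (\<Oplus>\<^bsub>P\<^esub>s\<in>A. c \<odot>\<^bsub>P\<^esub> (f s \<odot>\<^bsub>P\<^esub> \<phi> s))"
      using car f \<phi> c by (intro P.M.finsum_cong') (auto simp: P.smult_assoc1)
    also have "\<dots> = c \<odot>\<^bsub>P\<^esub> free_lift C P \<phi> f"
      unfolding free_lift_def A_def[symmetric]
      by (rule P.finsum_smult_ldistr[symmetric]) (use A c car f \<phi> in auto)
    finally show "free_lift C P \<phi> (c \<odot>\<^bsub>free_mod C S\<^esub> f) = c \<odot>\<^bsub>P\<^esub> free_lift C P \<phi> f" .
  }
qed

lemma free_lift_gen:
  assumes "module C P" "\<phi> \<in> S \<rightarrow> carrier P" "s \<in> S"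
  shows "free_lift C P \<phi> (free_gen C s) = \<phi> s"
proof -
  interpret P: module C P by fact
  have "free_lift C P \<phi> (free_gen C s) = (\<Oplus>\<^bsub>P\<^esub>t\<in>{s}. free_gen C s t \<odot>\<^bsub>P\<^esub> \<phi> t)"
    by (rule free_lift_superset[OF assms(1,2) free_gen_closed[OF P.R.is_cring assms(3)]])
      (use assms(3) in \<open>auto simp: free_gen_def\<close>)
  also have "\<dots> = \<phi> s"
  proof -
    have "\<phi> s \<in> carrier P" using assms(2,3) by blast
    then show ?thesis by (subst P.M.finsum_insert) (auto simp: free_gen_def)
  qed
  finally show ?thesis .
qed

section \<open>Quotient modules and modules given by generators and relators\<close>

lemma abelian_subgroup_of_submodule:
  assumes "module C M" "submodule N C M" shows "abelian_subgroup N M"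
proof -
  interpret M: module C M by fact
  show ?thesis
    by (intro abelian_subgroupI3 additive_subgroup.intro submodule.axioms(1)[OF assms(2)] M.abelian_group_axioms)
qed

lemma quot_mod_carrier: "carrier (quot_mod M N) = (\<lambda>x. N +>\<^bsub>M\<^esub> x) ` carrier M"
  by (auto simp: quot_mod_def A_RCOSETS_def')

text \<open>In \<open>quot_mod\<close> a scalar multiple is a union over representatives. All of
  them give the same coset, because \<open>N\<close> is stable under \<open>c\<close>, and a union
  of equal sets over a nonempty index set is that set.\<close>

lemma quot_mod_smult:
  assumes "module C M" "submodule N C M" "c \<in> carrier C" "x \<in> carrier M"
  shows "c \<odot>\<^bsub>quot_mod M N\<^esub> (N +>\<^bsub>M\<^esub> x) = N +>\<^bsub>M\<^esub> (c \<odot>\<^bsub>M\<^esub> x)"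
proof -
  interpret M: module C M by fact
  interpret N: abelian_subgroup N M by (rule abelian_subgroup_of_submodule) fact+
  have "N +>\<^bsub>M\<^esub> (c \<odot>\<^bsub>M\<^esub> y) = N +>\<^bsub>M\<^esub> (c \<odot>\<^bsub>M\<^esub> x)" if "y \<in> N +>\<^bsub>M\<^esub> x" for y
  proof -
    obtain n where n: "n \<in> N" "y = n \<oplus>\<^bsub>M\<^esub> x" using \<open>y \<in> N +>\<^bsub>M\<^esub> x\<close> by (auto simp: a_r_coset_def')
    have nM: "n \<in> carrier M" using n(1) by (rule N.a_Hcarr)
    have "c \<odot>\<^bsub>M\<^esub> y = c \<odot>\<^bsub>M\<^esub> n \<oplus>\<^bsub>M\<^esub> c \<odot>\<^bsub>M\<^esub> x" using n nM assms by (simp add: M.smult_r_distr)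
    then have "c \<odot>\<^bsub>M\<^esub> y \<in> N +>\<^bsub>M\<^esub> (c \<odot>\<^bsub>M\<^esub> x)"
      using M.submoduleE(4)[OF assms(2,3) n(1)] by (auto simp: a_r_coset_def')
    then show ?thesis
      using N.a_repr_independence' assms(3,4) by (metis M.smult_closed)
  qed
  moreover have "N +>\<^bsub>M\<^esub> x \<noteq> {}" using N.a_rcos_self[OF assms(4)] by blast
  ultimately have "(\<Union>y\<in>N +>\<^bsub>M\<^esub> x. N +>\<^bsub>M\<^esub> (c \<odot>\<^bsub>M\<^esub> y)) = N +>\<^bsub>M\<^esub> (c \<odot>\<^bsub>M\<^esub> x)"
    by (intro SUP_eq_const)
  then show ?thesis by (simp add: quot_mod_def)
qed

lemma quot_mod_add:
  assumes "module C M" "submodule N C M" "x \<in> carrier M" "y \<in> carrier M"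
  shows "(N +>\<^bsub>M\<^esub> x) \<oplus>\<^bsub>quot_mod M N\<^esub> (N +>\<^bsub>M\<^esub> y) = N +>\<^bsub>M\<^esub> (x \<oplus>\<^bsub>M\<^esub> y)"
  using abelian_subgroup.a_rcos_sum[OF abelian_subgroup_of_submodule[OF assms(1,2)] assms(3,4)]
  by (simp add: quot_mod_def)

lemma quot_mod_zero:
  assumes "module C M" "submodule N C M"
  shows "\<zero>\<^bsub>quot_mod M N\<^esub> = N +>\<^bsub>M\<^esub> \<zero>\<^bsub>M\<^esub>"
proof -
  interpret M: module C M by fact
  show ?thesis using M.submoduleE(1)[OF assms(2)] by (simp add: quot_mod_def)
qed

lemma module_quot_mod:
  assumes "module C M" "submodule N C M"
  shows "module C (quot_mod M N)"
proof -
  interpret M: module C M by fact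
  note s = quot_mod_smult[OF assms] quot_mod_add[OF assms] quot_mod_zero[OF assms]
  have ab: "abelian_group (quot_mod M N)"
  proof (rule abelian_groupI)
    fix X assume "X \<in> carrier (quot_mod M N)"
    then obtain x where x: "x \<in> carrier M" "X = N +>\<^bsub>M\<^esub> x" by (auto simp: quot_mod_carrier)
    then show "\<exists>Y\<in>carrier (quot_mod M N). Y \<oplus>\<^bsub>quot_mod M N\<^esub> X = \<zero>\<^bsub>quot_mod M N\<^esub>"
      by (intro bexI[of _ "N +>\<^bsub>M\<^esub> \<ominus>\<^bsub>M\<^esub> x"]) (auto simp: s quot_mod_carrier M.M.l_neg)
  qed (auto simp: quot_mod_carrier s M.M.a_ac)
  show ?thesis
    by (rule moduleI[OF M.R.is_cring ab])
      (auto simp: quot_mod_carrier s M.smult_l_distr M.smult_r_distr M.smult_assoc1)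
qed

lemma quot_mod_proj_hom:
  assumes "module C M" "submodule N C M"
  shows "(\<lambda>x. N +>\<^bsub>M\<^esub> x) \<in> mod_hom C M (quot_mod M N)"
  by (rule mod_homI) (auto simp: quot_mod_carrier quot_mod_smult[OF assms] quot_mod_add[OF assms])

lemma quot_mod_proj_zero:
  assumes "module C M" "submodule N C M" "x \<in> carrier M"
  shows "N +>\<^bsub>M\<^esub> x = \<zero>\<^bsub>quot_mod M N\<^esub> \<longleftrightarrow> x \<in> N"
proof -
  interpret M: module C M by fact
  interpret N: abelian_subgroup N M by (rule abelian_subgroup_of_submodule) fact+
  show ?thesis using N.a_rcos_const N.a_rcos_self[OF assms(3)] by (auto simp: quot_mod_def)
qed

lemma (in abelian_group) eq_of_minus_zero:
  assumes "a \<in> carrier G" "b \<in> carrier G" "a \<ominus> b = \<zero>" shows "a = b"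
  using assms minus_equality[of a "\<ominus> b"] by (simp add: minus_eq)

lemma quot_mod_eqI:
  fixes M :: "('c, 'm) module"
  assumes "module C M" "submodule N C M" "x \<in> carrier M" "y \<in> carrier M" "x \<ominus>\<^bsub>M\<^esub> y \<in> N"
  shows "N +>\<^bsub>M\<^esub> x = N +>\<^bsub>M\<^esub> y"
proof -
  interpret M: module C M by fact
  interpret Q: module C "quot_mod M N" by (rule module_quot_mod) fact+
  have "N +>\<^bsub>M\<^esub> (x \<ominus>\<^bsub>M\<^esub> y) = \<zero>\<^bsub>quot_mod M N\<^esub>"
    using quot_mod_proj_zero[OF assms(1,2)] assms(3-5) by blast
  then have "(N +>\<^bsub>M\<^esub> x) \<ominus>\<^bsub>quot_mod M N\<^esub> (N +>\<^bsub>M\<^esub> y) = \<zero>\<^bsub>quot_mod M N\<^esub>"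
    using mod_hom_minus[OF assms(1) Q.module_axioms quot_mod_proj_hom[OF assms(1,2)] assms(3,4)] by simp
  moreover have "N +>\<^bsub>M\<^esub> x \<in> carrier (quot_mod M N)" "N +>\<^bsub>M\<^esub> y \<in> carrier (quot_mod M N)"
    using assms(3,4) by (simp_all add: quot_mod_carrier)
  ultimately show ?thesis by (rule Q.M.eq_of_minus_zero[rotated 2])
qed

lemma spans_quot_mod:
  assumes "module C M" "submodule N C M" "spans C M G"
  shows "spans C (quot_mod M N) ((\<lambda>x. N +>\<^bsub>M\<^esub> x) ` G)"
proof (rule spansI)
  note m = module_quot_mod[OF assms(1,2)]
  show "module C (quot_mod M N)" by (rule m)
  show "(\<lambda>x. N +>\<^bsub>M\<^esub> x) ` G \<subseteq> carrier (quot_mod M N)"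
    using assms(3) by (auto simp: spans_def quot_mod_carrier)
  fix H X assume H: "submodule H C (quot_mod M N)" "(\<lambda>x. N +>\<^bsub>M\<^esub> x) ` G \<subseteq> H" "X \<in> carrier (quot_mod M N)"
  then obtain x where x: "x \<in> carrier M" "X = N +>\<^bsub>M\<^esub> x" by (auto simp: quot_mod_carrier)
  show "X \<in> H" unfolding x(2)
    by (rule mod_hom_submodule[OF assms(1) m assms(3) quot_mod_proj_hom[OF assms(1,2)] H(1) _ x(1)]) (use H(2) in auto)
qed

text \<open>The value on a coset is that of \<open>h\<close> at a chosen representative. The choice
  is immaterial because \<open>h\<close> vanishes on \<open>N\<close>.\<close>

lemma quot_mod_lift:
  assumes "module C M" "submodule N C M" "module C P" "h \<in> mod_hom C M P"
    and "\<And>x. x \<in> N \<Longrightarrow> h x = \<zero>\<^bsub>P\<^esub>"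
  obtains k where "k \<in> mod_hom C (quot_mod M N) P" "\<And>x. x \<in> carrier M \<Longrightarrow> k (N +>\<^bsub>M\<^esub> x) = h x"
proof -
  interpret M: module C M by fact
  interpret P: module C P by fact
  interpret N: abelian_subgroup N M by (rule abelian_subgroup_of_submodule) fact+
  define k where "k X = h (SOME x. x \<in> X)" for X
  have k: "k (N +>\<^bsub>M\<^esub> x) = h x" if x: "x \<in> carrier M" for x
  proof -
    have "(SOME y. y \<in> N +>\<^bsub>M\<^esub> x) \<in> N +>\<^bsub>M\<^esub> x" by (rule someI[of _ x], rule N.a_rcos_self[OF x])
    then obtain n where n: "n \<in> N" "(SOME y. y \<in> N +>\<^bsub>M\<^esub> x) = n \<oplus>\<^bsub>M\<^esub> x" by (auto simp: a_r_coset_def')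
    have "h (n \<oplus>\<^bsub>M\<^esub> x) = h x"
      using mod_hom_add[OF assms(4) N.a_Hcarr[OF n(1)] x] assms(5)[OF n(1)] mod_hom_closed[OF assms(4) x] by simp
    then show ?thesis unfolding k_def n(2) .
  qed
  have "k \<in> mod_hom C (quot_mod M N) P"
    by (rule mod_homI) (auto simp: quot_mod_carrier quot_mod_smult[OF assms(1,2)] quot_mod_add[OF assms(1,2)] k
      mod_hom_closed[OF assms(4)] mod_hom_add[OF assms(4)] mod_hom_smult[OF assms(4)])
  then show thesis using k that by blast
qed

text \<open>Universal property of the module with generators \<open>S\<close> and relators
  \<open>A\<close>: the kernel of the free extension is a submodule, so it contains all that the
  relators generate. Tensor products and tensor powers are both of this kind.\<close>

lemma quot_free_lift:
  assumes "module C P" "A \<subseteq> carrier (free_mod C S)" "\<phi> \<in> S \<rightarrow> carrier P"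
    and "\<And>a. a \<in> A \<Longrightarrow> free_lift C P \<phi> a = \<zero>\<^bsub>P\<^esub>"
  obtains k where "k \<in> mod_hom C (quot_mod (free_mod C S) (submodule_gen C (free_mod C S) A)) P"
    "\<And>s. s \<in> S \<Longrightarrow> k (submodule_gen C (free_mod C S) A +>\<^bsub>free_mod C S\<^esub> free_gen C s) = \<phi> s"
proof -
  interpret P: module C P by fact
  note F = module_free_mod[OF P.R.is_cring, of S]
  have sub: "submodule (submodule_gen C (free_mod C S) A) C (free_mod C S)"
    by (rule submodule_gen_submodule[OF F assms(2)])
  have "submodule {x \<in> carrier (free_mod C S). free_lift C P \<phi> x = \<zero>\<^bsub>P\<^esub>} C (free_mod C S)"
  proof -
    interpret F: module C "free_mod C S" by (rule F)
    note h = free_lift_hom[OF assms(1,3)]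
    show ?thesis
      by (rule F.submoduleI)
        (auto simp: mod_hom_add[OF h] mod_hom_smult[OF h] mod_hom_uminus[OF F assms(1) h]
          mod_hom_zero[OF F assms(1) h])
  qed
  then have 0: "free_lift C P \<phi> x = \<zero>\<^bsub>P\<^esub>" if "x \<in> submodule_gen C (free_mod C S) A" for x
    using submodule_gen_least[of _ C "free_mod C S" A] assms(2,4) that by blast
  obtain k where k: "k \<in> mod_hom C (quot_mod (free_mod C S) (submodule_gen C (free_mod C S) A)) P"
    "\<And>x. x \<in> carrier (free_mod C S) \<Longrightarrow>
      k (submodule_gen C (free_mod C S) A +>\<^bsub>free_mod C S\<^esub> x) = free_lift C P \<phi> x"
    using quot_mod_lift[OF F sub assms(1) free_lift_hom[OF assms(1,3)] 0] by blast
  show thesis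
    by (rule that[OF k(1)]) (simp add: k(2) free_gen_closed[OF P.R.is_cring] free_lift_gen[OF assms(1,3)])
qed

section \<open>The tensor product\<close>

context
  fixes C :: "('c, 'e) ring_scheme" and M :: "('c, 'm) module" and N :: "('c, 'n) module"
  assumes M: "module C M" and N: "module C N"
begin

interpretation M: module C M by (rule M)
interpretation N: module C N by (rule N)
interpretation F: module C "free_mod C (carrier M \<times> carrier N)"
  by (rule module_free_mod) (rule M.R.is_cring)

text \<open>Gives a name to the generating set that occurs inside \<open>tensor_rel\<close>.\<close>

definition tensor_relators where
  "tensor_relators = (let F = free_mod C (carrier M \<times> carrier N); \<delta> = (\<lambda>x y. free_gen C (x, y)) in
      {\<delta> (x \<oplus>\<^bsub>M\<^esub> x') y \<ominus>\<^bsub>F\<^esub> (\<delta> x y \<oplus>\<^bsub>F\<^esub> \<delta> x' y) |x x' y.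
          x \<in> carrier M \<and> x' \<in> carrier M \<and> y \<in> carrier N} \<union>
       {\<delta> x (y \<oplus>\<^bsub>N\<^esub> y') \<ominus>\<^bsub>F\<^esub> (\<delta> x y \<oplus>\<^bsub>F\<^esub> \<delta> x y') |x y y'.
          x \<in> carrier M \<and> y \<in> carrier N \<and> y' \<in> carrier N} \<union>
       {\<delta> (c \<odot>\<^bsub>M\<^esub> x) y \<ominus>\<^bsub>F\<^esub> c \<odot>\<^bsub>F\<^esub> \<delta> x y |c x y.
          c \<in> carrier C \<and> x \<in> carrier M \<and> y \<in> carrier N} \<union>
       {\<delta> x (c \<odot>\<^bsub>N\<^esub> y) \<ominus>\<^bsub>F\<^esub> c \<odot>\<^bsub>F\<^esub> \<delta> x y |c x y.
          c \<in> carrier C \<and> x \<in> carrier M \<and> y \<in> carrier N})"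

lemma tensor_rel_eq: "tensor_rel C M N = submodule_gen C (free_mod C (carrier M \<times> carrier N)) tensor_relators"
  unfolding tensor_rel_def tensor_relators_def Let_def by simp

lemma free_gen_pair: "\<lbrakk>x \<in> carrier M; y \<in> carrier N\<rbrakk> \<Longrightarrow> free_gen C (x, y) \<in> carrier (free_mod C (carrier M \<times> carrier N))"
  by (rule free_gen_closed) (auto intro: M.R.is_cring)

lemma tensor_relatorsI:
  fixes F \<delta> defines "F \<equiv> free_mod C (carrier M \<times> carrier N)" and "\<delta> \<equiv> \<lambda>x y. free_gen C (x, y)"
  assumes "x \<in> carrier M" "y \<in> carrier N"
  shows "x' \<in> carrier M \<Longrightarrow> \<delta> (x \<oplus>\<^bsub>M\<^esub> x') y \<ominus>\<^bsub>F\<^esub> (\<delta> x y \<oplus>\<^bsub>F\<^esub> \<delta> x' y) \<in> tensor_relators"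
    and "y' \<in> carrier N \<Longrightarrow> \<delta> x (y \<oplus>\<^bsub>N\<^esub> y') \<ominus>\<^bsub>F\<^esub> (\<delta> x y \<oplus>\<^bsub>F\<^esub> \<delta> x y') \<in> tensor_relators"
    and "c \<in> carrier C \<Longrightarrow> \<delta> (c \<odot>\<^bsub>M\<^esub> x) y \<ominus>\<^bsub>F\<^esub> c \<odot>\<^bsub>F\<^esub> \<delta> x y \<in> tensor_relators"
    and "c \<in> carrier C \<Longrightarrow> \<delta> x (c \<odot>\<^bsub>N\<^esub> y) \<ominus>\<^bsub>F\<^esub> c \<odot>\<^bsub>F\<^esub> \<delta> x y \<in> tensor_relators"
  using assms unfolding tensor_relators_def Let_def by blast+

lemma tensor_relators_closed: "tensor_relators \<subseteq> carrier (free_mod C (carrier M \<times> carrier N))"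
  unfolding tensor_relators_def Let_def
  by (safe; intro F.M.minus_closed F.M.a_closed F.smult_closed free_gen_pair) auto

lemma submodule_tensor_rel: "submodule (tensor_rel C M N) C (free_mod C (carrier M \<times> carrier N))"
  unfolding tensor_rel_eq by (rule submodule_gen_submodule[OF F.module_axioms tensor_relators_closed])

lemma module_tensor: "module C (tensor C M N)"
  unfolding tensor_def by (rule module_quot_mod[OF F.module_axioms submodule_tensor_rel])

lemma tens_closed: "\<lbrakk>x \<in> carrier M; y \<in> carrier N\<rbrakk> \<Longrightarrow> tens C M N x y \<in> carrier (tensor C M N)"
  unfolding tensor_def tens_def by (auto simp: quot_mod_carrier free_gen_pair)

text \<open>Each law of bilinearity is the vanishing of one of the four kinds of relators in the
  quotient.\<close>

lemma tens_bihom: "tens C M N \<in> mod_bihom C M N (tensor C M N)"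
proof -
  have rel: "tensor_rel C M N +>\<^bsub>free_mod C (carrier M \<times> carrier N)\<^esub> u
      = tensor_rel C M N +>\<^bsub>free_mod C (carrier M \<times> carrier N)\<^esub> v"
    if "u \<ominus>\<^bsub>free_mod C (carrier M \<times> carrier N)\<^esub> v \<in> tensor_relators"
      "u \<in> carrier (free_mod C (carrier M \<times> carrier N))" "v \<in> carrier (free_mod C (carrier M \<times> carrier N))" for u v
    by (rule quot_mod_eqI[OF F.module_axioms submodule_tensor_rel that(2,3)])
      (use that(1) submodule_gen_superset tensor_rel_eq in fastforce)
  note q = quot_mod_add[OF F.module_axioms submodule_tensor_rel] quot_mod_smult[OF F.module_axioms submodule_tensor_rel]
  note cl = free_gen_pair F.M.a_closed F.smult_closed
  show ?thesis
  proof (intro mod_bihomI mod_homI)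
    fix x y assume x: "x \<in> carrier M" and y: "y \<in> carrier N"
    show "tens C M N x y \<in> carrier (tensor C M N)" using x y by (rule tens_closed)
    then show "tens C M N x y \<in> carrier (tensor C M N)" .
    show "tens C M N (x \<oplus>\<^bsub>M\<^esub> x') y = tens C M N x y \<oplus>\<^bsub>tensor C M N\<^esub> tens C M N x' y" if "x' \<in> carrier M" for x'
      unfolding tens_def tensor_def using x y that
      by (subst q; (intro rel)?; auto intro: cl tensor_relatorsI)
    show "tens C M N x (y \<oplus>\<^bsub>N\<^esub> y') = tens C M N x y \<oplus>\<^bsub>tensor C M N\<^esub> tens C M N x y'" if "y' \<in> carrier N" for y'
      unfolding tens_def tensor_def using x y that
      by (subst q; (intro rel)?; auto intro: cl tensor_relatorsI)
    fix c assume c: "c \<in> carrier C"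
    show "tens C M N (c \<odot>\<^bsub>M\<^esub> x) y = c \<odot>\<^bsub>tensor C M N\<^esub> tens C M N x y"
      unfolding tens_def tensor_def using x y c
      by (subst q; (intro rel)?; auto intro: cl tensor_relatorsI)
    show "tens C M N x (c \<odot>\<^bsub>N\<^esub> y) = c \<odot>\<^bsub>tensor C M N\<^esub> tens C M N x y"
      unfolding tens_def tensor_def using x y c
      by (subst q; (intro rel)?; auto intro: cl tensor_relatorsI)
  qed
qed

text \<open>Linearity in the second factor extends membership to \<open>tens C M N x y\<close> with
  \<open>x\<close> in \<open>G\<close> and arbitrary \<open>y\<close>, linearity in the first to all
  pure tensors, and these generate the quotient.\<close>

lemma spans_tensor:
  assumes "spans C M G" "spans C N H"
  shows "spans C (tensor C M N) {tens C M N x y |x y. x \<in> G \<and> y \<in> H}"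
proof (rule spansI[OF module_tensor])
  show "{tens C M N x y |x y. x \<in> G \<and> y \<in> H} \<subseteq> carrier (tensor C M N)"
    using assms by (auto simp: spans_def intro!: tens_closed)
  fix K z assume K: "submodule K C (tensor C M N)" "{tens C M N x y |x y. x \<in> G \<and> y \<in> H} \<subseteq> K"
    and z: "z \<in> carrier (tensor C M N)"
  have G: "x \<in> carrier M" if "x \<in> G" for x using that assms(1) by (auto simp: spans_def)
  have 1: "tens C M N x y \<in> K" if "x \<in> G" "y \<in> carrier N" for x y
    by (rule mod_hom_submodule[OF N module_tensor assms(2) mod_bihom_right[OF tens_bihom] K(1) _ that(2)])
      (use that G K(2) in auto)
  have 2: "tens C M N x y \<in> K" if "x \<in> carrier M" "y \<in> carrier N" for x y
    by (rule mod_hom_submodule[OF M module_tensor assms(1) mod_bihom_left[OF tens_bihom] K(1) _ that(1)])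
      (use that 1 in auto)
  have a: "spans C (tensor C M N) ((\<lambda>x. tensor_rel C M N +>\<^bsub>free_mod C (carrier M \<times> carrier N)\<^esub> x) `
      free_gen C ` (carrier M \<times> carrier N))"
    unfolding tensor_def by (intro spans_quot_mod F.module_axioms submodule_tensor_rel spans_free_mod M.R.is_cring)
  have b: "(\<lambda>x. tensor_rel C M N +>\<^bsub>free_mod C (carrier M \<times> carrier N)\<^esub> x) `
      free_gen C ` (carrier M \<times> carrier N) \<subseteq> K"
    using 2 by (auto simp: tens_def)
  show "z \<in> K" using submodule_gen_least[OF K(1) b] a z unfolding spans_def by auto
qed

text \<open>The linear extension of a bilinear map to the free module on pairs annihilates the four
  kinds of relators.\<close>

lemma tensor_lift:
  assumes "module C P" "h \<in> mod_bihom C M N P"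
  obtains k where "k \<in> mod_hom C (tensor C M N) P"
    "\<And>x y. \<lbrakk>x \<in> carrier M; y \<in> carrier N\<rbrakk> \<Longrightarrow> k (tens C M N x y) = h x y"
proof -
  interpret P: module C P by fact
  define \<phi> where "\<phi> = (\<lambda>(x, y). h x y)"
  have \<phi>: "\<phi> \<in> carrier M \<times> carrier N \<rightarrow> carrier P"
    using mod_bihom_closed[OF assms(2)] by (auto simp: \<phi>_def)
  note fh = free_lift_hom[OF assms(1) \<phi>]
  note gen = free_lift_gen[OF assms(1) \<phi>]
  note hl = mod_bihom_left[OF assms(2)] and hr = mod_bihom_right[OF assms(2)]
  note s = mod_hom_minus[OF F.module_axioms assms(1) fh] mod_hom_add[OF fh] mod_hom_smult[OF fh] gen
    mod_hom_add[OF hl] mod_hom_add[OF hr] mod_hom_smult[OF hl] mod_hom_smult[OF hr] mod_bihom_closed[OF assms(2)]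
    P.M.r_neg
  have 0: "free_lift C P \<phi> a = \<zero>\<^bsub>P\<^esub>" if "a \<in> tensor_relators" for a
    using that unfolding tensor_relators_def Let_def
    by (auto simp: s free_gen_pair F.M.a_closed F.smult_closed) (simp_all add: \<phi>_def s a_minus_def)
  from quot_free_lift[OF assms(1) tensor_relators_closed \<phi> 0] obtain k where
    "k \<in> mod_hom C (tensor C M N) P"
    "\<And>s. s \<in> carrier M \<times> carrier N \<Longrightarrow>
       k (tensor_rel C M N +>\<^bsub>free_mod C (carrier M \<times> carrier N)\<^esub> free_gen C s) = \<phi> s"
    unfolding tensor_def tensor_rel_eq[symmetric] by blast
  then show thesis by (intro that[of k]) (auto simp: tens_def \<phi>_def)
qed

end

text \<open>Otherwise \<open>auto\<close> rewrites membership in \<open>lists\<close> into a statement about all letters.\<close>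

declare in_listsD [rule del] in_listsI [rule del]

text \<open>The algebras arise from modules by overwriting \<open>mult\<close> and
  \<open>one\<close>. Linear notions do not read these two fields, so facts about the underlying
  module carry over.\<close>

lemma module_update: "module C (M\<lparr>mult := p, one := e\<rparr>) \<longleftrightarrow> module C M"
  unfolding module_def abelian_group_def abelian_monoid_def abelian_group_axioms_def module_axioms_def by simp

lemma mod_hom_update:
  "mod_hom C (M\<lparr>mult := p, one := e\<rparr>) P = mod_hom C M P"
  "mod_hom C M (P\<lparr>mult := p', one := e'\<rparr>) = mod_hom C M P"
  unfolding mod_hom_def by simp_all

lemma mod_bihom_update:
  "mod_bihom C (M\<lparr>mult := p, one := e\<rparr>) N P = mod_bihom C M N P"
  "mod_bihom C M (N\<lparr>mult := p', one := e'\<rparr>) P = mod_bihom C M N P"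
  "mod_bihom C M N (P\<lparr>mult := p'', one := e''\<rparr>) = mod_bihom C M N P"
  unfolding mod_bihom_def mod_hom_update by simp_all

lemma submodule_update: "submodule H C (M\<lparr>mult := p, one := e\<rparr>) \<longleftrightarrow> submodule H C M"
  unfolding submodule_def submodule_axioms_def by simp

lemma spans_update: "spans C (M\<lparr>mult := p, one := e\<rparr>) G \<longleftrightarrow> spans C M G"
  unfolding spans_def submodule_gen_def submodule_update by simp

lemmas mult_updates = module_update mod_hom_update mod_bihom_update submodule_update spans_update

lemma mod_hom_cong:
  assumes "module C M" "f \<in> mod_hom C M P" "\<And>x. x \<in> carrier M \<Longrightarrow> g x = f x"
  shows "g \<in> mod_hom C M P"
proof -
  interpret M: module C M by fact
  show ?thesis by (rule mod_homI)
    (simp_all add: assms(3) mod_hom_closed[OF assms(2)] mod_hom_add[OF assms(2)] mod_hom_smult[OF assms(2)])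
qed

section \<open>Bilinear maps on tensor products, built from families of linear maps\<close>

lemma mod_bihom_flip: "h \<in> mod_bihom C M N P \<Longrightarrow> (\<lambda>y x. h x y) \<in> mod_bihom C N M P"
  unfolding mod_bihom_def by auto

text \<open>Here \<open>\<gamma> s\<close> runs through generators of \<open>M\<close>, and
  \<open>L s\<close> is the map wanted for that generator. For every \<open>t\<close> the values
  \<open>L s t\<close> extend linearly to \<open>M\<close>. That the extension depends linearly on
  \<open>t\<close> can be tested on the generators, where it equals \<open>L s t\<close>.\<close>

lemma mod_bihom_of_family:
  assumes "module C M" "module C N" "module C P" "spans C M (\<gamma> ` S)"
    and L: "\<And>s. s \<in> S \<Longrightarrow> L s \<in> mod_hom C N P"
    and lift: "\<And>t. t \<in> carrier N \<Longrightarrow> \<exists>k. k \<in> mod_hom C M P \<and> (\<forall>s\<in>S. k (\<gamma> s) = L s t)"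
  obtains p where "p \<in> mod_bihom C M N P"
    "\<And>s t. \<lbrakk>s \<in> S; t \<in> carrier N\<rbrakk> \<Longrightarrow> p (\<gamma> s) t = L s t"
proof -
  obtain K where K: "K t \<in> mod_hom C M P" "\<forall>s\<in>S. K t (\<gamma> s) = L s t" if "t \<in> carrier N" for t
    using lift by metis
  have "K \<in> mod_bihom C N M P"
  proof (rule mod_bihom_spanI[OF assms(2,1,3,4)])
    show "K t \<in> mod_hom C M P" if "t \<in> carrier N" for t using K that by blast
    show "(\<lambda>t. K t y) \<in> mod_hom C N P" if y: "y \<in> \<gamma> ` S" for y
    proof -
      obtain s where s: "s \<in> S" "y = \<gamma> s" using y by blast
      show ?thesis by (rule mod_hom_cong[OF assms(2) L[OF s(1)]]) (use K s in auto)
    qed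
  qed
  then have "(\<lambda>s t. K t s) \<in> mod_bihom C M N P" by (rule mod_bihom_flip)
  then show thesis by (rule that) (use K in auto)
qed

lemma spans_tensor_image:
  assumes "module C M" "module C N"
  shows "spans C (tensor C M N) ((\<lambda>(x, y). tens C M N x y) ` (carrier M \<times> carrier N))"
proof -
  have "{tens C M N x y |x y. x \<in> carrier M \<and> y \<in> carrier N} = (\<lambda>(x, y). tens C M N x y) ` (carrier M \<times> carrier N)"
    by auto
  then show ?thesis using spans_tensor[OF assms spans_carrier[OF assms(1)] spans_carrier[OF assms(2)]] by simp
qed

text \<open>A map that is linear in each of four arguments gives a bilinear map of two tensor
  products. The last two arguments are lifted first. The result is still bilinear in the first two,
  which is tested on pure tensors of the second product, and is lifted once more.\<close>

lemma tensor_bilift: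
  assumes "module C M" "module C N" "module C M'" "module C N'" "module C P"
    and r: "\<And>x y. \<lbrakk>x \<in> carrier M; y \<in> carrier N\<rbrakk> \<Longrightarrow> F x y \<in> mod_bihom C M' N' P"
    and l: "\<And>x' y'. \<lbrakk>x' \<in> carrier M'; y' \<in> carrier N'\<rbrakk> \<Longrightarrow> (\<lambda>x y. F x y x' y') \<in> mod_bihom C M N P"
  obtains p where "p \<in> mod_bihom C (tensor C M N) (tensor C M' N') P"
    "\<And>x y x' y'. \<lbrakk>x \<in> carrier M; y \<in> carrier N; x' \<in> carrier M'; y' \<in> carrier N'\<rbrakk>
      \<Longrightarrow> p (tens C M N x y) (tens C M' N' x' y') = F x y x' y'"
proof -
  note T = module_tensor[OF assms(1,2)] and T' = module_tensor[OF assms(3,4)]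
  have "\<exists>k. k \<in> mod_hom C (tensor C M' N') P \<and>
      (\<forall>x'\<in>carrier M'. \<forall>y'\<in>carrier N'. k (tens C M' N' x' y') = F x y x' y')"
    if "x \<in> carrier M" "y \<in> carrier N" for x y
    using tensor_lift[OF assms(3,4,5) r[OF that]] by metis
  then obtain L where L: "L x y \<in> mod_hom C (tensor C M' N') P"
    "\<lbrakk>x' \<in> carrier M'; y' \<in> carrier N'\<rbrakk> \<Longrightarrow> L x y (tens C M' N' x' y') = F x y x' y'"
    if "x \<in> carrier M" "y \<in> carrier N" for x y x' y'
    by metis
  note span' = spans_tensor_image[OF assms(3,4)]
  have 1: "(\<lambda>x t. L x y t) \<in> mod_bihom C M (tensor C M' N') P" if "y \<in> carrier N" for y
  proof (rule mod_bihom_spanI[OF assms(1) T' assms(5) span'])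
    fix t assume "t \<in> (\<lambda>(x, y). tens C M' N' x y) ` (carrier M' \<times> carrier N')"
    then obtain x' y' where t: "x' \<in> carrier M'" "y' \<in> carrier N'" "t = tens C M' N' x' y'" by auto
    show "(\<lambda>x. L x y t) \<in> mod_hom C M P"
      by (rule mod_hom_cong[OF assms(1) mod_bihom_left[OF l[OF t(1,2)] that]]) (use t that L in auto)
  qed (use L that in auto)
  have 2: "(\<lambda>y t. L x y t) \<in> mod_bihom C N (tensor C M' N') P" if "x \<in> carrier M" for x
  proof (rule mod_bihom_spanI[OF assms(2) T' assms(5) span'])
    fix t assume "t \<in> (\<lambda>(x, y). tens C M' N' x y) ` (carrier M' \<times> carrier N')"
    then obtain x' y' where t: "x' \<in> carrier M'" "y' \<in> carrier N'" "t = tens C M' N' x' y'" by auto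
    show "(\<lambda>y. L x y t) \<in> mod_hom C N P"
      by (rule mod_hom_cong[OF assms(2) mod_bihom_right[OF l[OF t(1,2)] that]]) (use t that L in auto)
  qed (use L that in auto)
  have 3: "(\<lambda>x y. L x y t) \<in> mod_bihom C M N P" if "t \<in> carrier (tensor C M' N')" for t
    by (rule mod_bihomI) (use mod_bihom_left[OF 1 that] mod_bihom_left[OF 2 that] in auto)
  have lift: "\<exists>k. k \<in> mod_hom C (tensor C M N) P \<and>
      (\<forall>s\<in>carrier M \<times> carrier N. k (case s of (x, y) \<Rightarrow> tens C M N x y) = (case s of (x, y) \<Rightarrow> L x y) t)"
    if t: "t \<in> carrier (tensor C M' N')" for t
  proof -
    obtain k where "k \<in> mod_hom C (tensor C M N) P"
      "\<And>x y. \<lbrakk>x \<in> carrier M; y \<in> carrier N\<rbrakk> \<Longrightarrow> k (tens C M N x y) = L x y t"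
      using tensor_lift[OF assms(1,2,5) 3[OF t]] by blast
    then show ?thesis by (intro exI[of _ k]) auto
  qed
  obtain p where p: "p \<in> mod_bihom C (tensor C M N) (tensor C M' N') P"
    "\<And>s t. \<lbrakk>s \<in> carrier M \<times> carrier N; t \<in> carrier (tensor C M' N')\<rbrakk>
      \<Longrightarrow> p (case s of (x, y) \<Rightarrow> tens C M N x y) t = (case s of (x, y) \<Rightarrow> L x y) t"
    by (rule mod_bihom_of_family[OF T T' assms(5) spans_tensor_image[OF assms(1,2)] _ lift])
      (use L in auto)
  show thesis
    by (rule that[OF p(1)]) (use p(2)[of "(x, y)" for x y] L tens_closed[OF assms(3,4)] in auto)
qed

section \<open>Tensor products of algebras\<close>

definition alg_hom where
  "alg_hom C A B = mod_hom C A B \<inter> ring_hom A B"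

lemma alg_homD:
  assumes "h \<in> alg_hom C A B"
  shows "h \<in> mod_hom C A B" "h \<in> ring_hom A B"
    "\<And>x. x \<in> carrier A \<Longrightarrow> h x \<in> carrier B"
    "\<And>x y. \<lbrakk>x \<in> carrier A; y \<in> carrier A\<rbrakk> \<Longrightarrow> h (x \<otimes>\<^bsub>A\<^esub> y) = h x \<otimes>\<^bsub>B\<^esub> h y"
    "\<And>x y. \<lbrakk>x \<in> carrier A; y \<in> carrier A\<rbrakk> \<Longrightarrow> h (x \<oplus>\<^bsub>A\<^esub> y) = h x \<oplus>\<^bsub>B\<^esub> h y"
    "\<And>c x. \<lbrakk>c \<in> carrier C; x \<in> carrier A\<rbrakk> \<Longrightarrow> h (c \<odot>\<^bsub>A\<^esub> x) = c \<odot>\<^bsub>B\<^esub> h x"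
    "h \<one>\<^bsub>A\<^esub> = \<one>\<^bsub>B\<^esub>"
  using assms unfolding alg_hom_def
  by (auto simp: mod_hom_add mod_hom_smult ring_hom_mult ring_hom_one ring_hom_closed ring_hom_add)

lemma alg_hom_comp: "\<lbrakk>g \<in> alg_hom C X Y; f \<in> alg_hom C Y Z\<rbrakk> \<Longrightarrow> (\<lambda>x. f (g x)) \<in> alg_hom C X Z"
  unfolding alg_hom_def using mod_hom_comp ring_hom_trans by (fastforce simp: comp_def)

lemma algebra_is_module: "algebra C A \<Longrightarrow> module C A"
  by (rule algebra.axioms)

lemma alg_hom_of_mod_hom:
  assumes "algebra C A" "algebra C B" "spans C A G" "h \<in> mod_hom C A B"
    and "\<And>x y. \<lbrakk>x \<in> G; y \<in> G\<rbrakk> \<Longrightarrow> h (x \<otimes>\<^bsub>A\<^esub> y) = h x \<otimes>\<^bsub>B\<^esub> h y" "h \<one>\<^bsub>A\<^esub> = \<one>\<^bsub>B\<^esub>"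
  shows "h \<in> alg_hom C A B"
  unfolding alg_hom_def
  using ring_hom_of_mod_hom[OF algebra_is_module[OF assms(1)] algebra_is_module[OF assms(2)] assms(3)
      algebra_bihom[OF assms(1)] algebra_bihom[OF assms(2)] assms(4-6)] assms(4) by blast

context
  fixes C :: "('c, 'e) ring_scheme" and A :: "('c, 'm) module" and B :: "('c, 'n) module"
  assumes A: "algebra C A" and B: "algebra C B"
begin

interpretation A: algebra C A by (rule A)
interpretation B: algebra C B by (rule B)

text \<open>Without such a map the choice in \<open>tensor_alg\<close> would be arbitrary.\<close>

lemma tensor_alg_mult_exists:
  "\<exists>p. p \<in> mod_bihom C (tensor C A B) (tensor C A B) (tensor C A B) \<and>
        (\<forall>a\<in>carrier A. \<forall>b\<in>carrier B. \<forall>a'\<in>carrier A. \<forall>b'\<in>carrier B.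
           p (tens C A B a b) (tens C A B a' b') = tens C A B (a \<otimes>\<^bsub>A\<^esub> a') (b \<otimes>\<^bsub>B\<^esub> b'))"
proof -
  note m = A.module_axioms B.module_axioms
  note t = tens_bihom[OF m]
  obtain p where "p \<in> mod_bihom C (tensor C A B) (tensor C A B) (tensor C A B)"
    "\<And>x y x' y'. \<lbrakk>x \<in> carrier A; y \<in> carrier B; x' \<in> carrier A; y' \<in> carrier B\<rbrakk>
      \<Longrightarrow> p (tens C A B x y) (tens C A B x' y') = tens C A B (x \<otimes>\<^bsub>A\<^esub> x') (y \<otimes>\<^bsub>B\<^esub> y')"
  proof (rule tensor_bilift[OF m m module_tensor[OF m], of "\<lambda>x y x' y'. tens C A B (x \<otimes>\<^bsub>A\<^esub> x') (y \<otimes>\<^bsub>B\<^esub> y')"])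
    show "(\<lambda>x' y'. tens C A B (x \<otimes>\<^bsub>A\<^esub> x') (y \<otimes>\<^bsub>B\<^esub> y')) \<in> mod_bihom C A B (tensor C A B)"
      if "x \<in> carrier A" "y \<in> carrier B" for x y
      using that
      by (intro mod_bihomI mod_hom_comp[OF mod_bihom_left[OF t] mod_hom_multl[OF A _ mod_hom_id]]
          mod_hom_comp[OF mod_bihom_right[OF t] mod_hom_multl[OF B _ mod_hom_id]]) auto
    show "(\<lambda>x y. tens C A B (x \<otimes>\<^bsub>A\<^esub> x') (y \<otimes>\<^bsub>B\<^esub> y')) \<in> mod_bihom C A B (tensor C A B)"
      if "x' \<in> carrier A" "y' \<in> carrier B" for x' y'
      using that
      by (intro mod_bihomI mod_hom_comp[OF mod_bihom_left[OF t] mod_hom_multr[OF A _ mod_hom_id]]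
          mod_hom_comp[OF mod_bihom_right[OF t] mod_hom_multr[OF B _ mod_hom_id]]) auto
  qed blast
  then show ?thesis by blast
qed

lemma tensor_alg_updates:
  "carrier (tensor_alg C A B) = carrier (tensor C A B)"
  "mod_hom C (tensor_alg C A B) P = mod_hom C (tensor C A B) P"
  "mod_hom C P' (tensor_alg C A B) = mod_hom C P' (tensor C A B)"
  "mod_bihom C P1 P2 (tensor_alg C A B) = mod_bihom C P1 P2 (tensor C A B)"
  "module C (tensor_alg C A B)"
  "spans C (tensor_alg C A B) G = spans C (tensor C A B) G"
  unfolding tensor_alg_def
  by (simp_all add: mult_updates module_tensor[OF A.module_axioms B.module_axioms])

lemma tensor_alg_bihom:
  "mult (tensor_alg C A B) \<in> mod_bihom C (tensor C A B) (tensor C A B) (tensor C A B)"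
  using someI_ex[OF tensor_alg_mult_exists] by (simp add: tensor_alg_def)

lemma tensor_alg_mult:
  "\<lbrakk>a \<in> carrier A; b \<in> carrier B; a' \<in> carrier A; b' \<in> carrier B\<rbrakk> \<Longrightarrow>
    tens C A B a b \<otimes>\<^bsub>tensor_alg C A B\<^esub> tens C A B a' b' = tens C A B (a \<otimes>\<^bsub>A\<^esub> a') (b \<otimes>\<^bsub>B\<^esub> b')"
  using someI_ex[OF tensor_alg_mult_exists] by (simp add: tensor_alg_def)

lemma tensor_alg_one: "\<one>\<^bsub>tensor_alg C A B\<^esub> = tens C A B \<one>\<^bsub>A\<^esub> \<one>\<^bsub>B\<^esub>"
  by (simp add: tensor_alg_def)

lemma spans_tensor_alg:
  assumes "spans C A G" "spans C B H"
  shows "spans C (tensor_alg C A B) {tens C A B x y |x y. x \<in> G \<and> y \<in> H}"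
  using spans_tensor[OF A.module_axioms B.module_axioms assms] by (simp add: tensor_alg_updates)

lemma tens_alg_closed: "\<lbrakk>a \<in> carrier A; b \<in> carrier B\<rbrakk> \<Longrightarrow> tens C A B a b \<in> carrier (tensor_alg C A B)"
  by (simp add: tensor_alg_updates tens_closed[OF A.module_axioms B.module_axioms])

lemma tens_alg_bihom: "tens C A B \<in> mod_bihom C A B (tensor_alg C A B)"
  by (simp add: tensor_alg_updates tens_bihom[OF A.module_axioms B.module_axioms])

lemma algebra_tensor_alg: "algebra C (tensor_alg C A B)"
proof (rule algebra_of_bihom[OF tensor_alg_updates(5)])
  show "spans C (tensor_alg C A B) {tens C A B x y |x y. x \<in> carrier A \<and> y \<in> carrier B}"
    by (intro spans_tensor_alg spans_carrier A.module_axioms B.module_axioms)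
  show "mult (tensor_alg C A B) \<in> mod_bihom C (tensor_alg C A B) (tensor_alg C A B) (tensor_alg C A B)"
    using tensor_alg_bihom by (simp add: mod_bihom_def tensor_alg_updates)
qed (auto simp: tensor_alg_mult tensor_alg_one tens_alg_closed A.m_ac B.m_ac)

lemma tensor_alg_inl: "(\<lambda>a. tens C A B a \<one>\<^bsub>B\<^esub>) \<in> alg_hom C A (tensor_alg C A B)"
  by (rule alg_hom_of_mod_hom[OF A algebra_tensor_alg spans_carrier[OF A.module_axioms]])
    (auto simp: tensor_alg_mult tensor_alg_one intro: mod_bihom_left[OF tens_alg_bihom])

lemma tensor_alg_inr: "(\<lambda>b. tens C A B \<one>\<^bsub>A\<^esub> b) \<in> alg_hom C B (tensor_alg C A B)"
  by (rule alg_hom_of_mod_hom[OF B algebra_tensor_alg spans_carrier[OF B.module_axioms]])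
    (auto simp: tensor_alg_mult tensor_alg_one intro: mod_bihom_right[OF tens_alg_bihom])

text \<open>Reduces computations with pure tensors to multiplying the images of the two
  factors.\<close>

lemma tens_eq_mult:
  "\<lbrakk>a \<in> carrier A; b \<in> carrier B\<rbrakk> \<Longrightarrow>
    tens C A B a b = tens C A B a \<one>\<^bsub>B\<^esub> \<otimes>\<^bsub>tensor_alg C A B\<^esub> tens C A B \<one>\<^bsub>A\<^esub> b"
  by (simp add: tensor_alg_mult)

text \<open>Only linearity of \<open>f\<close> and \<open>g\<close> is assumed, so that the parts of
  the derivation and the augmentations can be lifted in this way too.\<close>

lemma tensor_alg_lift_mult:
  assumes S: "algebra C S" and f: "f \<in> mod_hom C A S" and g: "g \<in> mod_hom C B S"
  obtains h where "h \<in> mod_hom C (tensor_alg C A B) S"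
    "\<And>a b. \<lbrakk>a \<in> carrier A; b \<in> carrier B\<rbrakk> \<Longrightarrow> h (tens C A B a b) = f a \<otimes>\<^bsub>S\<^esub> g b"
proof -
  have "(\<lambda>a b. f a \<otimes>\<^bsub>S\<^esub> g b) \<in> mod_bihom C A B S"
    by (intro mod_bihomI mod_hom_multl[OF S _ g] mod_hom_multr[OF S _ f] mod_hom_closed[OF f] mod_hom_closed[OF g])
  from tensor_lift[OF A.module_axioms B.module_axioms algebra_is_module[OF S] this] that show thesis
    unfolding tensor_alg_updates by blast
qed

lemma tensor_alg_lift:
  assumes S: "algebra C S" and f: "f \<in> alg_hom C A S" and g: "g \<in> alg_hom C B S"
  obtains h where "h \<in> alg_hom C (tensor_alg C A B) S"
    "\<And>a b. \<lbrakk>a \<in> carrier A; b \<in> carrier B\<rbrakk> \<Longrightarrow> h (tens C A B a b) = f a \<otimes>\<^bsub>S\<^esub> g b"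
proof -
  interpret S: algebra C S by fact
  obtain h where h: "h \<in> mod_hom C (tensor_alg C A B) S"
    "\<And>a b. \<lbrakk>a \<in> carrier A; b \<in> carrier B\<rbrakk> \<Longrightarrow> h (tens C A B a b) = f a \<otimes>\<^bsub>S\<^esub> g b"
    using tensor_alg_lift_mult[OF S alg_homD(1)[OF f] alg_homD(1)[OF g]] by blast
  have "h \<in> alg_hom C (tensor_alg C A B) S"
    by (rule alg_hom_of_mod_hom[OF algebra_tensor_alg S
          spans_tensor_alg[OF spans_carrier[OF A.module_axioms]
            spans_carrier[OF B.module_axioms]] h(1)])
      (auto simp: tensor_alg_mult tensor_alg_one h(2) alg_homD[OF f] alg_homD[OF g] S.m_ac)
  then show thesis using h(2) that by blast
qed

end

section \<open>Tensor powers\<close>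

text \<open>All lengths are treated at once: a letter may vary at any position of a word of any
  length. In the empty word no letter varies, so its value is constrained separately.\<close>

definition multilinear where
  "multilinear C M P \<phi> \<longleftrightarrow> \<phi> [] \<in> carrier P \<and>
    (\<forall>u\<in>lists (carrier M). \<forall>v\<in>lists (carrier M). (\<lambda>x. \<phi> (u @ x # v)) \<in> mod_hom C M P)"

lemma multilinearI:
  assumes "\<phi> [] \<in> carrier P"
    and "\<And>u v. \<lbrakk>u \<in> lists (carrier M); v \<in> lists (carrier M)\<rbrakk> \<Longrightarrow> (\<lambda>x. \<phi> (u @ x # v)) \<in> mod_hom C M P"
  shows "multilinear C M P \<phi>"
  using assms unfolding multilinear_def by blast

lemma multilinear_hom:
  "\<lbrakk>multilinear C M P \<phi>; u \<in> lists (carrier M); v \<in> lists (carrier M)\<rbrakk> \<Longrightarrow> (\<lambda>x. \<phi> (u @ x # v)) \<in> mod_hom C M P"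
  unfolding multilinear_def by blast

lemma multilinear_Cons:
  "\<lbrakk>multilinear C M P \<phi>; v \<in> lists (carrier M)\<rbrakk> \<Longrightarrow> (\<lambda>x. \<phi> (x # v)) \<in> mod_hom C M P"
  using multilinear_hom[of C M P \<phi> "[]" v] by simp

lemma multilinear_closed:
  assumes "multilinear C M P \<phi>" "w \<in> lists (carrier M)"
  shows "\<phi> w \<in> carrier P"
proof (cases w)
  case Nil then show ?thesis using assms(1) by (simp add: multilinear_def)
next
  case (Cons x v)
  then show ?thesis using mod_hom_closed[OF multilinear_Cons[OF assms(1), of v], of x] assms(2) by simp
qed

lemma multilinear_comp:
  assumes "multilinear C M P \<phi>" "h \<in> mod_hom C P P'"
  shows "multilinear C M P' (\<lambda>w. h (\<phi> w))"
  by (rule multilinearI)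
    (simp_all add: mod_hom_closed[OF assms(2)] multilinear_closed[OF assms(1)]
      mod_hom_comp[OF assms(2) multilinear_hom[OF assms(1)]])

lemma multilinear_append:
  assumes "multilinear C M P \<phi>" "w \<in> lists (carrier M)"
  shows "multilinear C M P (\<lambda>v. \<phi> (w @ v))" "multilinear C M P (\<lambda>v. \<phi> (v @ w))"
  using multilinear_hom[OF assms(1), of "w @ u" v for u v] multilinear_hom[OF assms(1), of u "v @ w" for u v]
    multilinear_closed[OF assms] assms(2)
  by (simp_all add: multilinear_def)

context
  fixes C :: "('c, 'e) ring_scheme" and M :: "('c, 'm) module"
  assumes M: "module C M"
begin

interpretation M: module C M by (rule M)
interpretation F: module C "free_mod C (lists (carrier M))"
  by (rule module_free_mod) (rule M.R.is_cring)

definition tpower_relators where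
  "tpower_relators = (let F = free_mod C (lists (carrier M)); \<delta> = free_gen C in
      {\<delta> (u @ (x \<oplus>\<^bsub>M\<^esub> y) # v) \<ominus>\<^bsub>F\<^esub> (\<delta> (u @ x # v) \<oplus>\<^bsub>F\<^esub> \<delta> (u @ y # v)) |u v x y.
          u \<in> lists (carrier M) \<and> v \<in> lists (carrier M) \<and> x \<in> carrier M \<and> y \<in> carrier M} \<union>
       {\<delta> (u @ (c \<odot>\<^bsub>M\<^esub> x) # v) \<ominus>\<^bsub>F\<^esub> c \<odot>\<^bsub>F\<^esub> \<delta> (u @ x # v) |u v c x.
          u \<in> lists (carrier M) \<and> v \<in> lists (carrier M) \<and> c \<in> carrier C \<and> x \<in> carrier M})"

lemma tpower_rel_eq: "tpower_rel C M = submodule_gen C (free_mod C (lists (carrier M))) tpower_relators"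
  unfolding tpower_rel_def tpower_relators_def Let_def by simp

lemma free_gen_word: "w \<in> lists (carrier M) \<Longrightarrow> free_gen C w \<in> carrier (free_mod C (lists (carrier M)))"
  by (rule free_gen_closed) (auto intro: M.R.is_cring)

lemma tpower_relatorsI:
  fixes F \<delta> defines "F \<equiv> free_mod C (lists (carrier M))" and "\<delta> \<equiv> free_gen C"
  assumes "u \<in> lists (carrier M)" "v \<in> lists (carrier M)" "x \<in> carrier M"
  shows "y \<in> carrier M \<Longrightarrow> \<delta> (u @ (x \<oplus>\<^bsub>M\<^esub> y) # v) \<ominus>\<^bsub>F\<^esub> (\<delta> (u @ x # v) \<oplus>\<^bsub>F\<^esub> \<delta> (u @ y # v)) \<in> tpower_relators"
    and "c \<in> carrier C \<Longrightarrow> \<delta> (u @ (c \<odot>\<^bsub>M\<^esub> x) # v) \<ominus>\<^bsub>F\<^esub> c \<odot>\<^bsub>F\<^esub> \<delta> (u @ x # v) \<in> tpower_relators"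
  using assms unfolding tpower_relators_def Let_def by blast+

lemma tpower_relators_closed: "tpower_relators \<subseteq> carrier (free_mod C (lists (carrier M)))"
  unfolding tpower_relators_def Let_def
  by (safe; intro F.M.minus_closed F.M.a_closed F.smult_closed free_gen_word) auto

lemma submodule_tpower_rel: "submodule (tpower_rel C M) C (free_mod C (lists (carrier M)))"
  unfolding tpower_rel_eq by (rule submodule_gen_submodule[OF F.module_axioms tpower_relators_closed])

lemma module_tpowers: "module C (tpowers C M)"
  unfolding tpowers_def by (rule module_quot_mod[OF F.module_axioms submodule_tpower_rel])

lemma pure_closed: "w \<in> lists (carrier M) \<Longrightarrow> pure C M w \<in> carrier (tpowers C M)"
  unfolding tpowers_def pure_def by (simp add: quot_mod_carrier free_gen_word)

lemma pure_multilinear: "multilinear C M (tpowers C M) (pure C M)"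
proof -
  have rel: "tpower_rel C M +>\<^bsub>free_mod C (lists (carrier M))\<^esub> u
      = tpower_rel C M +>\<^bsub>free_mod C (lists (carrier M))\<^esub> v"
    if "u \<ominus>\<^bsub>free_mod C (lists (carrier M))\<^esub> v \<in> tpower_relators"
      "u \<in> carrier (free_mod C (lists (carrier M)))" "v \<in> carrier (free_mod C (lists (carrier M)))" for u v
    by (rule quot_mod_eqI[OF F.module_axioms submodule_tpower_rel that(2,3)])
      (use that(1) submodule_gen_superset tpower_rel_eq in fastforce)
  note q = quot_mod_add[OF F.module_axioms submodule_tpower_rel] quot_mod_smult[OF F.module_axioms submodule_tpower_rel]
  note cl = free_gen_word F.M.a_closed F.smult_closed
  show ?thesis
  proof (intro multilinearI mod_homI)
    show "pure C M [] \<in> carrier (tpowers C M)" by (simp add: pure_closed)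
    fix u v x assume uv: "u \<in> lists (carrier M)" "v \<in> lists (carrier M)" and x: "x \<in> carrier M"
    show "pure C M (u @ x # v) \<in> carrier (tpowers C M)" using uv x by (intro pure_closed) auto
    show "pure C M (u @ (x \<oplus>\<^bsub>M\<^esub> y) # v) = pure C M (u @ x # v) \<oplus>\<^bsub>tpowers C M\<^esub> pure C M (u @ y # v)"
      if "y \<in> carrier M" for y
      unfolding pure_def tpowers_def using x uv that
      by (subst q; (intro rel)?; simp add: cl tpower_relatorsI)
    show "pure C M (u @ (c \<odot>\<^bsub>M\<^esub> x) # v) = c \<odot>\<^bsub>tpowers C M\<^esub> pure C M (u @ x # v)"
      if "c \<in> carrier C" for c
      unfolding pure_def tpowers_def using x uv that
      by (subst q; (intro rel)?; simp add: cl tpower_relatorsI)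
  qed
qed

lemma spans_tpowers: "spans C (tpowers C M) (pure C M ` lists (carrier M))"
proof -
  have "spans C (tpowers C M) ((\<lambda>x. tpower_rel C M +>\<^bsub>free_mod C (lists (carrier M))\<^esub> x) ` free_gen C ` lists (carrier M))"
    unfolding tpowers_def by (intro spans_quot_mod F.module_axioms submodule_tpower_rel spans_free_mod M.R.is_cring)
  then show ?thesis unfolding image_image pure_def .
qed

lemma tpowers_lift:
  assumes "module C P" "multilinear C M P \<phi>"
  obtains k where "k \<in> mod_hom C (tpowers C M) P" "\<And>w. w \<in> lists (carrier M) \<Longrightarrow> k (pure C M w) = \<phi> w"
proof -
  interpret P: module C P by fact
  have \<phi>: "\<phi> \<in> lists (carrier M) \<rightarrow> carrier P"
    using multilinear_closed[OF assms(2)] by blast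
  note fh = free_lift_hom[OF assms(1) \<phi>]
  note gen = free_lift_gen[OF assms(1) \<phi>]
  note m = multilinear_hom[OF assms(2)]
  have self: "a \<ominus>\<^bsub>P\<^esub> a = \<zero>\<^bsub>P\<^esub>" if "a \<in> carrier P" for a
    using that by (simp add: P.M.minus_eq P.M.r_neg)
  have 0: "free_lift C P \<phi> a = \<zero>\<^bsub>P\<^esub>" if "a \<in> tpower_relators" for a
    using that unfolding tpower_relators_def Let_def
    by (elim UnE CollectE exE conjE)
      (simp_all add: mod_hom_minus[OF F.module_axioms assms(1) fh] mod_hom_add[OF fh] mod_hom_smult[OF fh] gen
        free_gen_word mod_hom_add[OF m] mod_hom_smult[OF m] mod_hom_closed[OF m] self)
  from quot_free_lift[OF assms(1) tpower_relators_closed \<phi> 0] obtain k where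
    "k \<in> mod_hom C (tpowers C M) P"
    "\<And>s. s \<in> lists (carrier M) \<Longrightarrow>
       k (tpower_rel C M +>\<^bsub>free_mod C (lists (carrier M))\<^esub> free_gen C s) = \<phi> s"
    unfolding tpowers_def tpower_rel_eq[symmetric] by blast
  then show thesis by (intro that[of k]) (auto simp: pure_def)
qed

text \<open>The second word is extended first. At every \<open>t\<close> the extension is
  multilinear in the first word, because it is so at pure \<open>t\<close> and depends linearly on
  \<open>t\<close>; then the first word is extended.\<close>

lemma tpowers_bilift:
  assumes "module C P"
    and r: "\<And>u. u \<in> lists (carrier M) \<Longrightarrow> multilinear C M P (\<lambda>v. \<phi> u v)"
    and l: "\<And>v. v \<in> lists (carrier M) \<Longrightarrow> multilinear C M P (\<lambda>u. \<phi> u v)"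
  obtains p where "p \<in> mod_bihom C (tpowers C M) (tpowers C M) P"
    "\<And>u v. \<lbrakk>u \<in> lists (carrier M); v \<in> lists (carrier M)\<rbrakk> \<Longrightarrow> p (pure C M u) (pure C M v) = \<phi> u v"
proof -
  have "\<exists>k. k \<in> mod_hom C (tpowers C M) P \<and> (\<forall>v\<in>lists (carrier M). k (pure C M v) = \<phi> u v)"
    if "u \<in> lists (carrier M)" for u
    using tpowers_lift[OF assms(1) r[OF that]] by metis
  then obtain L where "\<forall>u\<in>lists (carrier M). L u \<in> mod_hom C (tpowers C M) P \<and>
      (\<forall>v\<in>lists (carrier M). L u (pure C M v) = \<phi> u v)"
    by metis
  then have L: "\<And>u. u \<in> lists (carrier M) \<Longrightarrow> L u \<in> mod_hom C (tpowers C M) P"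
    "\<And>u v. \<lbrakk>u \<in> lists (carrier M); v \<in> lists (carrier M)\<rbrakk> \<Longrightarrow> L u (pure C M v) = \<phi> u v"
    by blast+
  have mult: "multilinear C M P (\<lambda>u. L u t)" if t: "t \<in> carrier (tpowers C M)" for t
  proof (rule multilinearI)
    show "L [] t \<in> carrier P" using mod_hom_closed[OF L(1) t] by simp
    fix u v assume uv: "u \<in> lists (carrier M)" "v \<in> lists (carrier M)"
    have "(\<lambda>x t. L (u @ x # v) t) \<in> mod_bihom C M (tpowers C M) P"
    proof (rule mod_bihom_spanI[OF M module_tpowers assms(1) spans_tpowers])
      fix s assume "s \<in> pure C M ` lists (carrier M)"
      then obtain w where w: "w \<in> lists (carrier M)" "s = pure C M w" by blast
      show "(\<lambda>x. L (u @ x # v) s) \<in> mod_hom C M P"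
        by (rule mod_hom_cong[OF M multilinear_hom[OF l[OF w(1)] uv]]) (use uv w L in auto)
    qed (use uv L in auto)
    from mod_bihom_left[OF this t] show "(\<lambda>x. L (u @ x # v) t) \<in> mod_hom C M P" .
  qed
  have lift: "\<exists>k. k \<in> mod_hom C (tpowers C M) P \<and> (\<forall>u\<in>lists (carrier M). k (pure C M u) = L u t)"
    if t: "t \<in> carrier (tpowers C M)" for t
  proof -
    obtain k where "k \<in> mod_hom C (tpowers C M) P"
      "\<And>u. u \<in> lists (carrier M) \<Longrightarrow> k (pure C M u) = L u t"
      by (rule tpowers_lift[OF assms(1) mult[OF t]]) simp
    then show ?thesis by (intro exI[of _ k]) simp
  qed
  obtain p where p: "p \<in> mod_bihom C (tpowers C M) (tpowers C M) P"
    "\<And>u t. \<lbrakk>u \<in> lists (carrier M); t \<in> carrier (tpowers C M)\<rbrakk> \<Longrightarrow> p (pure C M u) t = L u t"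
    by (rule mod_bihom_of_family[OF module_tpowers module_tpowers assms(1) spans_tpowers L(1) lift]) simp_all
  show thesis by (rule that[OF p(1)]) (use p(2) L pure_closed in auto)
qed

text \<open>Concatenation is multilinear in either word.\<close>

lemma tensor_algebra_mult_exists:
  "\<exists>p. p \<in> mod_bihom C (tpowers C M) (tpowers C M) (tpowers C M) \<and>
        (\<forall>u\<in>lists (carrier M). \<forall>v\<in>lists (carrier M).
           p (pure C M u) (pure C M v) = pure C M (u @ v))"
proof -
  obtain p where "p \<in> mod_bihom C (tpowers C M) (tpowers C M) (tpowers C M)"
    "\<And>u v. \<lbrakk>u \<in> lists (carrier M); v \<in> lists (carrier M)\<rbrakk> \<Longrightarrow> p (pure C M u) (pure C M v) = pure C M (u @ v)"
    by (rule tpowers_bilift[OF module_tpowers multilinear_append(1)[OF pure_multilinear]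
        multilinear_append(2)[OF pure_multilinear]]) simp_all
  then show ?thesis by (intro exI[of _ p]) simp
qed

lemma tensor_algebra_updates:
  "carrier (tensor_algebra C M) = carrier (tpowers C M)"
  "mod_hom C (tensor_algebra C M) P = mod_hom C (tpowers C M) P"
  "mod_hom C P' (tensor_algebra C M) = mod_hom C P' (tpowers C M)"
  "mod_bihom C P1 P2 (tensor_algebra C M) = mod_bihom C P1 P2 (tpowers C M)"
  "mod_bihom C (tensor_algebra C M) P1 P3 = mod_bihom C (tpowers C M) P1 P3"
  "mod_bihom C P4 (tensor_algebra C M) P5 = mod_bihom C P4 (tpowers C M) P5"
  "module C (tensor_algebra C M)"
  "spans C (tensor_algebra C M) G = spans C (tpowers C M) G"
  "add (tensor_algebra C M) = add (tpowers C M)"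
  unfolding tensor_algebra_def by (simp_all add: mult_updates module_tpowers)

lemma tensor_algebra_bihom:
  "mult (tensor_algebra C M) \<in> mod_bihom C (tensor_algebra C M) (tensor_algebra C M) (tensor_algebra C M)"
  unfolding tensor_algebra_updates
  using someI_ex[OF tensor_algebra_mult_exists] by (simp add: tensor_algebra_def)

lemma tensor_algebra_mult:
  "\<lbrakk>u \<in> lists (carrier M); v \<in> lists (carrier M)\<rbrakk> \<Longrightarrow>
    pure C M u \<otimes>\<^bsub>tensor_algebra C M\<^esub> pure C M v = pure C M (u @ v)"
  using someI_ex[OF tensor_algebra_mult_exists] by (simp add: tensor_algebra_def)

lemma tensor_algebra_one: "\<one>\<^bsub>tensor_algebra C M\<^esub> = pure C M []"
  by (simp add: tensor_algebra_def)

lemma spans_tensor_algebra: "spans C (tensor_algebra C M) (pure C M ` lists (carrier M))"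
  using spans_tpowers by (simp add: tensor_algebra_updates)

lemma ring_tensor_algebra: "ring (tensor_algebra C M)"
  by (rule ring_of_bihom[OF tensor_algebra_updates(7) spans_tensor_algebra tensor_algebra_bihom])
    (auto simp: tensor_algebra_mult tensor_algebra_one tensor_algebra_updates(1) pure_closed)

end

section \<open>Quotient algebras and the symmetric algebra\<close>

text \<open>Scalars act through the unit, c x = (c 1) x, so a set that absorbs products absorbs
  scalars.\<close>

lemma ideal_submodule:
  fixes M :: "('c, 'm) module"
  assumes "module C M" "ring M" "mult M \<in> mod_bihom C M M M" "ideal I M"
  shows "submodule I C M"
proof -
  interpret M: module C M by fact
  interpret r: ring M by fact
  interpret I: ideal I M by fact
  show ?thesis
  proof (rule M.submoduleI)
    fix c x assume cx: "c \<in> carrier C" "x \<in> I"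
    have x: "x \<in> carrier M" using cx(2) by (rule I.a_Hcarr)
    have "c \<odot>\<^bsub>M\<^esub> x = c \<odot>\<^bsub>M\<^esub> (\<one>\<^bsub>M\<^esub> \<otimes>\<^bsub>M\<^esub> x)" using x by simp
    also have "\<dots> = (c \<odot>\<^bsub>M\<^esub> \<one>\<^bsub>M\<^esub>) \<otimes>\<^bsub>M\<^esub> x"
      using mod_hom_smult[OF mod_bihom_left[OF assms(3) x] cx(1) r.one_closed] by simp
    also have "\<dots> \<in> I" using cx by (intro I.I_l_closed) auto
    finally show "c \<odot>\<^bsub>M\<^esub> x \<in> I" .
  qed (use I.a_subset I.zero_closed in auto)
qed

lemma quot_mod_mult:
  fixes M :: "('c, 'm) module"
  assumes "ideal I M" "x \<in> carrier M" "y \<in> carrier M"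
  shows "(I +>\<^bsub>M\<^esub> x) \<otimes>\<^bsub>quot_mod M I\<^esub> (I +>\<^bsub>M\<^esub> y) = I +>\<^bsub>M\<^esub> (x \<otimes>\<^bsub>M\<^esub> y)"
  using ideal.rcoset_mult_add[OF assms] by (simp add: quot_mod_def)

lemma quot_mod_one: "\<one>\<^bsub>quot_mod M I\<^esub> = I +>\<^bsub>M\<^esub> \<one>\<^bsub>M\<^esub>"
  by (simp add: quot_mod_def)

lemma quot_mod_bihom:
  fixes M :: "('c, 'm) module"
  assumes "module C M" "ring M" "mult M \<in> mod_bihom C M M M" "ideal I M"
  shows "mult (quot_mod M I) \<in> mod_bihom C (quot_mod M I) (quot_mod M I) (quot_mod M I)"
proof -
  interpret M: module C M by fact
  interpret r: ring M by fact
  note sub = ideal_submodule[OF assms]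
  note q = quot_mod_add[OF assms(1) sub] quot_mod_smult[OF assms(1) sub] quot_mod_mult[OF assms(4)]
  note bl = mod_hom_smult[OF mod_bihom_left[OF assms(3)]] mod_hom_smult[OF mod_bihom_right[OF assms(3)]]
  show ?thesis
    by (intro mod_bihomI mod_homI) (auto simp: quot_mod_carrier q r.l_distr r.r_distr bl)
qed

lemma algebra_quot_mod:
  fixes M :: "('c, 'm) module"
  assumes "module C M" "ring M" "mult M \<in> mod_bihom C M M M" "ideal I M" "spans C M G"
    and comm: "\<And>x y. \<lbrakk>x \<in> G; y \<in> G\<rbrakk> \<Longrightarrow> I +>\<^bsub>M\<^esub> (x \<otimes>\<^bsub>M\<^esub> y) = I +>\<^bsub>M\<^esub> (y \<otimes>\<^bsub>M\<^esub> x)"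
  shows "algebra C (quot_mod M I)"
proof -
  interpret r: ring M by fact
  note sub = ideal_submodule[OF assms(1-4)]
  have G: "x \<in> carrier M" if "x \<in> G" for x using that assms(5) unfolding spans_def by blast
  show ?thesis
    by (rule algebra_of_bihom[OF module_quot_mod[OF assms(1) sub] spans_quot_mod[OF assms(1) sub assms(5)]
          quot_mod_bihom[OF assms(1-4)]])
      (auto simp: quot_mod_mult[OF assms(4)] quot_mod_one quot_mod_carrier G r.m_assoc comm)
qed

lemma algebra_quot_alg:
  fixes M :: "('c, 'm) module"
  assumes "algebra C M" "ideal I M"
  shows "algebra C (quot_mod M I)"
proof -
  interpret M: algebra C M by fact
  show ?thesis
    by (rule algebra_quot_mod[OF M.module_axioms M.ring_axioms algebra_bihom[OF assms(1)] assms(2)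
          spans_carrier[OF M.module_axioms]]) (simp add: M.m_comm)
qed

lemma quot_proj_alg_hom:
  fixes M :: "('c, 'm) module"
  assumes "algebra C M" "ideal I M"
  shows "(\<lambda>x. I +>\<^bsub>M\<^esub> x) \<in> alg_hom C M (quot_mod M I)"
proof -
  interpret M: algebra C M by fact
  note sub = ideal_submodule[OF M.module_axioms M.ring_axioms algebra_bihom[OF assms(1)] assms(2)]
  show ?thesis
    by (rule alg_hom_of_mod_hom[OF assms(1) algebra_quot_alg[OF assms] spans_carrier[OF M.module_axioms]
          quot_mod_proj_hom[OF M.module_axioms sub]])
      (simp_all add: quot_mod_mult[OF assms(2)] quot_mod_one)
qed

lemma alg_hom_kernel_ideal:
  assumes "ring M" "ring S" "h \<in> ring_hom M S"
  shows "ideal {x \<in> carrier M. h x = \<zero>\<^bsub>S\<^esub>} M"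
proof -
  interpret h: ring_hom_ring M S h by (rule ring_hom_ringI2) fact+
  show ?thesis using h.kernel_is_ideal unfolding a_kernel_def' .
qed

context
  fixes C :: "('c, 'e) ring_scheme" and M :: "('c, 'm) module"
  assumes M: "module C M"
begin

interpretation M: module C M by (rule M)
interpretation T: ring "tensor_algebra C M" by (rule ring_tensor_algebra[OF M])
interpretation Tm: module C "tensor_algebra C M" by (rule tensor_algebra_updates(7)[OF M])

lemma pure_closed_alg: "w \<in> lists (carrier M) \<Longrightarrow> pure C M w \<in> carrier (tensor_algebra C M)"
  by (simp add: tensor_algebra_updates(1)[OF M] pure_closed[OF M])

lemma ideal_sym_ideal: "ideal (sym_ideal C M) (tensor_algebra C M)"
  unfolding sym_ideal_def Let_def
  by (rule T.genideal_ideal) (auto intro!: T.minus_closed T.m_closed pure_closed_alg)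

lemma submodule_sym_ideal: "submodule (sym_ideal C M) C (tensor_algebra C M)"
  by (rule ideal_submodule[OF Tm.module_axioms T.ring_axioms tensor_algebra_bihom[OF M] ideal_sym_ideal])

text \<open>The class of a monomial, that is, the product of the images of its letters
  (\<open>sym_word_Cons\<close>).\<close>

definition sym_word where
  "sym_word w = sym_ideal C M +>\<^bsub>tensor_algebra C M\<^esub> pure C M w"

lemma module_Sym: "module C (Sym C M)"
  unfolding Sym_def by (rule module_quot_mod[OF Tm.module_axioms submodule_sym_ideal])

lemma ring_Sym: "ring (Sym C M)"
proof -
  note q = quot_mod_mult[OF ideal_sym_ideal] quot_mod_one
  show ?thesis unfolding Sym_def
    by (rule ring_of_bihom[OF module_quot_mod[OF Tm.module_axioms submodule_sym_ideal]
        spans_quot_mod[OF Tm.module_axioms submodule_sym_ideal spans_tensor_algebra[OF M]]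
        quot_mod_bihom[OF Tm.module_axioms T.ring_axioms tensor_algebra_bihom[OF M] ideal_sym_ideal]])
     (auto simp: q pure_closed_alg T.m_assoc quot_mod_carrier)
qed

interpretation S: ring "Sym C M" by (rule ring_Sym)

lemma sym_word_closed: "w \<in> lists (carrier M) \<Longrightarrow> sym_word w \<in> carrier (Sym C M)"
  unfolding sym_word_def Sym_def by (simp add: quot_mod_carrier pure_closed_alg)

lemma sym_word_append:
  "\<lbrakk>u \<in> lists (carrier M); v \<in> lists (carrier M)\<rbrakk> \<Longrightarrow> sym_word (u @ v) = sym_word u \<otimes>\<^bsub>Sym C M\<^esub> sym_word v"
  unfolding sym_word_def Sym_def
  by (simp add: quot_mod_mult[OF ideal_sym_ideal] pure_closed_alg tensor_algebra_mult[OF M])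

lemma sym_emb_eq_word: "sym_emb C M x = sym_word [x]"
  unfolding sym_word_def sym_emb_def by simp

lemma sym_word_Nil: "sym_word [] = \<one>\<^bsub>Sym C M\<^esub>"
  unfolding sym_word_def Sym_def by (simp add: quot_mod_one tensor_algebra_one[OF M])

lemma sym_emb_closed: "x \<in> carrier M \<Longrightarrow> sym_emb C M x \<in> carrier (Sym C M)"
  unfolding sym_emb_eq_word by (rule sym_word_closed) simp

lemma sym_word_Cons:
  "\<lbrakk>x \<in> carrier M; w \<in> lists (carrier M)\<rbrakk> \<Longrightarrow> sym_word (x # w) = sym_emb C M x \<otimes>\<^bsub>Sym C M\<^esub> sym_word w"
  using sym_word_append[of "[x]" w] by (simp add: sym_emb_eq_word)

lemma sym_emb_commute:
  assumes "x \<in> carrier M" "y \<in> carrier M"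
  shows "sym_emb C M x \<otimes>\<^bsub>Sym C M\<^esub> sym_emb C M y = sym_emb C M y \<otimes>\<^bsub>Sym C M\<^esub> sym_emb C M x"
proof -
  let ?T = "tensor_algebra C M"
  have p: "pure C M [x] \<in> carrier ?T" "pure C M [y] \<in> carrier ?T" using assms by (simp_all add: pure_closed_alg)
  let ?G = "{pure C M [x] \<otimes>\<^bsub>?T\<^esub> pure C M [y] \<ominus>\<^bsub>?T\<^esub> pure C M [y] \<otimes>\<^bsub>?T\<^esub> pure C M [x] |x y.
            x \<in> carrier M \<and> y \<in> carrier M}"
  have "?G \<subseteq> carrier ?T" by (auto intro!: T.minus_closed T.m_closed pure_closed_alg)
  then have "?G \<subseteq> sym_ideal C M" unfolding sym_ideal_def Let_def by (rule T.genideal_self)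
  then have "pure C M [x] \<otimes>\<^bsub>?T\<^esub> pure C M [y] \<ominus>\<^bsub>?T\<^esub> pure C M [y] \<otimes>\<^bsub>?T\<^esub> pure C M [x] \<in> sym_ideal C M"
    using assms by blast
  then have "sym_ideal C M +>\<^bsub>?T\<^esub> (pure C M [x] \<otimes>\<^bsub>?T\<^esub> pure C M [y])
      = sym_ideal C M +>\<^bsub>?T\<^esub> (pure C M [y] \<otimes>\<^bsub>?T\<^esub> pure C M [x])"
    using p by (intro quot_mod_eqI[OF Tm.module_axioms submodule_sym_ideal]) auto
  then show ?thesis
    using p unfolding Sym_def sym_emb_def by (simp add: quot_mod_mult[OF ideal_sym_ideal])
qed

lemma spans_Sym: "spans C (Sym C M) (sym_word ` lists (carrier M))"
  unfolding Sym_def sym_word_def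
  using spans_quot_mod[OF Tm.module_axioms submodule_sym_ideal spans_tensor_algebra[OF M]]
  by (simp add: image_image)

text \<open>Only generators commute by construction. Moving one letter past a word, and then a word
  past a word, gives commutativity on a spanning set.\<close>

lemma algebra_Sym: "algebra C (Sym C M)"
proof -
  have 1: "sym_emb C M x \<otimes>\<^bsub>Sym C M\<^esub> sym_word v = sym_word v \<otimes>\<^bsub>Sym C M\<^esub> sym_emb C M x"
    if x: "x \<in> carrier M" and v: "v \<in> lists (carrier M)" for x v
    using v
  proof (induction v)
    case Nil then show ?case using sym_emb_closed[OF x] by (simp add: sym_word_Nil)
  next
    case (Cons y v)
    have c: "sym_emb C M x \<in> carrier (Sym C M)" "sym_emb C M y \<in> carrier (Sym C M)" "sym_word v \<in> carrier (Sym C M)"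
      using Cons.hyps x sym_emb_closed sym_word_closed by auto
    have "sym_emb C M x \<otimes>\<^bsub>Sym C M\<^esub> sym_word (y # v)
        = (sym_emb C M x \<otimes>\<^bsub>Sym C M\<^esub> sym_emb C M y) \<otimes>\<^bsub>Sym C M\<^esub> sym_word v"
      using c Cons.hyps by (simp add: sym_word_Cons S.m_assoc)
    also have "\<dots> = sym_emb C M y \<otimes>\<^bsub>Sym C M\<^esub> (sym_emb C M x \<otimes>\<^bsub>Sym C M\<^esub> sym_word v)"
      using c sym_emb_commute[OF x Cons.hyps(1)] by (metis S.m_assoc)
    also have "\<dots> = sym_word (y # v) \<otimes>\<^bsub>Sym C M\<^esub> sym_emb C M x"
      using c Cons by (simp add: sym_word_Cons S.m_assoc)
    finally show ?case .
  qed
  have 2: "sym_word u \<otimes>\<^bsub>Sym C M\<^esub> sym_word v = sym_word v \<otimes>\<^bsub>Sym C M\<^esub> sym_word u"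
    if v: "v \<in> lists (carrier M)" and u: "u \<in> lists (carrier M)" for u v
    using u
  proof (induction u)
    case Nil then show ?case using sym_word_closed[OF v] by (simp add: sym_word_Nil)
  next
    case (Cons x u)
    have c: "sym_emb C M x \<in> carrier (Sym C M)" "sym_word u \<in> carrier (Sym C M)" "sym_word v \<in> carrier (Sym C M)"
      using Cons.hyps v sym_emb_closed sym_word_closed by auto
    have "sym_word (x # u) \<otimes>\<^bsub>Sym C M\<^esub> sym_word v
        = sym_emb C M x \<otimes>\<^bsub>Sym C M\<^esub> (sym_word v \<otimes>\<^bsub>Sym C M\<^esub> sym_word u)"
      using c Cons by (simp add: sym_word_Cons S.m_assoc)
    also have "\<dots> = (sym_word v \<otimes>\<^bsub>Sym C M\<^esub> sym_emb C M x) \<otimes>\<^bsub>Sym C M\<^esub> sym_word u"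
      using c 1[OF Cons.hyps(1) v] by (metis S.m_assoc)
    also have "\<dots> = sym_word v \<otimes>\<^bsub>Sym C M\<^esub> sym_word (x # u)"
      using c Cons.hyps by (simp add: sym_word_Cons S.m_assoc)
    finally show ?case .
  qed
  show ?thesis
    by (rule algebra_of_bihom[OF module_Sym spans_Sym
        quot_mod_bihom[OF Tm.module_axioms T.ring_axioms tensor_algebra_bihom[OF M] ideal_sym_ideal, folded Sym_def]])
      (auto simp: sym_word_closed S.m_assoc 2)
qed

lemma sym_emb_hom: "sym_emb C M \<in> mod_hom C M (Sym C M)"
proof -
  have "(\<lambda>x. pure C M [x]) \<in> mod_hom C M (tensor_algebra C M)"
    using multilinear_Cons[OF pure_multilinear[OF M], of "[]"] by (simp add: tensor_algebra_updates[OF M])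
  from mod_hom_comp[OF quot_mod_proj_hom[OF Tm.module_axioms submodule_sym_ideal] this]
  show ?thesis unfolding Sym_def sym_emb_def .
qed

text \<open>An induction principle: monomials arise from the unit by multiplying with one letter at
  a time, and arbitrary letters reduce to those in \<open>G\<close> because the embedding is
  linear.\<close>

lemma Sym_generated:
  assumes "spans C M G" "submodule H C (Sym C M)" "\<one>\<^bsub>Sym C M\<^esub> \<in> H"
    and "\<And>x y. \<lbrakk>x \<in> G; y \<in> H\<rbrakk> \<Longrightarrow> sym_emb C M x \<otimes>\<^bsub>Sym C M\<^esub> y \<in> H"
    and "s \<in> carrier (Sym C M)"
  shows "s \<in> H"
proof -
  interpret Sm: module C "Sym C M" by (rule module_Sym)
  have H: "H \<subseteq> carrier (Sym C M)" by (rule Sm.submoduleE(1)) fact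
  have mul: "sym_emb C M x \<otimes>\<^bsub>Sym C M\<^esub> y \<in> H" if x: "x \<in> carrier M" and y: "y \<in> H" for x y
    by (rule mod_hom_submodule[OF M module_Sym assms(1)
          mod_hom_multr[OF algebra_Sym _ sym_emb_hom] assms(2) _ x]) (use y H assms(4) in auto)
  have "sym_word w \<in> H" if "w \<in> lists (carrier M)" for w
    using that by (induction w) (simp_all add: sym_word_Nil assms(3) sym_word_Cons mul)
  then have "sym_word ` lists (carrier M) \<subseteq> H" by blast
  from submodule_gen_least[OF assms(2) this] show ?thesis using spans_Sym assms(5) unfolding spans_def by auto
qed

text \<open>A monomial is sent to the product of the images of its letters. This respects
  concatenation, and it kills commutators because \<open>A\<close> is commutative.\<close>

lemma Sym_lift:
  assumes A: "algebra C A" and h: "h \<in> mod_hom C M A"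
  obtains k where "k \<in> alg_hom C (Sym C M) A" "\<And>x. x \<in> carrier M \<Longrightarrow> k (sym_emb C M x) = h x"
proof -
  interpret A: algebra C A by fact
  note hc = mod_hom_closed[OF h]
  define \<phi> where "\<phi> w = foldr (\<lambda>x a. h x \<otimes>\<^bsub>A\<^esub> a) w \<one>\<^bsub>A\<^esub>" for w
  have [simp]: "\<phi> [] = \<one>\<^bsub>A\<^esub>" "\<phi> (x # w) = h x \<otimes>\<^bsub>A\<^esub> \<phi> w" for x w
    by (simp_all add: \<phi>_def)
  have \<phi>: "\<phi> w \<in> carrier A" if "w \<in> lists (carrier M)" for w
    using that by (induction w) (simp_all add: hc)
  have app: "\<phi> (u @ v) = \<phi> u \<otimes>\<^bsub>A\<^esub> \<phi> v" if "u \<in> lists (carrier M)" "v \<in> lists (carrier M)" for u v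
    using that by (induction u) (simp_all add: hc \<phi> A.m_assoc)
  have "multilinear C M A \<phi>"
  proof (rule multilinearI)
    fix u v assume uv: "u \<in> lists (carrier M)" "v \<in> lists (carrier M)"
    have "(\<lambda>x. \<phi> u \<otimes>\<^bsub>A\<^esub> (h x \<otimes>\<^bsub>A\<^esub> \<phi> v)) \<in> mod_hom C M A"
      by (intro mod_hom_multl[OF A \<phi>[OF uv(1)]] mod_hom_multr[OF A \<phi>[OF uv(2)]] h)
    then show "(\<lambda>x. \<phi> (u @ x # v)) \<in> mod_hom C M A"
      by (rule mod_hom_cong[OF M]) (simp add: app uv)
  qed simp
  then obtain k where "k \<in> mod_hom C (tpowers C M) A"
    and kp: "\<And>w. w \<in> lists (carrier M) \<Longrightarrow> k (pure C M w) = \<phi> w"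
    using tpowers_lift[OF M A.module_axioms] by blast
  then have k: "k \<in> mod_hom C (tensor_algebra C M) A" by (simp add: tensor_algebra_updates[OF M])
  have kr: "k \<in> ring_hom (tensor_algebra C M) A"
    by (rule ring_hom_of_mod_hom[OF Tm.module_axioms A.module_axioms spans_tensor_algebra[OF M]
          tensor_algebra_bihom[OF M] algebra_bihom[OF A] k])
      (auto simp: tensor_algebra_mult[OF M] kp app tensor_algebra_one[OF M])
  note km = ring_hom_mult[OF kr]
  \<comment> \<open>The kernel is an ideal, so it is enough that it contains the
    commutators.\<close>
  have "sym_ideal C M \<subseteq> {t \<in> carrier (tensor_algebra C M). k t = \<zero>\<^bsub>A\<^esub>}"
    unfolding sym_ideal_def Let_def
  proof (rule T.genideal_minimal[OF alg_hom_kernel_ideal[OF T.ring_axioms A.ring_axioms kr]], safe)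
    fix x y assume xy: "x \<in> carrier M" "y \<in> carrier M"
    have p: "pure C M [x] \<in> carrier (tensor_algebra C M)" "pure C M [y] \<in> carrier (tensor_algebra C M)"
      using xy by (simp_all add: pure_closed_alg)
    then show "pure C M [x] \<otimes>\<^bsub>tensor_algebra C M\<^esub> pure C M [y] \<ominus>\<^bsub>tensor_algebra C M\<^esub>
        pure C M [y] \<otimes>\<^bsub>tensor_algebra C M\<^esub> pure C M [x] \<in> carrier (tensor_algebra C M)" by simp
    show "k (pure C M [x] \<otimes>\<^bsub>tensor_algebra C M\<^esub> pure C M [y] \<ominus>\<^bsub>tensor_algebra C M\<^esub>
        pure C M [y] \<otimes>\<^bsub>tensor_algebra C M\<^esub> pure C M [x]) = \<zero>\<^bsub>A\<^esub>"
      using p xy by (simp add: mod_hom_minus[OF Tm.module_axioms A.module_axioms k] km kp hc A.m_comm[of "h x"]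
        A.M.minus_eq A.M.r_neg)
  qed
  then have ker: "k x = \<zero>\<^bsub>A\<^esub>" if "x \<in> sym_ideal C M" for x using that by blast
  obtain k' where k': "k' \<in> mod_hom C (Sym C M) A"
    and k'w: "\<And>x. x \<in> carrier (tensor_algebra C M) \<Longrightarrow> k' (sym_ideal C M +>\<^bsub>tensor_algebra C M\<^esub> x) = k x"
    using quot_mod_lift[OF Tm.module_axioms submodule_sym_ideal A.module_axioms k ker] unfolding Sym_def by blast
  have w: "k' (sym_word w) = \<phi> w" if "w \<in> lists (carrier M)" for w
    using that unfolding sym_word_def by (simp add: k'w pure_closed_alg kp)
  have "k' \<in> alg_hom C (Sym C M) A"
    by (rule alg_hom_of_mod_hom[OF algebra_Sym A spans_Sym k'])
      (auto simp: w app simp flip: sym_word_append sym_word_Nil)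
  moreover have "k' (sym_emb C M x) = h x" if "x \<in> carrier M" for x
    using w[of "[x]"] that hc by (simp add: sym_emb_eq_word)
  ultimately show thesis by (rule that)
qed

subsection \<open>The symmetric square\<close>

interpretation TM: module C "tensor C M M" by (rule module_tensor[OF M M])

lemma sym_square_rel_closed:
  "{tens C M M x y \<ominus>\<^bsub>tensor C M M\<^esub> tens C M M y x |x y. x \<in> carrier M \<and> y \<in> carrier M} \<subseteq> carrier (tensor C M M)"
  by (auto intro!: TM.M.minus_closed tens_closed[OF M M])

lemma submodule_sym_square_rel: "submodule (sym_square_rel C M) C (tensor C M M)"
  unfolding sym_square_rel_def by (rule submodule_gen_submodule[OF TM.module_axioms sym_square_rel_closed])

lemma module_sym_square: "module C (sym_square C M)"
  unfolding sym_square_def by (rule module_quot_mod[OF TM.module_axioms submodule_sym_square_rel])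

lemma sym_tens_bihom: "sym_tens C M \<in> mod_bihom C M M (sym_square C M)"
  unfolding sym_square_def sym_tens_def
  using quot_mod_proj_hom[OF TM.module_axioms submodule_sym_square_rel] tens_bihom[OF M M]
  by (intro mod_bihomI) (rule mod_hom_comp, assumption, erule mod_bihom_left mod_bihom_right, assumption)+

lemma sym_tens_commute:
  assumes "x \<in> carrier M" "y \<in> carrier M"
  shows "sym_tens C M x y = sym_tens C M y x"
  unfolding sym_tens_def
proof (rule quot_mod_eqI[OF TM.module_axioms submodule_sym_square_rel])
  show "tens C M M x y \<ominus>\<^bsub>tensor C M M\<^esub> tens C M M y x \<in> sym_square_rel C M"
    unfolding sym_square_rel_def using assms by (intro subsetD[OF submodule_gen_superset]) blast
qed (use assms tens_closed[OF M M] in auto)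

lemma spans_sym_square:
  assumes "spans C M G"
  shows "spans C (sym_square C M) {sym_tens C M x y |x y. x \<in> G \<and> y \<in> G}"
proof -
  have "{sym_tens C M x y |x y. x \<in> G \<and> y \<in> G} =
      (\<lambda>t. sym_square_rel C M +>\<^bsub>tensor C M M\<^esub> t) ` {tens C M M x y |x y. x \<in> G \<and> y \<in> G}"
    unfolding sym_tens_def by blast
  then show ?thesis
    using spans_quot_mod[OF TM.module_axioms submodule_sym_square_rel spans_tensor[OF M M assms assms]]
    unfolding sym_square_def by simp
qed

section \<open>The shuffle product\<close>

text \<open>The recursion by which \<open>shuffle\<close> is specified, run on words instead of
  classes. It is the witness that the specification can be met.\<close>

fun word_shuffle where
  "word_shuffle [] v = pure C M v"
| "word_shuffle (x # u) [] = pure C M (x # u)"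
| "word_shuffle (x # u) (y # v) =
     pure C M [x] \<otimes>\<^bsub>tensor_algebra C M\<^esub> word_shuffle u (y # v) \<oplus>\<^bsub>tensor_algebra C M\<^esub>
     pure C M [y] \<otimes>\<^bsub>tensor_algebra C M\<^esub> word_shuffle (x # u) v"

lemma word_shuffle_closed:
  "\<lbrakk>u \<in> lists (carrier M); v \<in> lists (carrier M)\<rbrakk> \<Longrightarrow> word_shuffle u v \<in> carrier (tensor_algebra C M)"
  by (induction u v rule: word_shuffle.induct) (simp_all add: pure_closed_alg)

lemma word_shuffle_commute:
  "\<lbrakk>u \<in> lists (carrier M); v \<in> lists (carrier M)\<rbrakk> \<Longrightarrow> word_shuffle u v = word_shuffle v u"
proof (induction u v rule: word_shuffle.induct)
  case (1 v) then show ?case by (cases v) simp_all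
next
  case (3 x u y v) then show ?case by (simp add: pure_closed_alg word_shuffle_closed T.a_comm)
qed simp

text \<open>In the recursion the varying letter either is the leading letter that is split off, or
  stays inside a shorter shuffle. The two nested inductions run over the prefix \<open>a\<close>
  before it and over the second word.\<close>

lemma word_shuffle_hom:
  assumes b: "b \<in> lists (carrier M)" "a \<in> lists (carrier M)" "v \<in> lists (carrier M)"
  shows "(\<lambda>x. word_shuffle (a @ x # b) v) \<in> mod_hom C M (tensor_algebra C M)"
  using b(2,3)
proof (induction a arbitrary: v)
  note p = multilinear_hom[OF pure_multilinear[OF M], folded tensor_algebra_updates(3)[OF M, of M]]
  note l = mod_bihom_left[OF tensor_algebra_bihom[OF M]] and r = mod_bihom_right[OF tensor_algebra_bihom[OF M]]
  note add = mod_hom_addf[OF Tm.module_axioms]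
  {
    case Nil
    from this show ?case
    proof (induction v)
      case Nil then show ?case using p[of "[]" b] b by simp
    next
      case (Cons y v)
      have "(\<lambda>x. pure C M [x] \<otimes>\<^bsub>tensor_algebra C M\<^esub> word_shuffle b (y # v)) \<in> mod_hom C M (tensor_algebra C M)"
        using p[of "[]" "[]"] b Cons.hyps by (intro mod_hom_comp[OF l]) (simp_all add: word_shuffle_closed)
      moreover have "(\<lambda>x. pure C M [y] \<otimes>\<^bsub>tensor_algebra C M\<^esub> word_shuffle (x # b) v) \<in> mod_hom C M (tensor_algebra C M)"
        using Cons by (intro mod_hom_comp[OF r]) (simp_all add: pure_closed_alg)
      ultimately show ?case by (simp add: add)
    qed
  next
    case (Cons c a)
    note IH = Cons.IH and ca = Cons.hyps
    from Cons.prems show ?case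
    proof (induction v)
      case Nil then show ?case using p[of "c # a" b] ca b by simp
    next
      case (Cons y v)
      have "(\<lambda>x. pure C M [c] \<otimes>\<^bsub>tensor_algebra C M\<^esub> word_shuffle (a @ x # b) (y # v)) \<in> mod_hom C M (tensor_algebra C M)"
        using IH[of "y # v"] ca Cons.hyps by (intro mod_hom_comp[OF r]) (simp_all add: pure_closed_alg)
      moreover have "(\<lambda>x. pure C M [y] \<otimes>\<^bsub>tensor_algebra C M\<^esub> word_shuffle (c # a @ x # b) v) \<in> mod_hom C M (tensor_algebra C M)"
        using Cons by (intro mod_hom_comp[OF r]) (simp_all add: pure_closed_alg)
      ultimately show ?case by (simp add: add)
    qed
  }
qed

lemma shuffle_exists:
  "\<exists>s. s \<in> mod_bihom C (tensor_algebra C M) (tensor_algebra C M) (tensor_algebra C M) \<and>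
    (\<forall>u\<in>lists (carrier M). \<forall>v\<in>lists (carrier M). s (pure C M u) (pure C M v) = word_shuffle u v)"
proof -
  have l: "multilinear C M (tensor_algebra C M) (\<lambda>u. word_shuffle u v)" if "v \<in> lists (carrier M)" for v
    using that by (intro multilinearI word_shuffle_hom) (simp_all add: pure_closed_alg)
  have r: "multilinear C M (tensor_algebra C M) (\<lambda>v. word_shuffle u v)" if u: "u \<in> lists (carrier M)" for u
  proof (rule multilinearI)
    fix a b assume ab: "a \<in> lists (carrier M)" "b \<in> lists (carrier M)"
    \<comment> \<open>Since \<open>word_shuffle\<close> is symmetric, linearity in the second word
      is linearity in the first.\<close>
    show "(\<lambda>x. word_shuffle u (a @ x # b)) \<in> mod_hom C M (tensor_algebra C M)"
      by (rule mod_hom_cong[OF M word_shuffle_hom[OF ab(2,1) u]]) (simp add: word_shuffle_commute u ab)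
  qed (simp add: word_shuffle_closed u)
  obtain s where "s \<in> mod_bihom C (tpowers C M) (tpowers C M) (tensor_algebra C M)"
    "\<And>u v. \<lbrakk>u \<in> lists (carrier M); v \<in> lists (carrier M)\<rbrakk> \<Longrightarrow> s (pure C M u) (pure C M v) = word_shuffle u v"
    by (rule tpowers_bilift[OF M Tm.module_axioms r l]) simp_all
  then show ?thesis by (intro exI[of _ s]) (simp add: tensor_algebra_updates[OF M])
qed

lemma shuffle_spec:
  "shuffle C M \<in> mod_bihom C (tensor_algebra C M) (tensor_algebra C M) (tensor_algebra C M) \<and>
    (\<forall>u\<in>lists (carrier M). shuffle C M (pure C M u) (pure C M []) = pure C M u \<otimes>\<^bsub>tensor_algebra C M\<^esub> pure C M []
       \<and> shuffle C M (pure C M []) (pure C M u) = pure C M [] \<otimes>\<^bsub>tensor_algebra C M\<^esub> pure C M u) \<and>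
    (\<forall>x\<in>carrier M. \<forall>u\<in>lists (carrier M). \<forall>y\<in>carrier M. \<forall>v\<in>lists (carrier M).
      shuffle C M (pure C M (x # u)) (pure C M (y # v)) =
        pure C M [x] \<otimes>\<^bsub>tensor_algebra C M\<^esub> shuffle C M (pure C M u) (pure C M (y # v)) \<oplus>\<^bsub>tensor_algebra C M\<^esub>
        pure C M [y] \<otimes>\<^bsub>tensor_algebra C M\<^esub> shuffle C M (pure C M (x # u)) (pure C M v))"
proof -
  obtain s where s: "s \<in> mod_bihom C (tensor_algebra C M) (tensor_algebra C M) (tensor_algebra C M)"
    "\<forall>u\<in>lists (carrier M). \<forall>v\<in>lists (carrier M). s (pure C M u) (pure C M v) = word_shuffle u v"
    using shuffle_exists by blast
  have nil: "word_shuffle u [] = pure C M u" for u by (cases u) simp_all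
  show ?thesis unfolding shuffle_def Let_def
    by (rule someI[of _ s]) (use s in \<open>simp add: tensor_algebra_mult[OF M] nil\<close>)
qed

lemma shuffle_bihom: "shuffle C M \<in> mod_bihom C (tpowers C M) (tpowers C M) (tpowers C M)"
  using shuffle_spec by (simp add: tensor_algebra_updates[OF M])

lemma shuffle_Nil: "u \<in> lists (carrier M) \<Longrightarrow> shuffle C M (pure C M u) (pure C M []) = pure C M u"
  "u \<in> lists (carrier M) \<Longrightarrow> shuffle C M (pure C M []) (pure C M u) = pure C M u"
  using shuffle_spec by (simp_all add: tensor_algebra_mult[OF M])

lemma shuffle_Cons:
  "\<lbrakk>x \<in> carrier M; u \<in> lists (carrier M); y \<in> carrier M; v \<in> lists (carrier M)\<rbrakk> \<Longrightarrow>
    shuffle C M (pure C M (x # u)) (pure C M (y # v)) =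
      pure C M [x] \<otimes>\<^bsub>tensor_algebra C M\<^esub> shuffle C M (pure C M u) (pure C M (y # v)) \<oplus>\<^bsub>tpowers C M\<^esub>
      pure C M [y] \<otimes>\<^bsub>tensor_algebra C M\<^esub> shuffle C M (pure C M (x # u)) (pure C M v)"
  using shuffle_spec by (simp add: tensor_algebra_updates[OF M])

section \<open>Tensors of positive length\<close>

lemma tpowers_pos_gens: "{pure C M w |w. w \<in> lists (carrier M) \<and> w \<noteq> []} \<subseteq> carrier (tpowers C M)"
  using pure_closed[OF M] by blast

lemma submodule_tpowers_pos: "submodule (carrier (tpowers_pos C M)) C (tpowers C M)"
  unfolding tpowers_pos_def using submodule_gen_submodule[OF module_tpowers[OF M] tpowers_pos_gens] by simp

lemma module_tpowers_pos: "module C (tpowers_pos C M)"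
  unfolding tpowers_pos_def
  by (rule submodule.submodule_is_module[OF submodule_gen_submodule[OF module_tpowers[OF M] tpowers_pos_gens]
      module_tpowers[OF M]])

lemma spans_tpowers_pos: "spans C (tpowers_pos C M) {pure C M w |w. w \<in> lists (carrier M) \<and> w \<noteq> []}"
  unfolding tpowers_pos_def by (rule spans_submodule_gen[OF module_tpowers[OF M] tpowers_pos_gens])

lemma tpowers_pos_subset: "carrier (tpowers_pos C M) \<subseteq> carrier (tpowers C M)"
  by (rule module.submoduleE(1)[OF module_tpowers[OF M] submodule_tpowers_pos])

lemma tpowers_pos_incl: "(\<lambda>t. t) \<in> mod_hom C (tpowers_pos C M) (tpowers C M)"
  using tpowers_pos_subset by (intro mod_homI) (auto simp: tpowers_pos_def)

lemma pure_pos: "\<lbrakk>w \<in> lists (carrier M); w \<noteq> []\<rbrakk> \<Longrightarrow> pure C M w \<in> carrier (tpowers_pos C M)"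
  using spans_tpowers_pos unfolding spans_def by blast

text \<open>Tensors of positive length form a direct summand. The projection onto it later extends
  the pairings \<epsilon> by zero to the empty tensor.\<close>

lemma tpowers_proj:
  obtains \<rho> where "\<rho> \<in> mod_hom C (tpowers C M) (tpowers_pos C M)"
    "\<rho> (pure C M []) = \<zero>\<^bsub>tpowers C M\<^esub>" "\<And>t. t \<in> carrier (tpowers_pos C M) \<Longrightarrow> \<rho> t = t"
proof -
  interpret P: module C "tpowers_pos C M" by (rule module_tpowers_pos)
  define \<phi> where "\<phi> w = (if w = [] then \<zero>\<^bsub>tpowers_pos C M\<^esub> else pure C M w)" for w
  have "multilinear C M (tpowers_pos C M) \<phi>"
  proof (rule multilinearI)
    fix u v assume uv: "u \<in> lists (carrier M)" "v \<in> lists (carrier M)"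
    note h = multilinear_hom[OF pure_multilinear[OF M] uv]
    show "(\<lambda>x. \<phi> (u @ x # v)) \<in> mod_hom C M (tpowers_pos C M)"
      using mod_hom_add[OF h] mod_hom_smult[OF h] uv pure_pos
      by (intro mod_homI) (simp_all add: \<phi>_def tpowers_pos_def)
  qed (simp add: \<phi>_def)
  then obtain \<rho> where \<rho>: "\<rho> \<in> mod_hom C (tpowers C M) (tpowers_pos C M)"
    "\<And>w. w \<in> lists (carrier M) \<Longrightarrow> \<rho> (pure C M w) = \<phi> w"
    using tpowers_lift[OF M P.module_axioms] by blast
  have "\<rho> t = t" if "t \<in> carrier (tpowers_pos C M)" for t
    by (rule mod_hom_eqI[OF P.module_axioms P.module_axioms spans_tpowers_pos mod_hom_comp[OF \<rho>(1) tpowers_pos_incl]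
          mod_hom_id _ that]) (auto simp: \<rho>(2) \<phi>_def)
  then show thesis using \<rho> that by (simp add: \<phi>_def tpowers_pos_def)
qed

lemma pure_mult_pos:
  assumes "x \<in> carrier M" "t \<in> carrier (tpowers C M)"
  shows "pure C M [x] \<otimes>\<^bsub>tensor_algebra C M\<^esub> t \<in> carrier (tpowers_pos C M)"
  by (rule mod_hom_submodule[OF module_tpowers[OF M] module_tpowers[OF M] spans_tpowers[OF M] _ submodule_tpowers_pos _ assms(2)])
    (use assms mod_bihom_right[OF tensor_algebra_bihom[OF M], of "pure C M [x]"] in
      \<open>auto simp: tensor_algebra_updates[OF M] pure_closed[OF M] tensor_algebra_mult[OF M] pure_pos\<close>)

text \<open>In the recursion each summand begins with a letter. Hence the shuffles to which
  \<epsilon> is applied in the relations of J_2 lie in its domain.\<close>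

lemma shuffle_pos:
  assumes "u \<in> lists (carrier M)" "v \<in> lists (carrier M)" "u \<noteq> [] \<or> v \<noteq> []"
  shows "shuffle C M (pure C M u) (pure C M v) \<in> carrier (tpowers_pos C M)"
proof (cases u)
  case Nil then show ?thesis using assms by (simp add: shuffle_Nil pure_pos)
next
  case u: (Cons x u')
  show ?thesis
  proof (cases v)
    case Nil then show ?thesis using assms u by (simp add: shuffle_Nil pure_pos)
  next
    case (Cons y v')
    interpret P: module C "tpowers C M" by (rule module_tpowers[OF M])
    show ?thesis using u Cons assms
      by (auto simp: shuffle_Cons intro!: P.submoduleE(5)[OF submodule_tpowers_pos] pure_mult_pos
        mod_bihom_closed[OF shuffle_bihom] pure_closed[OF M])
  qed
qed

end

section \<open>The deformed shuffle algebra\<close>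

lemma (in abelian_monoid) finsum_upt_Suc:
  fixes n :: nat
  assumes "\<And>i. i < Suc n \<Longrightarrow> h i \<in> carrier G"
  shows "(\<Oplus>i\<in>{0..<Suc n}. h i) = h 0 \<oplus> (\<Oplus>i\<in>{0..<n}. h (Suc i))"
proof -
  have "(\<Oplus>i\<in>{0..<Suc n}. h i) = (\<Oplus>i\<in>insert 0 (Suc ` {0..<n}). h i)"
    by (simp add: atLeast0_lessThan_Suc_eq_insert_0)
  also have "\<dots> = h 0 \<oplus> (\<Oplus>i\<in>Suc ` {0..<n}. h i)"
    using assms by (intro finsum_insert) auto
  also have "(\<Oplus>i\<in>Suc ` {0..<n}. h i) = (\<Oplus>i\<in>{0..<n}. h (Suc i))"
    using assms by (intro finsum_reindex) auto
  finally show ?thesis .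
qed

text \<open>The corner (0, 0) holds \<open>z\<close>; an entry on one of the two borders comes from
  just one of the families \<open>X\<close> and \<open>Y\<close>, shifted by one, and an inner entry
  is a sum of both. In \<open>G_Cons\<close> the indices are the positions at which two words are
  cut.\<close>

lemma (in abelian_monoid) double_sum_rec:
  fixes n m :: nat
  assumes X: "\<And>i j. \<lbrakk>i < n; j < Suc m\<rbrakk> \<Longrightarrow> X i j \<in> carrier G"
    and Y: "\<And>i j. \<lbrakk>i < Suc n; j < m\<rbrakk> \<Longrightarrow> Y i j \<in> carrier G"
    and z: "z \<in> carrier G"
    and t: "t 0 0 = z" "\<And>i. i < n \<Longrightarrow> t (Suc i) 0 = X i 0" "\<And>j. j < m \<Longrightarrow> t 0 (Suc j) = Y 0 j"
      "\<And>i j. \<lbrakk>i < n; j < m\<rbrakk> \<Longrightarrow> t (Suc i) (Suc j) = X i (Suc j) \<oplus> Y (Suc i) j"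
  shows "(\<Oplus>i\<in>{0..<Suc n}. \<Oplus>j\<in>{0..<Suc m}. t i j) =
    (\<Oplus>i\<in>{0..<n}. \<Oplus>j\<in>{0..<Suc m}. X i j) \<oplus> (\<Oplus>i\<in>{0..<Suc n}. \<Oplus>j\<in>{0..<m}. Y i j) \<oplus> z"
proof -
  have tc: "t i j \<in> carrier G" if "i < Suc n" "j < Suc m" for i j
    using that X Y z t by (cases i; cases j) auto
  have r0: "(\<Oplus>j\<in>{0..<Suc m}. t 0 j) = z \<oplus> (\<Oplus>j\<in>{0..<m}. Y 0 j)"
    using tc Y t by (subst finsum_upt_Suc) (auto intro!: arg_cong2[of _ _ _ _ "(\<oplus>)"] finsum_cong')
  have r: "(\<Oplus>j\<in>{0..<Suc m}. t (Suc i) j) = (\<Oplus>j\<in>{0..<Suc m}. X i j) \<oplus> (\<Oplus>j\<in>{0..<m}. Y (Suc i) j)"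
    if i: "i < n" for i
  proof -
    have "(\<Oplus>j\<in>{0..<Suc m}. t (Suc i) j) = t (Suc i) 0 \<oplus> (\<Oplus>j\<in>{0..<m}. t (Suc i) (Suc j))"
      using tc i by (intro finsum_upt_Suc) auto
    also have "t (Suc i) 0 = X i 0" using t(2) i .
    also have "(\<Oplus>j\<in>{0..<m}. t (Suc i) (Suc j)) = (\<Oplus>j\<in>{0..<m}. X i (Suc j) \<oplus> Y (Suc i) j)"
      using X Y t(4) i by (intro finsum_cong') auto
    also have "(\<Oplus>j\<in>{0..<m}. X i (Suc j) \<oplus> Y (Suc i) j)
        = (\<Oplus>j\<in>{0..<m}. X i (Suc j)) \<oplus> (\<Oplus>j\<in>{0..<m}. Y (Suc i) j)"
      using X Y i by (intro finsum_addf) auto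
    also have "X i 0 \<oplus> \<dots> = (X i 0 \<oplus> (\<Oplus>j\<in>{0..<m}. X i (Suc j))) \<oplus> (\<Oplus>j\<in>{0..<m}. Y (Suc i) j)"
      using X Y i by (intro a_assoc[symmetric] finsum_closed) auto
    also have "X i 0 \<oplus> (\<Oplus>j\<in>{0..<m}. X i (Suc j)) = (\<Oplus>j\<in>{0..<Suc m}. X i j)"
      using X i by (intro finsum_upt_Suc[symmetric]) auto
    finally show ?thesis .
  qed
  have cX: "(\<Oplus>j\<in>{0..<Suc m}. X i j) \<in> carrier G" if "i < n" for i
    using X that by (intro finsum_closed) auto
  have cY: "(\<Oplus>j\<in>{0..<m}. Y i j) \<in> carrier G" if "i < Suc n" for i
    using Y that by (intro finsum_closed) auto
  have "(\<Oplus>i\<in>{0..<Suc n}. \<Oplus>j\<in>{0..<Suc m}. t i j) =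
      (\<Oplus>j\<in>{0..<Suc m}. t 0 j) \<oplus> (\<Oplus>i\<in>{0..<n}. \<Oplus>j\<in>{0..<Suc m}. t (Suc i) j)"
    using tc by (intro finsum_upt_Suc finsum_closed) auto
  also have "(\<Oplus>i\<in>{0..<n}. \<Oplus>j\<in>{0..<Suc m}. t (Suc i) j)
      = (\<Oplus>i\<in>{0..<n}. (\<Oplus>j\<in>{0..<Suc m}. X i j) \<oplus> (\<Oplus>j\<in>{0..<m}. Y (Suc i) j))"
    using cX cY r by (intro finsum_cong') auto
  also have "\<dots> = (\<Oplus>i\<in>{0..<n}. \<Oplus>j\<in>{0..<Suc m}. X i j) \<oplus> (\<Oplus>i\<in>{0..<n}. \<Oplus>j\<in>{0..<m}. Y (Suc i) j)"
    using cX cY by (intro finsum_addf) auto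
  finally have 1: "(\<Oplus>i\<in>{0..<Suc n}. \<Oplus>j\<in>{0..<Suc m}. t i j) = (z \<oplus> (\<Oplus>j\<in>{0..<m}. Y 0 j)) \<oplus>
      ((\<Oplus>i\<in>{0..<n}. \<Oplus>j\<in>{0..<Suc m}. X i j) \<oplus> (\<Oplus>i\<in>{0..<n}. \<Oplus>j\<in>{0..<m}. Y (Suc i) j))"
    unfolding r0 .
  have 2: "(\<Oplus>i\<in>{0..<Suc n}. \<Oplus>j\<in>{0..<m}. Y i j) =
      (\<Oplus>j\<in>{0..<m}. Y 0 j) \<oplus> (\<Oplus>i\<in>{0..<n}. \<Oplus>j\<in>{0..<m}. Y (Suc i) j)"
    using cY by (intro finsum_upt_Suc) auto
  have "(\<Oplus>i\<in>{0..<n}. \<Oplus>j\<in>{0..<Suc m}. X i j) \<in> carrier G" "(\<Oplus>j\<in>{0..<m}. Y 0 j) \<in> carrier G"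
    "(\<Oplus>i\<in>{0..<n}. \<Oplus>j\<in>{0..<m}. Y (Suc i) j) \<in> carrier G"
    using cX cY by (auto intro!: finsum_closed)
  then show ?thesis unfolding 1 2 using z by (simp add: a_ac)
qed

text \<open>\<open>e2_assoc\<close> is the relation defining \<open>J2\<close>, written without subtraction. As \<open>e2\<close> vanishes on the empty
  word, the sums may run over all pairs of indices.\<close>

locale deformed_shuffle =
  fixes C :: "('c, 'e) ring_scheme" and M :: "('c, 'm) module" and K :: "('c, 'k) module"
    and e2 :: "('m list \<Rightarrow> 'c) set \<Rightarrow> ('m list \<Rightarrow> 'c) set \<Rightarrow> 'k"
  assumes M: "module C M" and K: "algebra C K"
    and e2: "e2 \<in> mod_bihom C (tpowers C M) (tpowers C M) K"
    and e2_Nil: "\<And>t. t \<in> carrier (tpowers C M) \<Longrightarrow> e2 (pure C M []) t = \<zero>\<^bsub>K\<^esub>"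
    and e2_commute: "\<And>s t. \<lbrakk>s \<in> carrier (tpowers C M); t \<in> carrier (tpowers C M)\<rbrakk> \<Longrightarrow> e2 s t = e2 t s"
    and e2_assoc: "\<And>f g h. \<lbrakk>f \<in> lists (carrier M); g \<in> lists (carrier M); h \<in> lists (carrier M); f \<noteq> []; g \<noteq> []; h \<noteq> []\<rbrakk> \<Longrightarrow>
      e2 (shuffle C M (pure C M f) (pure C M g)) (pure C M h) \<oplus>\<^bsub>K\<^esub>
        (\<Oplus>\<^bsub>K\<^esub>i\<in>{0..<length f}. \<Oplus>\<^bsub>K\<^esub>j\<in>{0..<length g}. e2 (pure C M (drop i f)) (pure C M (drop j g)) \<otimes>\<^bsub>K\<^esub>
          e2 (shuffle C M (pure C M (take i f)) (pure C M (take j g))) (pure C M h)) =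
      e2 (shuffle C M (pure C M h) (pure C M g)) (pure C M f) \<oplus>\<^bsub>K\<^esub>
        (\<Oplus>\<^bsub>K\<^esub>i\<in>{0..<length h}. \<Oplus>\<^bsub>K\<^esub>j\<in>{0..<length g}. e2 (pure C M (drop i h)) (pure C M (drop j g)) \<otimes>\<^bsub>K\<^esub>
          e2 (shuffle C M (pure C M (take i h)) (pure C M (take j g))) (pure C M f))"
begin

abbreviation "words \<equiv> lists (carrier M)"
abbreviation "T \<equiv> tpowers C M"
abbreviation "N0 \<equiv> tensor C K T"
abbreviation "tn \<equiv> tens C K T"
abbreviation "pw \<equiv> pure C M"
abbreviation "shf \<equiv> shuffle C M"

lemma T: "module C T" by (rule module_tpowers[OF M])

lemma Km: "module C K" by (rule algebra_is_module[OF K])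

lemma N0: "module C N0" by (rule module_tensor[OF Km T])

sublocale K: algebra C K by (rule K)
sublocale N0: module C N0 by (rule N0)

lemmas tnl = mod_bihom_left[OF tens_bihom[OF Km T]]
lemmas tnr = mod_bihom_right[OF tens_bihom[OF Km T]]
lemmas tn_closed = tens_closed[OF Km T]
lemmas pt_closed = pure_closed[OF M]
lemmas e2l = mod_bihom_left[OF e2]
lemmas e2r = mod_bihom_right[OF e2]
lemmas e2_closed = mod_bihom_closed[OF e2]
lemmas shl = mod_bihom_left[OF shuffle_bihom[OF M]]
lemmas shr = mod_bihom_right[OF shuffle_bihom[OF M]]
lemmas sh_closed = mod_bihom_closed[OF shuffle_bihom[OF M]]

lemma pre_hom: "x \<in> carrier M \<Longrightarrow> (\<lambda>t. pw [x] \<otimes>\<^bsub>tensor_algebra C M\<^esub> t) \<in> mod_hom C T T"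
  using mod_bihom_right[OF tensor_algebra_bihom[OF M], of "pw [x]"]
  by (simp add: tensor_algebra_updates[OF M] pt_closed)

lemma pre_pt: "\<lbrakk>x \<in> carrier M; w \<in> words\<rbrakk> \<Longrightarrow> pw [x] \<otimes>\<^bsub>tensor_algebra C M\<^esub> pw w = pw (x # w)"
  by (simp add: tensor_algebra_mult[OF M])

lemma spans_N0: "spans C N0 ((\<lambda>(c, w). tn c (pw w)) ` (carrier K \<times> words))"
proof -
  have "{tn c t |c t. c \<in> carrier K \<and> t \<in> pw ` words} = (\<lambda>(c, w). tn c (pw w)) ` (carrier K \<times> words)" by auto
  then show ?thesis using spans_tensor[OF Km T spans_carrier[OF Km] spans_tpowers[OF M]] by simp
qed

lemma N0_eqI:
  assumes "module C P" "f \<in> mod_hom C N0 P" "g \<in> mod_hom C N0 P"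
    and "\<And>c w. \<lbrakk>c \<in> carrier K; w \<in> words\<rbrakk> \<Longrightarrow> f (tn c (pw w)) = g (tn c (pw w))" "u \<in> carrier N0"
  shows "f u = g u"
  by (rule mod_hom_eqI[OF N0 assms(1) spans_N0 assms(2,3) _ assms(5)]) (auto simp: assms(4))

subsection \<open>Linear operators on the tensor product\<close>

definition act where
  "act c = (SOME k. k \<in> mod_hom C N0 N0 \<and> (\<forall>d\<in>carrier K. \<forall>t\<in>carrier T. k (tn d t) = tn (c \<otimes>\<^bsub>K\<^esub> d) t))"

definition cns where
  "cns x = (SOME k. k \<in> mod_hom C N0 N0 \<and>
     (\<forall>d\<in>carrier K. \<forall>t\<in>carrier T. k (tn d t) = tn d (pw [x] \<otimes>\<^bsub>tensor_algebra C M\<^esub> t)))"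

text \<open>Pairs a whole element with the word \<open>h\<close>. It provides the constant term of
  the product recursion in \<open>cns_mult\<close>.\<close>

definition E where
  "E h = (SOME k. k \<in> mod_hom C N0 K \<and>
     (\<forall>d\<in>carrier K. \<forall>t\<in>carrier T. k (tn d t) = d \<otimes>\<^bsub>K\<^esub> e2 t (pw h)))"

lemma some_lift:
  assumes "module C P" "h \<in> mod_bihom C K T P"
  shows "(SOME k. k \<in> mod_hom C N0 P \<and> (\<forall>d\<in>carrier K. \<forall>t\<in>carrier T. k (tn d t) = h d t)) \<in> mod_hom C N0 P \<and>
    (\<forall>d\<in>carrier K. \<forall>t\<in>carrier T.
      (SOME k. k \<in> mod_hom C N0 P \<and> (\<forall>d\<in>carrier K. \<forall>t\<in>carrier T. k (tn d t) = h d t)) (tn d t) = h d t)"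
proof -
  obtain k where "k \<in> mod_hom C N0 P" "\<And>d t. \<lbrakk>d \<in> carrier K; t \<in> carrier T\<rbrakk> \<Longrightarrow> k (tn d t) = h d t"
    using tensor_lift[OF Km T assms] by blast
  then have "\<exists>k. k \<in> mod_hom C N0 P \<and> (\<forall>d\<in>carrier K. \<forall>t\<in>carrier T. k (tn d t) = h d t)" by blast
  from someI_ex[OF this] show ?thesis .
qed

lemma act:
  assumes c: "c \<in> carrier K"
  shows "act c \<in> mod_hom C N0 N0" "\<And>d t. \<lbrakk>d \<in> carrier K; t \<in> carrier T\<rbrakk> \<Longrightarrow> act c (tn d t) = tn (c \<otimes>\<^bsub>K\<^esub> d) t"
proof -
  have "(\<lambda>d t. tn (c \<otimes>\<^bsub>K\<^esub> d) t) \<in> mod_bihom C K T N0"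
    using c by (intro mod_bihomI tnr mod_hom_comp[OF tnl mod_hom_multl[OF K c mod_hom_id]]) auto
  from some_lift[OF N0 this]
  show "act c \<in> mod_hom C N0 N0" "\<And>d t. \<lbrakk>d \<in> carrier K; t \<in> carrier T\<rbrakk> \<Longrightarrow> act c (tn d t) = tn (c \<otimes>\<^bsub>K\<^esub> d) t"
    unfolding act_def by blast+
qed

lemma cns:
  assumes x: "x \<in> carrier M"
  shows "cns x \<in> mod_hom C N0 N0"
    "\<And>d t. \<lbrakk>d \<in> carrier K; t \<in> carrier T\<rbrakk> \<Longrightarrow> cns x (tn d t) = tn d (pw [x] \<otimes>\<^bsub>tensor_algebra C M\<^esub> t)"
proof -
  have "(\<lambda>d t. tn d (pw [x] \<otimes>\<^bsub>tensor_algebra C M\<^esub> t)) \<in> mod_bihom C K T N0"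
    using pre_hom[OF x] by (intro mod_bihomI tnl mod_hom_comp[OF tnr pre_hom[OF x]]) (auto dest: mod_hom_closed)
  from some_lift[OF N0 this]
  show "cns x \<in> mod_hom C N0 N0"
    "\<And>d t. \<lbrakk>d \<in> carrier K; t \<in> carrier T\<rbrakk> \<Longrightarrow> cns x (tn d t) = tn d (pw [x] \<otimes>\<^bsub>tensor_algebra C M\<^esub> t)"
    unfolding cns_def by blast+
qed

lemma cns_pt: "\<lbrakk>x \<in> carrier M; d \<in> carrier K; w \<in> words\<rbrakk> \<Longrightarrow> cns x (tn d (pw w)) = tn d (pw (x # w))"
  by (simp add: cns pt_closed pre_pt)

lemma E:
  assumes h: "h \<in> words"
  shows "E h \<in> mod_hom C N0 K" "\<And>d t. \<lbrakk>d \<in> carrier K; t \<in> carrier T\<rbrakk> \<Longrightarrow> E h (tn d t) = d \<otimes>\<^bsub>K\<^esub> e2 t (pw h)"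
proof -
  have "(\<lambda>d t. d \<otimes>\<^bsub>K\<^esub> e2 t (pw h)) \<in> mod_bihom C K T K"
    using pt_closed[OF h]
    by (intro mod_bihomI mod_hom_multl[OF K _ e2l] mod_hom_multr[OF K _ mod_hom_id]) (auto intro: e2_closed)
  from some_lift[OF Km this]
  show "E h \<in> mod_hom C N0 K" "\<And>d t. \<lbrakk>d \<in> carrier K; t \<in> carrier T\<rbrakk> \<Longrightarrow> E h (tn d t) = d \<otimes>\<^bsub>K\<^esub> e2 t (pw h)"
    unfolding E_def by blast+
qed

lemmas act_closed = mod_hom_closed[OF act(1)]
lemmas cns_closed = mod_hom_closed[OF cns(1)]
lemmas E_closed = mod_hom_closed[OF E(1)]

lemma act_bihom: "act \<in> mod_bihom C K N0 N0"
proof (rule mod_bihom_spanI[OF Km N0 N0 spans_N0])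
  show "act c \<in> mod_hom C N0 N0" if "c \<in> carrier K" for c by (rule act(1)[OF that])
  show "(\<lambda>c. act c y) \<in> mod_hom C K N0" if y: "y \<in> (\<lambda>(c, w). tn c (pw w)) ` (carrier K \<times> words)" for y
  proof -
    obtain d w where d: "d \<in> carrier K" "w \<in> words" "y = tn d (pw w)" using y by auto
    have "(\<lambda>c. tn (c \<otimes>\<^bsub>K\<^esub> d) (pw w)) \<in> mod_hom C K N0"
      by (rule mod_hom_comp[OF tnl[OF pt_closed[OF d(2)]] mod_hom_multr[OF K d(1) mod_hom_id]])
    then show ?thesis by (rule mod_hom_cong[OF Km]) (simp add: d act pt_closed)
  qed
qed

lemma act_act:
  assumes "c \<in> carrier K" "d \<in> carrier K" "u \<in> carrier N0"
  shows "act c (act d u) = act (c \<otimes>\<^bsub>K\<^esub> d) u"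
  by (rule N0_eqI[OF N0 mod_hom_comp[OF act(1) act(1)] act(1) _ assms(3)])
    (use assms in \<open>simp_all add: act pt_closed K.m_assoc\<close>)

lemma act_one:
  assumes "u \<in> carrier N0" shows "act \<one>\<^bsub>K\<^esub> u = u"
  by (rule N0_eqI[OF N0 act(1) mod_hom_id _ assms]) (simp_all add: act pt_closed)

lemma act_cns:
  assumes "c \<in> carrier K" "x \<in> carrier M" "u \<in> carrier N0"
  shows "cns x (act c u) = act c (cns x u)"
  by (rule N0_eqI[OF N0 mod_hom_comp[OF cns(1) act(1)] mod_hom_comp[OF act(1) cns(1)] _ assms(3)])
    (use assms in \<open>simp_all add: act cns_pt pt_closed\<close>)

lemma E_act:
  assumes "c \<in> carrier K" "h \<in> words" "u \<in> carrier N0"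
  shows "E h (act c u) = c \<otimes>\<^bsub>K\<^esub> E h u"
  by (rule N0_eqI[OF Km mod_hom_comp[OF E(1) act(1)] mod_hom_multl[OF K _ E(1)] _ assms(3)])
    (use assms in \<open>simp_all add: act E pt_closed K.m_assoc e2_closed\<close>)

subsection \<open>The product of words\<close>

definition G_term where
  "G_term f g i j = tn (e2 (pw (drop i f)) (pw (drop j g))) (shf (pw (take i f)) (pw (take j g)))"

text \<open>The deformed product of two words with unit coefficients. Other coefficients are brought
  in through \<open>act\<close>.\<close>

definition G where
  "G f g = tn \<one>\<^bsub>K\<^esub> (shf (pw f) (pw g)) \<oplus>\<^bsub>N0\<^esub>
     (\<Oplus>\<^bsub>N0\<^esub>i\<in>{0..<length f}. \<Oplus>\<^bsub>N0\<^esub>j\<in>{0..<length g}. G_term f g i j)"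

lemma take_words: "w \<in> words \<Longrightarrow> take i w \<in> words" and drop_words: "w \<in> words \<Longrightarrow> drop i w \<in> words"
  by (auto simp: in_lists_conv_set dest: in_set_takeD in_set_dropD)

lemmas pt_td = pt_closed[OF take_words] pt_closed[OF drop_words]

lemma G_term_closed: "\<lbrakk>f \<in> words; g \<in> words\<rbrakk> \<Longrightarrow> G_term f g i j \<in> carrier N0"
  unfolding G_term_def by (intro tn_closed e2_closed sh_closed pt_td)

lemma G_closed: "\<lbrakk>f \<in> words; g \<in> words\<rbrakk> \<Longrightarrow> G f g \<in> carrier N0"
  unfolding G_def
  by (auto intro!: N0.M.a_closed tn_closed sh_closed pt_closed N0.M.finsum_closed G_term_closed)

text \<open>A letter of a word lies on exactly one side of a cut: in the suffix, which enters the
  pairing, or in the prefix, which enters the shuffle. So each summand \<open>G_term\<close>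
  contains it once and is linear in it.\<close>

lemma split_cases:
  fixes i :: nat and a :: "'z list"
  obtains "\<And>x b. take i (a @ x # b) = take i a" "\<And>x b. drop i (a @ x # b) = drop i a @ x # b"
  | k where "\<And>x b. take i (a @ x # b) = a @ x # take k b" "\<And>x b. drop i (a @ x # b) = drop k b"
proof (cases "i \<le> length a")
  case True
  then show thesis by (intro that(1)) simp_all
next
  case False
  then obtain k where "i = length a + Suc k" using less_iff_Suc_add by (metis add_Suc_right not_le)
  then show thesis by (intro that(2)[of k]) simp_all
qed

lemmas pt_hom = multilinear_hom[OF pure_multilinear[OF M]]

lemma G_term_multilinear:
  assumes w: "w \<in> words" and ab: "a \<in> words" "b \<in> words"
  shows "(\<lambda>x. G_term (a @ x # b) w i j) \<in> mod_hom C M N0"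
    and "(\<lambda>x. G_term w (a @ x # b) i j) \<in> mod_hom C M N0"
proof -
  note c = e2_closed sh_closed pt_td w ab take_words drop_words
  show "(\<lambda>x. G_term (a @ x # b) w i j) \<in> mod_hom C M N0"
  proof (cases rule: split_cases[of i a])
    case 1
    have "(\<lambda>x. tn (e2 (pw (drop i a @ x # b)) (pw (drop j w))) (shf (pw (take i a)) (pw (take j w)))) \<in> mod_hom C M N0"
      by (intro mod_hom_comp[OF tnl mod_hom_comp[OF e2l pt_hom]] c)
    then show ?thesis unfolding G_term_def 1 .
  next
    case (2 k)
    have "(\<lambda>x. tn (e2 (pw (drop k b)) (pw (drop j w))) (shf (pw (a @ x # take k b)) (pw (take j w)))) \<in> mod_hom C M N0"
      by (intro mod_hom_comp[OF tnr mod_hom_comp[OF shl pt_hom]] c)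
    then show ?thesis unfolding G_term_def 2 .
  qed
  show "(\<lambda>x. G_term w (a @ x # b) i j) \<in> mod_hom C M N0"
  proof (cases rule: split_cases[of j a])
    case 1
    have "(\<lambda>x. tn (e2 (pw (drop i w)) (pw (drop j a @ x # b))) (shf (pw (take i w)) (pw (take j a)))) \<in> mod_hom C M N0"
      by (intro mod_hom_comp[OF tnl mod_hom_comp[OF e2r pt_hom]] c)
    then show ?thesis unfolding G_term_def 1 .
  next
    case (2 k)
    have "(\<lambda>x. tn (e2 (pw (drop i w)) (pw (drop k b))) (shf (pw (take i w)) (pw (a @ x # take k b)))) \<in> mod_hom C M N0"
      by (intro mod_hom_comp[OF tnr mod_hom_comp[OF shr pt_hom]] c)
    then show ?thesis unfolding G_term_def 2 .
  qed
qed

lemma G_multilinear: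
  assumes w: "w \<in> words"
  shows "multilinear C M N0 (\<lambda>u. G u w)" "multilinear C M N0 (\<lambda>u. G w u)"
proof -
  note s = mod_hom_addf[OF N0 _ mod_hom_finsumf[OF N0 _ mod_hom_finsumf[OF N0]]]
  show "multilinear C M N0 (\<lambda>u. G u w)"
  proof (rule multilinearI)
    fix a b assume ab: "a \<in> words" "b \<in> words"
    show "(\<lambda>x. G (a @ x # b) w) \<in> mod_hom C M N0" unfolding G_def length_append list.size
      by (rule s[OF mod_hom_comp[OF tnr mod_hom_comp[OF shl pt_hom]]])
        (auto simp: G_term_multilinear w ab pt_closed)
  qed (simp add: G_closed w)
  show "multilinear C M N0 (\<lambda>u. G w u)"
  proof (rule multilinearI)
    fix a b assume ab: "a \<in> words" "b \<in> words"
    show "(\<lambda>x. G w (a @ x # b)) \<in> mod_hom C M N0" unfolding G_def length_append list.size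
      by (rule s[OF mod_hom_comp[OF tnr mod_hom_comp[OF shr pt_hom]]])
        (auto simp: G_term_multilinear w ab pt_closed)
  qed (simp add: G_closed w)
qed

lemma G_Nil: "w \<in> words \<Longrightarrow> G [] w = tn \<one>\<^bsub>K\<^esub> (pw w)" "w \<in> words \<Longrightarrow> G w [] = tn \<one>\<^bsub>K\<^esub> (pw w)"
  by (simp_all add: G_def shuffle_Nil[OF M] tn_closed pt_closed)

text \<open>Brings the product into the shape of the defining formula, where the coefficients stand
  inside the sums.\<close>

lemma act_G:
  assumes "c \<in> carrier K" "f \<in> words" "g \<in> words"
  shows "act c (G f g) = tn c (shf (pw f) (pw g)) \<oplus>\<^bsub>N0\<^esub>
     (\<Oplus>\<^bsub>N0\<^esub>i\<in>{0..<length f}. \<Oplus>\<^bsub>N0\<^esub>j\<in>{0..<length g}.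
        tn (c \<otimes>\<^bsub>K\<^esub> e2 (pw (drop i f)) (pw (drop j g))) (shf (pw (take i f)) (pw (take j g))))"
proof -
  have 1: "act c (G_term f g i j) = tn (c \<otimes>\<^bsub>K\<^esub> e2 (pw (drop i f)) (pw (drop j g))) (shf (pw (take i f)) (pw (take j g)))" for i j
    unfolding G_term_def using assms by (simp add: act e2_closed sh_closed pt_td)
  have "act c (\<Oplus>\<^bsub>N0\<^esub>i\<in>{0..<length f}. \<Oplus>\<^bsub>N0\<^esub>j\<in>{0..<length g}. G_term f g i j) =
      (\<Oplus>\<^bsub>N0\<^esub>i\<in>{0..<length f}. act c (\<Oplus>\<^bsub>N0\<^esub>j\<in>{0..<length g}. G_term f g i j))"
    using assms by (intro mod_hom_finsum[OF N0 N0 act(1)]) (auto intro!: N0.M.finsum_closed G_term_closed)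
  also have "\<dots> = (\<Oplus>\<^bsub>N0\<^esub>i\<in>{0..<length f}. \<Oplus>\<^bsub>N0\<^esub>j\<in>{0..<length g}. act c (G_term f g i j))"
    using assms by (simp add: mod_hom_finsum[OF N0 N0 act(1)] G_term_closed)
  finally have 2: "act c (\<Oplus>\<^bsub>N0\<^esub>i\<in>{0..<length f}. \<Oplus>\<^bsub>N0\<^esub>j\<in>{0..<length g}. G_term f g i j) =
      (\<Oplus>\<^bsub>N0\<^esub>i\<in>{0..<length f}. \<Oplus>\<^bsub>N0\<^esub>j\<in>{0..<length g}. act c (G_term f g i j))" .
  have "act c (G f g) = act c (tn \<one>\<^bsub>K\<^esub> (shf (pw f) (pw g))) \<oplus>\<^bsub>N0\<^esub>
      act c (\<Oplus>\<^bsub>N0\<^esub>i\<in>{0..<length f}. \<Oplus>\<^bsub>N0\<^esub>j\<in>{0..<length g}. G_term f g i j)"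
    unfolding G_def using assms
    by (intro mod_hom_add[OF act(1)]) (auto intro!: N0.M.finsum_closed G_term_closed tn_closed sh_closed pt_closed)
  then show ?thesis unfolding 2 1 using assms by (simp add: act sh_closed pt_closed)
qed

text \<open>As \<open>G\<close> is multilinear in both words, it extends to pairs of tensors; the
  coefficients are then attached by \<open>act\<close>.\<close>

lemma product_exists:
  "\<exists>p. p \<in> mod_bihom C N0 N0 N0 \<and>
    (\<forall>c\<in>carrier K. \<forall>d\<in>carrier K. \<forall>f\<in>words. \<forall>g\<in>words.
      p (tn c (pw f)) (tn d (pw g)) = act (c \<otimes>\<^bsub>K\<^esub> d) (G f g))"
proof -
  obtain Gh where Gh: "Gh \<in> mod_bihom C T T N0" "\<And>u v. \<lbrakk>u \<in> words; v \<in> words\<rbrakk> \<Longrightarrow> Gh (pw u) (pw v) = G u v"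
    by (rule tpowers_bilift[OF M N0 G_multilinear(2) G_multilinear(1)]) simp_all
  note ghc = mod_bihom_closed[OF Gh(1)]
  note al = mod_bihom_left[OF act_bihom] and ar = mod_bihom_right[OF act_bihom]
  obtain p where "p \<in> mod_bihom C N0 N0 N0"
    "\<And>c s d t. \<lbrakk>c \<in> carrier K; s \<in> carrier T; d \<in> carrier K; t \<in> carrier T\<rbrakk>
      \<Longrightarrow> p (tn c s) (tn d t) = act (c \<otimes>\<^bsub>K\<^esub> d) (Gh s t)"
  proof (rule tensor_bilift[OF Km T Km T N0, of "\<lambda>c s d t. act (c \<otimes>\<^bsub>K\<^esub> d) (Gh s t)"])
    fix c s assume cs: "c \<in> carrier K" "s \<in> carrier T"
    show "(\<lambda>d t. act (c \<otimes>\<^bsub>K\<^esub> d) (Gh s t)) \<in> mod_bihom C K T N0"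
      using cs ghc by (intro mod_bihomI mod_hom_comp[OF al mod_hom_multl[OF K cs(1) mod_hom_id]]
          mod_hom_comp[OF ar mod_bihom_right[OF Gh(1)]]) auto
    show "(\<lambda>d t. act (d \<otimes>\<^bsub>K\<^esub> c) (Gh t s)) \<in> mod_bihom C K T N0"
      using cs ghc by (intro mod_bihomI mod_hom_comp[OF al mod_hom_multr[OF K cs(1) mod_hom_id]]
          mod_hom_comp[OF ar mod_bihom_left[OF Gh(1)]]) auto
  qed simp
  then show ?thesis using Gh(2) by (intro exI[of _ p]) (simp add: pt_closed)
qed

text \<open>The summand for the cut (i, j) contains a shuffle of two prefixes. If both are nonempty,
  the shuffle recursion splits it by its first letter. If exactly one is empty, the first letter
  belongs to the other word. The cut (0, 0) leaves the pairing of the two whole words.\<close>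

lemma G_Cons:
  assumes "x \<in> carrier M" "f \<in> words" "y \<in> carrier M" "g \<in> words"
  shows "G (x # f) (y # g) = cns x (G f (y # g)) \<oplus>\<^bsub>N0\<^esub> cns y (G (x # f) g) \<oplus>\<^bsub>N0\<^esub>
    tn (e2 (pw (x # f)) (pw (y # g))) (pw [])"
proof -
  have w: "x # f \<in> words" "y # g \<in> words" using assms by auto
  let ?n = "length f" and ?m = "length g"
  let ?X = "\<lambda>i j. cns x (G_term f (y # g) i j)" and ?Y = "\<lambda>i j. cns y (G_term (x # f) g i j)"
  have dist: "cns z (G a b) = cns z (tn \<one>\<^bsub>K\<^esub> (shf (pw a) (pw b))) \<oplus>\<^bsub>N0\<^esub>
      (\<Oplus>\<^bsub>N0\<^esub>i\<in>{0..<length a}. \<Oplus>\<^bsub>N0\<^esub>j\<in>{0..<length b}. cns z (G_term a b i j))"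
    if "z \<in> carrier M" "a \<in> words" "b \<in> words" for z a b
  proof -
    have "cns z (\<Oplus>\<^bsub>N0\<^esub>i\<in>{0..<length a}. \<Oplus>\<^bsub>N0\<^esub>j\<in>{0..<length b}. G_term a b i j) =
        (\<Oplus>\<^bsub>N0\<^esub>i\<in>{0..<length a}. cns z (\<Oplus>\<^bsub>N0\<^esub>j\<in>{0..<length b}. G_term a b i j))"
      using that by (intro mod_hom_finsum[OF N0 N0 cns(1)]) (auto intro!: N0.M.finsum_closed G_term_closed)
    also have "\<dots> = (\<Oplus>\<^bsub>N0\<^esub>i\<in>{0..<length a}. \<Oplus>\<^bsub>N0\<^esub>j\<in>{0..<length b}. cns z (G_term a b i j))"
      using that by (simp add: mod_hom_finsum[OF N0 N0 cns(1)] G_term_closed)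
    finally show ?thesis unfolding G_def using that
      by (subst mod_hom_add[OF cns(1)])
        (auto intro!: N0.M.finsum_closed G_term_closed tn_closed sh_closed pt_closed)
  qed
  have zc: "tn (e2 (pw (x # f)) (pw (y # g))) (pw []) \<in> carrier N0"
    using w by (simp add: tn_closed e2_closed pt_closed)
  have "(\<Oplus>\<^bsub>N0\<^esub>i\<in>{0..<Suc ?n}. \<Oplus>\<^bsub>N0\<^esub>j\<in>{0..<Suc ?m}. G_term (x # f) (y # g) i j) =
    (\<Oplus>\<^bsub>N0\<^esub>i\<in>{0..<?n}. \<Oplus>\<^bsub>N0\<^esub>j\<in>{0..<Suc ?m}. ?X i j) \<oplus>\<^bsub>N0\<^esub>
    (\<Oplus>\<^bsub>N0\<^esub>i\<in>{0..<Suc ?n}. \<Oplus>\<^bsub>N0\<^esub>j\<in>{0..<?m}. ?Y i j) \<oplus>\<^bsub>N0\<^esub> tn (e2 (pw (x # f)) (pw (y # g))) (pw [])"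
  proof (rule N0.M.double_sum_rec)
    note cl = e2_closed sh_closed pt_td take_words drop_words pt_closed w assms
    show "G_term (x # f) (y # g) 0 0 = tn (e2 (pw (x # f)) (pw (y # g))) (pw [])"
      by (simp add: G_term_def shuffle_Nil[OF M])
    show "G_term (x # f) (y # g) (Suc i) 0 = ?X i 0" for i
      using assms by (simp add: G_term_def shuffle_Nil[OF M] cns_pt cl)
    show "G_term (x # f) (y # g) 0 (Suc j) = ?Y 0 j" for j
      using assms by (simp add: G_term_def shuffle_Nil[OF M] cns_pt cl)
    show "G_term (x # f) (y # g) (Suc i) (Suc j) = ?X i (Suc j) \<oplus>\<^bsub>N0\<^esub> ?Y (Suc i) j" for i j
      using assms
      by (simp add: G_term_def shuffle_Cons[OF M] cns cl mod_hom_add[OF tnr] mod_hom_closed[OF pre_hom])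
  qed (use assms w zc in \<open>simp_all add: cns_closed G_term_closed\<close>)
  moreover have "tn \<one>\<^bsub>K\<^esub> (shf (pw (x # f)) (pw (y # g))) =
      cns x (tn \<one>\<^bsub>K\<^esub> (shf (pw f) (pw (y # g)))) \<oplus>\<^bsub>N0\<^esub> cns y (tn \<one>\<^bsub>K\<^esub> (shf (pw (x # f)) (pw g)))"
    using assms
    by (simp add: shuffle_Cons[OF M] cns sh_closed pt_closed mod_hom_add[OF tnr] mod_hom_closed[OF pre_hom])
  moreover have "(\<Oplus>\<^bsub>N0\<^esub>i\<in>{0..<?n}. \<Oplus>\<^bsub>N0\<^esub>j\<in>{0..<Suc ?m}. ?X i j) \<in> carrier N0"
    "(\<Oplus>\<^bsub>N0\<^esub>i\<in>{0..<Suc ?n}. \<Oplus>\<^bsub>N0\<^esub>j\<in>{0..<?m}. ?Y i j) \<in> carrier N0"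
    using assms w by (auto intro!: N0.M.finsum_closed cns_closed G_term_closed)
  moreover have "cns x (tn \<one>\<^bsub>K\<^esub> (shf (pw f) (pw (y # g)))) \<in> carrier N0" "cns y (tn \<one>\<^bsub>K\<^esub> (shf (pw (x # f)) (pw g))) \<in> carrier N0"
    using assms w by (simp_all add: cns_closed tn_closed sh_closed pt_closed)
  ultimately show ?thesis
    unfolding dist[OF assms(1,2) w(2)] dist[OF assms(3) w(1) assms(4)]
    using zc by (simp add: G_def[of "x # f"] N0.M.a_ac)
qed

text \<open>The recursion \<open>G_Cons\<close> is symmetric in the two words, given that
  \<open>e2\<close> is.\<close>

lemma G_commute:
  "\<lbrakk>f \<in> words; g \<in> words\<rbrakk> \<Longrightarrow> G f g = G g f"
proof (induction f arbitrary: g)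
  case Nil then show ?case by (simp add: G_Nil)
next
  case f: (Cons x f)
  from f.prems(2) show ?case
  proof (induction g)
    case Nil then show ?case using f.prems by (simp add: G_Nil)
  next
    case (Cons y g)
    then show ?case using f.prems f.IH[of "y # g"]
      by (simp add: G_Cons cns_closed G_closed tn_closed e2_closed pt_closed N0.M.a_ac e2_commute[of "pw (x # f)"])
  qed
qed

text \<open>Identifies either side of \<open>e2_assoc\<close> as \<open>E\<close> applied to a
  product of two words.\<close>

lemma E_G:
  assumes "f \<in> words" "g \<in> words" "h \<in> words"
  shows "E h (G f g) = e2 (shf (pw f) (pw g)) (pw h) \<oplus>\<^bsub>K\<^esub>
    (\<Oplus>\<^bsub>K\<^esub>i\<in>{0..<length f}. \<Oplus>\<^bsub>K\<^esub>j\<in>{0..<length g}. e2 (pw (drop i f)) (pw (drop j g)) \<otimes>\<^bsub>K\<^esub>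
      e2 (shf (pw (take i f)) (pw (take j g))) (pw h))"
proof -
  have 1: "E h (G_term f g i j) = e2 (pw (drop i f)) (pw (drop j g)) \<otimes>\<^bsub>K\<^esub> e2 (shf (pw (take i f)) (pw (take j g))) (pw h)" for i j
    unfolding G_term_def using assms by (simp add: E e2_closed sh_closed pt_td)
  have "E h (\<Oplus>\<^bsub>N0\<^esub>i\<in>{0..<length f}. \<Oplus>\<^bsub>N0\<^esub>j\<in>{0..<length g}. G_term f g i j) =
      (\<Oplus>\<^bsub>K\<^esub>i\<in>{0..<length f}. E h (\<Oplus>\<^bsub>N0\<^esub>j\<in>{0..<length g}. G_term f g i j))"
    using assms by (intro mod_hom_finsum[OF N0 Km E(1)]) (auto intro!: N0.M.finsum_closed G_term_closed)
  also have "\<dots> = (\<Oplus>\<^bsub>K\<^esub>i\<in>{0..<length f}. \<Oplus>\<^bsub>K\<^esub>j\<in>{0..<length g}. E h (G_term f g i j))"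
    using assms by (simp add: mod_hom_finsum[OF N0 Km E(1)] G_term_closed)
  finally have 2: "E h (\<Oplus>\<^bsub>N0\<^esub>i\<in>{0..<length f}. \<Oplus>\<^bsub>N0\<^esub>j\<in>{0..<length g}. G_term f g i j) =
      (\<Oplus>\<^bsub>K\<^esub>i\<in>{0..<length f}. \<Oplus>\<^bsub>K\<^esub>j\<in>{0..<length g}. E h (G_term f g i j))" .
  have "E h (G f g) = E h (tn \<one>\<^bsub>K\<^esub> (shf (pw f) (pw g))) \<oplus>\<^bsub>K\<^esub>
      E h (\<Oplus>\<^bsub>N0\<^esub>i\<in>{0..<length f}. \<Oplus>\<^bsub>N0\<^esub>j\<in>{0..<length g}. G_term f g i j)"
    unfolding G_def using assms
    by (intro mod_hom_add[OF E(1)]) (auto intro!: N0.M.finsum_closed G_term_closed tn_closed sh_closed pt_closed)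
  then show ?thesis unfolding 2 1 using assms by (simp add: E sh_closed pt_closed e2_closed)
qed

lemma E_G_commute:
  "\<lbrakk>f \<in> words; g \<in> words; h \<in> words; f \<noteq> []; g \<noteq> []; h \<noteq> []\<rbrakk> \<Longrightarrow> E h (G f g) = E f (G h g)"
  by (simp add: E_G e2_assoc)

end

subsection \<open>The algebra\<close>

text \<open>The product of the algebra is a choice, so it enters only through bilinearity and its
  values on pure tensors.\<close>

locale deformed_shuffle_algebra = deformed_shuffle +
  fixes N
  assumes N_spec: "\<exists>p. N = N0\<lparr>mult := p, one := tn \<one>\<^bsub>K\<^esub> (pw [])\<rparr> \<and> p \<in> mod_bihom C N0 N0 N0 \<and>
    (\<forall>c\<in>carrier K. \<forall>d\<in>carrier K. \<forall>f\<in>words. \<forall>g\<in>words.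
      p (tn c (pw f)) (tn d (pw g)) = act (c \<otimes>\<^bsub>K\<^esub> d) (G f g))"
begin

lemma N_sel: "carrier N = carrier N0" "add N = add N0" "zero N = zero N0" "smult N = smult N0"
    "\<one>\<^bsub>N\<^esub> = tn \<one>\<^bsub>K\<^esub> (pw [])"
  and N_updates: "mod_hom C N P = mod_hom C N0 P" "mod_hom C P' N = mod_hom C P' N0"
    "mod_bihom C P1 P2 N = mod_bihom C P1 P2 N0"
    "mod_bihom C N P3 P4 = mod_bihom C N0 P3 P4" "mod_bihom C P5 N P6 = mod_bihom C P5 N0 P6"
    "module C N" "spans C N X = spans C N0 X"
  and N_bihom0: "mult N \<in> mod_bihom C N0 N0 N0"
  and N_mult: "\<lbrakk>c \<in> carrier K; d \<in> carrier K; f \<in> words; g \<in> words\<rbrakk> \<Longrightarrow>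
      tn c (pw f) \<otimes>\<^bsub>N\<^esub> tn d (pw g) = act (c \<otimes>\<^bsub>K\<^esub> d) (G f g)"
  using N_spec by (auto simp: mult_updates N0)

definition wd where "wd w = tn \<one>\<^bsub>K\<^esub> (pw w)"
definition kap where "kap c = tn c (pw [])"

lemmas ml = mod_bihom_left[OF N_bihom0]
lemmas mr = mod_bihom_right[OF N_bihom0]
lemmas m_cl = mod_bihom_closed[OF N_bihom0]

lemma wd_closed0: "w \<in> words \<Longrightarrow> wd w \<in> carrier N0"
  unfolding wd_def by (simp add: tn_closed pt_closed)

lemma act_wd: "\<lbrakk>c \<in> carrier K; w \<in> words\<rbrakk> \<Longrightarrow> act c (wd w) = tn c (pw w)"
  unfolding wd_def by (simp add: act pt_closed)

lemma wd_mult: "\<lbrakk>f \<in> words; g \<in> words\<rbrakk> \<Longrightarrow> wd f \<otimes>\<^bsub>N\<^esub> wd g = G f g"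
  unfolding wd_def by (simp add: N_mult act_one G_closed)

lemma cns_wd: "\<lbrakk>x \<in> carrier M; w \<in> words\<rbrakk> \<Longrightarrow> cns x (wd w) = wd (x # w)"
  unfolding wd_def by (simp add: cns_pt)

lemma wd_Cons_mult:
  "\<lbrakk>x \<in> carrier M; f \<in> words; y \<in> carrier M; g \<in> words\<rbrakk> \<Longrightarrow>
    wd (x # f) \<otimes>\<^bsub>N\<^esub> wd (y # g) = cns x (wd f \<otimes>\<^bsub>N\<^esub> wd (y # g)) \<oplus>\<^bsub>N0\<^esub> cns y (wd (x # f) \<otimes>\<^bsub>N\<^esub> wd g) \<oplus>\<^bsub>N0\<^esub>
      kap (e2 (pw (x # f)) (pw (y # g)))"
  by (simp add: wd_mult G_Cons kap_def)

lemma N_commute: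
  assumes "u \<in> carrier N0" "v \<in> carrier N0" shows "u \<otimes>\<^bsub>N\<^esub> v = v \<otimes>\<^bsub>N\<^esub> u"
  by (rule mod_bihom_commute[OF N0 N0 spans_N0 N_bihom0 _ assms])
    (auto simp: N_mult G_commute K.m_comm)

lemma act_mult:
  assumes "c \<in> carrier K" "u \<in> carrier N0" "v \<in> carrier N0"
  shows "act c u \<otimes>\<^bsub>N\<^esub> v = act c (u \<otimes>\<^bsub>N\<^esub> v)"
proof (rule mod_bihom_eqI[OF N0 N0 N0 spans_N0 spans_N0 _ _ _ assms(2,3)])
  show "(\<lambda>u v. act c u \<otimes>\<^bsub>N\<^esub> v) \<in> mod_bihom C N0 N0 N0"
    using assms by (intro mod_bihomI mr mod_hom_comp[OF ml act(1)]) (auto simp: act_closed)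
  show "(\<lambda>u v. act c (u \<otimes>\<^bsub>N\<^esub> v)) \<in> mod_bihom C N0 N0 N0"
    using assms(1) by (intro mod_bihomI mod_hom_comp[OF act(1) ml] mod_hom_comp[OF act(1) mr])
qed (use assms in \<open>auto simp: act N_mult act_act G_closed pt_closed K.m_assoc\<close>)

text \<open>The recursion for the product of two words, extended linearly in the first factor. In a
  triple product the first factor is itself a product and not a word.\<close>

lemma cns_mult:
  assumes "x \<in> carrier M" "z \<in> carrier M" "h \<in> words" "u \<in> carrier N0"
  shows "cns x u \<otimes>\<^bsub>N\<^esub> wd (z # h) = cns x (u \<otimes>\<^bsub>N\<^esub> wd (z # h)) \<oplus>\<^bsub>N0\<^esub> cns z (cns x u \<otimes>\<^bsub>N\<^esub> wd h) \<oplus>\<^bsub>N0\<^esub>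
    kap (E (z # h) (cns x u))"
proof (rule N0_eqI[OF N0 _ _ _ assms(4)])
  have zh: "z # h \<in> words" using assms by simp
  note w = wd_closed0[OF zh] wd_closed0[OF assms(3)]
  show "(\<lambda>u. cns x u \<otimes>\<^bsub>N\<^esub> wd (z # h)) \<in> mod_hom C N0 N0"
    by (rule mod_hom_comp[OF ml[OF w(1)] cns(1)[OF assms(1)]])
  have "(\<lambda>u. kap (E (z # h) (cns x u))) \<in> mod_hom C N0 N0"
    unfolding kap_def
    by (rule mod_hom_comp[OF tnl mod_hom_comp[OF E(1)[OF zh] cns(1)[OF assms(1)]]]) (simp add: pt_closed)
  then show "(\<lambda>u. cns x (u \<otimes>\<^bsub>N\<^esub> wd (z # h)) \<oplus>\<^bsub>N0\<^esub> cns z (cns x u \<otimes>\<^bsub>N\<^esub> wd h) \<oplus>\<^bsub>N0\<^esub> kap (E (z # h) (cns x u)))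
      \<in> mod_hom C N0 N0"
    by (intro mod_hom_addf[OF N0] mod_hom_comp[OF cns(1)[OF assms(1)] ml[OF w(1)]]
        mod_hom_comp[OF cns(1)[OF assms(2)] mod_hom_comp[OF ml[OF w(2)] cns(1)[OF assms(1)]]])
  fix c f assume cf: "c \<in> carrier K" "f \<in> words"
  have xf: "x # f \<in> words" using cf assms by simp
  have c1: "cns x (tn c (pw f)) = act c (wd (x # f))" using assms cf by (simp add: cns_pt act_wd)
  have e: "E (z # h) (wd (x # f)) = e2 (pw (x # f)) (pw (z # h))"
    unfolding wd_def using E(2)[OF zh] xf zh by (simp add: pt_closed e2_closed)
  have k: "kap (c \<otimes>\<^bsub>K\<^esub> e2 (pw (x # f)) (pw (z # h))) = act c (kap (e2 (pw (x # f)) (pw (z # h))))"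
    unfolding kap_def using cf xf zh by (simp add: act e2_closed pt_closed)
  have kc: "kap (e2 (pw (x # f)) (pw (z # h))) \<in> carrier N0"
    unfolding kap_def using xf zh by (simp add: tn_closed e2_closed pt_closed)
  have c2: "tn c (pw f) = act c (wd f)" using cf by (simp add: act_wd)
  note cl = wd_closed0[OF cf(2)] wd_closed0[OF xf] w
  have "cns x (tn c (pw f)) \<otimes>\<^bsub>N\<^esub> wd (z # h) = act c (wd (x # f) \<otimes>\<^bsub>N\<^esub> wd (z # h))"
    unfolding c1 by (rule act_mult[OF cf(1) cl(2,3)])
  also have "\<dots> = act c (cns x (wd f \<otimes>\<^bsub>N\<^esub> wd (z # h))) \<oplus>\<^bsub>N0\<^esub> act c (cns z (wd (x # f) \<otimes>\<^bsub>N\<^esub> wd h)) \<oplus>\<^bsub>N0\<^esub>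
      act c (kap (e2 (pw (x # f)) (pw (z # h))))"
    using assms cf cl kc by (simp add: wd_Cons_mult mod_hom_add[OF act(1)] cns_closed m_cl)
  also have "act c (cns x (wd f \<otimes>\<^bsub>N\<^esub> wd (z # h))) = cns x (tn c (pw f) \<otimes>\<^bsub>N\<^esub> wd (z # h))"
    unfolding c2 using assms cf cl by (simp add: act_mult act_cns m_cl)
  also have "act c (cns z (wd (x # f) \<otimes>\<^bsub>N\<^esub> wd h)) = cns z (cns x (tn c (pw f)) \<otimes>\<^bsub>N\<^esub> wd h)"
    unfolding c1 using assms cf cl by (simp add: act_mult act_cns m_cl)
  also have "act c (kap (e2 (pw (x # f)) (pw (z # h)))) = kap (E (z # h) (cns x (tn c (pw f))))"
    unfolding c1 using cf zh cl by (simp add: E_act e k)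
  finally show "cns x (tn c (pw f)) \<otimes>\<^bsub>N\<^esub> wd (z # h) = cns x (tn c (pw f) \<otimes>\<^bsub>N\<^esub> wd (z # h)) \<oplus>\<^bsub>N0\<^esub>
      cns z (cns x (tn c (pw f)) \<otimes>\<^bsub>N\<^esub> wd h) \<oplus>\<^bsub>N0\<^esub> kap (E (z # h) (cns x (tn c (pw f))))" .
qed

lemma wd_Nil_mult: "u \<in> carrier N0 \<Longrightarrow> wd [] \<otimes>\<^bsub>N\<^esub> u = u"
  by (rule N0_eqI[OF N0 mr mod_hom_id]) (simp_all add: wd_def N_mult act_G G_Nil act tn_closed pt_closed)

lemma kap_closed: "c \<in> carrier K \<Longrightarrow> kap c \<in> carrier N0"
  unfolding kap_def by (simp add: tn_closed pt_closed)

text \<open>Apart from triple products of shorter words, the expansion is symmetric in the first and the last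
  factor by \<open>e2_assoc\<close>.\<close>

lemma triple_expand:
  assumes "x \<in> carrier M" "f \<in> words" "y \<in> carrier M" "g \<in> words" "z \<in> carrier M" "h \<in> words"
  shows "(wd (x # f) \<otimes>\<^bsub>N\<^esub> wd (y # g)) \<otimes>\<^bsub>N\<^esub> wd (z # h) =
    cns x ((wd f \<otimes>\<^bsub>N\<^esub> wd (y # g)) \<otimes>\<^bsub>N\<^esub> wd (z # h)) \<oplus>\<^bsub>N0\<^esub>
    cns y ((wd (x # f) \<otimes>\<^bsub>N\<^esub> wd g) \<otimes>\<^bsub>N\<^esub> wd (z # h)) \<oplus>\<^bsub>N0\<^esub>
    cns z ((wd (x # f) \<otimes>\<^bsub>N\<^esub> wd (y # g)) \<otimes>\<^bsub>N\<^esub> wd h) \<oplus>\<^bsub>N0\<^esub>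
    kap (E (z # h) (wd (x # f) \<otimes>\<^bsub>N\<^esub> wd (y # g)))"
proof -
  have w: "x # f \<in> words" "y # g \<in> words" "z # h \<in> words" using assms by auto
  note cl = wd_closed0[OF w(1)] wd_closed0[OF w(2)] wd_closed0[OF w(3)] wd_closed0[OF assms(2)]
    wd_closed0[OF assms(4)] wd_closed0[OF assms(6)]
  define u where "u = wd f \<otimes>\<^bsub>N\<^esub> wd (y # g)"
  define v where "v = wd (x # f) \<otimes>\<^bsub>N\<^esub> wd g"
  define e where "e = e2 (pw (x # f)) (pw (y # g))"
  have uv: "u \<in> carrier N0" "v \<in> carrier N0" unfolding u_def v_def using cl by (simp_all add: m_cl)
  have cuv: "cns x u \<in> carrier N0" "cns y v \<in> carrier N0" using uv assms by (simp_all add: cns_closed)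
  have ec: "e \<in> carrier K" unfolding e_def using w by (simp add: e2_closed pt_closed)
  have ke: "kap e = act e (wd [])" using ec by (simp add: kap_def act_wd)
  have kec: "kap e \<in> carrier N0" by (rule kap_closed[OF ec])
  have kw: "kap e \<otimes>\<^bsub>N\<^esub> wd w = act e (wd w)" if "w \<in> words" for w
    unfolding ke using ec that by (simp add: act_mult wd_closed0 wd_Nil_mult)
  have xy: "wd (x # f) \<otimes>\<^bsub>N\<^esub> wd (y # g) = cns x u \<oplus>\<^bsub>N0\<^esub> cns y v \<oplus>\<^bsub>N0\<^esub> kap e"
    unfolding u_def v_def e_def by (rule wd_Cons_mult[OF assms(1-4)])
  have add: "(cns x u \<oplus>\<^bsub>N0\<^esub> cns y v \<oplus>\<^bsub>N0\<^esub> kap e) \<otimes>\<^bsub>N\<^esub> wd w =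
      cns x u \<otimes>\<^bsub>N\<^esub> wd w \<oplus>\<^bsub>N0\<^esub> cns y v \<otimes>\<^bsub>N\<^esub> wd w \<oplus>\<^bsub>N0\<^esub> act e (wd w)" if "w \<in> words" for w
    using that cuv kec by (simp add: mod_hom_add[OF ml] wd_closed0 kw)
  \<comment> \<open>A constant is carried by the empty word, which pairs to zero with every
    word.\<close>
  have Ee: "E (z # h) (kap e) = \<zero>\<^bsub>K\<^esub>"
    unfolding kap_def using ec w by (simp add: E pt_closed e2_Nil)
  have kadd: "kap (a \<oplus>\<^bsub>K\<^esub> b) = kap a \<oplus>\<^bsub>N0\<^esub> kap b" if "a \<in> carrier K" "b \<in> carrier K" for a b
    unfolding kap_def using that by (simp add: mod_hom_add[OF tnl] pt_closed)
  have Exy: "kap (E (z # h) (cns x u \<oplus>\<^bsub>N0\<^esub> cns y v \<oplus>\<^bsub>N0\<^esub> kap e)) =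
      kap (E (z # h) (cns x u)) \<oplus>\<^bsub>N0\<^esub> kap (E (z # h) (cns y v))"
    using cuv kec w(3) by (simp add: mod_hom_add[OF E(1)] Ee kadd E_closed)
  \<comment> \<open>The constant \<open>e\<close> of the inner product also multiplies
    \<open>wd h\<close> here. The resulting \<open>act e (wd (z # h))\<close> is the term that
    \<open>kap e\<close> times \<open>wd (z # h)\<close> contributes, so the third summand of the
    claim absorbs it.\<close>
  have zz: "cns z (cns x u \<otimes>\<^bsub>N\<^esub> wd h \<oplus>\<^bsub>N0\<^esub> cns y v \<otimes>\<^bsub>N\<^esub> wd h \<oplus>\<^bsub>N0\<^esub> act e (wd h)) =
      cns z (cns x u \<otimes>\<^bsub>N\<^esub> wd h) \<oplus>\<^bsub>N0\<^esub> cns z (cns y v \<otimes>\<^bsub>N\<^esub> wd h) \<oplus>\<^bsub>N0\<^esub> act e (wd (z # h))"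
    using cuv ec cl assms by (simp add: mod_hom_add[OF cns(1)] m_cl act_closed act_cns cns_wd)
  note cm = cns_mult[OF assms(1,5,6) uv(1)] cns_mult[OF assms(3,5,6) uv(2)]
  have "cns x (u \<otimes>\<^bsub>N\<^esub> wd (z # h)) \<in> carrier N0" "cns y (v \<otimes>\<^bsub>N\<^esub> wd (z # h)) \<in> carrier N0"
    "cns z (cns x u \<otimes>\<^bsub>N\<^esub> wd h) \<in> carrier N0" "cns z (cns y v \<otimes>\<^bsub>N\<^esub> wd h) \<in> carrier N0"
    "kap (E (z # h) (cns x u)) \<in> carrier N0" "kap (E (z # h) (cns y v)) \<in> carrier N0" "act e (wd (z # h)) \<in> carrier N0"
    using uv cuv ec cl w assms by (simp_all add: cns_closed m_cl kap_closed E_closed act_closed)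
  then show ?thesis
    unfolding u_def[symmetric] v_def[symmetric] xy add[OF w(3)] add[OF assms(6)] Exy zz cm
    by (simp add: N0.M.a_ac)
qed

text \<open>Given commutativity, this is associativity. The form is chosen for its symmetry:
  exchanging \<open>f\<close> and \<open>h\<close> in \<open>triple_expand\<close> exchanges the
  first and the third summand and keeps the second, and each of the three contains a triple product
  of smaller total length.\<close>

lemma wd_triple_swap:
  "\<lbrakk>f \<in> words; g \<in> words; h \<in> words\<rbrakk> \<Longrightarrow>
    (wd f \<otimes>\<^bsub>N\<^esub> wd g) \<otimes>\<^bsub>N\<^esub> wd h = (wd h \<otimes>\<^bsub>N\<^esub> wd g) \<otimes>\<^bsub>N\<^esub> wd f"
proof (induction "length f + length g + length h" arbitrary: f g h rule: less_induct)
  case less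
  note c = wd_closed0
  show ?case
  proof (cases "f = [] \<or> g = [] \<or> h = []")
    case True
    then show ?thesis
    proof (elim disjE)
      assume "f = []" then show ?thesis using less.prems
        by (metis N_commute c m_cl wd_Nil_mult)
    next
      assume "g = []" then show ?thesis using less.prems
        by (metis N_commute c m_cl wd_Nil_mult)
    next
      assume "h = []" then show ?thesis using less.prems
        by (metis N_commute c m_cl wd_Nil_mult)
    qed
  next
    case False
    then obtain x f' y g' z h' where fgh: "f = x # f'" "g = y # g'" "h = z # h'" by (meson neq_Nil_conv)
    have m: "x \<in> carrier M" "f' \<in> words" "y \<in> carrier M" "g' \<in> words" "z \<in> carrier M" "h' \<in> words"
      using less.prems fgh by auto
    have w: "f \<in> words" "g \<in> words" "h \<in> words" by fact+
    have ih: "(wd f' \<otimes>\<^bsub>N\<^esub> wd g) \<otimes>\<^bsub>N\<^esub> wd h = (wd h \<otimes>\<^bsub>N\<^esub> wd g) \<otimes>\<^bsub>N\<^esub> wd f'"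
      "(wd f \<otimes>\<^bsub>N\<^esub> wd g') \<otimes>\<^bsub>N\<^esub> wd h = (wd h \<otimes>\<^bsub>N\<^esub> wd g') \<otimes>\<^bsub>N\<^esub> wd f"
      "(wd f \<otimes>\<^bsub>N\<^esub> wd g) \<otimes>\<^bsub>N\<^esub> wd h' = (wd h' \<otimes>\<^bsub>N\<^esub> wd g) \<otimes>\<^bsub>N\<^esub> wd f"
      using less.hyps[of f' g h] less.hyps[of f g' h] less.hyps[of f g h'] m w fgh by simp_all
    have e: "E h (wd f \<otimes>\<^bsub>N\<^esub> wd g) = E f (wd h \<otimes>\<^bsub>N\<^esub> wd g)"
      using E_G_commute w fgh by (simp add: wd_mult)
    have cl: "wd f \<in> carrier N0" "wd g \<in> carrier N0" "wd h \<in> carrier N0" "wd f' \<in> carrier N0"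
      "wd g' \<in> carrier N0" "wd h' \<in> carrier N0"
      using w m by (simp_all add: c)
    have "cns x ((wd h \<otimes>\<^bsub>N\<^esub> wd g) \<otimes>\<^bsub>N\<^esub> wd f') \<in> carrier N0" "cns y ((wd h \<otimes>\<^bsub>N\<^esub> wd g') \<otimes>\<^bsub>N\<^esub> wd f) \<in> carrier N0"
      "cns z ((wd h' \<otimes>\<^bsub>N\<^esub> wd g) \<otimes>\<^bsub>N\<^esub> wd f) \<in> carrier N0" "kap (E f (wd h \<otimes>\<^bsub>N\<^esub> wd g)) \<in> carrier N0"
      using cl m w by (simp_all add: cns_closed m_cl kap_closed E_closed)
    then show ?thesis
      using triple_expand[OF m, folded fgh] triple_expand[OF m(5,6,3,4,1,2), folded fgh]
      by (simp add: ih e N0.M.a_ac)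
  qed
qed

theorem algebra_N: "algebra C N"
proof (rule algebra_of_bihom[OF N_updates(6)])
  show "spans C N ((\<lambda>(c, w). tn c (pw w)) ` (carrier K \<times> words))" using spans_N0 by (simp add: N_updates)
  show "mult N \<in> mod_bihom C N N N" using N_bihom0 by (simp add: N_updates)
  show "\<one>\<^bsub>N\<^esub> \<in> carrier N" by (simp add: N_sel tn_closed pt_closed)
next
  fix u v t assume uvt: "u \<in> (\<lambda>(c, w). tn c (pw w)) ` (carrier K \<times> words)" "v \<in> (\<lambda>(c, w). tn c (pw w)) ` (carrier K \<times> words)"
    "t \<in> (\<lambda>(c, w). tn c (pw w)) ` (carrier K \<times> words)"
  then obtain c f d g e h where
    u: "c \<in> carrier K" "f \<in> words" "u = act c (wd f)" and v: "d \<in> carrier K" "g \<in> words" "v = act d (wd g)"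
    and t: "e \<in> carrier K" "h \<in> words" "t = act e (wd h)"
    by (auto simp: act_wd[symmetric])
  note cl = wd_closed0[OF u(2)] wd_closed0[OF v(2)] wd_closed0[OF t(2)]
  have cl': "u \<in> carrier N0" "v \<in> carrier N0" "t \<in> carrier N0" unfolding u(3) v(3) t(3) using cl u v t by (simp_all add: act_closed)
  have mulr: "a \<otimes>\<^bsub>N\<^esub> act c b = act c (a \<otimes>\<^bsub>N\<^esub> b)" if "c \<in> carrier K" "a \<in> carrier N0" "b \<in> carrier N0" for a b c
    using that by (metis N_commute act_closed act_mult)
  \<comment> \<open>Commutativity turns the symmetric form back into associativity.\<close>
  have swap: "(wd f \<otimes>\<^bsub>N\<^esub> wd g) \<otimes>\<^bsub>N\<^esub> wd h = wd f \<otimes>\<^bsub>N\<^esub> (wd g \<otimes>\<^bsub>N\<^esub> wd h)"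
    using wd_triple_swap[OF u(2) v(2) t(2)] N_commute cl m_cl by metis
  show "(u \<otimes>\<^bsub>N\<^esub> v) \<otimes>\<^bsub>N\<^esub> t = u \<otimes>\<^bsub>N\<^esub> (v \<otimes>\<^bsub>N\<^esub> t)"
    unfolding u(3) v(3) t(3) using u v t cl
    by (simp add: act_mult mulr act_closed m_cl swap)
  show "u \<otimes>\<^bsub>N\<^esub> v = v \<otimes>\<^bsub>N\<^esub> u" by (rule N_commute[OF cl'(1,2)])
  show "\<one>\<^bsub>N\<^esub> \<otimes>\<^bsub>N\<^esub> u = u" using wd_Nil_mult[OF cl'(1)] by (simp add: N_sel wd_def)
qed

end

section \<open>Quasi-integro-differential rings as modules over their constants\<close>

lemma self_alg_sel [simp]:
  "carrier (self_alg R) = carrier R" "mult (self_alg R) = mult R" "one (self_alg R) = one R"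
  "zero (self_alg R) = zero R" "add (self_alg R) = add R" "smult (self_alg R) = mult R"
  by (simp_all add: self_alg_def)

lemma const_ring_sel [simp]:
  "carrier (const_ring R der) = constants R der" "mult (const_ring R der) = mult R" "one (const_ring R der) = one R"
  "zero (const_ring R der) = zero R" "add (const_ring R der) = add R"
  by (simp_all add: const_ring_def)

lemma RT_sel [simp]:
  "carrier (RT R Q) = {x \<in> carrier R. Q x = \<zero>\<^bsub>R\<^esub>}" "zero (RT R Q) = zero R" "add (RT R Q) = add R"
  "smult (RT R Q) = mult R"
  by (simp_all add: RT_def)

lemma RJ_sel [simp]:
  "carrier (RJ R Q) = Q ` carrier R" "zero (RJ R Q) = zero R" "add (RJ R Q) = add R" "smult (RJ R Q) = mult R"
  by (simp_all add: RJ_def)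

text \<open>Rings and modules are records of different types; the axioms pass between them when the
  common fields agree.\<close>

lemma abelian_group_cong:
  assumes "abelian_group G" "carrier H = carrier G" "add H = add G" "zero H = zero G"
  shows "abelian_group H"
proof -
  interpret abelian_group G by fact
  show ?thesis
    by (rule abelian_groupI) (auto simp: assms(2-4) a_ac intro!: bexI[of _ "\<ominus>\<^bsub>G\<^esub> x" for x] l_neg)
qed

lemma ring_cong:
  assumes "ring G" "carrier H = carrier G" "add H = add G" "zero H = zero G" "mult H = mult G" "one H = one G"
  shows "ring H"
proof -
  interpret ring G by fact
  show ?thesis
    by (rule ringI[OF abelian_group_cong[OF abelian_group_axioms assms(2-4)]])
      (auto simp: assms m_assoc l_distr r_distr intro!: monoidI)
qed

lemma cring_cong:
  assumes "cring G" "carrier H = carrier G" "add H = add G" "zero H = zero G" "mult H = mult G" "one H = one G"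
  shows "cring H"
proof -
  interpret cring G by fact
  interpret H: ring H by (rule ring_cong[OF ring_axioms assms(2-6)])
  show ?thesis
    by (intro cring.intro H.ring_axioms comm_monoid.intro H.monoid_axioms comm_monoid_axioms.intro)
      (simp add: assms m_comm)
qed

lemma (in abelian_group) minus_self: "x \<in> carrier G \<Longrightarrow> x \<ominus> x = \<zero>"
  by (simp add: minus_eq r_neg)

locale qidr = comm_quasi_integro_differential_ring R der Q
  for R :: "'a ring" (structure) and der Q
begin

abbreviation "C \<equiv> const_ring R der"
abbreviation "RR \<equiv> self_alg R"

lemma der_zero: "der \<zero> = \<zero>"
proof -
  have "der \<zero> = der \<zero> \<oplus> der \<zero>" using der_add[of \<zero> \<zero>] by simp
  then show ?thesis using der_closed[of \<zero>] by (metis add.r_cancel_one' zero_closed)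
qed

lemma der_one: "der \<one> = \<zero>"
proof -
  have "der \<one> = der \<one> \<oplus> der \<one>" using der_mult[of \<one> \<one>] der_closed[of \<one>] by simp
  then show ?thesis using der_closed[of \<one>] by (metis add.r_cancel_one' one_closed)
qed

lemma der_uminus: "x \<in> carrier R \<Longrightarrow> der (\<ominus> x) = \<ominus> der x"
  using der_add[of x "\<ominus> x"] der_closed[of x] der_closed[of "\<ominus> x"]
  by (simp add: der_zero r_neg) (metis minus_equality a_comm minus_minus)

lemma constants_iff: "c \<in> constants R der \<longleftrightarrow> c \<in> carrier R \<and> der c = \<zero>"
  by (simp add: constants_def)

lemma cring_C: "cring C"
proof (rule cringI)
  show "abelian_group C"
    by (rule abelian_groupI)
      (auto simp: constants_iff der_zero der_uminus der_add a_ac r_neg intro!: bexI[of _ "\<ominus> x" for x])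
  show "Group.comm_monoid C"
    by (rule comm_monoidI) (auto simp: constants_iff der_one der_mult m_ac)
qed (auto simp: constants_iff l_distr)

lemma algebra_RR: "algebra C RR"
proof (rule algebraI[OF cring_C])
  show "cring RR" by (rule cring_cong[OF is_cring]) simp_all
qed (auto simp: constants_iff m_ac l_distr r_distr)

lemma module_RR: "module C RR" by (rule algebra_is_module[OF algebra_RR])

lemma uminus_RR: "x \<in> carrier R \<Longrightarrow> \<ominus>\<^bsub>RR\<^esub> x = \<ominus> x"
proof -
  interpret RR: module C RR by (rule module_RR)
  assume "x \<in> carrier R"
  then show ?thesis by (intro RR.M.minus_equality) (auto simp: l_neg)
qed

lemma der_hom: "der \<in> mod_hom C RR RR"
  by (rule mod_homI) (auto simp: constants_iff der_closed der_add der_mult)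

lemma Q_hom_RR: "Q \<in> mod_hom C RR RR"
  by (rule mod_homI) (auto simp: Q_closed Q_add Q_const)

lemma Q_zero: "Q \<zero> = \<zero>"
  using mod_hom_zero[OF module_RR module_RR Q_hom_RR] by simp

lemma Q_minus: "\<lbrakk>x \<in> carrier R; y \<in> carrier R\<rbrakk> \<Longrightarrow> Q (x \<ominus> y) = Q x \<ominus> Q y"
  using mod_hom_minus[OF module_RR module_RR Q_hom_RR, of x y]
  by (simp add: a_minus_def uminus_RR Q_closed)

lemma der_minus: "\<lbrakk>x \<in> carrier R; y \<in> carrier R\<rbrakk> \<Longrightarrow> der (x \<ominus> y) = der x \<ominus> der y"
  by (simp add: a_minus_def der_add der_uminus)

lemma submodule_RT: "submodule (carrier (RT R Q)) C RR"
proof -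
  interpret RR: module C RR by (rule module_RR)
  have "Q (\<ominus> x) = \<zero>" if "x \<in> carrier R" "Q x = \<zero>" for x
    using Q_minus[of \<zero> x] that by (simp add: Q_zero a_minus_def)
  then show ?thesis
    by (intro RR.submoduleI) (auto simp: Q_zero Q_add Q_const constants_iff uminus_RR)
qed

lemma submodule_RJ: "submodule (carrier (RJ R Q)) C RR"
proof -
  interpret RR: module C RR by (rule module_RR)
  have "\<ominus> Q x = Q (\<ominus> x)" if "x \<in> carrier R" for x
    using Q_minus[of \<zero> x] that by (simp add: Q_zero a_minus_def Q_closed)
  moreover have "Q x \<oplus> Q y = Q (x \<oplus> y)" if "x \<in> carrier R" "y \<in> carrier R" for x y
    using that by (simp add: Q_add)
  moreover have "c \<otimes> Q x = Q (c \<otimes> x)" if "x \<in> carrier R" "c \<in> constants R der" for x c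
    using that by (simp add: Q_const)
  moreover have "\<zero> \<in> Q ` carrier R" using Q_zero by (metis imageI zero_closed)
  ultimately show ?thesis
    by (intro RR.submoduleI) (auto simp: constants_iff Q_closed uminus_RR)
qed

lemma module_RT: "module C (RT R Q)"
  using submodule.submodule_is_module[OF submodule_RT module_RR] by (simp add: RT_def)

lemma module_RJ: "module C (RJ R Q)"
  using submodule.submodule_is_module[OF submodule_RJ module_RR] by (simp add: RJ_def)

lemma Q_hom: "Q \<in> mod_hom C RR (RJ R Q)"
  by (rule mod_homI) (auto simp: Q_add Q_const)

lemma RT_incl: "(\<lambda>x. x) \<in> mod_hom C (RT R Q) RR"
  by (rule mod_homI) auto

text \<open>The projection onto \<open>RT\<close> along the derivatives.\<close>

definition rem where "rem f = f \<ominus> der (Q f)"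

lemma rem_RT: "f \<in> carrier R \<Longrightarrow> rem f \<in> carrier (RT R Q)"
  by (simp add: rem_def Q_closed der_closed Q_minus Q_der_Q minus_self)

lemma rem_closed: "f \<in> carrier R \<Longrightarrow> rem f \<in> carrier R" and Q_rem: "f \<in> carrier R \<Longrightarrow> Q (rem f) = \<zero>"
  using rem_RT by simp_all

lemma rem_hom: "rem \<in> mod_hom C RR (RT R Q)"
proof -
  interpret RR: module C RR by (rule module_RR)
  have "rem \<in> mod_hom C RR RR"
    by (rule mod_hom_cong[OF module_RR mod_hom_minusf[OF module_RR mod_hom_id mod_hom_comp[OF der_hom Q_hom_RR]]])
      (simp add: rem_def a_minus_def uminus_RR der_closed Q_closed)
  then show ?thesis using rem_RT by (auto simp: mod_hom_def)
qed

lemma rem_der: "f \<in> carrier R \<Longrightarrow> rem (der f) = \<zero>"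
  by (simp add: rem_def der_Q_der der_closed minus_self)

lemma rem_RT_eq: "f \<in> carrier (RT R Q) \<Longrightarrow> rem f = f"
  by (simp add: rem_def der_zero a_minus_def)

lemma rem_sum: "f \<in> carrier R \<Longrightarrow> der (Q f) \<oplus> rem f = f"
  by (simp add: rem_def a_minus_def der_closed Q_closed a_lcomm r_neg)

text \<open>This is the component of \<open>f\<close> in the constants when R is decomposed into
  constants and \<open>RJ\<close>.\<close>

lemma minus_Q_der_const: "f \<in> carrier R \<Longrightarrow> f \<ominus> Q (der f) \<in> constants R der"
  by (simp add: constants_iff der_minus der_closed Q_closed der_Q_der minus_self)

end

section \<open>The nested tensor algebra\<close>

locale closure0 = qidr R der Q + deformed_shuffle_algebra "const_ring R der" "RT R Q" K e2 N
  for R :: "'a ring" (structure) and der Q and K :: "('a, 'k) module" and e2 N +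
  fixes A :: "('a, 'x) module" and e :: "'a \<Rightarrow> ('a list \<Rightarrow> 'a) set \<Rightarrow> 'x"
  assumes A: "algebra C A" and e: "e \<in> mod_bihom C (RJ R Q) T A"
begin

abbreviation "B \<equiv> tensor_alg C A N"
abbreviation "S \<equiv> tensor_alg C RR B"

lemma B: "algebra C B" by (rule algebra_tensor_alg[OF A algebra_N])
lemma S: "algebra C S" by (rule algebra_tensor_alg[OF algebra_RR B])
lemma Sm: "module C S" by (rule algebra_is_module[OF S])
lemma Nm: "module C N" by (rule algebra_is_module[OF algebra_N])

sublocale A: algebra C A by (rule A)
sublocale N: algebra C N by (rule algebra_N)
sublocale B: algebra C B by (rule B)
sublocale S: algebra C S by (rule S)

definition ct where "ct f0 c1 c2 t = tens C RR B f0 (tens C A N c1 (tn c2 t))"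

text \<open>From here to \<open>nw\<close>, the single tensor factors are embedded into
  \<open>S\<close>. Pure tensors then become products (\<open>gen\<close>), and computations in
  \<open>S\<close> become commutative ring arithmetic.\<close>

definition io where "io r = tens C RR B r \<one>\<^bsub>B\<^esub>"
definition jb where "jb b = tens C RR B \<one> b"
definition al where "al a = jb (tens C A N a \<one>\<^bsub>N\<^esub>)"
definition nu where "nu n = jb (tens C A N \<one>\<^bsub>A\<^esub> n)"
definition nk where "nk c = nu (kap c)"
definition nw where "nw w = nu (wd w)"
definition gen where "gen r a c w = io r \<otimes>\<^bsub>S\<^esub> (al a \<otimes>\<^bsub>S\<^esub> (nk c \<otimes>\<^bsub>S\<^esub> nw w))"

lemma io: "io \<in> alg_hom C RR S"
  using tensor_alg_inl[OF algebra_RR B] by (simp add: io_def[abs_def])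

lemma jb: "jb \<in> alg_hom C B S"
  using tensor_alg_inr[OF algebra_RR B] by (simp add: jb_def[abs_def])

lemma al: "al \<in> alg_hom C A S"
  using alg_hom_comp[OF tensor_alg_inl[OF A algebra_N] jb] by (simp add: al_def[abs_def])

lemma nu: "nu \<in> alg_hom C N S"
  using alg_hom_comp[OF tensor_alg_inr[OF A algebra_N] jb] by (simp add: nu_def[abs_def])

lemma kap: "kap \<in> alg_hom C K N"
proof (rule alg_hom_of_mod_hom[OF K algebra_N spans_carrier[OF Km]])
  show "kap \<in> mod_hom C K N"
    unfolding kap_def[abs_def] N_updates by (rule tnl) (simp add: pt_closed)
  show "kap (c \<otimes>\<^bsub>K\<^esub> d) = kap c \<otimes>\<^bsub>N\<^esub> kap d" if "c \<in> carrier K" "d \<in> carrier K" for c d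
    using that by (simp add: kap_def N_mult G_Nil act pt_closed)
qed (simp add: kap_def N_sel)

lemma nk: "nk \<in> alg_hom C K S"
  using alg_hom_comp[OF kap nu] by (simp add: nk_def[abs_def])

lemma io_closed [simp]: "r \<in> carrier R \<Longrightarrow> io r \<in> carrier S" using alg_homD(3)[OF io, of r] by simp
lemma jb_closed [simp]: "b \<in> carrier B \<Longrightarrow> jb b \<in> carrier S" using alg_homD(3)[OF jb, of b] by simp
lemma al_closed [simp]: "a \<in> carrier A \<Longrightarrow> al a \<in> carrier S" using alg_homD(3)[OF al, of a] by simp
lemma nu_closed [simp]: "n \<in> carrier N \<Longrightarrow> nu n \<in> carrier S" using alg_homD(3)[OF nu, of n] by simp
lemma nk_closed [simp]: "c \<in> carrier K \<Longrightarrow> nk c \<in> carrier S" using alg_homD(3)[OF nk, of c] by simp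
lemma wd_closed: "w \<in> words \<Longrightarrow> wd w \<in> carrier N" by (simp add: wd_closed0 N_sel)
lemma nw_closed [simp]: "w \<in> words \<Longrightarrow> nw w \<in> carrier S" unfolding nw_def by (simp add: wd_closed)
lemma gen_closed [simp]:
  "\<lbrakk>r \<in> carrier R; a \<in> carrier A; c \<in> carrier K; w \<in> words\<rbrakk> \<Longrightarrow> gen r a c w \<in> carrier S"
  by (simp add: gen_def)

lemma nw_Nil [simp]: "nw [] = \<one>\<^bsub>S\<^esub>"
  unfolding nw_def wd_def using alg_homD(7)[OF nu] by (simp add: N_sel)

lemma tn_eq: "\<lbrakk>c \<in> carrier K; w \<in> words\<rbrakk> \<Longrightarrow> tn c (pw w) = kap c \<otimes>\<^bsub>N\<^esub> wd w"
  unfolding kap_def wd_def by (simp add: N_mult G_Nil act pt_closed)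

text \<open>Once the algebra structure is there, acting by a constant is multiplying by its
  image.\<close>

lemma act_eq: "\<lbrakk>c \<in> carrier K; u \<in> carrier N\<rbrakk> \<Longrightarrow> act c u = kap c \<otimes>\<^bsub>N\<^esub> u"
  using act_mult[of c "wd []" u] act_wd[of c "[]"] wd_Nil_mult[of u] wd_closed0[of "[]"]
  by (simp add: kap_def N_sel)

lemma jb_tens: "\<lbrakk>a \<in> carrier A; n \<in> carrier N\<rbrakk> \<Longrightarrow> jb (tens C A N a n) = al a \<otimes>\<^bsub>S\<^esub> nu n"
  unfolding al_def nu_def using alg_homD(4)[OF jb]
  by (simp add: tens_alg_closed[OF A algebra_N] tensor_alg_mult[OF A algebra_N] flip: alg_homD(4)[OF jb])

lemma tens_S: "\<lbrakk>r \<in> carrier R; b \<in> carrier B\<rbrakk> \<Longrightarrow> tens C RR B r b = io r \<otimes>\<^bsub>S\<^esub> jb b"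
  unfolding io_def jb_def using tens_eq_mult[OF algebra_RR B, of r b] by simp

lemma nu_tn: "\<lbrakk>c \<in> carrier K; w \<in> words\<rbrakk> \<Longrightarrow> nu (tn c (pw w)) = nk c \<otimes>\<^bsub>S\<^esub> nw w"
  unfolding nk_def nw_def by (simp add: tn_eq alg_homD(4)[OF nu] alg_homD(3)[OF kap] wd_closed)

lemma tn_closed_N: "\<lbrakk>c \<in> carrier K; t \<in> carrier T\<rbrakk> \<Longrightarrow> tn c t \<in> carrier N"
  by (simp add: N_sel tn_closed)

lemma ct_eq:
  "\<lbrakk>r \<in> carrier R; a \<in> carrier A; c \<in> carrier K; w \<in> words\<rbrakk> \<Longrightarrow> ct r a c (pw w) = gen r a c w"
  unfolding ct_def gen_def
  by (simp add: tens_S tens_alg_closed[OF A algebra_N] tn_closed_N pt_closed jb_tens nu_tn)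

lemma spans_N: "spans C N {tn c (pw w) |c w. c \<in> carrier K \<and> w \<in> words}"
proof -
  have "{tn c (pw w) |c w. c \<in> carrier K \<and> w \<in> words} = (\<lambda>(c, w). tn c (pw w)) ` (carrier K \<times> words)" by auto
  then show ?thesis using spans_N0 by (simp add: N_updates)
qed

lemma spans_B: "spans C B {tens C A N a (tn c (pw w)) |a c w. a \<in> carrier A \<and> c \<in> carrier K \<and> w \<in> words}"
proof -
  have "{tens C A N a (tn c (pw w)) |a c w. a \<in> carrier A \<and> c \<in> carrier K \<and> w \<in> words} =
      {tens C A N x y |x y. x \<in> carrier A \<and> y \<in> {tn c (pw w) |c w. c \<in> carrier K \<and> w \<in> words}}" by blast
  then show ?thesis
    using spans_tensor_alg[OF A algebra_N spans_carrier[OF A.module_axioms] spans_N] by simp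
qed

lemma spans_S: "spans C S {gen r a c w |r a c w. r \<in> carrier R \<and> a \<in> carrier A \<and> c \<in> carrier K \<and> w \<in> words}"
proof -
  have "{gen r a c w |r a c w. r \<in> carrier R \<and> a \<in> carrier A \<and> c \<in> carrier K \<and> w \<in> words} =
      {ct r a c (pw w) |r a c w. r \<in> carrier R \<and> a \<in> carrier A \<and> c \<in> carrier K \<and> w \<in> words}"
    using ct_eq by (intro Collect_cong) metis
  also have "\<dots> = {tens C RR B x y |x y. x \<in> carrier RR \<and>
      y \<in> {tens C A N a (tn c (pw w)) |a c w. a \<in> carrier A \<and> c \<in> carrier K \<and> w \<in> words}}"
    unfolding ct_def self_alg_sel by blast
  finally show ?thesis
    using spans_tensor_alg[OF algebra_RR B spans_carrier[OF module_RR] spans_B] by simp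
qed

lemma S_eqI:
  assumes "module C P" "f \<in> mod_hom C S P" "g \<in> mod_hom C S P"
    and "\<And>r a c w. \<lbrakk>r \<in> carrier R; a \<in> carrier A; c \<in> carrier K; w \<in> words\<rbrakk> \<Longrightarrow> f (gen r a c w) = g (gen r a c w)"
    and "u \<in> carrier S"
  shows "f u = g u"
  by (rule mod_hom_eqI[OF Sm assms(1) spans_S assms(2,3) _ assms(5)]) (use assms(4) in blast)

lemma nw_multilinear: "multilinear C (RT R Q) S nw"
proof -
  have "multilinear C (RT R Q) N wd"
    unfolding wd_def[abs_def]
    by (rule multilinear_comp[OF pure_multilinear[OF M]]) (simp add: N_updates tnr)
  from multilinear_comp[OF this alg_homD(1)[OF nu]] show ?thesis unfolding nw_def[abs_def] .
qed

lemma RT_carrier: "x \<in> carrier (RT R Q) \<Longrightarrow> x \<in> carrier R" by simp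

lemma io_mult: "\<lbrakk>r \<in> carrier R; s \<in> carrier R\<rbrakk> \<Longrightarrow> io (r \<otimes> s) = io r \<otimes>\<^bsub>S\<^esub> io s"
  using alg_homD(4)[OF io, of r s] by simp
lemma io_add: "\<lbrakk>r \<in> carrier R; s \<in> carrier R\<rbrakk> \<Longrightarrow> io (r \<oplus> s) = io r \<oplus>\<^bsub>S\<^esub> io s"
  using alg_homD(5)[OF io, of r s] by simp
lemma io_one [simp]: "io \<one> = \<one>\<^bsub>S\<^esub>"
  using alg_homD(7)[OF io] by simp
lemma io_zero [simp]: "io \<zero> = \<zero>\<^bsub>S\<^esub>"
  using mod_hom_zero[OF module_RR Sm alg_homD(1)[OF io]] by simp
lemma al_zero [simp]: "al \<zero>\<^bsub>A\<^esub> = \<zero>\<^bsub>S\<^esub>"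
  by (rule mod_hom_zero[OF A.module_axioms Sm alg_homD(1)[OF al]])
lemma al_one [simp]: "al \<one>\<^bsub>A\<^esub> = \<one>\<^bsub>S\<^esub>" by (rule alg_homD(7)[OF al])
lemma nk_one [simp]: "nk \<one>\<^bsub>K\<^esub> = \<one>\<^bsub>S\<^esub>" by (rule alg_homD(7)[OF nk])
lemmas al_mult = alg_homD(4)[OF al]
lemmas nk_mult = alg_homD(4)[OF nk]
lemmas jb_mult = alg_homD(4)[OF jb]

lemma io_const: "k \<in> constants R der \<Longrightarrow> io k = k \<odot>\<^bsub>S\<^esub> \<one>\<^bsub>S\<^esub>"
  using alg_homD(6)[OF io, of k \<one>] by (simp add: constants_iff)

lemma io_const_mult: "\<lbrakk>k \<in> constants R der; u \<in> carrier S\<rbrakk> \<Longrightarrow> io k \<otimes>\<^bsub>S\<^esub> u = k \<odot>\<^bsub>S\<^esub> u"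
  by (simp add: io_const S.smult_assoc2)

lemma nw_zero: "w \<in> words \<Longrightarrow> nw (\<zero> # w) = \<zero>\<^bsub>S\<^esub>"
  using mod_hom_zero[OF M Sm multilinear_Cons[OF nw_multilinear]] by simp

subsection \<open>The derivation\<close>

definition der_spec where
  "der_spec D \<longleftrightarrow> D \<in> mod_hom C S S \<and>
       (\<forall>f0\<in>carrier R. \<forall>c1\<in>carrier A. \<forall>c2\<in>carrier K.
          D (ct f0 c1 c2 (pw [])) = ct (der f0) c1 c2 (pw []) \<and>
          (\<forall>x\<in>carrier (RT R Q). \<forall>f\<in>words.
             D (ct f0 c1 c2 (pw (x # f))) =
               ct (der f0) c1 c2 (pw (x # f)) \<oplus>\<^bsub>S\<^esub> ct (f0 \<otimes> x) c1 c2 (pw f)))"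

text \<open>The derivative of a word: the outermost integral sign disappears and its letter moves to
  the factor R.\<close>

fun strip where
  "strip [] = \<zero>\<^bsub>S\<^esub>"
| "strip (x # w) = io x \<otimes>\<^bsub>S\<^esub> nw w"

lemma strip_closed: "w \<in> words \<Longrightarrow> strip w \<in> carrier S"
  by (cases w) simp_all

lemma strip_multilinear: "multilinear C (RT R Q) S strip"
proof (rule multilinearI)
  fix u v assume uv: "u \<in> words" "v \<in> words"
  show "(\<lambda>x. strip (u @ x # v)) \<in> mod_hom C (RT R Q) S"
  proof (cases u)
    case Nil
    then show ?thesis
      using mod_hom_multr[OF S nw_closed[OF uv(2)] mod_hom_comp[OF alg_homD(1)[OF io] RT_incl]] by simp
  next
    case (Cons y u')
    then have y: "y \<in> carrier R" "u' \<in> words" using uv by auto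
    then show ?thesis
      using mod_hom_multl[OF S io_closed[OF y(1)] multilinear_hom[OF nw_multilinear y(2) uv(2)]] Cons by simp
  qed
qed simp

lemma tau_exists:
  obtains \<tau> where "\<tau> \<in> mod_hom C N S"
    "\<And>c w. \<lbrakk>c \<in> carrier K; w \<in> words\<rbrakk> \<Longrightarrow> \<tau> (tn c (pw w)) = nk c \<otimes>\<^bsub>S\<^esub> strip w"
proof -
  obtain t0 where t0: "t0 \<in> mod_hom C T S" "\<And>w. w \<in> words \<Longrightarrow> t0 (pw w) = strip w"
    using tpowers_lift[OF M Sm strip_multilinear] by blast
  have "(\<lambda>c t. nk c \<otimes>\<^bsub>S\<^esub> t0 t) \<in> mod_bihom C K T S"
    by (intro mod_bihomI mod_hom_multl[OF S _ t0(1)] mod_hom_multr[OF S _ alg_homD(1)[OF nk]])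
      (simp_all add: mod_hom_closed[OF t0(1)])
  from tensor_lift[OF Km T Sm this] obtain \<tau> where "\<tau> \<in> mod_hom C N0 S"
    "\<And>c t. \<lbrakk>c \<in> carrier K; t \<in> carrier T\<rbrakk> \<Longrightarrow> \<tau> (tn c t) = nk c \<otimes>\<^bsub>S\<^esub> t0 t" by blast
  then show thesis by (intro that[of \<tau>]) (simp_all add: N_updates t0(2) pt_closed)
qed

text \<open>The derivation restricted to the factor \<open>N\<close>, linear over
  \<open>K\<close>.\<close>

definition tau where
  "tau = (SOME \<tau>. \<tau> \<in> mod_hom C N S \<and>
    (\<forall>c\<in>carrier K. \<forall>w\<in>words. \<tau> (tn c (pw w)) = nk c \<otimes>\<^bsub>S\<^esub> strip w))"

lemma tau: "tau \<in> mod_hom C N S"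
  "\<lbrakk>c \<in> carrier K; w \<in> words\<rbrakk> \<Longrightarrow> tau (tn c (pw w)) = nk c \<otimes>\<^bsub>S\<^esub> strip w"
proof -
  have "\<exists>\<tau>. \<tau> \<in> mod_hom C N S \<and> (\<forall>c\<in>carrier K. \<forall>w\<in>words. \<tau> (tn c (pw w)) = nk c \<otimes>\<^bsub>S\<^esub> strip w)"
    using tau_exists by metis
  from someI_ex[OF this, folded tau_def]
  show "tau \<in> mod_hom C N S" "\<lbrakk>c \<in> carrier K; w \<in> words\<rbrakk> \<Longrightarrow> tau (tn c (pw w)) = nk c \<otimes>\<^bsub>S\<^esub> strip w" by blast+
qed

lemmas tau_closed = mod_hom_closed[OF tau(1)]

lemma tau_wd: "w \<in> words \<Longrightarrow> tau (wd w) = strip w"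
  using tau(2)[of "\<one>\<^bsub>K\<^esub>" w] strip_closed by (simp add: wd_def)

lemma tau_kap: "c \<in> carrier K \<Longrightarrow> tau (kap c) = \<zero>\<^bsub>S\<^esub>"
  using tau(2)[of c "[]"] by (simp add: kap_def)

lemma act_hom_N: "c \<in> carrier K \<Longrightarrow> act c \<in> mod_hom C N N"
  by (simp add: N_updates act(1))

lemma cns_hom_N: "x \<in> carrier (RT R Q) \<Longrightarrow> cns x \<in> mod_hom C N N"
  by (simp add: N_updates cns(1) del: RT_sel)

lemma N_eqI:
  assumes "module C P" "f \<in> mod_hom C N P" "g \<in> mod_hom C N P"
    and "\<And>c w. \<lbrakk>c \<in> carrier K; w \<in> words\<rbrakk> \<Longrightarrow> f (tn c (pw w)) = g (tn c (pw w))" "u \<in> carrier N"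
  shows "f u = g u"
  by (rule mod_hom_eqI[OF Nm assms(1) spans_N assms(2,3) _ assms(5)]) (auto simp: assms(4))

lemma tau_act:
  assumes "c \<in> carrier K" "u \<in> carrier N"
  shows "tau (act c u) = nk c \<otimes>\<^bsub>S\<^esub> tau u"
  by (rule N_eqI[OF Sm mod_hom_comp[OF tau(1) act_hom_N[OF assms(1)]] mod_hom_multl[OF S nk_closed[OF assms(1)] tau(1)] _ assms(2)])
    (simp add: act pt_closed assms tau nk_mult S.m_assoc strip_closed)

text \<open>Prefixing by \<open>x\<close> is integration of \<open>x\<close> times the element; this
  is why the derivation removes it, and it holds for all elements of \<open>N\<close>, not only for
  words.\<close>

lemma tau_cns:
  assumes "x \<in> carrier (RT R Q)" "u \<in> carrier N"
  shows "tau (cns x u) = io x \<otimes>\<^bsub>S\<^esub> nu u"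
  by (rule N_eqI[OF Sm mod_hom_comp[OF tau(1) cns_hom_N[OF assms(1)]] mod_hom_multl[OF S io_closed alg_homD(1)[OF nu]] _ assms(2)])
    (use assms(1) in \<open>auto simp: cns_pt tau nu_tn S.m_ac simp del: RT_sel dest: RT_carrier\<close>)

lemma nu_act: "\<lbrakk>c \<in> carrier K; u \<in> carrier N\<rbrakk> \<Longrightarrow> nu (act c u) = nk c \<otimes>\<^bsub>S\<^esub> nu u"
  by (simp add: act_eq nk_def alg_homD(4)[OF nu] alg_homD(3)[OF kap])

text \<open>No induction is involved: \<open>tau\<close> is applied to the product recursion. It
  turns prefixing by a letter into multiplication by that letter, and the constant that stems from
  the pairing disappears.\<close>

lemma tau_wd_mult:
  assumes "f \<in> words" "g \<in> words"
  shows "tau (wd f \<otimes>\<^bsub>N\<^esub> wd g) = tau (wd f) \<otimes>\<^bsub>S\<^esub> nw g \<oplus>\<^bsub>S\<^esub> nw f \<otimes>\<^bsub>S\<^esub> tau (wd g)"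
proof (cases f)
  case Nil
  then show ?thesis using assms wd_Nil_mult[of "wd g"] wd_closed0[of g] by (simp add: tau_wd strip_closed)
next
  case f: (Cons x f')
  then have m: "x \<in> carrier (RT R Q)" "f' \<in> words" using assms by auto
  show ?thesis
  proof (cases g)
    case Nil
    then show ?thesis using assms wd_Nil_mult[of "wd f"] wd_closed0[of f] N_commute[of "wd f" "wd []"] wd_closed0[of "[]"]
      by (simp add: tau_wd strip_closed)
  next
    case g: (Cons y g')
    then have m': "y \<in> carrier (RT R Q)" "g' \<in> words" using assms by auto
    note wc = wd_closed[OF assms(1)] wd_closed[OF assms(2)] wd_closed[OF m(2)] wd_closed[OF m'(2)]
    have c: "cns x (wd f' \<otimes>\<^bsub>N\<^esub> wd g) \<in> carrier N" "cns y (wd f \<otimes>\<^bsub>N\<^esub> wd g') \<in> carrier N"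
      "kap (e2 (pw f) (pw g)) \<in> carrier N" "e2 (pw f) (pw g) \<in> carrier K"
      using wc m m' assms
      by (auto simp: mod_hom_closed[OF cns_hom_N] alg_homD(3)[OF kap] e2_closed pt_closed simp del: RT_sel)
    have "wd f \<otimes>\<^bsub>N\<^esub> wd g = cns x (wd f' \<otimes>\<^bsub>N\<^esub> wd g) \<oplus>\<^bsub>N\<^esub> cns y (wd f \<otimes>\<^bsub>N\<^esub> wd g') \<oplus>\<^bsub>N\<^esub> kap (e2 (pw f) (pw g))"
      using wd_Cons_mult[OF m m'] f g by (simp add: N_sel)
    then have "tau (wd f \<otimes>\<^bsub>N\<^esub> wd g) = io x \<otimes>\<^bsub>S\<^esub> nu (wd f' \<otimes>\<^bsub>N\<^esub> wd g) \<oplus>\<^bsub>S\<^esub> io y \<otimes>\<^bsub>S\<^esub> nu (wd f \<otimes>\<^bsub>N\<^esub> wd g')"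
      using c wc m m' RT_carrier[OF m(1)] RT_carrier[OF m'(1)]
      by (simp add: mod_hom_add[OF tau(1)] tau_cns tau_kap del: RT_sel)
    also have "\<dots> = (io x \<otimes>\<^bsub>S\<^esub> nw f') \<otimes>\<^bsub>S\<^esub> nw g \<oplus>\<^bsub>S\<^esub> nw f \<otimes>\<^bsub>S\<^esub> (io y \<otimes>\<^bsub>S\<^esub> nw g')"
      using wc m m' assms RT_carrier[OF m(1)] RT_carrier[OF m'(1)]
      by (simp add: alg_homD(4)[OF nu] nw_def[symmetric] S.m_ac del: RT_sel)
    also have "\<dots> = tau (wd f) \<otimes>\<^bsub>S\<^esub> nw g \<oplus>\<^bsub>S\<^esub> nw f \<otimes>\<^bsub>S\<^esub> tau (wd g)"
      using f g assms by (simp add: tau_wd)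
    finally show ?thesis .
  qed
qed

lemma tau_mult:
  assumes "u \<in> carrier N" "v \<in> carrier N"
  shows "tau (u \<otimes>\<^bsub>N\<^esub> v) = tau u \<otimes>\<^bsub>S\<^esub> nu v \<oplus>\<^bsub>S\<^esub> nu u \<otimes>\<^bsub>S\<^esub> tau v"
proof (rule mod_bihom_eqI[OF Nm Nm Sm spans_N spans_N _ _ _ assms])
  note nb = algebra_bihom[OF algebra_N]
  show "(\<lambda>u v. tau (u \<otimes>\<^bsub>N\<^esub> v)) \<in> mod_bihom C N N S"
    by (intro mod_bihomI mod_hom_comp[OF tau(1) mod_bihom_left[OF nb]] mod_hom_comp[OF tau(1) mod_bihom_right[OF nb]])
  show "(\<lambda>u v. tau u \<otimes>\<^bsub>S\<^esub> nu v \<oplus>\<^bsub>S\<^esub> nu u \<otimes>\<^bsub>S\<^esub> tau v) \<in> mod_bihom C N N S"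
    by (intro mod_bihomI mod_hom_addf[OF Sm] mod_hom_multl[OF S _ tau(1)] mod_hom_multr[OF S _ tau(1)]
        mod_hom_multl[OF S _ alg_homD(1)[OF nu]] mod_hom_multr[OF S _ alg_homD(1)[OF nu]]) (simp_all add: tau_closed)
  fix u v assume "u \<in> {tn c (pw w) |c w. c \<in> carrier K \<and> w \<in> words}" "v \<in> {tn c (pw w) |c w. c \<in> carrier K \<and> w \<in> words}"
  then obtain c f d g where "c \<in> carrier K" "f \<in> words" "u = tn c (pw f)"
    and "d \<in> carrier K" "g \<in> words" "v = tn d (pw g)"
    by blast
  then have u: "c \<in> carrier K" "f \<in> words" "u = act c (wd f)"
    and v: "d \<in> carrier K" "g \<in> words" "v = act d (wd g)"
    by (simp_all add: act_wd)
  have cl: "wd f \<in> carrier N" "wd g \<in> carrier N" "act d (wd g) \<in> carrier N" "kap c \<in> carrier N" "kap d \<in> carrier N"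
    using u v by (simp_all add: wd_closed mod_hom_closed[OF act_hom_N] alg_homD(3)[OF kap])
  have uv: "u \<otimes>\<^bsub>N\<^esub> v = act c (act d (wd f \<otimes>\<^bsub>N\<^esub> wd g))"
    unfolding u(3) v(3) using u v cl by (simp add: act_eq N.m_ac)
  have tc: "tau (wd f) \<in> carrier S" "tau (wd g) \<in> carrier S" "nw f \<in> carrier S" "nw g \<in> carrier S"
    "nk c \<in> carrier S" "nk d \<in> carrier S"
    using u v cl by (simp_all add: tau_closed)
  show "tau (u \<otimes>\<^bsub>N\<^esub> v) = tau u \<otimes>\<^bsub>S\<^esub> nu v \<oplus>\<^bsub>S\<^esub> nu u \<otimes>\<^bsub>S\<^esub> tau v"
    unfolding uv using u v cl tc
    by (simp add: tau_act nu_act mod_hom_closed[OF act_hom_N] tau_wd_mult nw_def[symmetric] S.r_distr S.m_ac)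
qed

lemma theta_exists:
  obtains \<theta> where "\<theta> \<in> mod_hom C B S"
    "\<And>a n. \<lbrakk>a \<in> carrier A; n \<in> carrier N\<rbrakk> \<Longrightarrow> \<theta> (tens C A N a n) = al a \<otimes>\<^bsub>S\<^esub> tau n"
  using tensor_alg_lift_mult[OF A algebra_N S alg_homD(1)[OF al] tau(1)] by blast

text \<open>The derivation restricted to \<open>B\<close>, where the elements of \<open>A\<close>
  count as constants.\<close>

definition theta where
  "theta = (SOME \<theta>. \<theta> \<in> mod_hom C B S \<and>
    (\<forall>a\<in>carrier A. \<forall>n\<in>carrier N. \<theta> (tens C A N a n) = al a \<otimes>\<^bsub>S\<^esub> tau n))"

lemma theta: "theta \<in> mod_hom C B S"
  "\<lbrakk>a \<in> carrier A; n \<in> carrier N\<rbrakk> \<Longrightarrow> theta (tens C A N a n) = al a \<otimes>\<^bsub>S\<^esub> tau n"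
proof -
  have "\<exists>\<theta>. \<theta> \<in> mod_hom C B S \<and> (\<forall>a\<in>carrier A. \<forall>n\<in>carrier N. \<theta> (tens C A N a n) = al a \<otimes>\<^bsub>S\<^esub> tau n)"
    using theta_exists by metis
  from someI_ex[OF this, folded theta_def]
  show "theta \<in> mod_hom C B S" "\<lbrakk>a \<in> carrier A; n \<in> carrier N\<rbrakk> \<Longrightarrow> theta (tens C A N a n) = al a \<otimes>\<^bsub>S\<^esub> tau n" by blast+
qed

lemmas theta_closed = mod_hom_closed[OF theta(1)]

lemma theta_mult:
  assumes "u \<in> carrier B" "v \<in> carrier B"
  shows "theta (u \<otimes>\<^bsub>B\<^esub> v) = theta u \<otimes>\<^bsub>S\<^esub> jb v \<oplus>\<^bsub>S\<^esub> jb u \<otimes>\<^bsub>S\<^esub> theta v"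
proof -
  note sp = spans_tensor_alg[OF A algebra_N spans_carrier[OF A.module_axioms] spans_carrier[OF Nm]]
  note nb = algebra_bihom[OF B]
  note Bm = algebra_is_module[OF B]
  show ?thesis
  proof (rule mod_bihom_eqI[OF Bm Bm Sm sp sp _ _ _ assms])
    show "(\<lambda>u v. theta (u \<otimes>\<^bsub>B\<^esub> v)) \<in> mod_bihom C B B S"
      by (intro mod_bihomI mod_hom_comp[OF theta(1) mod_bihom_left[OF nb]] mod_hom_comp[OF theta(1) mod_bihom_right[OF nb]])
    show "(\<lambda>u v. theta u \<otimes>\<^bsub>S\<^esub> jb v \<oplus>\<^bsub>S\<^esub> jb u \<otimes>\<^bsub>S\<^esub> theta v) \<in> mod_bihom C B B S"
      by (intro mod_bihomI mod_hom_addf[OF Sm] mod_hom_multl[OF S _ theta(1)] mod_hom_multr[OF S _ theta(1)]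
        mod_hom_multl[OF S _ alg_homD(1)[OF jb]] mod_hom_multr[OF S _ alg_homD(1)[OF jb]]) (simp_all add: theta_closed)
    fix u v assume "u \<in> {tens C A N x y |x y. x \<in> carrier A \<and> y \<in> carrier N}" "v \<in> {tens C A N x y |x y. x \<in> carrier A \<and> y \<in> carrier N}"
    then obtain a n b m where u: "a \<in> carrier A" "n \<in> carrier N" "u = tens C A N a n"
      and v: "b \<in> carrier A" "m \<in> carrier N" "v = tens C A N b m" by blast
    show "theta (u \<otimes>\<^bsub>B\<^esub> v) = theta u \<otimes>\<^bsub>S\<^esub> jb v \<oplus>\<^bsub>S\<^esub> jb u \<otimes>\<^bsub>S\<^esub> theta v"
      unfolding u(3) v(3) using u(1,2) v(1,2)
      by (simp add: tensor_alg_mult[OF A algebra_N] theta tau_mult jb_tens al_mult tau_closed S.r_distr S.m_ac)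
  qed
qed

lemma der_spec_exists: "\<exists>D. der_spec D"
proof -
  \<comment> \<open>\<open>D1\<close> differentiates the factor in R and \<open>D2\<close> the word;
    the derivation is their sum.\<close>
  obtain D1 where D1: "D1 \<in> mod_hom C S S"
    "\<And>r b. \<lbrakk>r \<in> carrier RR; b \<in> carrier B\<rbrakk> \<Longrightarrow> D1 (tens C RR B r b) = io (der r) \<otimes>\<^bsub>S\<^esub> jb b"
    using tensor_alg_lift_mult[OF algebra_RR B S mod_hom_comp[OF alg_homD(1)[OF io] der_hom] alg_homD(1)[OF jb]] by blast
  obtain D2 where D2: "D2 \<in> mod_hom C S S"
    "\<And>r b. \<lbrakk>r \<in> carrier RR; b \<in> carrier B\<rbrakk> \<Longrightarrow> D2 (tens C RR B r b) = io r \<otimes>\<^bsub>S\<^esub> theta b"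
    using tensor_alg_lift_mult[OF algebra_RR B S alg_homD(1)[OF io] theta(1)] by blast
  note bc = tens_alg_closed[OF A algebra_N] tn_closed_N pt_closed
  have "der_spec (\<lambda>u. D1 u \<oplus>\<^bsub>S\<^esub> D2 u)"
    unfolding der_spec_def
  proof (intro conjI ballI mod_hom_addf[OF Sm D1(1) D2(1)])
    fix f0 c1 c2 assume m: "f0 \<in> carrier R" "c1 \<in> carrier A" "c2 \<in> carrier K"
    have *: "D1 (ct f0 c1 c2 (pw w)) \<oplus>\<^bsub>S\<^esub> D2 (ct f0 c1 c2 (pw w)) =
        gen (der f0) c1 c2 w \<oplus>\<^bsub>S\<^esub> io f0 \<otimes>\<^bsub>S\<^esub> (al c1 \<otimes>\<^bsub>S\<^esub> (nk c2 \<otimes>\<^bsub>S\<^esub> strip w))" if "w \<in> words" for w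
      unfolding ct_def gen_def using m that by (simp add: D1 D2 bc theta tau jb_tens nu_tn)
    show "D1 (ct f0 c1 c2 (pw [])) \<oplus>\<^bsub>S\<^esub> D2 (ct f0 c1 c2 (pw [])) = ct (der f0) c1 c2 (pw [])"
      unfolding *[OF lists.Nil] using m by (simp add: ct_eq der_closed)
    fix x f assume x: "x \<in> carrier (RT R Q)" "f \<in> words"
    then have xf: "x # f \<in> words" by simp
    show "D1 (ct f0 c1 c2 (pw (x # f))) \<oplus>\<^bsub>S\<^esub> D2 (ct f0 c1 c2 (pw (x # f))) =
        ct (der f0) c1 c2 (pw (x # f)) \<oplus>\<^bsub>S\<^esub> ct (f0 \<otimes> x) c1 c2 (pw f)"
      unfolding *[OF xf] using m x by (simp add: ct_eq der_closed) (simp add: gen_def io_mult S.m_ac)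
  qed
  then show ?thesis by blast
qed

subsection \<open>The integral\<close>

definition int_spec where
  "int_spec I \<longleftrightarrow> I \<in> mod_hom C S S \<and>
       (\<forall>f0\<in>carrier R. \<forall>c1\<in>carrier A. \<forall>c2\<in>carrier K.
          I (ct f0 c1 c2 (pw [])) =
            ct (Q f0) c1 c2 (pw [])
            \<ominus>\<^bsub>S\<^esub> ct \<one> (c1 \<otimes>\<^bsub>A\<^esub> e (Q f0) (pw [])) c2 (pw [])
            \<oplus>\<^bsub>S\<^esub> ct \<one> c1 c2 (pw [f0 \<ominus> der (Q f0)]) \<and>
          (\<forall>x\<in>carrier (RT R Q). \<forall>f\<in>words.
             I (ct f0 c1 c2 (pw (x # f))) =
               ct (Q f0) c1 c2 (pw (x # f))
               \<ominus>\<^bsub>S\<^esub> ct \<one> (c1 \<otimes>\<^bsub>A\<^esub> e (Q f0) (pw (x # f))) c2 (pw [])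
               \<ominus>\<^bsub>S\<^esub> I (ct (Q f0 \<otimes> x) c1 c2 (pw f))
               \<oplus>\<^bsub>S\<^esub> ct \<one> c1 c2 (pw ((f0 \<ominus> der (Q f0)) # x # f))))"

text \<open>\<open>J f w\<close> is the integral of \<open>f \<otimes> 1 \<otimes> 1 \<otimes> w\<close>; the integral is linear over \<open>A\<close> and \<open>K\<close>.\<close>

fun J where
  "J f [] = io (Q f) \<ominus>\<^bsub>S\<^esub> al (e (Q f) (pw [])) \<oplus>\<^bsub>S\<^esub> nw [rem f]"
| "J f (x # w) = io (Q f) \<otimes>\<^bsub>S\<^esub> nw (x # w) \<ominus>\<^bsub>S\<^esub> al (e (Q f) (pw (x # w))) \<ominus>\<^bsub>S\<^esub> J (Q f \<otimes> x) w \<oplus>\<^bsub>S\<^esub> nw (rem f # x # w)"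

lemma e_closed: "\<lbrakk>f \<in> carrier R; w \<in> words\<rbrakk> \<Longrightarrow> e (Q f) (pw w) \<in> carrier A"
  using mod_bihom_closed[OF e, of "Q f" "pw w"] by (simp add: pt_closed)

lemma rem_words: "\<lbrakk>f \<in> carrier R; w \<in> words\<rbrakk> \<Longrightarrow> rem f # w \<in> words"
  using rem_RT[of f] by simp

lemma J_closed: "\<lbrakk>f \<in> carrier R; w \<in> words\<rbrakk> \<Longrightarrow> J f w \<in> carrier S"
proof (induction w arbitrary: f)
  case Nil then show ?case using rem_words[of f "[]"] by (simp add: Q_closed e_closed)
next
  case (Cons x w)
  then have x: "x \<in> carrier R" "Q x = \<zero>" "w \<in> words" "f \<in> carrier R" by simp_all
  then show ?case using Cons.IH[of "Q f \<otimes> x"] rem_words[of f "x # w"] by (simp add: Q_closed e_closed)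
qed

lemma e_Q_hom: "w \<in> words \<Longrightarrow> (\<lambda>f. al (e (Q f) (pw w))) \<in> mod_hom C RR S"
  by (rule mod_hom_comp[OF alg_homD(1)[OF al] mod_hom_comp[OF mod_bihom_left[OF e] Q_hom]]) (simp add: pt_closed)

lemma J_hom: "w \<in> words \<Longrightarrow> (\<lambda>f. J f w) \<in> mod_hom C RR S"
proof (induction w)
  note ioQ = mod_hom_comp[OF alg_homD(1)[OF io] Q_hom_RR]
  have nr: "(\<lambda>f. nw (rem f # v)) \<in> mod_hom C RR S" if "v \<in> words" for v
    by (rule mod_hom_comp[OF multilinear_Cons[OF nw_multilinear that] rem_hom])
  {
    case Nil
    show ?case unfolding J.simps by (intro mod_hom_addf[OF Sm] mod_hom_minusf[OF Sm] ioQ e_Q_hom nr) simp_all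
  next
    case (Cons x w)
    have x: "x \<in> carrier RR" "w \<in> words" "x # w \<in> words" using Cons.prems by simp_all
    from mod_hom_comp[OF Cons.IH[OF x(2)] mod_hom_comp[OF mod_hom_multr[OF algebra_RR x(1) mod_hom_id] Q_hom_RR]]
    have "(\<lambda>f. J (Q f \<otimes> x) w) \<in> mod_hom C RR S" by simp
    then show ?case unfolding J.simps using x
      by (intro mod_hom_addf[OF Sm] mod_hom_minusf[OF Sm] mod_hom_multr[OF S _ ioQ] e_Q_hom nr) simp_all
  }
qed

text \<open>Induction on the letters before the varying one, for all \<open>f\<close> at once
  because each letter changes the coefficient to \<open>Q f \<otimes> y\<close>. When the varying
  letter comes first, it enters through that coefficient as well, and \<open>J_hom\<close>
  applies.\<close>

lemma J_multilinear:
  assumes "f \<in> carrier R"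
  shows "multilinear C (RT R Q) S (J f)"
proof (rule multilinearI)
  show "J f [] \<in> carrier S" using J_closed assms by blast
  fix u v assume uv: "u \<in> words" "v \<in> words"
  show "(\<lambda>x. J f (u @ x # v)) \<in> mod_hom C (RT R Q) S" using assms uv(1)
  proof (induction u arbitrary: f)
    note ep = mod_hom_comp[OF alg_homD(1)[OF al] mod_hom_comp[OF mod_bihom_right[OF e] pt_hom]]
    {
      case Nil
      have f: "Q f \<in> carrier (RJ R Q)" "Q f \<in> carrier R" using Nil by (auto simp: Q_closed)
      have "(\<lambda>x. J (Q f \<otimes> x) v) \<in> mod_hom C (RT R Q) S"
        using mod_hom_comp[OF J_hom[OF uv(2)] mod_hom_multl[OF algebra_RR, of "Q f", OF _ RT_incl]] f by simp
      moreover have "(\<lambda>x. nw (rem f # x # v)) \<in> mod_hom C (RT R Q) S"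
        using multilinear_hom[OF nw_multilinear _ uv(2), of "[rem f]"] rem_words[of f "[]"] Nil by simp
      ultimately have "(\<lambda>x. J f ([] @ x # v)) \<in> mod_hom C (RT R Q) S"
        unfolding append_Nil J.simps
        using f uv ep[OF f(1), of "[]" v]
        by (intro mod_hom_addf[OF Sm] mod_hom_minusf[OF Sm] mod_hom_multl[OF S] multilinear_Cons[OF nw_multilinear]) simp_all
      then show ?case .
    next
      case (Cons y u)
      have f: "Q f \<in> carrier (RJ R Q)" "Q f \<in> carrier R" and y: "y \<in> carrier R" "u \<in> words" "y # u \<in> words"
        using Cons by (auto simp: Q_closed)
      have "(\<lambda>x. J (Q f \<otimes> y) (u @ x # v)) \<in> mod_hom C (RT R Q) S"
        using Cons.IH[of "Q f \<otimes> y"] f y by simp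
      moreover have "(\<lambda>x. nw (rem f # y # u @ x # v)) \<in> mod_hom C (RT R Q) S"
        using multilinear_hom[OF nw_multilinear _ uv(2), of "rem f # y # u"] rem_words[of f "y # u"] Cons.prems y by simp
      moreover have "(\<lambda>x. nw (y # u @ x # v)) \<in> mod_hom C (RT R Q) S"
        using multilinear_hom[OF nw_multilinear y(3) uv(2)] by simp
      ultimately have "(\<lambda>x. J f ((y # u) @ x # v)) \<in> mod_hom C (RT R Q) S"
        unfolding append_Cons J.simps
        using f uv ep[OF f(1) y(3), of v]
        by (intro mod_hom_addf[OF Sm] mod_hom_minusf[OF Sm] mod_hom_multl[OF S]) simp_all
      then show ?case .
    }
  qed
qed

text \<open>\<open>J f w\<close> is not a product of a part depending on \<open>f\<close> and a part
  depending on \<open>w\<close>, so lifting a product of maps is not enough. For each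
  \<open>f\<close> the map \<open>J f\<close> is lifted through the words, \<open>K\<close> and
  \<open>A\<close>, and the resulting family is shown to be linear in \<open>f\<close>.\<close>

lemma I_exists:
  obtains I where "I \<in> mod_hom C S S"
    "\<And>f a c w. \<lbrakk>f \<in> carrier R; a \<in> carrier A; c \<in> carrier K; w \<in> words\<rbrakk>
      \<Longrightarrow> I (gen f a c w) = al a \<otimes>\<^bsub>S\<^esub> (nk c \<otimes>\<^bsub>S\<^esub> J f w)"
proof -
  have "\<exists>h. h \<in> mod_hom C B S \<and> (\<forall>a\<in>carrier A. \<forall>c\<in>carrier K. \<forall>w\<in>words.
      h (tens C A N a (tn c (pw w))) = al a \<otimes>\<^bsub>S\<^esub> (nk c \<otimes>\<^bsub>S\<^esub> J f w))" if f: "f \<in> carrier R" for f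
  proof -
    obtain L where L: "L \<in> mod_hom C T S" "\<And>w. w \<in> words \<Longrightarrow> L (pw w) = J f w"
      using tpowers_lift[OF M Sm J_multilinear[OF f]] by blast
    have "(\<lambda>c t. nk c \<otimes>\<^bsub>S\<^esub> L t) \<in> mod_bihom C K T S"
      by (intro mod_bihomI mod_hom_multl[OF S _ L(1)] mod_hom_multr[OF S _ alg_homD(1)[OF nk]])
        (simp_all add: mod_hom_closed[OF L(1)])
    from tensor_lift[OF Km T Sm this] obtain \<kappa> where \<kappa>: "\<kappa> \<in> mod_hom C N0 S"
      "\<And>c t. \<lbrakk>c \<in> carrier K; t \<in> carrier T\<rbrakk> \<Longrightarrow> \<kappa> (tn c t) = nk c \<otimes>\<^bsub>S\<^esub> L t" by blast
    have "\<kappa> \<in> mod_hom C N S" using \<kappa>(1) by (simp add: N_updates)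
    from tensor_alg_lift_mult[OF A algebra_N S alg_homD(1)[OF al] this] obtain h where
      "h \<in> mod_hom C B S" "\<And>a n. \<lbrakk>a \<in> carrier A; n \<in> carrier N\<rbrakk> \<Longrightarrow> h (tens C A N a n) = al a \<otimes>\<^bsub>S\<^esub> \<kappa> n" by blast
    then show ?thesis by (intro exI[of _ h]) (simp add: \<kappa> L tn_closed_N pt_closed)
  qed
  then obtain h where "\<forall>f\<in>carrier R. h f \<in> mod_hom C B S \<and> (\<forall>a\<in>carrier A. \<forall>c\<in>carrier K. \<forall>w\<in>words.
      h f (tens C A N a (tn c (pw w))) = al a \<otimes>\<^bsub>S\<^esub> (nk c \<otimes>\<^bsub>S\<^esub> J f w))" by metis
  then have h: "\<And>f. f \<in> carrier R \<Longrightarrow> h f \<in> mod_hom C B S"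
    "\<And>f a c w. \<lbrakk>f \<in> carrier R; a \<in> carrier A; c \<in> carrier K; w \<in> words\<rbrakk> \<Longrightarrow>
      h f (tens C A N a (tn c (pw w))) = al a \<otimes>\<^bsub>S\<^esub> (nk c \<otimes>\<^bsub>S\<^esub> J f w)" by blast+
  have bh: "h \<in> mod_bihom C RR B S"
  proof (rule mod_bihom_spanI[OF module_RR algebra_is_module[OF B] Sm spans_B])
    show "h f \<in> mod_hom C B S" if "f \<in> carrier RR" for f using that h(1) by simp
    fix b assume "b \<in> {tens C A N a (tn c (pw w)) |a c w. a \<in> carrier A \<and> c \<in> carrier K \<and> w \<in> words}"
    then obtain a c w where b: "a \<in> carrier A" "c \<in> carrier K" "w \<in> words" "b = tens C A N a (tn c (pw w))" by blast
    have "(\<lambda>f. al a \<otimes>\<^bsub>S\<^esub> (nk c \<otimes>\<^bsub>S\<^esub> J f w)) \<in> mod_hom C RR S"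
      using b by (intro mod_hom_multl[OF S] J_hom) simp_all
    then show "(\<lambda>f. h f b) \<in> mod_hom C RR S"
      by (rule mod_hom_cong[OF module_RR]) (simp add: b h del: RT_sel)
  qed
  obtain I where I: "I \<in> mod_hom C (tensor C RR B) S"
    "\<And>f b. \<lbrakk>f \<in> carrier RR; b \<in> carrier B\<rbrakk> \<Longrightarrow> I (tens C RR B f b) = h f b"
    using tensor_lift[OF module_RR algebra_is_module[OF B] Sm bh] by blast
  show thesis
  proof (rule that[of I])
    show "I \<in> mod_hom C S S" using I(1) by (simp add: tensor_alg_updates[OF algebra_RR B])
    fix f a c w assume "f \<in> carrier R" "a \<in> carrier A" "c \<in> carrier K" "w \<in> words"
    then show "I (gen f a c w) = al a \<otimes>\<^bsub>S\<^esub> (nk c \<otimes>\<^bsub>S\<^esub> J f w)"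
      by (simp add: ct_eq[symmetric] ct_def I(2) h(2) tens_alg_closed[OF A algebra_N] tn_closed_N pt_closed)
  qed
qed

lemma S_expand:
  assumes "s \<in> carrier S" "u1 \<in> carrier S" "u2 \<in> carrier S" "u3 \<in> carrier S" "u4 \<in> carrier S"
  shows "s \<otimes>\<^bsub>S\<^esub> (u1 \<ominus>\<^bsub>S\<^esub> u2 \<oplus>\<^bsub>S\<^esub> u3) = s \<otimes>\<^bsub>S\<^esub> u1 \<ominus>\<^bsub>S\<^esub> s \<otimes>\<^bsub>S\<^esub> u2 \<oplus>\<^bsub>S\<^esub> s \<otimes>\<^bsub>S\<^esub> u3"
    and "s \<otimes>\<^bsub>S\<^esub> (u1 \<ominus>\<^bsub>S\<^esub> u2 \<ominus>\<^bsub>S\<^esub> u4 \<oplus>\<^bsub>S\<^esub> u3) = s \<otimes>\<^bsub>S\<^esub> u1 \<ominus>\<^bsub>S\<^esub> s \<otimes>\<^bsub>S\<^esub> u2 \<ominus>\<^bsub>S\<^esub> s \<otimes>\<^bsub>S\<^esub> u4 \<oplus>\<^bsub>S\<^esub> s \<otimes>\<^bsub>S\<^esub> u3"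
  using assms by (simp_all add: S.minus_eq S.r_distr S.r_minus)

text \<open>The recursion of \<open>J\<close> multiplied by constants, which is the shape of the
  recursion in \<open>int_spec\<close>.\<close>

lemma J_scaled:
  assumes "f \<in> carrier R" "a \<in> carrier A" "c \<in> carrier K" "w \<in> words"
  shows "al a \<otimes>\<^bsub>S\<^esub> (nk c \<otimes>\<^bsub>S\<^esub> J f []) = gen (Q f) a c [] \<ominus>\<^bsub>S\<^esub> gen \<one> (a \<otimes>\<^bsub>A\<^esub> e (Q f) (pw [])) c []
      \<oplus>\<^bsub>S\<^esub> gen \<one> a c [rem f]"
    and "x \<in> carrier (RT R Q) \<Longrightarrow> al a \<otimes>\<^bsub>S\<^esub> (nk c \<otimes>\<^bsub>S\<^esub> J f (x # w)) =
      gen (Q f) a c (x # w) \<ominus>\<^bsub>S\<^esub> gen \<one> (a \<otimes>\<^bsub>A\<^esub> e (Q f) (pw (x # w))) c []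
      \<ominus>\<^bsub>S\<^esub> al a \<otimes>\<^bsub>S\<^esub> (nk c \<otimes>\<^bsub>S\<^esub> J (Q f \<otimes> x) w) \<oplus>\<^bsub>S\<^esub> gen \<one> a c (rem f # x # w)"
proof -
  note c = Q_closed e_closed assms nw_closed[OF rem_words]
  have "(al a \<otimes>\<^bsub>S\<^esub> nk c) \<otimes>\<^bsub>S\<^esub> J f [] = gen (Q f) a c [] \<ominus>\<^bsub>S\<^esub> gen \<one> (a \<otimes>\<^bsub>A\<^esub> e (Q f) (pw [])) c []
      \<oplus>\<^bsub>S\<^esub> gen \<one> a c [rem f]"
    unfolding J.simps by (subst S_expand(1)) (auto simp: c gen_def al_mult S.m_ac)
  then show "al a \<otimes>\<^bsub>S\<^esub> (nk c \<otimes>\<^bsub>S\<^esub> J f []) = gen (Q f) a c [] \<ominus>\<^bsub>S\<^esub> gen \<one> (a \<otimes>\<^bsub>A\<^esub> e (Q f) (pw [])) c []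
      \<oplus>\<^bsub>S\<^esub> gen \<one> a c [rem f]" using assms J_closed by (simp add: S.m_assoc del: J.simps)
  assume x: "x \<in> carrier (RT R Q)"
  then have xw: "x # w \<in> words" "x \<in> carrier R" using assms by auto
  have "(al a \<otimes>\<^bsub>S\<^esub> nk c) \<otimes>\<^bsub>S\<^esub> J f (x # w) =
      gen (Q f) a c (x # w) \<ominus>\<^bsub>S\<^esub> gen \<one> (a \<otimes>\<^bsub>A\<^esub> e (Q f) (pw (x # w))) c []
      \<ominus>\<^bsub>S\<^esub> (al a \<otimes>\<^bsub>S\<^esub> nk c) \<otimes>\<^bsub>S\<^esub> J (Q f \<otimes> x) w \<oplus>\<^bsub>S\<^esub> gen \<one> a c (rem f # x # w)"
    unfolding J.simps by (subst S_expand(2)) (use xw in \<open>auto simp: c gen_def al_mult S.m_ac J_closed\<close>)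
  then show "al a \<otimes>\<^bsub>S\<^esub> (nk c \<otimes>\<^bsub>S\<^esub> J f (x # w)) =
      gen (Q f) a c (x # w) \<ominus>\<^bsub>S\<^esub> gen \<one> (a \<otimes>\<^bsub>A\<^esub> e (Q f) (pw (x # w))) c []
      \<ominus>\<^bsub>S\<^esub> al a \<otimes>\<^bsub>S\<^esub> (nk c \<otimes>\<^bsub>S\<^esub> J (Q f \<otimes> x) w) \<oplus>\<^bsub>S\<^esub> gen \<one> a c (rem f # x # w)"
    using assms xw J_closed Q_closed by (simp add: S.m_assoc del: J.simps)
qed

text \<open>The specification mentions the integral on its right-hand side. Induction on the word,
  with the coefficient arbitrary, unrolls it into explicit values on the spanning set.\<close>

lemma int_spec_iff:
  assumes I: "I \<in> mod_hom C S S"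
  shows "int_spec I \<longleftrightarrow> (\<forall>f\<in>carrier R. \<forall>a\<in>carrier A. \<forall>c\<in>carrier K. \<forall>w\<in>words.
    I (gen f a c w) = al a \<otimes>\<^bsub>S\<^esub> (nk c \<otimes>\<^bsub>S\<^esub> J f w))" (is "_ = ?r")
proof
  note c = Q_closed e_closed rem_RT rem_closed Q_rem
  {
    assume spec: "int_spec I"
    show ?r
    proof (intro ballI)
      fix f a c w assume m: "f \<in> carrier R" "a \<in> carrier A" "c \<in> carrier K" "w \<in> words"
      show "I (gen f a c w) = al a \<otimes>\<^bsub>S\<^esub> (nk c \<otimes>\<^bsub>S\<^esub> J f w)" using m(4,1)
      proof (induction w arbitrary: f)
        case Nil
        then have "I (ct f a c (pw [])) = ct (Q f) a c (pw []) \<ominus>\<^bsub>S\<^esub> ct \<one> (a \<otimes>\<^bsub>A\<^esub> e (Q f) (pw [])) c (pw [])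
            \<oplus>\<^bsub>S\<^esub> ct \<one> a c (pw [rem f])"
          using spec m unfolding int_spec_def rem_def by blast
        then show ?case using Nil m by (simp add: ct_eq c J_scaled(1)[OF _ m(2-4)] del: J.simps)
      next
        case (Cons x w)
        then have x: "x \<in> carrier (RT R Q)" "x \<in> carrier R" "w \<in> words" "f \<in> carrier R" by auto
        then have "I (ct f a c (pw (x # w))) =
               ct (Q f) a c (pw (x # w))
               \<ominus>\<^bsub>S\<^esub> ct \<one> (a \<otimes>\<^bsub>A\<^esub> e (Q f) (pw (x # w))) c (pw [])
               \<ominus>\<^bsub>S\<^esub> I (ct (Q f \<otimes> x) a c (pw w))
               \<oplus>\<^bsub>S\<^esub> ct \<one> a c (pw (rem f # x # w))"
          using spec m unfolding int_spec_def rem_def by blast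
        then show ?case using x m Cons.IH[of "Q f \<otimes> x"]
          by (simp add: ct_eq c J_scaled(2)[OF x(4) m(2,3) x(3,1)] Cons.hyps del: J.simps RT_sel)
      qed
    qed
  }
  {
    assume r: ?r
    show "int_spec I" unfolding int_spec_def rem_def[symmetric]
    proof (intro conjI ballI I)
      fix f a c assume m: "f \<in> carrier R" "a \<in> carrier A" "c \<in> carrier K"
      show "I (ct f a c (pw [])) = ct (Q f) a c (pw []) \<ominus>\<^bsub>S\<^esub> ct \<one> (a \<otimes>\<^bsub>A\<^esub> e (Q f) (pw [])) c (pw [])
            \<oplus>\<^bsub>S\<^esub> ct \<one> a c (pw [rem f])"
        using m r by (simp add: ct_eq c J_scaled(1)[OF _ _ _ lists.Nil] del: J.simps)
      fix x w assume x: "x \<in> carrier (RT R Q)" "w \<in> words"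
      have xw: "x # w \<in> words" "x \<in> carrier R" using x by auto
      show "I (ct f a c (pw (x # w))) =
               ct (Q f) a c (pw (x # w))
               \<ominus>\<^bsub>S\<^esub> ct \<one> (a \<otimes>\<^bsub>A\<^esub> e (Q f) (pw (x # w))) c (pw [])
               \<ominus>\<^bsub>S\<^esub> I (ct (Q f \<otimes> x) a c (pw w))
               \<oplus>\<^bsub>S\<^esub> ct \<one> a c (pw (rem f # x # w))"
        using m x(2) xw r by (simp add: ct_eq c J_scaled(2)[OF m x(2,1)] del: J.simps RT_sel)
    qed
  }
qed

lemma int_spec_exists: "\<exists>I. int_spec I"
proof -
  obtain I where I: "I \<in> mod_hom C S S"
    "\<And>f a c w. \<lbrakk>f \<in> carrier R; a \<in> carrier A; c \<in> carrier K; w \<in> words\<rbrakk>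
      \<Longrightarrow> I (gen f a c w) = al a \<otimes>\<^bsub>S\<^esub> (nk c \<otimes>\<^bsub>S\<^esub> J f w)"
    using I_exists by blast
  have "int_spec I" unfolding int_spec_iff[OF I(1)] by (intro ballI I(2))
  then show ?thesis by blast
qed

end

text \<open>The derivation and the integral are choices as well, so only their specifications are
  assumed.\<close>

locale closure = closure0 +
  fixes dS iS
  assumes dS: "der_spec dS" and iS: "int_spec iS"
begin

section \<open>The Leibniz rule, and the integral as a right inverse of the derivation\<close>

lemma dS_hom: "dS \<in> mod_hom C S S" using dS unfolding der_spec_def by blast
lemma iS_hom: "iS \<in> mod_hom C S S" using iS unfolding int_spec_def by blast

lemma iS_gen: "\<lbrakk>f \<in> carrier R; a \<in> carrier A; c \<in> carrier K; w \<in> words\<rbrakk> \<Longrightarrow>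
    iS (gen f a c w) = al a \<otimes>\<^bsub>S\<^esub> (nk c \<otimes>\<^bsub>S\<^esub> J f w)"
  using iS int_spec_iff[OF iS_hom] by blast

lemmas dS_closed = mod_hom_closed[OF dS_hom]
lemmas iS_closed = mod_hom_closed[OF iS_hom]
lemmas dS_add = mod_hom_add[OF dS_hom]
lemmas iS_add = mod_hom_add[OF iS_hom]
lemmas dS_minus = mod_hom_minus[OF Sm Sm dS_hom]
lemmas dS_uminus = mod_hom_uminus[OF Sm Sm dS_hom]
lemmas dS_zero = mod_hom_zero[OF Sm Sm dS_hom]
lemmas iS_zero = mod_hom_zero[OF Sm Sm iS_hom]

lemma dS_gen:
  assumes "f \<in> carrier R" "a \<in> carrier A" "c \<in> carrier K" "w \<in> words"
  shows "dS (gen f a c w) = gen (der f) a c w \<oplus>\<^bsub>S\<^esub> io f \<otimes>\<^bsub>S\<^esub> (al a \<otimes>\<^bsub>S\<^esub> (nk c \<otimes>\<^bsub>S\<^esub> strip w))"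
proof (cases w)
  case Nil
  have "dS (ct f a c (pw [])) = ct (der f) a c (pw [])"
    using dS assms unfolding der_spec_def by blast
  then show ?thesis using Nil assms by (simp add: ct_eq der_closed)
next
  case (Cons x v)
  then have x: "x \<in> carrier (RT R Q)" "v \<in> words" "x \<in> carrier R" using assms by auto
  have "dS (ct f a c (pw (x # v))) = ct (der f) a c (pw (x # v)) \<oplus>\<^bsub>S\<^esub> ct (f \<otimes> x) a c (pw v)"
    using dS assms x unfolding der_spec_def by blast
  moreover have "gen (f \<otimes> x) a c v = io f \<otimes>\<^bsub>S\<^esub> (al a \<otimes>\<^bsub>S\<^esub> (nk c \<otimes>\<^bsub>S\<^esub> strip w))"
    using Cons assms x by (simp add: gen_def io_mult S.m_ac)
  ultimately show ?thesis using Cons assms x by (simp add: ct_eq der_closed del: strip.simps)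
qed

lemma gen_tens: "\<lbrakk>r \<in> carrier R; a \<in> carrier A; c \<in> carrier K; w \<in> words\<rbrakk> \<Longrightarrow>
    io r \<otimes>\<^bsub>S\<^esub> jb (tens C A N a (tn c (pw w))) = gen r a c w"
  unfolding gen_def by (simp add: jb_tens nu_tn tn_closed_N pt_closed)

lemma dS_io_jb:
  assumes "r \<in> carrier R" "b \<in> carrier B"
  shows "dS (io r \<otimes>\<^bsub>S\<^esub> jb b) = io (der r) \<otimes>\<^bsub>S\<^esub> jb b \<oplus>\<^bsub>S\<^esub> io r \<otimes>\<^bsub>S\<^esub> theta b"
proof (rule mod_hom_eqI[OF algebra_is_module[OF B] Sm spans_B _ _ _ assms(2)])
  have c: "io r \<in> carrier S" "io (der r) \<in> carrier S" using assms by (simp_all add: der_closed)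
  show "(\<lambda>b. dS (io r \<otimes>\<^bsub>S\<^esub> jb b)) \<in> mod_hom C B S"
    by (intro mod_hom_comp[OF dS_hom mod_hom_multl[OF S c(1) alg_homD(1)[OF jb]]])
  show "(\<lambda>b. io (der r) \<otimes>\<^bsub>S\<^esub> jb b \<oplus>\<^bsub>S\<^esub> io r \<otimes>\<^bsub>S\<^esub> theta b) \<in> mod_hom C B S"
    by (intro mod_hom_addf[OF Sm] mod_hom_multl[OF S] c theta(1) alg_homD(1)[OF jb])
  fix x assume "x \<in> {tens C A N a (tn c (pw w)) |a c w. a \<in> carrier A \<and> c \<in> carrier K \<and> w \<in> words}"
  then obtain a k w where x: "a \<in> carrier A" "k \<in> carrier K" "w \<in> words" "x = tens C A N a (tn k (pw w))" by blast
  show "dS (io r \<otimes>\<^bsub>S\<^esub> jb x) = io (der r) \<otimes>\<^bsub>S\<^esub> jb x \<oplus>\<^bsub>S\<^esub> io r \<otimes>\<^bsub>S\<^esub> theta x"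
    unfolding x(4) using x assms
    by (simp add: gen_tens dS_gen der_closed theta tau tn_closed_N pt_closed del: RT_sel)
qed

text \<open>On pure tensors the rule splits into the Leibniz rule of R and
  \<open>theta_mult\<close>.\<close>

lemma dS_mult:
  assumes "u \<in> carrier S" "v \<in> carrier S"
  shows "dS (u \<otimes>\<^bsub>S\<^esub> v) = dS u \<otimes>\<^bsub>S\<^esub> v \<oplus>\<^bsub>S\<^esub> u \<otimes>\<^bsub>S\<^esub> dS v"
proof -
  note sp = spans_tensor_alg[OF algebra_RR B spans_carrier[OF module_RR] spans_carrier[OF algebra_is_module[OF B]]]
  note nb = algebra_bihom[OF S]
  show ?thesis
  proof (rule mod_bihom_eqI[OF Sm Sm Sm sp sp _ _ _ assms])
    show "(\<lambda>u v. dS (u \<otimes>\<^bsub>S\<^esub> v)) \<in> mod_bihom C S S S"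
      by (intro mod_bihomI mod_hom_comp[OF dS_hom mod_bihom_left[OF nb]] mod_hom_comp[OF dS_hom mod_bihom_right[OF nb]])
    show "(\<lambda>u v. dS u \<otimes>\<^bsub>S\<^esub> v \<oplus>\<^bsub>S\<^esub> u \<otimes>\<^bsub>S\<^esub> dS v) \<in> mod_bihom C S S S"
      by (intro mod_bihomI mod_hom_addf[OF Sm] mod_hom_multl[OF S _ dS_hom] mod_hom_multr[OF S _ dS_hom]
        mod_hom_multl[OF S _ mod_hom_id] mod_hom_multr[OF S _ mod_hom_id]) (simp_all add: dS_closed)
    fix u v assume "u \<in> {tens C RR B x y |x y. x \<in> carrier RR \<and> y \<in> carrier B}" "v \<in> {tens C RR B x y |x y. x \<in> carrier RR \<and> y \<in> carrier B}"
    then obtain r b s d where u: "r \<in> carrier RR" "b \<in> carrier B" "u = tens C RR B r b"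
      and v: "s \<in> carrier RR" "d \<in> carrier B" "v = tens C RR B s d" by blast
    have u': "u = io r \<otimes>\<^bsub>S\<^esub> jb b" and v': "v = io s \<otimes>\<^bsub>S\<^esub> jb d" using u v by (simp_all add: tens_S)
    have rs: "r \<in> carrier R" "s \<in> carrier R" using u v by simp_all
    have uv: "u \<otimes>\<^bsub>S\<^esub> v = io (r \<otimes> s) \<otimes>\<^bsub>S\<^esub> jb (b \<otimes>\<^bsub>B\<^esub> d)"
      unfolding u' v' using rs u(2) v(2) by (simp add: io_mult jb_mult S.m_ac)
    have c: "io r \<in> carrier S" "io s \<in> carrier S" "io (der r) \<in> carrier S" "io (der s) \<in> carrier S"
      "jb b \<in> carrier S" "jb d \<in> carrier S" "theta b \<in> carrier S" "theta d \<in> carrier S"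
      using rs u v by (simp_all add: der_closed theta_closed)
    have "dS (u \<otimes>\<^bsub>S\<^esub> v) = io (der (r \<otimes> s)) \<otimes>\<^bsub>S\<^esub> jb (b \<otimes>\<^bsub>B\<^esub> d) \<oplus>\<^bsub>S\<^esub> io (r \<otimes> s) \<otimes>\<^bsub>S\<^esub> theta (b \<otimes>\<^bsub>B\<^esub> d)"
      unfolding uv using rs u(2) v(2) by (simp add: dS_io_jb)
    also have "\<dots> = (io (der r) \<otimes>\<^bsub>S\<^esub> io s \<oplus>\<^bsub>S\<^esub> io r \<otimes>\<^bsub>S\<^esub> io (der s)) \<otimes>\<^bsub>S\<^esub> (jb b \<otimes>\<^bsub>S\<^esub> jb d) \<oplus>\<^bsub>S\<^esub>
        (io r \<otimes>\<^bsub>S\<^esub> io s) \<otimes>\<^bsub>S\<^esub> (theta b \<otimes>\<^bsub>S\<^esub> jb d \<oplus>\<^bsub>S\<^esub> jb b \<otimes>\<^bsub>S\<^esub> theta d)"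
      using rs u(2) v(2) by (simp add: der_mult io_add io_mult jb_mult theta_mult der_closed)
    also have "\<dots> = dS u \<otimes>\<^bsub>S\<^esub> v \<oplus>\<^bsub>S\<^esub> u \<otimes>\<^bsub>S\<^esub> dS v"
      unfolding u' v' using rs u(2) v(2) c by (simp add: dS_io_jb S.r_distr S.l_distr S.m_ac S.a_ac)
    finally show "dS (u \<otimes>\<^bsub>S\<^esub> v) = dS u \<otimes>\<^bsub>S\<^esub> v \<oplus>\<^bsub>S\<^esub> u \<otimes>\<^bsub>S\<^esub> dS v" .
  qed
qed

lemma dS_jb: "b \<in> carrier B \<Longrightarrow> dS (jb b) = theta b"
  using dS_io_jb[of \<one> b] by (simp add: der_one theta_closed)

lemma one_N: "\<one>\<^bsub>N\<^esub> = wd []" by (simp add: N_sel wd_def)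

lemma dS_al: "a \<in> carrier A \<Longrightarrow> dS (al a) = \<zero>\<^bsub>S\<^esub>"
  unfolding al_def
  by (simp add: dS_jb tens_alg_closed[OF A algebra_N] theta) (simp add: one_N tau_wd)

lemma dS_nu: "n \<in> carrier N \<Longrightarrow> dS (nu n) = tau n"
  unfolding nu_def by (simp add: dS_jb tens_alg_closed[OF A algebra_N] theta tau_closed)

lemma dS_nk: "c \<in> carrier K \<Longrightarrow> dS (nk c) = \<zero>\<^bsub>S\<^esub>"
  unfolding nk_def by (simp add: dS_nu tau_kap alg_homD(3)[OF kap])

lemma dS_nw: "w \<in> words \<Longrightarrow> dS (nw w) = strip w"
  unfolding nw_def by (simp add: dS_nu tau_wd wd_closed)

lemma dS_io: "r \<in> carrier R \<Longrightarrow> dS (io r) = io (der r)"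
  using dS_io_jb[of r "\<one>\<^bsub>B\<^esub>"] dS_jb[of "\<one>\<^bsub>B\<^esub>"] alg_homD(7)[OF jb] dS_al[of "\<one>\<^bsub>A\<^esub>"]
  by (simp add: der_closed)

sublocale dring: comm_differential_ring S dS
  by unfold_locales (simp_all add: dS_closed dS_add dS_mult)

text \<open>When the recursion is differentiated, the term in which the derivation removes the first
  letter cancels against the induction hypothesis for \<open>J (Q f \<otimes> x) w\<close>. What
  remains has the coefficient \<partial>Qf + (f - \<partial>Qf) = f.\<close>

lemma dS_J: "\<lbrakk>f \<in> carrier R; w \<in> words\<rbrakk> \<Longrightarrow> dS (J f w) = io f \<otimes>\<^bsub>S\<^esub> nw w"
proof (induction w arbitrary: f)
  case Nil
  have c: "nw [rem f] \<in> carrier S" using Nil rem_words[of f "[]"] by simp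
  have "dS (J f []) = io (der (Q f)) \<oplus>\<^bsub>S\<^esub> io (rem f)"
    using Nil c rem_words[of f "[]"]
    by (simp add: dS_add dS_uminus dS_io dS_al dS_nw e_closed Q_closed der_closed S.minus_eq rem_closed)
  also have "\<dots> = io (der (Q f) \<oplus> rem f)" using Nil by (simp add: io_add der_closed Q_closed rem_closed)
  finally show ?case using Nil by (simp add: rem_sum)
next
  case (Cons x w)
  then have x: "x \<in> carrier R" "w \<in> words" "x # w \<in> words" "f \<in> carrier R" by simp_all
  have w: "rem f # x # w \<in> words" using x rem_words by simp
  have q: "Q f \<in> carrier R" "Q f \<otimes> x \<in> carrier R" using x by (simp_all add: Q_closed)
  have J: "J (Q f \<otimes> x) w \<in> carrier S" "dS (J (Q f \<otimes> x) w) = io (Q f \<otimes> x) \<otimes>\<^bsub>S\<^esub> nw w"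
    using J_closed Cons.IH x q by auto
  have c: "io (Q f) \<in> carrier S" "io (der (Q f)) \<in> carrier S" "io x \<in> carrier S" "nw w \<in> carrier S" "nw (x # w) \<in> carrier S"
    "nw (rem f # x # w) \<in> carrier S" "al (e (Q f) (pw (x # w))) \<in> carrier S" "io (rem f) \<in> carrier S"
    using q x w e_closed[of f "x # w"] by (simp_all add: der_closed rem_closed)
  have "dS (J f (x # w)) = (io (der (Q f)) \<otimes>\<^bsub>S\<^esub> nw (x # w) \<oplus>\<^bsub>S\<^esub> io (Q f) \<otimes>\<^bsub>S\<^esub> (io x \<otimes>\<^bsub>S\<^esub> nw w)) \<ominus>\<^bsub>S\<^esub> \<zero>\<^bsub>S\<^esub>
      \<ominus>\<^bsub>S\<^esub> io (Q f \<otimes> x) \<otimes>\<^bsub>S\<^esub> nw w \<oplus>\<^bsub>S\<^esub> io (rem f) \<otimes>\<^bsub>S\<^esub> nw (x # w)"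
  proof -
    have "dS (J f (x # w)) = dS (io (Q f) \<otimes>\<^bsub>S\<^esub> nw (x # w)) \<ominus>\<^bsub>S\<^esub> dS (al (e (Q f) (pw (x # w))))
        \<ominus>\<^bsub>S\<^esub> dS (J (Q f \<otimes> x) w) \<oplus>\<^bsub>S\<^esub> dS (nw (rem f # x # w))"
      unfolding J.simps using c J(1) by (simp add: dS_add dS_minus)
    then show ?thesis
      using c J q x w e_closed[of f "x # w"] by (simp add: dS_mult dS_io dS_al dS_nw del: RT_sel)
  qed
  also have "\<dots> = io (der (Q f)) \<otimes>\<^bsub>S\<^esub> nw (x # w) \<oplus>\<^bsub>S\<^esub> io (rem f) \<otimes>\<^bsub>S\<^esub> nw (x # w)"
    using c q x by (simp add: io_mult S.minus_eq S.m_assoc S.a_assoc S.r_neg1) (simp add: S.a_ac S.r_neg S.r_neg1 S.r_neg2)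
  also have "\<dots> = io (der (Q f) \<oplus> rem f) \<otimes>\<^bsub>S\<^esub> nw (x # w)"
    using c x q by (simp add: io_add der_closed rem_closed S.l_distr)
  finally show ?case using x by (simp add: rem_sum)
qed

lemma gen_split: "\<lbrakk>f \<in> carrier R; a \<in> carrier A; c \<in> carrier K; w \<in> words\<rbrakk> \<Longrightarrow>
    gen f a c w = (al a \<otimes>\<^bsub>S\<^esub> nk c) \<otimes>\<^bsub>S\<^esub> (io f \<otimes>\<^bsub>S\<^esub> nw w)"
  unfolding gen_def by (simp add: S.m_ac)

lemma dS_iS:
  assumes "u \<in> carrier S" shows "dS (iS u) = u"
proof (rule S_eqI[OF Sm mod_hom_comp[OF dS_hom iS_hom] mod_hom_id _ assms])
  fix f a c w assume m: "f \<in> carrier R" "a \<in> carrier A" "c \<in> carrier K" "w \<in> words"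
  have Jc: "J f w \<in> carrier S" using m J_closed by blast
  show "dS (iS (gen f a c w)) = gen f a c w"
    unfolding iS_gen[OF m]
    using m Jc by (simp add: dS_mult dS_al dS_nk dS_J dS_closed gen_def S.m_ac)
qed

lemma J_zero: "w \<in> words \<Longrightarrow> J \<zero> w = \<zero>\<^bsub>S\<^esub>"
  using mod_hom_zero[OF module_RR Sm J_hom] by simp

lemma e_zero: "t \<in> carrier T \<Longrightarrow> e \<zero> t = \<zero>\<^bsub>A\<^esub>"
  using mod_hom_zero[OF module_RJ A.module_axioms mod_bihom_left[OF e]] by simp

text \<open>Here \<open>Q x\<close> vanishes and \<open>rem x\<close> is \<open>x\<close>. Hence a
  word is literally the nested integral of its letters.\<close>

lemma J_RT: "\<lbrakk>x \<in> carrier (RT R Q); w \<in> words\<rbrakk> \<Longrightarrow> J x w = nw (x # w)"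
proof (cases w)
  assume x: "x \<in> carrier (RT R Q)" "w \<in> words"
  have xw: "nw (x # w) \<in> carrier S" using x by simp
  have q: "Q x = \<zero>" "x \<in> carrier R" using x by simp_all
  {
    case Nil
    then show ?thesis using xw q rem_RT_eq[OF x(1)] by (simp add: e_zero pt_closed S.minus_eq)
  next
    case (Cons y v)
    have y: "y \<in> carrier R" "v \<in> words" "pw (y # v) \<in> carrier T" "nw (y # v) \<in> carrier S"
      using x(2) Cons pt_closed[of w] nw_closed[of w] by simp_all
    then show ?thesis using xw q rem_RT_eq[OF x(1)] Cons by (simp add: e_zero J_zero S.minus_eq)
  }
qed

lemma iS_io_nw: "\<lbrakk>f \<in> carrier R; w \<in> words\<rbrakk> \<Longrightarrow> iS (io f \<otimes>\<^bsub>S\<^esub> nw w) = J f w"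
  using iS_gen[of f "\<one>\<^bsub>A\<^esub>" "\<one>\<^bsub>K\<^esub>" w] J_closed[of f w] by (simp add: gen_def)

subsection \<open>The constants\<close>

text \<open>\<open>Z\<close> consists of those elements over which the integral is linear. Since \<open>1 - \<integral>\<partial>\<close> maps into \<open>Z\<close>, the
  constants lie in \<open>Z\<close>.\<close>

definition Z where "Z = {z \<in> carrier S. \<forall>x\<in>carrier S. iS (z \<otimes>\<^bsub>S\<^esub> x) = z \<otimes>\<^bsub>S\<^esub> iS x}"

lemma ZD: "z \<in> Z \<Longrightarrow> z \<in> carrier S" "\<lbrakk>z \<in> Z; x \<in> carrier S\<rbrakk> \<Longrightarrow> iS (z \<otimes>\<^bsub>S\<^esub> x) = z \<otimes>\<^bsub>S\<^esub> iS x"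
  by (auto simp: Z_def)

lemma Z_add: "\<lbrakk>y \<in> Z; z \<in> Z\<rbrakk> \<Longrightarrow> y \<oplus>\<^bsub>S\<^esub> z \<in> Z"
  by (simp add: Z_def S.l_distr iS_add iS_closed)

lemma Z_mult: "\<lbrakk>y \<in> Z; z \<in> Z\<rbrakk> \<Longrightarrow> y \<otimes>\<^bsub>S\<^esub> z \<in> Z"
  by (simp add: Z_def S.m_assoc iS_closed)

lemma Z_smult: "\<lbrakk>c \<in> constants R der; z \<in> Z\<rbrakk> \<Longrightarrow> c \<odot>\<^bsub>S\<^esub> z \<in> Z"
  by (simp add: Z_def S.smult_assoc2 iS_closed mod_hom_smult[OF iS_hom])

lemma Z_one: "\<one>\<^bsub>S\<^esub> \<in> Z"
  by (simp add: Z_def iS_closed)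

lemma Z_submodule: "submodule Z C S"
proof (rule S.submoduleI_smult)
  show "\<zero>\<^bsub>S\<^esub> \<in> Z" by (simp add: Z_def iS_zero iS_closed)
qed (use ZD Z_add Z_smult in auto)

text \<open>Multiplication by \<open>a\<close> changes only the factor from \<open>A\<close> of a
  pure tensor, and the integral leaves that factor outside.\<close>

lemma Z_al: "a \<in> carrier A \<Longrightarrow> al a \<in> Z"
proof -
  assume a: "a \<in> carrier A"
  have "iS (al a \<otimes>\<^bsub>S\<^esub> x) = al a \<otimes>\<^bsub>S\<^esub> iS x" if "x \<in> carrier S" for x
  proof (rule S_eqI[OF Sm _ _ _ that])
    show "(\<lambda>x. iS (al a \<otimes>\<^bsub>S\<^esub> x)) \<in> mod_hom C S S" "(\<lambda>x. al a \<otimes>\<^bsub>S\<^esub> iS x) \<in> mod_hom C S S"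
      using mod_hom_comp[OF iS_hom mod_hom_multl[OF S al_closed[OF a] mod_hom_id]]
        mod_hom_multl[OF S al_closed[OF a] iS_hom] by auto
    fix r b c w assume m: "r \<in> carrier R" "b \<in> carrier A" "c \<in> carrier K" "w \<in> words"
    have "al a \<otimes>\<^bsub>S\<^esub> gen r b c w = gen r (a \<otimes>\<^bsub>A\<^esub> b) c w" using m a by (simp add: gen_def al_mult S.m_ac)
    then show "iS (al a \<otimes>\<^bsub>S\<^esub> gen r b c w) = al a \<otimes>\<^bsub>S\<^esub> iS (gen r b c w)"
      using m a J_closed[OF m(1,4)] by (simp add: iS_gen al_mult S.m_assoc)
  qed
  then show ?thesis using a by (simp add: Z_def)
qed

lemma Z_nk: "d \<in> carrier K \<Longrightarrow> nk d \<in> Z"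
proof -
  assume a: "d \<in> carrier K"
  have "iS (nk d \<otimes>\<^bsub>S\<^esub> x) = nk d \<otimes>\<^bsub>S\<^esub> iS x" if "x \<in> carrier S" for x
  proof (rule S_eqI[OF Sm _ _ _ that])
    show "(\<lambda>x. iS (nk d \<otimes>\<^bsub>S\<^esub> x)) \<in> mod_hom C S S" "(\<lambda>x. nk d \<otimes>\<^bsub>S\<^esub> iS x) \<in> mod_hom C S S"
      using mod_hom_comp[OF iS_hom mod_hom_multl[OF S nk_closed[OF a] mod_hom_id]]
        mod_hom_multl[OF S nk_closed[OF a] iS_hom] by auto
    fix r b c w assume m: "r \<in> carrier R" "b \<in> carrier A" "c \<in> carrier K" "w \<in> words"
    have "nk d \<otimes>\<^bsub>S\<^esub> gen r b c w = gen r b (d \<otimes>\<^bsub>K\<^esub> c) w" using m a by (simp add: gen_def nk_mult S.m_ac)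
    then show "iS (nk d \<otimes>\<^bsub>S\<^esub> gen r b c w) = nk d \<otimes>\<^bsub>S\<^esub> iS (gen r b c w)"
      using m a J_closed[OF m(1,4)] by (simp add: iS_gen nk_mult S.m_ac)
  qed
  then show ?thesis using a by (simp add: Z_def)
qed

lemma Z_io: "k \<in> constants R der \<Longrightarrow> io k \<in> Z"
  by (simp add: io_const Z_smult Z_one)

text \<open>The difference can be computed. At the empty word it is the constant part of
  \<open>r\<close> plus the pairing of \<open>Q (der r)\<close> with the empty word; at a nonempty
  \<open>w\<close> it is the pairing of \<open>Q (der r)\<close> with \<open>w\<close> alone. Both
  are visibly in \<open>Z\<close>.\<close>

lemma ev_io_nw:
  assumes r: "r \<in> carrier R" and w: "w \<in> words"
  shows "io r \<otimes>\<^bsub>S\<^esub> nw w \<ominus>\<^bsub>S\<^esub> iS (dS (io r \<otimes>\<^bsub>S\<^esub> nw w)) \<in> Z"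
proof -
  define k where "k = r \<ominus> Q (der r)"
  have k: "k \<in> constants R der" unfolding k_def by (rule minus_Q_der_const[OF r])
  have kR: "k \<in> carrier R" using k by (simp add: constants_iff)
  have qc: "Q (der r) \<in> carrier R" "der r \<in> carrier R" using r by (simp_all add: Q_closed der_closed)
  have rk: "r = k \<oplus> Q (der r)" unfolding k_def using r qc by (simp add: minus_eq a_assoc l_neg)
  have iork: "io r = io k \<oplus>\<^bsub>S\<^esub> io (Q (der r))" using rk kR qc by (metis io_add)
  have ec: "al (e (Q (der r)) (pw w)) \<in> carrier S" using e_closed[OF qc(2) w] by simp
  have "\<exists>z\<in>Z. io r \<otimes>\<^bsub>S\<^esub> nw w = z \<oplus>\<^bsub>S\<^esub> iS (dS (io r \<otimes>\<^bsub>S\<^esub> nw w))"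
  proof (cases w)
    case Nil
    have J: "iS (dS (io r \<otimes>\<^bsub>S\<^esub> nw w)) = io (Q (der r)) \<ominus>\<^bsub>S\<^esub> al (e (Q (der r)) (pw []))"
      using r Nil iS_io_nw[of "der r" "[]"] qc ec
      by (simp add: dS_io rem_der nw_zero)
    have z: "io k \<oplus>\<^bsub>S\<^esub> al (e (Q (der r)) (pw [])) \<in> Z"
      using e_closed[OF qc(2) w] Nil by (intro Z_add Z_io[OF k] Z_al) simp
    show ?thesis
    proof (rule bexI[OF _ z])
      show "io r \<otimes>\<^bsub>S\<^esub> nw w = io k \<oplus>\<^bsub>S\<^esub> al (e (Q (der r)) (pw [])) \<oplus>\<^bsub>S\<^esub> iS (dS (io r \<otimes>\<^bsub>S\<^esub> nw w))"
        unfolding J using Nil qc kR ec r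
        by (simp add: iork S.minus_eq S.a_ac S.r_neg S.r_neg1 S.r_neg2)
    qed
  next
    case (Cons x v)
    then have x: "x \<in> carrier (RT R Q)" "x \<in> carrier R" "v \<in> words" using w by auto
    have c: "io r \<in> carrier S" "io k \<in> carrier S" "io (Q (der r)) \<in> carrier S" "nw w \<in> carrier S" "nw v \<in> carrier S"
      "io (der r) \<in> carrier S" "io x \<in> carrier S"
      using r kR qc w x by simp_all
    have d: "dS (io r \<otimes>\<^bsub>S\<^esub> nw w) = io (der r) \<otimes>\<^bsub>S\<^esub> nw w \<oplus>\<^bsub>S\<^esub> io (r \<otimes> x) \<otimes>\<^bsub>S\<^esub> nw v"
      using c r w x Cons by (simp add: dS_mult dS_io dS_nw io_mult S.m_assoc del: RT_sel)
    have Jc: "J (Q (der r) \<otimes> x) v \<in> carrier S" "J (k \<otimes> x) v \<in> carrier S" "J (r \<otimes> x) v \<in> carrier S"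
      using qc kR r x by (simp_all add: J_closed)
    have J1: "J (der r) w = io (Q (der r)) \<otimes>\<^bsub>S\<^esub> nw w \<ominus>\<^bsub>S\<^esub> al (e (Q (der r)) (pw w)) \<ominus>\<^bsub>S\<^esub> J (Q (der r) \<otimes> x) v"
      unfolding Cons J.simps using r w Cons c ec Jc nw_zero[of "x # v"] by (simp add: rem_der)
    have J2: "J (r \<otimes> x) v = J (k \<otimes> x) v \<oplus>\<^bsub>S\<^esub> J (Q (der r) \<otimes> x) v"
    proof -
      have "r \<otimes> x = k \<otimes> x \<oplus> Q (der r) \<otimes> x" using rk kR qc x by (metis l_distr)
      then show ?thesis using mod_hom_add[OF J_hom[OF x(3)], of "k \<otimes> x" "Q (der r) \<otimes> x"] kR qc x by simp
    qed
    \<comment> \<open>As \<open>k\<close> is constant and \<open>x\<close> lies in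
      \<open>RT\<close>, integrating amounts to prefixing \<open>x\<close>. This supplies the part
      of \<open>io r\<close> times \<open>nw w\<close> with coefficient \<open>k\<close>, which the
      term with \<open>Q (der r)\<close> misses.\<close>
    have J3: "J (k \<otimes> x) v = io k \<otimes>\<^bsub>S\<^esub> nw w"
      using mod_hom_smult[OF J_hom[OF x(3)], of k x] k x Cons c(4) by (simp add: J_RT io_const_mult)
    have I: "iS (dS (io r \<otimes>\<^bsub>S\<^esub> nw w)) = J (der r) w \<oplus>\<^bsub>S\<^esub> J (r \<otimes> x) v"
      unfolding d using qc w x r by (simp add: iS_add iS_io_nw)
    have z: "al (e (Q (der r)) (pw w)) \<in> Z"
      by (rule Z_al[OF e_closed[OF qc(2) w]])
    show ?thesis
    proof (rule bexI[OF _ z])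
      have "io k \<otimes>\<^bsub>S\<^esub> nw w \<in> carrier S" "io (Q (der r)) \<otimes>\<^bsub>S\<^esub> nw w \<in> carrier S" using c by simp_all
      then show "io r \<otimes>\<^bsub>S\<^esub> nw w = al (e (Q (der r)) (pw w)) \<oplus>\<^bsub>S\<^esub> iS (dS (io r \<otimes>\<^bsub>S\<^esub> nw w))"
        unfolding I J1 J2 J3 unfolding iork using ec Jc c
        by algebra
    qed
  qed
  then obtain z where z: "z \<in> Z" "io r \<otimes>\<^bsub>S\<^esub> nw w = z \<oplus>\<^bsub>S\<^esub> iS (dS (io r \<otimes>\<^bsub>S\<^esub> nw w))" by blast
  have c: "iS (dS (io r \<otimes>\<^bsub>S\<^esub> nw w)) \<in> carrier S" using r w by (simp add: iS_closed dS_closed)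
  have "io r \<otimes>\<^bsub>S\<^esub> nw w \<ominus>\<^bsub>S\<^esub> iS (dS (io r \<otimes>\<^bsub>S\<^esub> nw w)) = z"
    by (subst z(2)) (use z(1) ZD c in \<open>simp add: S.minus_eq S.a_assoc S.r_neg\<close>)
  then show ?thesis using z(1) by simp
qed

text \<open>The factors from \<open>A\<close> and \<open>K\<close> are annihilated by the derivation
  and lie in \<open>Z\<close>, so they pass through both maps, and only the factors from R and the
  word matter.\<close>

lemma ev_Z:
  assumes "u \<in> carrier S" shows "u \<ominus>\<^bsub>S\<^esub> iS (dS u) \<in> Z"
proof (rule mod_hom_submodule[OF Sm Sm spans_S _ Z_submodule _ assms])
  show "(\<lambda>u. u \<ominus>\<^bsub>S\<^esub> iS (dS u)) \<in> mod_hom C S S"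
    by (intro mod_hom_minusf[OF Sm] mod_hom_id mod_hom_comp[OF iS_hom dS_hom])
  fix g assume "g \<in> {gen r a c w |r a c w. r \<in> carrier R \<and> a \<in> carrier A \<and> c \<in> carrier K \<and> w \<in> words}"
  then obtain r a c w where m: "r \<in> carrier R" "a \<in> carrier A" "c \<in> carrier K" "w \<in> words" "g = gen r a c w" by blast
  define z where "z = al a \<otimes>\<^bsub>S\<^esub> nk c"
  have z: "z \<in> Z" "z \<in> carrier S" unfolding z_def using m by (simp_all add: Z_mult Z_al Z_nk)
  have dz: "dS z = \<zero>\<^bsub>S\<^esub>" unfolding z_def using m by (simp add: dS_mult dS_al dS_nk)
  have y: "io r \<otimes>\<^bsub>S\<^esub> nw w \<in> carrier S" using m by simp
  have g: "g = z \<otimes>\<^bsub>S\<^esub> (io r \<otimes>\<^bsub>S\<^esub> nw w)" unfolding m(5) z_def by (rule gen_split[OF m(1-4)])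
  have "dS g = z \<otimes>\<^bsub>S\<^esub> dS (io r \<otimes>\<^bsub>S\<^esub> nw w)" unfolding g using z y dz dS_closed[OF y] dS_mult[OF z(2) y] by simp
  then have "iS (dS g) = z \<otimes>\<^bsub>S\<^esub> iS (dS (io r \<otimes>\<^bsub>S\<^esub> nw w))" using ZD(2)[OF z(1) dS_closed[OF y]] by simp
  then have "g \<ominus>\<^bsub>S\<^esub> iS (dS g) = z \<otimes>\<^bsub>S\<^esub> (io r \<otimes>\<^bsub>S\<^esub> nw w \<ominus>\<^bsub>S\<^esub> iS (dS (io r \<otimes>\<^bsub>S\<^esub> nw w)))"
    using z y iS_closed[OF dS_closed[OF y]] by (simp add: g S.minus_eq S.r_distr S.r_minus)
  then show "g \<ominus>\<^bsub>S\<^esub> iS (dS g) \<in> Z" using Z_mult[OF z(1) ev_io_nw[OF m(1,4)]] by simp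
qed

lemma constants_Z: "constants S dS \<subseteq> Z"
proof
  fix u assume "u \<in> constants S dS"
  then have u: "u \<in> carrier S" "dS u = \<zero>\<^bsub>S\<^esub>" by (simp_all add: constants_def)
  then show "u \<in> Z" using ev_Z[OF u(1)] by (simp add: iS_zero S.minus_eq)
qed

theorem integro_differential: "comm_integro_differential_ring S dS iS"
  by unfold_locales (use constants_Z ZD in \<open>auto simp: iS_closed iS_add dS_iS\<close>)

section \<open>The embedding of R and its injectivity\<close>

lemma io_differential_hom: "differential_hom R der S dS io"
proof -
  have "io \<in> ring_hom R S"
    by (rule ring_hom_memI) (simp_all add: io_mult io_add)
  then show ?thesis unfolding differential_hom_def by (simp add: dS_io)
qed

text \<open>A derivative has remainder zero, so besides the first term of \<open>J\<close> only the
  pairing could survive.\<close>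

lemma iS_io:
  assumes "f \<in> carrier R" "e (Q (der f)) (pw []) = \<zero>\<^bsub>A\<^esub>"
  shows "iS (io (der f)) = io (Q (der f))"
  using iS_io_nw[of "der f" "[]"] assms
  by (simp add: der_closed Q_closed rem_der nw_zero S.minus_eq)

text \<open>Over an arbitrary commutative ring a tensor factor need not embed. The augmentations
  \<open>pA\<close> and \<open>pK\<close>, together with the projection of tensors to the
  coefficient of the empty word, define a left inverse of \<open>io\<close>.\<close>

lemma io_inj:
  assumes pA: "pA \<in> mod_hom C A RR" "pA \<one>\<^bsub>A\<^esub> = \<one>" and pK: "pK \<in> mod_hom C K RR" "pK \<one>\<^bsub>K\<^esub> = \<one>"
  shows "inj_on io (carrier R)"
proof -
  define \<phi> where "\<phi> w = (if w = [] then \<one> else \<zero>)" for w :: "'a list"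
  have "multilinear C (RT R Q) RR \<phi>"
    by (rule multilinearI) (use mod_hom_const_zero[OF module_RR] in \<open>simp_all add: \<phi>_def\<close>)
  then obtain pT where pT: "pT \<in> mod_hom C T RR" "\<And>w. w \<in> words \<Longrightarrow> pT (pw w) = \<phi> w"
    using tpowers_lift[OF M module_RR] by blast
  have "(\<lambda>c t. pK c \<otimes>\<^bsub>RR\<^esub> pT t) \<in> mod_bihom C K T RR"
    using mod_hom_closed[OF pK(1)] mod_hom_closed[OF pT(1)]
    by (intro mod_bihomI mod_hom_multl[OF algebra_RR _ pT(1)] mod_hom_multr[OF algebra_RR _ pK(1)]) simp_all
  from tensor_lift[OF Km T module_RR this] obtain pN where pN: "pN \<in> mod_hom C N0 RR"
    "\<And>c t. \<lbrakk>c \<in> carrier K; t \<in> carrier T\<rbrakk> \<Longrightarrow> pN (tn c t) = pK c \<otimes>\<^bsub>RR\<^esub> pT t" by blast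
  have pN': "pN \<in> mod_hom C N RR" using pN(1) by (simp add: N_updates)
  obtain pB where pB: "pB \<in> mod_hom C B RR"
    "\<And>a n. \<lbrakk>a \<in> carrier A; n \<in> carrier N\<rbrakk> \<Longrightarrow> pB (tens C A N a n) = pA a \<otimes>\<^bsub>RR\<^esub> pN n"
    using tensor_alg_lift_mult[OF A algebra_N algebra_RR pA(1) pN'] by blast
  obtain pS where pS: "pS \<in> mod_hom C S RR"
    "\<And>r b. \<lbrakk>r \<in> carrier RR; b \<in> carrier B\<rbrakk> \<Longrightarrow> pS (tens C RR B r b) = r \<otimes>\<^bsub>RR\<^esub> pB b"
    using tensor_alg_lift_mult[OF algebra_RR B algebra_RR mod_hom_id pB(1)] by blast
  have "pS (io r) = r" if "r \<in> carrier R" for r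
    unfolding io_def using that tn_closed_N[of "\<one>\<^bsub>K\<^esub>" "pw []"]
    by (simp add: pS tensor_alg_one[OF A algebra_N] tens_alg_closed[OF A algebra_N] pB pA N_sel(5) pN pK pT pt_closed \<phi>_def)
  then show ?thesis by (metis inj_onI)
qed

subsection \<open>Generation\<close>

text \<open>Words are integrals of shorter words by \<open>J_RT\<close>. The pairings
  \<open>e\<close> are recovered by solving the recursion of \<open>J\<close> for them, and the
  pairings \<open>e2\<close> by solving the product recursion of words. The hypotheses
  \<open>genA\<close> and \<open>genK\<close> then reach all of \<open>A\<close> and
  \<open>K\<close>.\<close>

lemma generated:
  assumes H: "submodule H C S" and Hm: "\<And>u v. \<lbrakk>u \<in> H; v \<in> H\<rbrakk> \<Longrightarrow> u \<otimes>\<^bsub>S\<^esub> v \<in> H"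
    and Hi: "\<And>u. u \<in> H \<Longrightarrow> iS u \<in> H" and Hio: "\<And>r. r \<in> carrier R \<Longrightarrow> io r \<in> H"
    and genA: "\<And>A'. \<lbrakk>submodule A' C A; \<one>\<^bsub>A\<^esub> \<in> A';
      \<And>r w a. \<lbrakk>r \<in> carrier (RJ R Q); w \<in> words; a \<in> A'\<rbrakk> \<Longrightarrow> e r (pw w) \<otimes>\<^bsub>A\<^esub> a \<in> A'\<rbrakk> \<Longrightarrow> carrier A \<subseteq> A'"
    and genK: "\<And>K'. \<lbrakk>submodule K' C K; \<one>\<^bsub>K\<^esub> \<in> K';
      \<And>f g c. \<lbrakk>f \<in> words; g \<in> words; f \<noteq> []; g \<noteq> []; c \<in> K'\<rbrakk> \<Longrightarrow> e2 (pw f) (pw g) \<otimes>\<^bsub>K\<^esub> c \<in> K'\<rbrakk> \<Longrightarrow> carrier K \<subseteq> K'"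
  shows "carrier S \<subseteq> H"
proof -
  have HS: "u \<in> carrier S" if "u \<in> H" for u using that S.submoduleE(1)[OF H] by blast
  have Hadd: "u \<oplus>\<^bsub>S\<^esub> v \<in> H" if "u \<in> H" "v \<in> H" for u v using that by (rule S.submoduleE(5)[OF H])
  have Hmin: "u \<ominus>\<^bsub>S\<^esub> v \<in> H" if "u \<in> H" "v \<in> H" for u v
    unfolding S.minus_eq using that S.submoduleE(3)[OF H] Hadd by blast
  have H1: "\<one>\<^bsub>S\<^esub> \<in> H" using Hio[OF one_closed] by simp
  have nwH: "nw w \<in> H" if "w \<in> words" for w
    using that
  proof (induction w)
    case Nil then show ?case using H1 by simp
  next
    case (Cons x w)
    then have x: "x \<in> carrier (RT R Q)" "x \<in> carrier R" "w \<in> words" by simp_all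
    have "iS (io x \<otimes>\<^bsub>S\<^esub> nw w) \<in> H" using Cons x by (intro Hi Hm Hio) simp_all
    then show ?case using x by (simp add: iS_io_nw J_RT)
  qed
  have JH: "J f w \<in> H" if "f \<in> carrier R" "w \<in> words" for f w
    using iS_io_nw[OF that] Hi[OF Hm[OF Hio[OF that(1)] nwH[OF that(2)]]] by simp
  have alH: "al (e r (pw w)) \<in> H" if r: "r \<in> carrier (RJ R Q)" and w: "w \<in> words" for r w
  proof -
    obtain f where f: "f \<in> carrier R" "r = Q f" using r by auto
    have q: "Q f \<in> carrier R" using f by (simp add: Q_closed)
    note qc = io_closed[OF q]
    have ec: "al (e r (pw w)) \<in> carrier S" using e_closed[OF f(1) w] f by simp
    have rw: "rem f # w \<in> words" using f w rem_words by simp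
    show ?thesis
    proof (cases w)
      case Nil
      have "al (e r (pw w)) = (io (Q f) \<oplus>\<^bsub>S\<^esub> nw [rem f]) \<ominus>\<^bsub>S\<^esub> J f []"
        using ec qc nw_closed[OF rw] f(2) unfolding Nil J.simps by (simp only: Nil) algebra
      then show ?thesis using Hmin[OF Hadd[OF Hio[OF q] nwH[OF rw]] JH[OF f(1)], of "[]"] Nil by simp
    next
      case (Cons x v)
      then have x: "x \<in> carrier R" "v \<in> words" using w by simp_all
      have Jc: "J (Q f \<otimes> x) v \<in> H" "J f w \<in> H" using x q f w JH by simp_all
      have "al (e r (pw w)) = (io (Q f) \<otimes>\<^bsub>S\<^esub> nw w \<oplus>\<^bsub>S\<^esub> nw (rem f # w)) \<ominus>\<^bsub>S\<^esub> J (Q f \<otimes> x) v \<ominus>\<^bsub>S\<^esub> J f w"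
        using ec qc nw_closed[OF rw] nw_closed[OF w] HS[OF Jc(1)] f(2)
        unfolding Cons J.simps by (simp only: Cons) algebra
      then show ?thesis using Hmin[OF Hmin[OF Hadd[OF Hm[OF Hio[OF q] nwH[OF w]] nwH[OF rw]] Jc(1)] Jc(2)] by simp
    qed
  qed
  \<comment> \<open>Integration against a letter of \<open>RT\<close> is prefixing, here for
    arbitrary elements of \<open>N\<close>, because the product recursion prefixes letters to
    products of words.\<close>
  have cnsH: "iS (io x \<otimes>\<^bsub>S\<^esub> nu u) = nu (cns x u)" if x: "x \<in> carrier (RT R Q)" and u: "u \<in> carrier N" for x u
  proof (rule N_eqI[OF Sm _ _ _ u])
    have xR: "io x \<in> carrier S" using x by simp
    show "(\<lambda>u. iS (io x \<otimes>\<^bsub>S\<^esub> nu u)) \<in> mod_hom C N S"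
      by (rule mod_hom_comp[OF iS_hom mod_hom_multl[OF S xR alg_homD(1)[OF nu]]])
    show "(\<lambda>u. nu (cns x u)) \<in> mod_hom C N S"
      by (rule mod_hom_comp[OF alg_homD(1)[OF nu] cns_hom_N[OF x]])
    fix c w assume cw: "c \<in> carrier K" "w \<in> words"
    have xw: "x # w \<in> words" "x \<in> carrier R" using x cw by simp_all
    have "io x \<otimes>\<^bsub>S\<^esub> nu (tn c (pw w)) = nk c \<otimes>\<^bsub>S\<^esub> (io x \<otimes>\<^bsub>S\<^esub> nw w)"
      using cw xR by (simp add: nu_tn S.m_ac)
    then have "iS (io x \<otimes>\<^bsub>S\<^esub> nu (tn c (pw w))) = nk c \<otimes>\<^bsub>S\<^esub> nw (x # w)"
      using cw xR xw x ZD(2)[OF Z_nk[OF cw(1)]] by (simp add: iS_io_nw J_RT)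
    then show "iS (io x \<otimes>\<^bsub>S\<^esub> nu (tn c (pw w))) = nu (cns x (tn c (pw w)))"
      using cw x xw by (simp add: cns_pt nu_tn del: RT_sel)
  qed
  have nkH: "nk (e2 (pw f) (pw g)) \<in> H" if fg: "f \<in> words" "g \<in> words" "f \<noteq> []" "g \<noteq> []" for f g
  proof -
    obtain x f' y g' where f: "f = x # f'" and g: "g = y # g'" using fg by (meson neq_Nil_conv)
    have m: "x \<in> carrier (RT R Q)" "f' \<in> words" "y \<in> carrier (RT R Q)" "g' \<in> words" using fg f g by simp_all
    note wc = wd_closed[OF fg(1)] wd_closed[OF fg(2)] wd_closed[OF m(2)] wd_closed[OF m(4)]
    define a where "a = cns x (wd f' \<otimes>\<^bsub>N\<^esub> wd g)"
    define b where "b = cns y (wd f \<otimes>\<^bsub>N\<^esub> wd g')"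
    have ab: "a \<in> carrier N" "b \<in> carrier N" unfolding a_def b_def using wc m
      by (simp_all add: mod_hom_closed[OF cns_hom_N] del: RT_sel)
    have kc: "kap (e2 (pw f) (pw g)) \<in> carrier N" using fg by (simp add: alg_homD(3)[OF kap] e2_closed pt_closed)
    have "wd f \<otimes>\<^bsub>N\<^esub> wd g = a \<oplus>\<^bsub>N\<^esub> b \<oplus>\<^bsub>N\<^esub> kap (e2 (pw f) (pw g))"
      unfolding a_def b_def f g using wd_Cons_mult[OF m] by (simp add: N_sel)
    then have "nw f \<otimes>\<^bsub>S\<^esub> nw g = nu a \<oplus>\<^bsub>S\<^esub> nu b \<oplus>\<^bsub>S\<^esub> nk (e2 (pw f) (pw g))"
      unfolding nw_def nk_def using ab kc wc by (simp add: alg_homD(5)[OF nu] flip: alg_homD(4)[OF nu])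
    then have 1: "nk (e2 (pw f) (pw g)) = nw f \<otimes>\<^bsub>S\<^esub> nw g \<ominus>\<^bsub>S\<^esub> nu a \<ominus>\<^bsub>S\<^esub> nu b"
      using nu_closed[OF ab(1)] nu_closed[OF ab(2)] nu_closed[OF kc, folded nk_def]
      by (simp only:) algebra
    have "nu a = iS (io x \<otimes>\<^bsub>S\<^esub> (nw f' \<otimes>\<^bsub>S\<^esub> nw g))" "nu b = iS (io y \<otimes>\<^bsub>S\<^esub> (nw f \<otimes>\<^bsub>S\<^esub> nw g'))"
      unfolding a_def b_def using wc m by (simp_all add: nw_def alg_homD(4)[OF nu] flip: cnsH)
    then have "nu a \<in> H" "nu b \<in> H"
      using m fg by (auto intro!: Hi Hm Hio nwH)
    then show ?thesis unfolding 1 using fg by (intro Hmin Hm nwH)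
  qed
  define A' where "A' = {a \<in> carrier A. al a \<in> H}"
  have smul: "c \<odot>\<^bsub>S\<^esub> u \<in> H" if "c \<in> constants R der" "u \<in> H" for c u using S.submoduleE(4)[OF H] that by simp
  have "carrier A \<subseteq> A'"
  proof (rule genA)
    show "submodule A' C A"
      by (rule A.submoduleI)
        (use S.submoduleE(3)[OF H] submodule_zero[OF H] Hadd smul in
          \<open>auto simp: A'_def mod_hom_uminus[OF A.module_axioms Sm alg_homD(1)[OF al]] alg_homD[OF al]\<close>)
    show "\<one>\<^bsub>A\<^esub> \<in> A'" using H1 by (simp add: A'_def)
    show "e r (pw w) \<otimes>\<^bsub>A\<^esub> a \<in> A'" if "r \<in> carrier (RJ R Q)" "w \<in> words" "a \<in> A'" for r w a
      using that alH[OF that(1,2)] mod_bihom_closed[OF e that(1) pt_closed[OF that(2)]] Hm by (simp add: A'_def al_mult)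
  qed
  define K' where "K' = {a \<in> carrier K. nk a \<in> H}"
  have "carrier K \<subseteq> K'"
  proof (rule genK)
    show "submodule K' C K"
      by (rule K.submoduleI)
        (use S.submoduleE(3)[OF H] submodule_zero[OF H] Hadd smul in
          \<open>auto simp: K'_def mod_hom_uminus[OF Km Sm alg_homD(1)[OF nk]] mod_hom_zero[OF Km Sm alg_homD(1)[OF nk]] alg_homD[OF nk]\<close>)
    show "\<one>\<^bsub>K\<^esub> \<in> K'" using H1 by (simp add: K'_def)
    show "e2 (pw f) (pw g) \<otimes>\<^bsub>K\<^esub> c \<in> K'" if "f \<in> words" "g \<in> words" "f \<noteq> []" "g \<noteq> []" "c \<in> K'" for f g c
      using that nkH[OF that(1-4)] Hm e2_closed pt_closed by (simp add: K'_def nk_mult)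
  qed
  have "{gen r a c w |r a c w. r \<in> carrier R \<and> a \<in> carrier A \<and> c \<in> carrier K \<and> w \<in> words} \<subseteq> H"
    unfolding gen_def using \<open>carrier A \<subseteq> A'\<close> \<open>carrier K \<subseteq> K'\<close> A'_def K'_def by (auto intro!: Hm Hio nwH)
  from submodule_gen_least[OF H this] show ?thesis using spans_S unfolding spans_def by simp
qed

end

section \<open>Algebra homomorphisms out of a closure\<close>

context closure0
begin

lemma S_lift:
  assumes P: "algebra C P" and h: "h \<in> alg_hom C RR P" and f: "f \<in> alg_hom C A P" and g: "g \<in> alg_hom C N P"
  obtains \<phi> where "\<phi> \<in> alg_hom C S P" "\<And>r. r \<in> carrier R \<Longrightarrow> \<phi> (io r) = h r"
    "\<And>a. a \<in> carrier A \<Longrightarrow> \<phi> (al a) = f a" "\<And>n. n \<in> carrier N \<Longrightarrow> \<phi> (nu n) = g n"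
proof -
  interpret P: algebra C P by fact
  obtain b where b: "b \<in> alg_hom C B P"
    "\<And>a n. \<lbrakk>a \<in> carrier A; n \<in> carrier N\<rbrakk> \<Longrightarrow> b (tens C A N a n) = f a \<otimes>\<^bsub>P\<^esub> g n"
    using tensor_alg_lift[OF A algebra_N P f g] by blast
  obtain \<phi> where \<phi>: "\<phi> \<in> alg_hom C S P"
    "\<And>r x. \<lbrakk>r \<in> carrier RR; x \<in> carrier B\<rbrakk> \<Longrightarrow> \<phi> (tens C RR B r x) = h r \<otimes>\<^bsub>P\<^esub> b x"
    using tensor_alg_lift[OF algebra_RR B P h b(1)] by blast
  have h1: "h \<one> = \<one>\<^bsub>P\<^esub>" using alg_homD(7)[OF h] by simp
  have hc: "h r \<in> carrier P" if "r \<in> carrier R" for r using alg_homD(3)[OF h] that by simp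
  show thesis
  proof (rule that[OF \<phi>(1)])
    show "\<phi> (io r) = h r" if "r \<in> carrier R" for r
      unfolding io_def using that hc by (simp add: \<phi>(2) alg_homD(7)[OF b(1)])
    show "\<phi> (al a) = f a" if "a \<in> carrier A" for a
      unfolding al_def jb_def using that
      by (simp add: \<phi>(2) tens_alg_closed[OF A algebra_N] h1 b(2) alg_homD[OF g] alg_homD(3)[OF f])
    show "\<phi> (nu n) = g n" if "n \<in> carrier N" for n
      unfolding nu_def jb_def using that
      by (simp add: \<phi>(2) tens_alg_closed[OF A algebra_N] h1 b(2) alg_homD[OF f] alg_homD(3)[OF g])
  qed
qed

end

section \<open>Changing the first algebra of constants\<close>

text \<open>By \<open>p_e\<close> and \<open>e'_Nil\<close> the map \<open>p\<close> kills the
  pairings with the empty word, while \<open>s\<close> returns the other pairings unchanged. The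
  assumptions \<open>genA\<close> and \<open>genK\<close> say that pairings generate
  \<open>A\<close> and \<open>K\<close>, in the form of induction principles.\<close>

locale closure_pair =
  X: closure R der Q K e2 N A e dS iS + Y: closure R der Q K e2 N A' e' dS' iS'
  for R :: "'a ring" (structure) and der Q and K :: "('a, 'k) module" and e2 N
    and A :: "('a, 'x) module" and e dS iS and A' :: "('a, 'y) module" and e' dS' iS' +
  fixes p s
  assumes p: "p \<in> alg_hom (const_ring R der) A A'" and s: "s \<in> alg_hom (const_ring R der) A' A"
    and p_e: "\<And>r w. \<lbrakk>r \<in> carrier (RJ R Q); w \<in> lists (carrier (RT R Q))\<rbrakk> \<Longrightarrow>
        p (e r (pure (const_ring R der) (RT R Q) w)) = e' r (pure (const_ring R der) (RT R Q) w)"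
    and p_s: "\<And>a. a \<in> carrier A' \<Longrightarrow> p (s a) = a"
    and e'_Nil: "\<And>r. r \<in> carrier (RJ R Q) \<Longrightarrow> e' r (pure (const_ring R der) (RT R Q) []) = \<zero>\<^bsub>A'\<^esub>"
    and s_e': "\<And>r w. \<lbrakk>r \<in> carrier (RJ R Q); w \<in> lists (carrier (RT R Q)); w \<noteq> []\<rbrakk> \<Longrightarrow>
        s (e' r (pure (const_ring R der) (RT R Q) w)) = e r (pure (const_ring R der) (RT R Q) w)"
    and genA: "\<And>H. \<lbrakk>submodule H (const_ring R der) A; \<one>\<^bsub>A\<^esub> \<in> H;
      \<And>r w a. \<lbrakk>r \<in> carrier (RJ R Q); w \<in> lists (carrier (RT R Q)); a \<in> H\<rbrakk> \<Longrightarrow>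
        e r (pure (const_ring R der) (RT R Q) w) \<otimes>\<^bsub>A\<^esub> a \<in> H\<rbrakk> \<Longrightarrow> carrier A \<subseteq> H"
    and genK: "\<And>H. \<lbrakk>submodule H (const_ring R der) K; \<one>\<^bsub>K\<^esub> \<in> H;
      \<And>f g c. \<lbrakk>f \<in> lists (carrier (RT R Q)); g \<in> lists (carrier (RT R Q)); f \<noteq> []; g \<noteq> []; c \<in> H\<rbrakk> \<Longrightarrow>
        e2 (pure (const_ring R der) (RT R Q) f) (pure (const_ring R der) (RT R Q) g) \<otimes>\<^bsub>K\<^esub> c \<in> H\<rbrakk> \<Longrightarrow> carrier K \<subseteq> H"
begin

abbreviation "SX \<equiv> X.S"
abbreviation "SY \<equiv> Y.S"

lemma phi_exists:
  "\<exists>\<phi>. \<phi> \<in> alg_hom X.C SX SY \<and> (\<forall>r\<in>carrier R. \<phi> (X.io r) = Y.io r) \<and>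
    (\<forall>a\<in>carrier A. \<phi> (X.al a) = Y.al (p a)) \<and> (\<forall>n\<in>carrier N. \<phi> (X.nu n) = Y.nu n)"
  using X.S_lift[OF Y.S Y.io alg_hom_comp[OF p Y.al] Y.nu] by metis

definition phi where
  "phi = (SOME \<phi>. \<phi> \<in> alg_hom X.C SX SY \<and> (\<forall>r\<in>carrier R. \<phi> (X.io r) = Y.io r) \<and>
    (\<forall>a\<in>carrier A. \<phi> (X.al a) = Y.al (p a)) \<and> (\<forall>n\<in>carrier N. \<phi> (X.nu n) = Y.nu n))"

lemma phi: "phi \<in> alg_hom X.C SX SY" "r \<in> carrier R \<Longrightarrow> phi (X.io r) = Y.io r"
  "a \<in> carrier A \<Longrightarrow> phi (X.al a) = Y.al (p a)" "n \<in> carrier N \<Longrightarrow> phi (X.nu n) = Y.nu n"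
  using someI_ex[OF phi_exists, folded phi_def] by blast+

lemmas phi_D = alg_homD[OF phi(1)]
lemmas phi_minus = mod_hom_minus[OF X.Sm Y.Sm phi_D(1)]
lemmas phi_zero = mod_hom_zero[OF X.Sm Y.Sm phi_D(1)]

lemma phi_nw: "w \<in> X.words \<Longrightarrow> phi (X.nw w) = Y.nw w"
  unfolding X.nw_def Y.nw_def by (simp add: phi X.wd_closed del: RT_sel)

lemma phi_nk: "c \<in> carrier K \<Longrightarrow> phi (X.nk c) = Y.nk c"
  unfolding X.nk_def Y.nk_def by (simp add: phi alg_homD(3)[OF X.kap])

lemma p_closed: "a \<in> carrier A \<Longrightarrow> p a \<in> carrier A'" by (rule alg_homD(3)[OF p])
lemma s_closed: "a \<in> carrier A' \<Longrightarrow> s a \<in> carrier A" by (rule alg_homD(3)[OF s])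

lemma phi_gen: "\<lbrakk>r \<in> carrier R; a \<in> carrier A; c \<in> carrier K; w \<in> X.words\<rbrakk> \<Longrightarrow>
    phi (X.gen r a c w) = Y.gen r (p a) c w"
  unfolding X.gen_def Y.gen_def by (simp add: phi_D phi phi_nw phi_nk del: RT_sel)

lemma phi_strip: "w \<in> X.words \<Longrightarrow> phi (X.strip w) = Y.strip w"
  by (cases w) (simp_all add: phi_zero phi_D phi phi_nw)

text \<open>The two recursions have the same shape, and \<open>p\<close> carries one pairing to the
  other.\<close>

lemma phi_J: "\<lbrakk>f \<in> carrier R; w \<in> X.words\<rbrakk> \<Longrightarrow> phi (X.J f w) = Y.J f w"
proof (induction w arbitrary: f)
  case Nil
  have q: "Q f \<in> carrier (RJ R Q)" "Q f \<in> carrier R" using Nil by (simp_all add: X.Q_closed)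
  have c: "[X.rem f] \<in> X.words" "X.nw [X.rem f] \<in> carrier SX" "X.al (e (Q f) (X.pw [])) \<in> carrier SX" "X.io (Q f) \<in> carrier SX"
    using Nil X.rem_words[of f "[]"] X.nw_closed[of "[X.rem f]"] X.e_closed[of f "[]"] q by simp_all
  show ?case
    using c q p_e[of "Q f" "[]"] X.e_closed[OF Nil(1), of "[]"]
    by (simp add: phi_D phi_minus phi phi_nw del: RT_sel RJ_sel)
next
  case (Cons x w)
  then have f: "f \<in> carrier R" and x: "x \<in> carrier R" "w \<in> X.words" "x # w \<in> X.words" by simp_all
  have q: "Q f \<in> carrier (RJ R Q)" "Q f \<in> carrier R" "Q f \<otimes> x \<in> carrier R" using f x by (simp_all add: X.Q_closed)
  have rw: "X.rem f # x # w \<in> X.words" using X.rem_words[OF f x(3)] .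
  have c: "X.nw (X.rem f # x # w) \<in> carrier SX" "X.al (e (Q f) (X.pw (x # w))) \<in> carrier SX" "X.io (Q f) \<in> carrier SX"
    "X.nw (x # w) \<in> carrier SX" "X.J (Q f \<otimes> x) w \<in> carrier SX" "e (Q f) (X.pw (x # w)) \<in> carrier A"
    using X.nw_closed[OF rw] X.nw_closed[OF x(3)] X.e_closed[OF f x(3)] q X.J_closed[OF q(3) x(2)] by simp_all
  have IH: "phi (X.J (Q f \<otimes> x) w) = Y.J (Q f \<otimes> x) w" using Cons.IH[OF q(3) x(2)] .
  show ?case unfolding X.J.simps Y.J.simps
    using c q p_e[OF q(1) x(3)] IH phi_nw[OF rw] phi_nw[OF x(3)]
    by (simp add: phi_D phi_minus phi del: RT_sel RJ_sel X.J.simps Y.J.simps)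
qed

lemma phi_dS:
  assumes "u \<in> carrier SX" shows "phi (dS u) = dS' (phi u)"
proof (rule X.S_eqI[OF Y.Sm mod_hom_comp[OF phi_D(1) X.dS_hom] mod_hom_comp[OF Y.dS_hom phi_D(1)] _ assms])
  fix r a c w assume m: "r \<in> carrier R" "a \<in> carrier A" "c \<in> carrier K" "w \<in> X.words"
  show "phi (dS (X.gen r a c w)) = dS' (phi (X.gen r a c w))"
    unfolding X.dS_gen[OF m] phi_gen[OF m] Y.dS_gen[OF m(1) p_closed[OF m(2)] m(3,4)]
    using m X.strip_closed[OF m(4)]
    by (simp add: phi_D phi_gen phi phi_nk phi_strip X.der_closed del: RT_sel X.strip.simps Y.strip.simps)
qed

lemma phi_iS:
  assumes "u \<in> carrier SX" shows "phi (iS u) = iS' (phi u)"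
proof (rule X.S_eqI[OF Y.Sm mod_hom_comp[OF phi_D(1) X.iS_hom] mod_hom_comp[OF Y.iS_hom phi_D(1)] _ assms])
  fix r a c w assume m: "r \<in> carrier R" "a \<in> carrier A" "c \<in> carrier K" "w \<in> X.words"
  show "phi (iS (X.gen r a c w)) = iS' (phi (X.gen r a c w))"
    unfolding X.iS_gen[OF m] phi_gen[OF m] Y.iS_gen[OF m(1) p_closed[OF m(2)] m(3,4)]
    using m X.J_closed[OF m(1,4)]
    by (simp add: phi_D phi phi_nk phi_J del: RT_sel)
qed

text \<open>The section is compared with \<open>phi\<close> purely as an algebra homomorphism;
  derivations and integrals enter through \<open>phi\<close> alone.\<close>

lemma sigma_exists:
  "\<exists>\<sigma>. \<sigma> \<in> alg_hom X.C SY SX \<and> (\<forall>r\<in>carrier R. \<sigma> (Y.io r) = X.io r) \<and>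
    (\<forall>a\<in>carrier A'. \<sigma> (Y.al a) = X.al (s a)) \<and> (\<forall>n\<in>carrier N. \<sigma> (Y.nu n) = X.nu n)"
  using Y.S_lift[OF X.S X.io alg_hom_comp[OF s X.al] X.nu] by metis

definition sigma where
  "sigma = (SOME \<sigma>. \<sigma> \<in> alg_hom X.C SY SX \<and> (\<forall>r\<in>carrier R. \<sigma> (Y.io r) = X.io r) \<and>
    (\<forall>a\<in>carrier A'. \<sigma> (Y.al a) = X.al (s a)) \<and> (\<forall>n\<in>carrier N. \<sigma> (Y.nu n) = X.nu n))"

lemma sigma: "sigma \<in> alg_hom X.C SY SX" "r \<in> carrier R \<Longrightarrow> sigma (Y.io r) = X.io r"
  "a \<in> carrier A' \<Longrightarrow> sigma (Y.al a) = X.al (s a)" "n \<in> carrier N \<Longrightarrow> sigma (Y.nu n) = X.nu n"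
  using someI_ex[OF sigma_exists, folded sigma_def] by blast+

lemmas sigma_D = alg_homD[OF sigma(1)]

lemma sigma_gen: "\<lbrakk>r \<in> carrier R; a \<in> carrier A'; c \<in> carrier K; w \<in> X.words\<rbrakk> \<Longrightarrow>
    sigma (Y.gen r a c w) = X.gen r (s a) c w"
  unfolding X.gen_def Y.gen_def X.nk_def Y.nk_def X.nw_def Y.nw_def
  by (simp add: sigma_D sigma alg_homD(3)[OF X.kap] X.wd_closed del: RT_sel)

lemma phi_sigma:
  assumes "u \<in> carrier SY" shows "phi (sigma u) = u"
  by (rule Y.S_eqI[OF Y.Sm mod_hom_comp[OF phi_D(1) sigma_D(1)] mod_hom_id _ assms])
    (simp add: sigma_gen phi_gen s_closed p_s del: RT_sel)

lemma phi_surj: "phi ` carrier SX = carrier SY"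
  using phi_D(3) phi_sigma sigma_D(3) by (metis image_subsetI imageI subsetI subset_antisym)

section \<open>Ideals between the pairings with the empty tensor and the kernel of
  \<open>phi\<close>\<close>

context
  fixes I
  assumes I: "integro_differential_ideal I SX dS iS"
    and I_ker: "\<And>u. u \<in> I \<Longrightarrow> phi u = \<zero>\<^bsub>SY\<^esub>"
    and I_gen: "\<And>r. r \<in> carrier (RJ R Q) \<Longrightarrow> X.al (e r (X.pw [])) \<in> I"
begin

interpretation I: ideal I SX using I unfolding integro_differential_ideal_def by blast

lemma I_dS: "u \<in> I \<Longrightarrow> dS u \<in> I" and I_iS: "u \<in> I \<Longrightarrow> iS u \<in> I"
  using I unfolding integro_differential_ideal_def by blast+

lemma I_submodule: "submodule I X.C SX"
  by (rule ideal_submodule[OF X.Sm X.S.ring_axioms algebra_bihom[OF X.S] I.ideal_axioms])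

text \<open>By \<open>genA\<close> it is enough to pass from \<open>a\<close> to the product of a
  pairing with \<open>a\<close>. A pairing with the empty word lies in the ideal and is sent to zero
  by \<open>p\<close>; any other pairing is fixed by \<open>s\<close> after
  \<open>p\<close>.\<close>

lemma al_diff:
  assumes "a \<in> carrier A" shows "X.al a \<ominus>\<^bsub>SX\<^esub> X.al (s (p a)) \<in> I"
proof -
  define H where "H = {a \<in> carrier A. X.al a \<ominus>\<^bsub>SX\<^esub> X.al (s (p a)) \<in> I}"
  note Im = X.S.submoduleE[OF I_submodule]
  have d: "(\<lambda>a. X.al a \<ominus>\<^bsub>SX\<^esub> X.al (s (p a))) \<in> mod_hom X.C A SX"
    by (intro mod_hom_minusf[OF X.Sm] alg_homD(1)[OF X.al]
        mod_hom_comp[OF alg_homD(1)[OF X.al] mod_hom_comp[OF alg_homD(1)[OF s] alg_homD(1)[OF p]]])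
  have "carrier A \<subseteq> H"
  proof (rule genA)
    show "submodule H X.C A"
      by (rule X.A.submoduleI_smult)
        (use Im submodule_zero[OF I_submodule] mod_hom_add[OF d] mod_hom_smult[OF d] mod_hom_zero[OF X.A.module_axioms X.Sm d]
         in \<open>auto simp: H_def\<close>)
    show "\<one>\<^bsub>A\<^esub> \<in> H" using I.zero_closed
      by (simp add: H_def alg_homD(7)[OF p] alg_homD(7)[OF s] X.S.minus_self)
    fix r w a assume r: "r \<in> carrier (RJ R Q)" and w: "w \<in> X.words" and a: "a \<in> H"
    define b where "b = e r (X.pw w)"
    have b: "b \<in> carrier A" unfolding b_def using mod_bihom_closed[OF X.e r X.pt_closed[OF w]] .
    have ac: "a \<in> carrier A" "X.al a \<ominus>\<^bsub>SX\<^esub> X.al (s (p a)) \<in> I" using a by (simp_all add: H_def)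
    have bI: "X.al b \<ominus>\<^bsub>SX\<^esub> X.al (s (p b)) \<in> I"
    proof (cases "w = []")
      case True
      have pb: "p b = \<zero>\<^bsub>A'\<^esub>" using p_e[OF r w] e'_Nil[OF r] True by (simp add: b_def)
      have "s (p b) = \<zero>\<^bsub>A\<^esub>" unfolding pb by (rule mod_hom_zero[OF Y.A.module_axioms X.A.module_axioms alg_homD(1)[OF s]])
      then show ?thesis using I_gen[OF r] True b by (simp add: b_def X.S.minus_eq)
    next
      case False
      then have "s (p b) = b" using p_e[OF r w] s_e'[OF r w] by (simp add: b_def)
      then show ?thesis using I.zero_closed b by (simp add: X.S.minus_self)
    qed
    define a1 where "a1 = X.al a"
    define a2 where "a2 = X.al (s (p a))"
    define b1 where "b1 = X.al b"
    define b2 where "b2 = X.al (s (p b))"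
    have c: "a1 \<in> carrier SX" "a2 \<in> carrier SX" "b1 \<in> carrier SX" "b2 \<in> carrier SX"
      unfolding a1_def a2_def b1_def b2_def using b ac by (simp_all add: p_closed s_closed)
    have "X.al (b \<otimes>\<^bsub>A\<^esub> a) \<ominus>\<^bsub>SX\<^esub> X.al (s (p (b \<otimes>\<^bsub>A\<^esub> a))) = b1 \<otimes>\<^bsub>SX\<^esub> a1 \<ominus>\<^bsub>SX\<^esub> b2 \<otimes>\<^bsub>SX\<^esub> a2"
      unfolding a1_def a2_def b1_def b2_def using b ac
      by (simp add: X.al_mult alg_homD(4)[OF p] alg_homD(4)[OF s] p_closed s_closed)
    also have "\<dots> = b1 \<otimes>\<^bsub>SX\<^esub> (a1 \<ominus>\<^bsub>SX\<^esub> a2) \<oplus>\<^bsub>SX\<^esub> (b1 \<ominus>\<^bsub>SX\<^esub> b2) \<otimes>\<^bsub>SX\<^esub> a2"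
      using c by algebra
    also have "\<dots> \<in> I"
      using ac(2) bI c unfolding a1_def[symmetric] a2_def[symmetric] b1_def[symmetric] b2_def[symmetric]
      by (intro I.a_closed I.I_l_closed I.I_r_closed)
    finally show "e r (X.pw w) \<otimes>\<^bsub>A\<^esub> a \<in> H" using b ac by (simp add: H_def b_def)
  qed
  then show ?thesis using assms by (auto simp: H_def)
qed

text \<open>On a pure tensor the composite changes only the factor from \<open>A\<close>, which
  \<open>al_diff\<close> covers.\<close>

lemma sigma_phi_diff:
  assumes "u \<in> carrier SX" shows "u \<ominus>\<^bsub>SX\<^esub> sigma (phi u) \<in> I"
proof (rule mod_hom_submodule[OF X.Sm X.Sm X.spans_S _ I_submodule _ assms])
  show "(\<lambda>u. u \<ominus>\<^bsub>SX\<^esub> sigma (phi u)) \<in> mod_hom X.C SX SX"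
    by (intro mod_hom_minusf[OF X.Sm] mod_hom_id mod_hom_comp[OF sigma_D(1) phi_D(1)])
  fix g assume "g \<in> {X.gen r a c w |r a c w. r \<in> carrier R \<and> a \<in> carrier A \<and> c \<in> carrier K \<and> w \<in> X.words}"
  then obtain r a c w where m: "r \<in> carrier R" "a \<in> carrier A" "c \<in> carrier K" "w \<in> X.words" "g = X.gen r a c w" by blast
  define x where "x = X.nk c \<otimes>\<^bsub>SX\<^esub> (X.io r \<otimes>\<^bsub>SX\<^esub> X.nw w)"
  have x: "x \<in> carrier SX" unfolding x_def using m by simp
  have sp: "s (p a) \<in> carrier A" using m by (simp add: p_closed s_closed)
  have "sigma (phi g) = X.gen r (s (p a)) c w"
    unfolding m(5) using m(1-4) by (simp add: phi_gen sigma_gen p_closed del: RT_sel)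
  then have "g = X.al a \<otimes>\<^bsub>SX\<^esub> x" "sigma (phi g) = X.al (s (p a)) \<otimes>\<^bsub>SX\<^esub> x"
    unfolding m(5) x_def using m(1-4) sp by (simp_all add: X.gen_split X.S.m_assoc del: RT_sel)
  then have "g \<ominus>\<^bsub>SX\<^esub> sigma (phi g) = (X.al a \<ominus>\<^bsub>SX\<^esub> X.al (s (p a))) \<otimes>\<^bsub>SX\<^esub> x"
    using m(2) sp x by (simp add: X.S.minus_eq X.S.l_distr X.S.l_minus)
  then show "g \<ominus>\<^bsub>SX\<^esub> sigma (phi g) \<in> I" using I.I_r_closed[OF al_diff[OF m(2)] x] by simp
qed

text \<open>If \<open>phi u\<close> is zero, then \<open>u\<close> equals its difference to
  \<open>sigma (phi u)\<close>, which lies in the ideal.\<close>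

lemma I_eq_kernel: "I = a_kernel SX SY phi"
proof -
  have "u \<in> I" if "u \<in> carrier SX" "phi u = \<zero>\<^bsub>SY\<^esub>" for u
    using sigma_phi_diff[OF that(1)] that mod_hom_zero[OF Y.Sm X.Sm sigma_D(1)] by (simp add: X.S.minus_eq)
  then show ?thesis using I_ker I.a_subset by (auto simp: a_kernel_def')
qed

lemma phi_ring_hom: "ring_hom_ring SX SY phi"
  by (rule ring_hom_ringI2[OF X.S.ring_axioms Y.S.ring_axioms phi_D(2)])

text \<open>The induced map is a union over representatives. They all yield the same coset because
  \<open>h\<close> preserves the ideal.\<close>

lemma induced_coset:
  assumes h: "h \<in> mod_hom X.C SX SX" and hI: "\<And>u. u \<in> I \<Longrightarrow> h u \<in> I" and u: "u \<in> carrier SX"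
  shows "induced_map SX I h (I +>\<^bsub>SX\<^esub> u) = I +>\<^bsub>SX\<^esub> h u"
proof -
  have "I +>\<^bsub>SX\<^esub> h v = I +>\<^bsub>SX\<^esub> h u" if "v \<in> I +>\<^bsub>SX\<^esub> u" for v
  proof -
    obtain i where i: "i \<in> I" "v = i \<oplus>\<^bsub>SX\<^esub> u" using \<open>v \<in> I +>\<^bsub>SX\<^esub> u\<close> by (auto simp: a_r_coset_def')
    have ic: "i \<in> carrier SX" using i(1) I.a_subset by blast
    have hc: "h i \<in> carrier SX" "h u \<in> carrier SX" using mod_hom_closed[OF h] ic u by auto
    have hv: "h v = h i \<oplus>\<^bsub>SX\<^esub> h u" unfolding i(2) by (rule mod_hom_add[OF h ic u])
    have "h v \<ominus>\<^bsub>SX\<^esub> h u = h i" unfolding hv using hc by algebra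
    then show ?thesis
      using hI[OF i(1)] hc hv by (intro quot_mod_eqI[OF X.Sm I_submodule]) simp_all
  qed
  moreover have "I +>\<^bsub>SX\<^esub> u \<noteq> {}" using I.a_rcos_self[OF u] by blast
  ultimately show ?thesis unfolding induced_map_def by (intro SUP_eq_const)
qed

lemma Quot_carrier: "carrier (SX Quot I) = (\<lambda>u. I +>\<^bsub>SX\<^esub> u) ` carrier SX"
  by (auto simp: FactRing_def A_RCOSETS_def')

lemma Quot_ops:
  assumes "u \<in> carrier SX" "v \<in> carrier SX"
  shows "(I +>\<^bsub>SX\<^esub> u) \<otimes>\<^bsub>SX Quot I\<^esub> (I +>\<^bsub>SX\<^esub> v) = I +>\<^bsub>SX\<^esub> (u \<otimes>\<^bsub>SX\<^esub> v)"
    "(I +>\<^bsub>SX\<^esub> u) \<oplus>\<^bsub>SX Quot I\<^esub> (I +>\<^bsub>SX\<^esub> v) = I +>\<^bsub>SX\<^esub> (u \<oplus>\<^bsub>SX\<^esub> v)"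
  using assms by (simp_all add: FactRing_def I.rcoset_mult_add I.a_rcos_sum)

text \<open>As \<open>phi\<close> is constant on each coset, \<open>the_elem\<close> reads off its
  value. The restriction to the carrier makes the map extensional, so that uniqueness can be stated
  as an equality of functions.\<close>

definition psi where
  "psi = (\<lambda>X\<in>carrier (SX Quot I). the_elem (phi ` X))"

lemma psi_coset: "u \<in> carrier SX \<Longrightarrow> psi (I +>\<^bsub>SX\<^esub> u) = phi u"
proof -
  assume u: "u \<in> carrier SX"
  have "phi v = phi u" if "v \<in> I +>\<^bsub>SX\<^esub> u" for v
  proof -
    obtain i where i: "i \<in> I" "v = i \<oplus>\<^bsub>SX\<^esub> u" using \<open>v \<in> I +>\<^bsub>SX\<^esub> u\<close> by (auto simp: a_r_coset_def')
    have ic: "i \<in> carrier SX" using i(1) I.a_subset by blast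
    show ?thesis unfolding i(2) using ic u I_ker[OF i(1)] phi_D(3)[OF u] by (simp add: phi_D(5))
  qed
  moreover have "u \<in> I +>\<^bsub>SX\<^esub> u" by (rule I.a_rcos_self[OF u])
  ultimately have "phi ` (I +>\<^bsub>SX\<^esub> u) = {phi u}" by blast
  then show ?thesis unfolding psi_def using u by (simp add: Quot_carrier)
qed

text \<open>The homomorphism theorem for the surjection \<open>phi\<close>, with the ideal in the
  place of its kernel.\<close>

lemma psi_iso: "psi \<in> ring_iso (SX Quot I) SY"
proof -
  interpret h: ring_hom_ring SX SY phi by (rule phi_ring_hom)
  have "(\<lambda>X. the_elem (phi ` X)) \<in> ring_iso (SX Quot I) SY"
    using h.FactRing_iso_set[OF phi_surj] unfolding I_eq_kernel .
  moreover have Q: "ring (SX Quot I)" by (rule I.quotient_is_ring)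
  ultimately show ?thesis
    unfolding psi_def ring_iso_def
    by (auto simp: ring_hom_def ring.ring_simprules bij_betw_def inj_on_def cong: image_cong)
qed

theorem quotient_iso:
  "\<exists>!\<psi>. \<psi> \<in> extensional (carrier (SX Quot I))
     \<and> integro_differential_hom (SX Quot I) (induced_map SX I dS) (induced_map SX I iS) SY dS' iS' \<psi>
     \<and> bij_betw \<psi> (carrier (SX Quot I)) (carrier SY)
     \<and> (\<forall>f\<in>carrier R. \<psi> (I +>\<^bsub>SX\<^esub> X.io f) = Y.io f)"
proof (rule ex1I[of _ psi])
  have ind: "induced_map SX I dS (I +>\<^bsub>SX\<^esub> u) = I +>\<^bsub>SX\<^esub> dS u"
    "induced_map SX I iS (I +>\<^bsub>SX\<^esub> u) = I +>\<^bsub>SX\<^esub> iS u" if "u \<in> carrier SX" for u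
    using induced_coset[OF X.dS_hom _ that] induced_coset[OF X.iS_hom _ that] I_dS I_iS by blast+
  have "integro_differential_hom (SX Quot I) (induced_map SX I dS) (induced_map SX I iS) SY dS' iS' psi"
    using psi_iso unfolding integro_differential_hom_def differential_hom_def ring_iso_def
    by (auto simp: Quot_carrier ind psi_coset X.dS_closed X.iS_closed phi_dS phi_iS)
  then show "psi \<in> extensional (carrier (SX Quot I))
     \<and> integro_differential_hom (SX Quot I) (induced_map SX I dS) (induced_map SX I iS) SY dS' iS' psi
     \<and> bij_betw psi (carrier (SX Quot I)) (carrier SY)
     \<and> (\<forall>f\<in>carrier R. psi (I +>\<^bsub>SX\<^esub> X.io f) = Y.io f)"
    using psi_iso by (simp add: ring_iso_def psi_coset phi) (simp add: psi_def)
  fix \<psi> assume \<psi>: "\<psi> \<in> extensional (carrier (SX Quot I))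
     \<and> integro_differential_hom (SX Quot I) (induced_map SX I dS) (induced_map SX I iS) SY dS' iS' \<psi>
     \<and> bij_betw \<psi> (carrier (SX Quot I)) (carrier SY)
     \<and> (\<forall>f\<in>carrier R. \<psi> (I +>\<^bsub>SX\<^esub> X.io f) = Y.io f)"
  have hom: "\<psi> \<in> ring_hom (SX Quot I) SY" using \<psi> unfolding integro_differential_hom_def differential_hom_def by blast
  have mem: "I +>\<^bsub>SX\<^esub> u \<in> carrier (SX Quot I)" if "u \<in> carrier SX" for u using that by (simp add: Quot_carrier)
  have pm: "\<psi> (I +>\<^bsub>SX\<^esub> (u \<otimes>\<^bsub>SX\<^esub> v)) = \<psi> (I +>\<^bsub>SX\<^esub> u) \<otimes>\<^bsub>SY\<^esub> \<psi> (I +>\<^bsub>SX\<^esub> v)"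
    and pa: "\<psi> (I +>\<^bsub>SX\<^esub> (u \<oplus>\<^bsub>SX\<^esub> v)) = \<psi> (I +>\<^bsub>SX\<^esub> u) \<oplus>\<^bsub>SY\<^esub> \<psi> (I +>\<^bsub>SX\<^esub> v)"
    if "u \<in> carrier SX" "v \<in> carrier SX" for u v
    using ring_hom_mult[OF hom mem[OF that(1)] mem[OF that(2)]] ring_hom_add[OF hom mem[OF that(1)] mem[OF that(2)]]
    by (simp_all add: Quot_ops that)
  have pi: "\<psi> (I +>\<^bsub>SX\<^esub> iS u) = iS' (\<psi> (I +>\<^bsub>SX\<^esub> u))" if "u \<in> carrier SX" for u
    using \<psi> mem[OF that] unfolding integro_differential_hom_def ind(2)[OF that, symmetric] by blast
  have pio: "\<psi> (I +>\<^bsub>SX\<^esub> X.io r) = Y.io r" if "r \<in> carrier R" for r using \<psi> that by blast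
  \<comment> \<open>The set on which the two candidates agree, pulled back along the
    projection.\<close>
  define H where "H = {u \<in> carrier SX. \<psi> (I +>\<^bsub>SX\<^esub> u) = phi u}"
  have Hio: "X.io r \<in> H" if "r \<in> carrier R" for r using that by (simp add: H_def pio phi)
  have Hm: "u \<otimes>\<^bsub>SX\<^esub> v \<in> H" if "u \<in> H" "v \<in> H" for u v
    using that by (simp add: H_def pm phi_D)
  have Ha: "u \<oplus>\<^bsub>SX\<^esub> v \<in> H" if "u \<in> H" "v \<in> H" for u v
    using that by (simp add: H_def pa phi_D)
  have "carrier SX \<subseteq> H"
  proof (rule X.generated[OF _ Hm _ Hio genA genK])
    show "submodule H X.C SX"
    proof (rule X.S.submoduleI_smult)
      show "\<zero>\<^bsub>SX\<^esub> \<in> H" using Hio[of "\<zero>"] by simp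
      \<comment> \<open>A scalar acts as multiplication by the image of a constant of R, so this is
        an instance of closure under products.\<close>
      show "c \<odot>\<^bsub>SX\<^esub> u \<in> H" if "c \<in> carrier X.C" "u \<in> H" for c u
      proof -
        have "c \<in> constants R der" "u \<in> carrier SX" using that by (simp_all add: H_def)
        then show ?thesis using Hm[OF Hio that(2), of c] by (simp add: X.io_const_mult X.constants_iff)
      qed
    qed (use Ha in \<open>auto simp: H_def\<close>)
    show "iS u \<in> H" if "u \<in> H" for u using that by (simp add: H_def pi phi_iS X.iS_closed)
  qed
  then have eq: "\<psi> (I +>\<^bsub>SX\<^esub> u) = psi (I +>\<^bsub>SX\<^esub> u)" if "u \<in> carrier SX" for u
    using that by (auto simp: H_def psi_coset)
  show "\<psi> = psi"
  proof (rule extensionalityI)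
    show "\<psi> \<in> extensional (carrier (SX Quot I))" using \<psi> by blast
    show "psi \<in> extensional (carrier (SX Quot I))" by (simp add: psi_def)
  qed (use eq in \<open>auto simp: Quot_carrier\<close>)
qed

end

end

section \<open>Rules for finite sums, and symmetry of the shuffle product\<close>

lemma (in abelian_monoid) finsum_swap:
  assumes "finite A" "finite B" "\<And>i j. \<lbrakk>i \<in> A; j \<in> B\<rbrakk> \<Longrightarrow> f i j \<in> carrier G"
  shows "(\<Oplus>i\<in>A. \<Oplus>j\<in>B. f i j) = (\<Oplus>j\<in>B. \<Oplus>i\<in>A. f i j)"
  using assms(1,3)
proof (induction A rule: finite_induct)
  case empty
  then show ?case by (simp add: finsum_zero)
next
  case (insert a A)
  have c: "f a j \<in> carrier G" "(\<Oplus>i\<in>A. f i j) \<in> carrier G" if "j \<in> B" for j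
    using insert.prems that by (auto intro!: finsum_closed)
  have "(\<Oplus>i\<in>insert a A. \<Oplus>j\<in>B. f i j) = (\<Oplus>j\<in>B. f a j) \<oplus> (\<Oplus>i\<in>A. \<Oplus>j\<in>B. f i j)"
    using insert.hyps insert.prems by (intro finsum_insert) (auto intro!: finsum_closed)
  also have "\<dots> = (\<Oplus>j\<in>B. f a j) \<oplus> (\<Oplus>j\<in>B. \<Oplus>i\<in>A. f i j)"
    using insert.IH insert.prems by simp
  also have "\<dots> = (\<Oplus>j\<in>B. f a j \<oplus> (\<Oplus>i\<in>A. f i j))"
    using c by (intro finsum_addf[symmetric]) auto
  also have "\<dots> = (\<Oplus>j\<in>B. \<Oplus>i\<in>insert a A. f i j)"
  proof (rule finsum_cong')
    show "f a j \<oplus> (\<Oplus>i\<in>A. f i j) = (\<Oplus>i\<in>insert a A. f i j)" if "j \<in> B" for j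
      using insert.hyps insert.prems that by (intro finsum_insert[symmetric]) auto
    show "(\<lambda>j. \<Oplus>i\<in>insert a A. f i j) \<in> B \<rightarrow> carrier G"
      using insert.prems by (auto intro!: finsum_closed)
  qed simp
  finally show ?case .
qed

lemma (in abelian_group) finsum_minus:
  assumes "finite A" "\<And>i. i \<in> A \<Longrightarrow> f i \<in> carrier G" "\<And>i. i \<in> A \<Longrightarrow> g i \<in> carrier G"
  shows "(\<Oplus>i\<in>A. f i \<ominus> g i) = (\<Oplus>i\<in>A. f i) \<ominus> (\<Oplus>i\<in>A. g i)"
  using assms
proof (induction A rule: finite_induct)
  case empty
  then show ?case by (simp add: minus_self)
next
  case (insert a A)
  have c: "(\<Oplus>i\<in>A. f i) \<in> carrier G" "(\<Oplus>i\<in>A. g i) \<in> carrier G" using insert.prems by (auto intro!: finsum_closed)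
  have "(\<Oplus>i\<in>insert a A. f i \<ominus> g i) = (f a \<ominus> g a) \<oplus> ((\<Oplus>i\<in>A. f i) \<ominus> (\<Oplus>i\<in>A. g i))"
    using insert by (subst finsum_insert) auto
  also have "\<dots> = (f a \<oplus> (\<Oplus>i\<in>A. f i)) \<ominus> (g a \<oplus> (\<Oplus>i\<in>A. g i))"
    using c insert.prems by (simp add: minus_eq minus_add a_ac)
  also have "\<dots> = (\<Oplus>i\<in>insert a A. f i) \<ominus> (\<Oplus>i\<in>insert a A. g i)"
    using insert by (subst (1 2) finsum_insert) auto
  finally show ?case .
qed

text \<open>\<open>shuffle\<close> is known through its recursion only, which is symmetric up to the
  order of the two summands.\<close>

lemma shuffle_commute:
  assumes M: "module C M"
  shows "\<lbrakk>u \<in> lists (carrier M); v \<in> lists (carrier M)\<rbrakk> \<Longrightarrow>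
    shuffle C M (pure C M u) (pure C M v) = shuffle C M (pure C M v) (pure C M u)"
proof (induction "length u + length v" arbitrary: u v rule: less_induct)
  case less
  interpret T: module C "tpowers C M" by (rule module_tpowers[OF M])
  show ?case
  proof (cases "u = [] \<or> v = []")
    case True
    then show ?thesis using less.prems by (auto simp: shuffle_Nil[OF M])
  next
    case False
    then obtain x u' y v' where uv: "u = x # u'" "v = y # v'" by (meson neq_Nil_conv)
    then have m: "x \<in> carrier M" "u' \<in> lists (carrier M)" "y \<in> carrier M" "v' \<in> lists (carrier M)"
      using less.prems by auto
    have "pure C M [x] \<otimes>\<^bsub>tensor_algebra C M\<^esub> shuffle C M (pure C M u') (pure C M v) \<in> carrier (tpowers C M)"
      "pure C M [y] \<otimes>\<^bsub>tensor_algebra C M\<^esub> shuffle C M (pure C M u) (pure C M v') \<in> carrier (tpowers C M)"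
      using m less.prems
      by (simp_all add: subsetD[OF tpowers_pos_subset[OF M] pure_mult_pos[OF M]]
        mod_bihom_closed[OF shuffle_bihom[OF M]] pure_closed[OF M])
    then show ?thesis using less.hyps[of u' v] less.hyps[of u v'] less.prems m uv
      by (simp add: shuffle_Cons[OF M] T.M.a_comm)
  qed
qed

section \<open>The constants of the closures\<close>

context qidr
begin

abbreviation "TC \<equiv> tpowers C (RT R Q)"
abbreviation "TP \<equiv> tpowers_pos C (RT R Q)"
abbreviation "ww \<equiv> pure C (RT R Q)"
abbreviation "WW \<equiv> lists (carrier (RT R Q))"
abbreviation "shf \<equiv> shuffle C (RT R Q)"
abbreviation "E2f \<equiv> eps2_free R der Q"
abbreviation "E2 \<equiv> eps2 R der Q"
abbreviation "SM2 \<equiv> SymM2 R der Q"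
abbreviation "K2 \<equiv> C2 R der Q"

lemmas TCm = module_tpowers[OF module_RT]
lemmas TPm = module_tpowers_pos[OF module_RT]
lemmas M2m = module_sym_square[OF TPm]
lemmas ww_pos = pure_pos[OF module_RT]
lemmas ww_closed = pure_closed[OF module_RT]
lemmas shf_pos = shuffle_pos[OF module_RT]
lemmas shf_closed = mod_bihom_closed[OF shuffle_bihom[OF module_RT]]

lemma SM2_eq: "SM2 = Sym C (sym_square C TP)"
  by (simp add: SymM2_def Tens_pos_def)

lemma E2f_eq: "E2f x y = sym_emb C (sym_square C TP) (sym_tens C TP x y)"
  by (simp add: eps2_free_def Tens_pos_def)

lemma algebra_SM2: "algebra C SM2" unfolding SM2_eq by (rule algebra_Sym[OF M2m])

lemma E2f_bihom: "E2f \<in> mod_bihom C TP TP SM2"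
  unfolding SM2_eq E2f_eq[abs_def]
  by (intro mod_bihomI mod_hom_comp[OF sym_emb_hom[OF M2m] mod_bihom_left[OF sym_tens_bihom[OF TPm]]]
      mod_hom_comp[OF sym_emb_hom[OF M2m] mod_bihom_right[OF sym_tens_bihom[OF TPm]]])

lemmas E2f_closed = mod_bihom_closed[OF E2f_bihom]

lemma E2f_commute: "\<lbrakk>x \<in> carrier TP; y \<in> carrier TP\<rbrakk> \<Longrightarrow> E2f x y = E2f y x"
  unfolding E2f_eq by (simp add: sym_tens_commute[OF TPm])

lemma words_td: "w \<in> WW \<Longrightarrow> take i w \<in> WW" "w \<in> WW \<Longrightarrow> drop i w \<in> WW"
  by (auto simp: in_lists_conv_set simp del: RT_sel dest: in_set_takeD in_set_dropD)

lemma drop_pos: "\<lbrakk>w \<in> WW; i < length w\<rbrakk> \<Longrightarrow> ww (drop i w) \<in> carrier TP"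
  by (rule ww_pos) (simp_all add: words_td del: RT_sel)

lemma take_shf_pos: "\<lbrakk>f \<in> WW; g \<in> WW; i < length f; j < length g; 1 - j \<le> i\<rbrakk> \<Longrightarrow>
    shf (ww (take i f)) (ww (take j g)) \<in> carrier TP"
  by (rule shf_pos) (auto simp: words_td simp del: RT_sel)

context
  fixes f g h assumes f: "f \<in> WW" "f \<noteq> []" and g: "g \<in> WW" "g \<noteq> []" and h: "h \<in> WW" "h \<noteq> []"
begin

interpretation SM2: algebra C SM2 by (rule algebra_SM2)

text \<open>The bounds \<open>i < length f\<close> and \<open>j < length g\<close> keep the suffixes
  nonempty, and \<open>1 - j \<le> i\<close> excludes that both prefixes are empty; likewise for
  \<open>k\<close> and \<open>h\<close>. So \<epsilon> is applied to tensors of positive length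
  throughout.\<close>

lemma J2_factors:
  "i < length f \<Longrightarrow> j < length g \<Longrightarrow> 1 - j \<le> i \<Longrightarrow> E2f (ww (drop i f)) (ww (drop j g)) \<in> carrier SM2"
  "i < length f \<Longrightarrow> j < length g \<Longrightarrow> 1 - j \<le> i \<Longrightarrow> E2f (shf (ww (take i f)) (ww (take j g))) (ww h) \<in> carrier SM2"
  "k < length h \<Longrightarrow> j < length g \<Longrightarrow> 1 - j \<le> k \<Longrightarrow> E2f (ww f) (shf (ww (take j g)) (ww (take k h))) \<in> carrier SM2"
  "k < length h \<Longrightarrow> j < length g \<Longrightarrow> 1 - j \<le> k \<Longrightarrow> E2f (ww (drop j g)) (ww (drop k h)) \<in> carrier SM2"
  "E2f (shf (ww f) (ww g)) (ww h) \<in> carrier SM2"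
  "E2f (ww f) (shf (ww g) (ww h)) \<in> carrier SM2"
proof -
  show "k < length h \<Longrightarrow> j < length g \<Longrightarrow> 1 - j \<le> k \<Longrightarrow> E2f (ww f) (shf (ww (take j g)) (ww (take k h))) \<in> carrier SM2"
    by (intro E2f_closed ww_pos f shf_pos) (use f g h in \<open>auto simp: words_td simp del: RT_sel\<close>)
qed (use f g h in \<open>auto intro!: E2f_closed drop_pos take_shf_pos ww_pos shf_pos simp: words_td simp del: RT_sel\<close>)

lemma J2_sum_closed:
  assumes "j < length g"
  shows "(\<Oplus>\<^bsub>SM2\<^esub>i\<in>{1 - j..<length f}. E2f (ww (drop i f)) (ww (drop j g)) \<otimes>\<^bsub>SM2\<^esub>
           E2f (shf (ww (take i f)) (ww (take j g))) (ww h)) \<in> carrier SM2"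
    "(\<Oplus>\<^bsub>SM2\<^esub>k\<in>{1 - j..<length h}. E2f (ww f) (shf (ww (take j g)) (ww (take k h))) \<otimes>\<^bsub>SM2\<^esub>
           E2f (ww (drop j g)) (ww (drop k h))) \<in> carrier SM2"
  using assms J2_factors by (auto intro!: SM2.M.finsum_closed SM2.m_closed)

lemma J2_generator_closed: "J2_generator R der Q f g h \<in> carrier SM2"
  unfolding J2_generator_def
  using J2_sum_closed J2_factors(5,6)
  by (intro SM2.M.a_closed SM2.M.minus_closed SM2.M.finsum_closed) auto

text \<open>Applied twice: to the projection onto C_2, where the image is zero, and to the
  homomorphism that kills every \<epsilon>.\<close>

lemma J2_generator_image:
  assumes P: "algebra C P" and \<chi>: "\<chi> \<in> alg_hom C SM2 P"
  shows "\<chi> (J2_generator R der Q f g h) =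
    (\<chi> (E2f (shf (ww f) (ww g)) (ww h)) \<ominus>\<^bsub>P\<^esub> \<chi> (E2f (ww f) (shf (ww g) (ww h)))) \<oplus>\<^bsub>P\<^esub>
     (\<Oplus>\<^bsub>P\<^esub>j\<in>{0..<length g}.
        (\<Oplus>\<^bsub>P\<^esub>i\<in>{1 - j..<length f}. \<chi> (E2f (ww (drop i f)) (ww (drop j g))) \<otimes>\<^bsub>P\<^esub>
           \<chi> (E2f (shf (ww (take i f)) (ww (take j g))) (ww h))) \<ominus>\<^bsub>P\<^esub>
        (\<Oplus>\<^bsub>P\<^esub>k\<in>{1 - j..<length h}. \<chi> (E2f (ww f) (shf (ww (take j g)) (ww (take k h)))) \<otimes>\<^bsub>P\<^esub>
           \<chi> (E2f (ww (drop j g)) (ww (drop k h)))))"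
proof -
  interpret P: algebra C P by fact
  note m = alg_homD(1)[OF \<chi>]
  note \<chi>m = mod_hom_minus[OF SM2.module_axioms P.module_axioms m]
  note \<chi>s = mod_hom_finsum[OF SM2.module_axioms P.module_axioms m]
  note \<chi>c = alg_homD(3)[OF \<chi>]
  have 1: "\<chi> (\<Oplus>\<^bsub>SM2\<^esub>i\<in>{1 - j..<length f}. E2f (ww (drop i f)) (ww (drop j g)) \<otimes>\<^bsub>SM2\<^esub>
           E2f (shf (ww (take i f)) (ww (take j g))) (ww h)) =
        (\<Oplus>\<^bsub>P\<^esub>i\<in>{1 - j..<length f}. \<chi> (E2f (ww (drop i f)) (ww (drop j g))) \<otimes>\<^bsub>P\<^esub>
           \<chi> (E2f (shf (ww (take i f)) (ww (take j g))) (ww h)))"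
    if j: "j < length g" for j
  proof -
    have "\<chi> (\<Oplus>\<^bsub>SM2\<^esub>i\<in>{1 - j..<length f}. E2f (ww (drop i f)) (ww (drop j g)) \<otimes>\<^bsub>SM2\<^esub>
           E2f (shf (ww (take i f)) (ww (take j g))) (ww h)) =
        (\<Oplus>\<^bsub>P\<^esub>i\<in>{1 - j..<length f}. \<chi> (E2f (ww (drop i f)) (ww (drop j g)) \<otimes>\<^bsub>SM2\<^esub>
           E2f (shf (ww (take i f)) (ww (take j g))) (ww h)))"
      using J2_factors(1,2) j by (intro \<chi>s) auto
    also have "\<dots> = (\<Oplus>\<^bsub>P\<^esub>i\<in>{1 - j..<length f}. \<chi> (E2f (ww (drop i f)) (ww (drop j g))) \<otimes>\<^bsub>P\<^esub>
           \<chi> (E2f (shf (ww (take i f)) (ww (take j g))) (ww h)))"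
      using J2_factors(1,2) j \<chi>c by (intro P.M.finsum_cong') (auto simp: alg_homD(4)[OF \<chi>])
    finally show ?thesis .
  qed
  have 2: "\<chi> (\<Oplus>\<^bsub>SM2\<^esub>k\<in>{1 - j..<length h}. E2f (ww f) (shf (ww (take j g)) (ww (take k h))) \<otimes>\<^bsub>SM2\<^esub>
           E2f (ww (drop j g)) (ww (drop k h))) =
        (\<Oplus>\<^bsub>P\<^esub>k\<in>{1 - j..<length h}. \<chi> (E2f (ww f) (shf (ww (take j g)) (ww (take k h)))) \<otimes>\<^bsub>P\<^esub>
           \<chi> (E2f (ww (drop j g)) (ww (drop k h))))"
    if j: "j < length g" for j
  proof -
    have "\<chi> (\<Oplus>\<^bsub>SM2\<^esub>k\<in>{1 - j..<length h}. E2f (ww f) (shf (ww (take j g)) (ww (take k h))) \<otimes>\<^bsub>SM2\<^esub>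
           E2f (ww (drop j g)) (ww (drop k h))) =
        (\<Oplus>\<^bsub>P\<^esub>k\<in>{1 - j..<length h}. \<chi> (E2f (ww f) (shf (ww (take j g)) (ww (take k h))) \<otimes>\<^bsub>SM2\<^esub>
           E2f (ww (drop j g)) (ww (drop k h))))"
      using J2_factors(3,4) j by (intro \<chi>s) auto
    also have "\<dots> = (\<Oplus>\<^bsub>P\<^esub>k\<in>{1 - j..<length h}. \<chi> (E2f (ww f) (shf (ww (take j g)) (ww (take k h)))) \<otimes>\<^bsub>P\<^esub>
           \<chi> (E2f (ww (drop j g)) (ww (drop k h))))"
      using J2_factors(3,4) j \<chi>c by (intro P.M.finsum_cong') (auto simp: alg_homD(4)[OF \<chi>])
    finally show ?thesis .
  qed
  let ?S1 = "\<lambda>j. \<Oplus>\<^bsub>SM2\<^esub>i\<in>{1 - j..<length f}. E2f (ww (drop i f)) (ww (drop j g)) \<otimes>\<^bsub>SM2\<^esub>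
           E2f (shf (ww (take i f)) (ww (take j g))) (ww h)"
  let ?S2 = "\<lambda>j. \<Oplus>\<^bsub>SM2\<^esub>k\<in>{1 - j..<length h}. E2f (ww f) (shf (ww (take j g)) (ww (take k h))) \<otimes>\<^bsub>SM2\<^esub>
           E2f (ww (drop j g)) (ww (drop k h))"
  have 3: "\<chi> (\<Oplus>\<^bsub>SM2\<^esub>j\<in>{0..<length g}. ?S1 j \<ominus>\<^bsub>SM2\<^esub> ?S2 j) = (\<Oplus>\<^bsub>P\<^esub>j\<in>{0..<length g}. \<chi> (?S1 j \<ominus>\<^bsub>SM2\<^esub> ?S2 j))"
    using J2_sum_closed by (intro \<chi>s) auto
  have 4: "(\<Oplus>\<^bsub>P\<^esub>j\<in>{0..<length g}. \<chi> (?S1 j \<ominus>\<^bsub>SM2\<^esub> ?S2 j)) = (\<Oplus>\<^bsub>P\<^esub>j\<in>{0..<length g}. \<chi> (?S1 j) \<ominus>\<^bsub>P\<^esub> \<chi> (?S2 j))"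
    using J2_sum_closed \<chi>c by (intro P.M.finsum_cong') (auto simp: \<chi>m)
  have 5: "(\<Oplus>\<^bsub>P\<^esub>j\<in>{0..<length g}. \<chi> (?S1 j) \<ominus>\<^bsub>P\<^esub> \<chi> (?S2 j)) = (\<Oplus>\<^bsub>P\<^esub>j\<in>{0..<length g}.
        (\<Oplus>\<^bsub>P\<^esub>i\<in>{1 - j..<length f}. \<chi> (E2f (ww (drop i f)) (ww (drop j g))) \<otimes>\<^bsub>P\<^esub>
           \<chi> (E2f (shf (ww (take i f)) (ww (take j g))) (ww h))) \<ominus>\<^bsub>P\<^esub>
        (\<Oplus>\<^bsub>P\<^esub>k\<in>{1 - j..<length h}. \<chi> (E2f (ww f) (shf (ww (take j g)) (ww (take k h)))) \<otimes>\<^bsub>P\<^esub>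
           \<chi> (E2f (ww (drop j g)) (ww (drop k h)))))"
    by (intro P.M.finsum_cong') (use J2_factors \<chi>c in \<open>auto simp: 1[unfolded One_nat_def] 2[unfolded One_nat_def] intro!: P.M.finsum_closed P.M.minus_closed P.m_closed\<close>)
  have "(\<Oplus>\<^bsub>SM2\<^esub>j\<in>{0..<length g}. ?S1 j \<ominus>\<^bsub>SM2\<^esub> ?S2 j) \<in> carrier SM2"
    using J2_sum_closed by (intro SM2.M.finsum_closed) auto
  then show ?thesis
    unfolding J2_generator_def
    using J2_factors(5,6) by (simp only: alg_homD(5)[OF \<chi>] \<chi>m SM2.M.minus_closed 3 4 5)
qed

end

section \<open>The algebra C_2 and its pairing\<close>

lemma ideal_J2: "ideal (J2 R der Q) SM2"
proof -
  interpret SM2: algebra C SM2 by (rule algebra_SM2)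
  show ?thesis unfolding J2_def
    by (rule SM2.genideal_ideal) (use J2_generator_closed in blast)
qed

lemma J2_generator_in: "\<lbrakk>f \<in> WW; g \<in> WW; h \<in> WW; f \<noteq> []; g \<noteq> []; h \<noteq> []\<rbrakk> \<Longrightarrow> J2_generator R der Q f g h \<in> J2 R der Q"
proof -
  interpret SM2: algebra C SM2 by (rule algebra_SM2)
  assume "f \<in> WW" "g \<in> WW" "h \<in> WW" "f \<noteq> []" "g \<noteq> []" "h \<noteq> []"
  moreover have "{J2_generator R der Q f g h |f g h. f \<in> WW \<and> g \<in> WW \<and> h \<in> WW \<and> f \<noteq> [] \<and> g \<noteq> [] \<and> h \<noteq> []} \<subseteq> J2 R der Q"
    unfolding J2_def by (rule SM2.genideal_self) (use J2_generator_closed in blast)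
  ultimately show ?thesis by blast
qed

lemma algebra_K2: "algebra C K2"
  unfolding C2_def by (rule algebra_quot_alg[OF algebra_SM2 ideal_J2])

lemmas K2m = algebra_is_module[OF algebra_K2]

abbreviation "\<pi>2 x \<equiv> J2 R der Q +>\<^bsub>SM2\<^esub> x"

lemma pi2: "(\<lambda>x. \<pi>2 x) \<in> alg_hom C SM2 K2"
  unfolding C2_def by (rule quot_proj_alg_hom[OF algebra_SM2 ideal_J2])

lemma E2_eq: "E2 x y = \<pi>2 (E2f x y)" by (simp add: eps2_def)

lemma E2_bihom: "E2 \<in> mod_bihom C TP TP K2"
  unfolding E2_eq[abs_def]
  by (intro mod_bihomI mod_hom_comp[OF alg_homD(1)[OF pi2] mod_bihom_left[OF E2f_bihom]]
      mod_hom_comp[OF alg_homD(1)[OF pi2] mod_bihom_right[OF E2f_bihom]])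

definition rho where
  "rho = (SOME \<rho>. \<rho> \<in> mod_hom C TC TP \<and> \<rho> (ww []) = \<zero>\<^bsub>TC\<^esub> \<and> (\<forall>t\<in>carrier TP. \<rho> t = t))"

lemma rho: "rho \<in> mod_hom C TC TP" "rho (ww []) = \<zero>\<^bsub>TC\<^esub>" "t \<in> carrier TP \<Longrightarrow> rho t = t"
proof -
  have "\<exists>\<rho>. \<rho> \<in> mod_hom C TC TP \<and> \<rho> (ww []) = \<zero>\<^bsub>TC\<^esub> \<and> (\<forall>t\<in>carrier TP. \<rho> t = t)"
    using tpowers_proj[OF module_RT] by metis
  from someI_ex[OF this, folded rho_def]
  show "rho \<in> mod_hom C TC TP" "rho (ww []) = \<zero>\<^bsub>TC\<^esub>" "t \<in> carrier TP \<Longrightarrow> rho t = t" by blast+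
qed

lemmas rho_closed = mod_hom_closed[OF rho(1)]

lemma zero_TP: "\<zero>\<^bsub>TP\<^esub> = \<zero>\<^bsub>TC\<^esub>" by (simp add: tpowers_pos_def)

text \<open>The pairing \<epsilon> is given on tensors of positive length. Extended by zero it
  becomes a pairing on all tensors, as the abstract construction requires, and it is unchanged where
  it was defined.\<close>

definition e2c where "e2c x y = E2 (rho x) (rho y)"

lemma e2c_bihom: "e2c \<in> mod_bihom C TC TC K2"
  unfolding e2c_def[abs_def]
  by (intro mod_bihomI mod_hom_comp[OF mod_bihom_left[OF E2_bihom] rho(1)]
      mod_hom_comp[OF mod_bihom_right[OF E2_bihom] rho(1)] rho_closed)

lemmas e2c_closed = mod_bihom_closed[OF e2c_bihom]

lemma e2c_pos: "\<lbrakk>x \<in> carrier TP; y \<in> carrier TP\<rbrakk> \<Longrightarrow> e2c x y = E2 x y"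
  by (simp add: e2c_def rho)

lemma e2c_Nil: "y \<in> carrier TC \<Longrightarrow> e2c (ww []) y = \<zero>\<^bsub>K2\<^esub>"
  unfolding e2c_def rho(2) zero_TP[symmetric]
  by (rule mod_hom_zero[OF TPm K2m mod_bihom_left[OF E2_bihom rho_closed]])

lemma e2c_commute: "\<lbrakk>x \<in> carrier TC; y \<in> carrier TC\<rbrakk> \<Longrightarrow> e2c x y = e2c y x"
  unfolding e2c_def E2_eq by (simp add: E2f_commute[OF rho_closed rho_closed])

text \<open>The relation J_2 in symmetric form. The index pair (0, 0), which J_2 omits, contributes
  zero; the order of summation is exchanged; and symmetry of \<epsilon> and of the shuffle turns the
  subtracted half into the other one with \<open>f\<close> and \<open>h\<close> exchanged.\<close>

lemma e2c_assoc:
  assumes f: "f \<in> WW" "f \<noteq> []" and g: "g \<in> WW" "g \<noteq> []" and h: "h \<in> WW" "h \<noteq> []"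
  shows "e2c (shf (ww f) (ww g)) (ww h) \<oplus>\<^bsub>K2\<^esub>
        (\<Oplus>\<^bsub>K2\<^esub>i\<in>{0..<length f}. \<Oplus>\<^bsub>K2\<^esub>j\<in>{0..<length g}. e2c (ww (drop i f)) (ww (drop j g)) \<otimes>\<^bsub>K2\<^esub>
          e2c (shf (ww (take i f)) (ww (take j g))) (ww h)) =
      e2c (shf (ww h) (ww g)) (ww f) \<oplus>\<^bsub>K2\<^esub>
        (\<Oplus>\<^bsub>K2\<^esub>i\<in>{0..<length h}. \<Oplus>\<^bsub>K2\<^esub>j\<in>{0..<length g}. e2c (ww (drop i h)) (ww (drop j g)) \<otimes>\<^bsub>K2\<^esub>
          e2c (shf (ww (take i h)) (ww (take j g))) (ww f))"
proof -
  interpret K2: algebra C K2 by (rule algebra_K2)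
  interpret SM2: algebra C SM2 by (rule algebra_SM2)
  define a where "a u v i j = e2c (ww (drop i u)) (ww (drop j g)) \<otimes>\<^bsub>K2\<^esub>
      e2c (shf (ww (take i u)) (ww (take j g))) (ww v)" for u v i j
  have ac: "a u v i j \<in> carrier K2" if "u \<in> WW" "v \<in> WW" for u v i j
    unfolding a_def using that g by (intro K2.m_closed e2c_closed shf_closed ww_closed words_td)
  \<comment> \<open>With both prefixes empty, the second factor is a pairing with the empty
    tensor.\<close>
  have a00: "a u v 0 0 = \<zero>\<^bsub>K2\<^esub>" if "u \<in> WW" "v \<in> WW" for u v
    unfolding a_def using that g
    by (simp add: shuffle_Nil[OF module_RT] e2c_Nil e2c_closed ww_closed del: RT_sel)
  have ext: "(\<Oplus>\<^bsub>K2\<^esub>i\<in>{1 - j..<length u}. a u v i j) = (\<Oplus>\<^bsub>K2\<^esub>i\<in>{0..<length u}. a u v i j)"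
    if "u \<in> WW" "v \<in> WW" for u v j
  proof (rule K2.M.add.finprod_mono_neutral_cong_left)
    show "a u v i j = \<zero>\<^bsub>K2\<^esub>" if "i \<in> {0..<length u} - {1 - j..<length u}" for i
    proof -
      \<comment> \<open>The bound \<open>1 - j\<close> exceeds 0 only for \<open>j = 0\<close>, and
        then just the index 0 is omitted.\<close>
      have "i = 0 \<and> j = 0" using that by auto
      then show ?thesis using a00 \<open>u \<in> WW\<close> \<open>v \<in> WW\<close> by simp
    qed
  qed (use ac that in auto)
  have sc: "(\<Oplus>\<^bsub>K2\<^esub>i\<in>{0..<length u}. a u v i j) \<in> carrier K2" if "u \<in> WW" "v \<in> WW" for u v j
    using ac that by (intro K2.M.finsum_closed) auto
  have p: "ww f \<in> carrier TP" "ww g \<in> carrier TP" "ww h \<in> carrier TP"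
    "shf (ww f) (ww g) \<in> carrier TP" "shf (ww g) (ww h) \<in> carrier TP"
    using f g h by (auto intro!: ww_pos shf_pos simp del: RT_sel)
  have e1: "(\<Oplus>\<^bsub>K2\<^esub>i\<in>{1 - j..<length f}. E2 (ww (drop i f)) (ww (drop j g)) \<otimes>\<^bsub>K2\<^esub>
           E2 (shf (ww (take i f)) (ww (take j g))) (ww h)) = (\<Oplus>\<^bsub>K2\<^esub>i\<in>{0..<length f}. a f h i j)"
    if j: "j < length g" for j
  proof -
    have "(\<Oplus>\<^bsub>K2\<^esub>i\<in>{1 - j..<length f}. E2 (ww (drop i f)) (ww (drop j g)) \<otimes>\<^bsub>K2\<^esub>
           E2 (shf (ww (take i f)) (ww (take j g))) (ww h)) = (\<Oplus>\<^bsub>K2\<^esub>i\<in>{1 - j..<length f}. a f h i j)"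
    proof (rule K2.M.finsum_cong')
      show "E2 (ww (drop i f)) (ww (drop j g)) \<otimes>\<^bsub>K2\<^esub> E2 (shf (ww (take i f)) (ww (take j g))) (ww h) = a f h i j"
        if "i \<in> {1 - j..<length f}" for i
      proof -
        have i: "i < length f" "1 - j \<le> i" using that by auto
        show ?thesis unfolding a_def using f(1) g(1) j i
          by (simp only: e2c_pos drop_pos take_shf_pos p(3))
      qed
    qed (use ac f h in auto)
    then show ?thesis using ext f h by simp
  qed
  have e2: "(\<Oplus>\<^bsub>K2\<^esub>k\<in>{1 - j..<length h}. E2 (ww f) (shf (ww (take j g)) (ww (take k h))) \<otimes>\<^bsub>K2\<^esub>
           E2 (ww (drop j g)) (ww (drop k h))) = (\<Oplus>\<^bsub>K2\<^esub>i\<in>{0..<length h}. a h f i j)"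
    if j: "j < length g" for j
  proof -
    have "(\<Oplus>\<^bsub>K2\<^esub>k\<in>{1 - j..<length h}. E2 (ww f) (shf (ww (take j g)) (ww (take k h))) \<otimes>\<^bsub>K2\<^esub>
           E2 (ww (drop j g)) (ww (drop k h))) = (\<Oplus>\<^bsub>K2\<^esub>i\<in>{1 - j..<length h}. a h f i j)"
    proof (rule K2.M.finsum_cong')
      show "E2 (ww f) (shf (ww (take j g)) (ww (take i h))) \<otimes>\<^bsub>K2\<^esub> E2 (ww (drop j g)) (ww (drop i h)) = a h f i j"
        if "i \<in> {1 - j..<length h}" for i
      proof -
        have i: "i < length h" "1 - j \<le> i" using that by auto
        have sw: "shf (ww (take j g)) (ww (take i h)) = shf (ww (take i h)) (ww (take j g))"
          by (rule shuffle_commute[OF module_RT words_td(1)[OF g(1)] words_td(1)[OF h(1)]])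
        have tp: "shf (ww (take i h)) (ww (take j g)) \<in> carrier TP" by (rule take_shf_pos[OF h(1) g(1) i(1) j i(2)])
        note c = drop_pos[OF g(1) j] drop_pos[OF h(1) i(1)] tp p(1)
        have "E2 (ww f) (shf (ww (take i h)) (ww (take j g))) = e2c (shf (ww (take i h)) (ww (take j g))) (ww f)"
          using c e2c_pos E2f_commute unfolding E2_eq by simp
        moreover have "E2 (ww (drop j g)) (ww (drop i h)) = e2c (ww (drop i h)) (ww (drop j g))"
          using c e2c_pos E2f_commute unfolding E2_eq by simp
        moreover have "e2c (shf (ww (take i h)) (ww (take j g))) (ww f) \<in> carrier K2" "e2c (ww (drop i h)) (ww (drop j g)) \<in> carrier K2"
          using f g h by (auto intro!: e2c_closed shf_closed ww_closed words_td simp del: RT_sel)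
        ultimately show ?thesis unfolding a_def sw by (simp add: K2.m_comm)
      qed
    qed (use ac f h in auto)
    then show ?thesis using ext f h by simp
  qed
  have "\<pi>2 (J2_generator R der Q f g h) = \<zero>\<^bsub>K2\<^esub>"
  proof -
    have "submodule (J2 R der Q) C SM2"
      by (rule ideal_submodule[OF SM2.module_axioms SM2.ring_axioms algebra_bihom[OF algebra_SM2] ideal_J2])
    then show ?thesis
      using quot_mod_proj_zero[OF SM2.module_axioms _ J2_generator_closed[OF f g h]]
        J2_generator_in[OF f(1) g(1) h(1) f(2) g(2) h(2)] unfolding C2_def by blast
  qed
  then have "(E2 (shf (ww f) (ww g)) (ww h) \<ominus>\<^bsub>K2\<^esub> E2 (ww f) (shf (ww g) (ww h))) \<oplus>\<^bsub>K2\<^esub>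
     (\<Oplus>\<^bsub>K2\<^esub>j\<in>{0..<length g}.
        (\<Oplus>\<^bsub>K2\<^esub>i\<in>{1 - j..<length f}. E2 (ww (drop i f)) (ww (drop j g)) \<otimes>\<^bsub>K2\<^esub>
           E2 (shf (ww (take i f)) (ww (take j g))) (ww h)) \<ominus>\<^bsub>K2\<^esub>
        (\<Oplus>\<^bsub>K2\<^esub>k\<in>{1 - j..<length h}. E2 (ww f) (shf (ww (take j g)) (ww (take k h))) \<otimes>\<^bsub>K2\<^esub>
           E2 (ww (drop j g)) (ww (drop k h)))) = \<zero>\<^bsub>K2\<^esub>"
    unfolding J2_generator_image[OF f g h algebra_K2 pi2] E2_eq .
  moreover have "(\<Oplus>\<^bsub>K2\<^esub>j\<in>{0..<length g}.
        (\<Oplus>\<^bsub>K2\<^esub>i\<in>{1 - j..<length f}. E2 (ww (drop i f)) (ww (drop j g)) \<otimes>\<^bsub>K2\<^esub>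
           E2 (shf (ww (take i f)) (ww (take j g))) (ww h)) \<ominus>\<^bsub>K2\<^esub>
        (\<Oplus>\<^bsub>K2\<^esub>k\<in>{1 - j..<length h}. E2 (ww f) (shf (ww (take j g)) (ww (take k h))) \<otimes>\<^bsub>K2\<^esub>
           E2 (ww (drop j g)) (ww (drop k h)))) =
      (\<Oplus>\<^bsub>K2\<^esub>j\<in>{0..<length g}. (\<Oplus>\<^bsub>K2\<^esub>i\<in>{0..<length f}. a f h i j) \<ominus>\<^bsub>K2\<^esub> (\<Oplus>\<^bsub>K2\<^esub>i\<in>{0..<length h}. a h f i j))"
    using sc f(1) h(1) by (intro K2.M.finsum_cong') (auto simp: e1[unfolded One_nat_def] e2[unfolded One_nat_def] simp del: RT_sel)
  moreover have "\<dots> = (\<Oplus>\<^bsub>K2\<^esub>j\<in>{0..<length g}. \<Oplus>\<^bsub>K2\<^esub>i\<in>{0..<length f}. a f h i j) \<ominus>\<^bsub>K2\<^esub>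
      (\<Oplus>\<^bsub>K2\<^esub>j\<in>{0..<length g}. \<Oplus>\<^bsub>K2\<^esub>i\<in>{0..<length h}. a h f i j)"
    using sc f(1) h(1) by (intro K2.M.finsum_minus) auto
  moreover have "(\<Oplus>\<^bsub>K2\<^esub>j\<in>{0..<length g}. \<Oplus>\<^bsub>K2\<^esub>i\<in>{0..<length f}. a f h i j) =
      (\<Oplus>\<^bsub>K2\<^esub>i\<in>{0..<length f}. \<Oplus>\<^bsub>K2\<^esub>j\<in>{0..<length g}. a f h i j)"
    using ac f(1) h(1) by (intro K2.M.finsum_swap) auto
  moreover have "(\<Oplus>\<^bsub>K2\<^esub>j\<in>{0..<length g}. \<Oplus>\<^bsub>K2\<^esub>i\<in>{0..<length h}. a h f i j) =
      (\<Oplus>\<^bsub>K2\<^esub>i\<in>{0..<length h}. \<Oplus>\<^bsub>K2\<^esub>j\<in>{0..<length g}. a h f i j)"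
    using ac f(1) h(1) by (intro K2.M.finsum_swap) auto
  moreover have "E2 (shf (ww f) (ww g)) (ww h) = e2c (shf (ww f) (ww g)) (ww h)" using p by (simp add: e2c_pos)
  moreover have "E2 (ww f) (shf (ww g) (ww h)) = e2c (shf (ww h) (ww g)) (ww f)"
    using p shuffle_commute[OF module_RT g(1) h(1)] e2c_commute[OF ww_closed[OF f(1)] shf_closed[OF ww_closed[OF g(1)] ww_closed[OF h(1)]]]
    by (simp add: e2c_pos)
  moreover have "(\<Oplus>\<^bsub>K2\<^esub>i\<in>{0..<length f}. \<Oplus>\<^bsub>K2\<^esub>j\<in>{0..<length g}. a f h i j) \<in> carrier K2"
    "(\<Oplus>\<^bsub>K2\<^esub>i\<in>{0..<length h}. \<Oplus>\<^bsub>K2\<^esub>j\<in>{0..<length g}. a h f i j) \<in> carrier K2"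
    using ac f(1) h(1) by (auto intro!: K2.M.finsum_closed)
  moreover have "e2c (shf (ww f) (ww g)) (ww h) \<in> carrier K2" "e2c (shf (ww h) (ww g)) (ww f) \<in> carrier K2"
    using f g h by (auto intro!: e2c_closed shf_closed ww_closed simp del: RT_sel)
  ultimately have c: "e2c (shf (ww f) (ww g)) (ww h) \<in> carrier K2" "e2c (shf (ww h) (ww g)) (ww f) \<in> carrier K2"
      "(\<Oplus>\<^bsub>K2\<^esub>i\<in>{0..<length f}. \<Oplus>\<^bsub>K2\<^esub>j\<in>{0..<length g}. a f h i j) \<in> carrier K2"
      "(\<Oplus>\<^bsub>K2\<^esub>i\<in>{0..<length h}. \<Oplus>\<^bsub>K2\<^esub>j\<in>{0..<length g}. a h f i j) \<in> carrier K2"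
    and eq: "(e2c (shf (ww f) (ww g)) (ww h) \<ominus>\<^bsub>K2\<^esub> e2c (shf (ww h) (ww g)) (ww f)) \<oplus>\<^bsub>K2\<^esub>
      ((\<Oplus>\<^bsub>K2\<^esub>i\<in>{0..<length f}. \<Oplus>\<^bsub>K2\<^esub>j\<in>{0..<length g}. a f h i j) \<ominus>\<^bsub>K2\<^esub>
       (\<Oplus>\<^bsub>K2\<^esub>i\<in>{0..<length h}. \<Oplus>\<^bsub>K2\<^esub>j\<in>{0..<length g}. a h f i j)) = \<zero>\<^bsub>K2\<^esub>"
    by (simp_all only:)
  have arr: "u = v" if "u' \<in> carrier K2" "v' \<in> carrier K2" "x \<in> carrier K2" "y \<in> carrier K2"
    "(u' \<ominus>\<^bsub>K2\<^esub> v') \<oplus>\<^bsub>K2\<^esub> (x \<ominus>\<^bsub>K2\<^esub> y) = \<zero>\<^bsub>K2\<^esub>" "u = u' \<oplus>\<^bsub>K2\<^esub> x" "v = v' \<oplus>\<^bsub>K2\<^esub> y" for u v u' v' x y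
  proof (rule K2.M.eq_of_minus_zero)
    have "(u' \<oplus>\<^bsub>K2\<^esub> x) \<ominus>\<^bsub>K2\<^esub> (v' \<oplus>\<^bsub>K2\<^esub> y) = (u' \<ominus>\<^bsub>K2\<^esub> v') \<oplus>\<^bsub>K2\<^esub> (x \<ominus>\<^bsub>K2\<^esub> y)"
      using that(1-4) by algebra
    then show "u \<ominus>\<^bsub>K2\<^esub> v = \<zero>\<^bsub>K2\<^esub>" using that(5-7) by simp
  qed (use that in auto)
  show ?thesis unfolding a_def[symmetric] by (rule arr[OF c eq refl refl])
qed

lemma deformed_shuffle_e2c: "deformed_shuffle C (RT R Q) K2 e2c"
  by (rule deformed_shuffle.intro[OF module_RT algebra_K2 e2c_bihom e2c_Nil e2c_commute e2c_assoc])

text \<open>The predicate under the choice in the definition uses \<epsilon>, the abstract one its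
  extension by zero. They are equivalent because the suffixes that occur are nonempty.\<close>

lemma deformed_shuffle_algebra_C2T: "deformed_shuffle_algebra C (RT R Q) K2 e2c (C2T R der Q)"
proof -
  interpret D: deformed_shuffle C "RT R Q" K2 e2c by (rule deformed_shuffle_e2c)
  let ?P = "\<lambda>p. p \<in> mod_bihom C D.N0 D.N0 D.N0 \<and>
         (\<forall>c\<in>carrier K2. \<forall>d\<in>carrier K2. \<forall>f\<in>WW. \<forall>g\<in>WW.
            p (D.tn c (ww f)) (D.tn d (ww g)) =
              D.tn (c \<otimes>\<^bsub>K2\<^esub> d) (shf (ww f) (ww g)) \<oplus>\<^bsub>D.N0\<^esub>
              (\<Oplus>\<^bsub>D.N0\<^esub>i\<in>{0..<length f}. \<Oplus>\<^bsub>D.N0\<^esub>j\<in>{0..<length g}.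
                 D.tn (c \<otimes>\<^bsub>K2\<^esub> d \<otimes>\<^bsub>K2\<^esub> E2 (ww (drop i f)) (ww (drop j g)))
                    (shf (ww (take i f)) (ww (take j g)))))"
  let ?P' = "\<lambda>p. p \<in> mod_bihom C D.N0 D.N0 D.N0 \<and>
         (\<forall>c\<in>carrier K2. \<forall>d\<in>carrier K2. \<forall>f\<in>WW. \<forall>g\<in>WW.
            p (D.tn c (ww f)) (D.tn d (ww g)) = D.act (c \<otimes>\<^bsub>K2\<^esub> d) (D.G f g))"
  have eq: "D.act (c \<otimes>\<^bsub>K2\<^esub> d) (D.G f g) = D.tn (c \<otimes>\<^bsub>K2\<^esub> d) (shf (ww f) (ww g)) \<oplus>\<^bsub>D.N0\<^esub>
              (\<Oplus>\<^bsub>D.N0\<^esub>i\<in>{0..<length f}. \<Oplus>\<^bsub>D.N0\<^esub>j\<in>{0..<length g}.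
                 D.tn (c \<otimes>\<^bsub>K2\<^esub> d \<otimes>\<^bsub>K2\<^esub> E2 (ww (drop i f)) (ww (drop j g)))
                    (shf (ww (take i f)) (ww (take j g))))"
    if m: "c \<in> carrier K2" "d \<in> carrier K2" "f \<in> WW" "g \<in> WW" for c d f g
  proof -
    have cd: "c \<otimes>\<^bsub>K2\<^esub> d \<in> carrier K2" using m by simp
    have t: "D.tn (c \<otimes>\<^bsub>K2\<^esub> d \<otimes>\<^bsub>K2\<^esub> e2c (ww (drop i f)) (ww (drop j g))) (shf (ww (take i f)) (ww (take j g))) \<in> carrier D.N0" for i j
      using m cd by (intro D.tn_closed D.K.m_closed e2c_closed shf_closed ww_closed words_td) 
    have "(\<Oplus>\<^bsub>D.N0\<^esub>i\<in>{0..<length f}. \<Oplus>\<^bsub>D.N0\<^esub>j\<in>{0..<length g}.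
        D.tn (c \<otimes>\<^bsub>K2\<^esub> d \<otimes>\<^bsub>K2\<^esub> E2 (ww (drop i f)) (ww (drop j g))) (shf (ww (take i f)) (ww (take j g)))) =
      (\<Oplus>\<^bsub>D.N0\<^esub>i\<in>{0..<length f}. \<Oplus>\<^bsub>D.N0\<^esub>j\<in>{0..<length g}.
        D.tn (c \<otimes>\<^bsub>K2\<^esub> d \<otimes>\<^bsub>K2\<^esub> e2c (ww (drop i f)) (ww (drop j g))) (shf (ww (take i f)) (ww (take j g))))"
      using m t by (intro D.N0.M.finsum_cong') (auto simp: e2c_pos drop_pos intro!: D.N0.M.finsum_closed D.N0.M.finsum_cong' simp del: RT_sel)
    then show ?thesis unfolding D.act_G[OF cd m(3,4)] by simp
  qed
  have iff: "?P p \<longleftrightarrow> ?P' p" for p using eq by (intro conj_cong ball_cong refl) simp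
  have "\<exists>p. ?P p" unfolding iff by (rule D.product_exists)
  then have "?P (SOME p. ?P p)" by (rule someI_ex)
  then have s: "?P' (SOME p. ?P p)" unfolding iff .
  have "C2T R der Q = D.N0\<lparr>mult := (SOME p. ?P p), one := D.tn \<one>\<^bsub>K2\<^esub> (ww [])\<rparr>"
    unfolding C2T_def Let_def Tens_def ..
  with s show ?thesis
    by (intro deformed_shuffle_algebra.intro[OF deformed_shuffle_e2c] deformed_shuffle_algebra_axioms.intro) blast
qed

text \<open>The submodule is pulled back to the symmetric algebra, where
  \<open>Sym_generated\<close> applies with symmetric products of words as generators.\<close>

lemma K2_generated:
  assumes "submodule H C K2" "\<one>\<^bsub>K2\<^esub> \<in> H"
    and "\<And>f g c. \<lbrakk>f \<in> WW; g \<in> WW; f \<noteq> []; g \<noteq> []; c \<in> H\<rbrakk> \<Longrightarrow> e2c (ww f) (ww g) \<otimes>\<^bsub>K2\<^esub> c \<in> H"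
  shows "carrier K2 \<subseteq> H"
proof -
  interpret K2: algebra C K2 by (rule algebra_K2)
  interpret SM2: algebra C SM2 by (rule algebra_SM2)
  define H' where "H' = {x \<in> carrier SM2. \<pi>2 x \<in> H}"
  note Hm = K2.submoduleE[OF assms(1)]
  have H': "submodule H' C SM2"
    by (rule SM2.submoduleI_smult)
      (use Hm submodule_zero[OF assms(1)] mod_hom_zero[OF SM2.module_axioms K2m alg_homD(1)[OF pi2]] in
        \<open>auto simp: H'_def alg_homD(5,6)[OF pi2]\<close>)
  have "x \<in> H'" if "x \<in> carrier SM2" for x
  proof (rule Sym_generated[OF M2m spans_sym_square[OF TPm spans_tpowers_pos[OF module_RT]] H'[unfolded SM2_eq] _ _
        that[unfolded SM2_eq]])
    show "\<one>\<^bsub>Sym C (sym_square C TP)\<^esub> \<in> H'"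
      using assms(2) SM2.one_closed unfolding SM2_eq[symmetric] by (simp add: H'_def alg_homD(7)[OF pi2])
    fix z y assume z: "z \<in> {sym_tens C TP x y |x y. x \<in> {ww w |w. w \<in> WW \<and> w \<noteq> []} \<and> y \<in> {ww w |w. w \<in> WW \<and> w \<noteq> []}}"
      and y: "y \<in> H'"
    then obtain f g where fg: "f \<in> WW" "f \<noteq> []" "g \<in> WW" "g \<noteq> []" "z = sym_tens C TP (ww f) (ww g)" by blast
    have p: "ww f \<in> carrier TP" "ww g \<in> carrier TP" using fg by (simp_all add: ww_pos del: RT_sel)
    have yc: "y \<in> carrier SM2" "\<pi>2 y \<in> H" using y by (simp_all add: H'_def)
    have "\<pi>2 (E2f (ww f) (ww g) \<otimes>\<^bsub>SM2\<^esub> y) = e2c (ww f) (ww g) \<otimes>\<^bsub>K2\<^esub> \<pi>2 y"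
      using p yc by (simp add: alg_homD(4)[OF pi2] E2f_closed e2c_pos E2_eq)
    also have "\<dots> \<in> H" using assms(3) fg yc by blast
    finally show "sym_emb C (sym_square C TP) z \<otimes>\<^bsub>Sym C (sym_square C TP)\<^esub> y \<in> H'"
      unfolding SM2_eq[symmetric] fg(5) E2f_eq[symmetric] using p yc by (simp add: H'_def E2f_closed)
  qed
  then show ?thesis by (auto simp: C2_def quot_mod_carrier H'_def)
qed

text \<open>The homomorphism to R that sends every \<epsilon> to zero. It respects J_2, since each
  term of a relator has a factor \<epsilon>.\<close>

lemma K2_augmentation:
  obtains \<chi> where "\<chi> \<in> mod_hom C K2 RR" "\<chi> \<one>\<^bsub>K2\<^esub> = \<one>"
proof -
  interpret RR: algebra C RR by (rule algebra_RR)
  interpret SM2: algebra C SM2 by (rule algebra_SM2)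
  have sub: "submodule (J2 R der Q) C SM2"
    by (rule ideal_submodule[OF SM2.module_axioms SM2.ring_axioms algebra_bihom[OF algebra_SM2] ideal_J2])
  obtain a where a: "a \<in> alg_hom C SM2 RR"
    "\<And>x. x \<in> carrier (sym_square C TP) \<Longrightarrow> a (sym_emb C (sym_square C TP) x) = \<zero>\<^bsub>RR\<^esub>"
    using Sym_lift[OF M2m algebra_RR mod_hom_const_zero[OF module_RR]] unfolding SM2_eq by blast
  have a0: "a (E2f x y) = \<zero>\<^bsub>RR\<^esub>" if "x \<in> carrier TP" "y \<in> carrier TP" for x y
    unfolding E2f_eq using a(2) mod_bihom_closed[OF sym_tens_bihom[OF TPm] that] by blast
  have "J2 R der Q \<subseteq> {x \<in> carrier SM2. a x = \<zero>\<^bsub>RR\<^esub>}"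
    unfolding J2_def
  proof (rule SM2.genideal_minimal[OF alg_hom_kernel_ideal[OF SM2.ring_axioms RR.ring_axioms alg_homD(2)[OF a(1)]]], rule subsetI)
    fix x assume "x \<in> {J2_generator R der Q f g h |f g h. f \<in> WW \<and> g \<in> WW \<and> h \<in> WW \<and> f \<noteq> [] \<and> g \<noteq> [] \<and> h \<noteq> []}"
    then obtain f g h where f: "f \<in> WW" "f \<noteq> []" and g: "g \<in> WW" "g \<noteq> []" and h: "h \<in> WW" "h \<noteq> []"
      and x: "x = J2_generator R der Q f g h" by blast
    have p: "ww f \<in> carrier TP" "ww g \<in> carrier TP" "ww h \<in> carrier TP"
      "shf (ww f) (ww g) \<in> carrier TP" "shf (ww g) (ww h) \<in> carrier TP"
      using f g h by (auto intro!: ww_pos shf_pos simp del: RT_sel)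
    have t1: "(\<Oplus>\<^bsub>RR\<^esub>i\<in>{1 - j..<length f}. a (E2f (ww (drop i f)) (ww (drop j g))) \<otimes>\<^bsub>RR\<^esub>
           a (E2f (shf (ww (take i f)) (ww (take j g))) (ww h))) = \<zero>\<^bsub>RR\<^esub>" if j: "j < length g" for j
    proof -
      have "(\<Oplus>\<^bsub>RR\<^esub>i\<in>{1 - j..<length f}. a (E2f (ww (drop i f)) (ww (drop j g))) \<otimes>\<^bsub>RR\<^esub>
           a (E2f (shf (ww (take i f)) (ww (take j g))) (ww h))) = (\<Oplus>\<^bsub>RR\<^esub>i\<in>{1 - j..<length f}. \<zero>\<^bsub>RR\<^esub>)"
        by (rule RR.M.finsum_cong') (use f g j p in \<open>auto simp: a0 drop_pos take_shf_pos simp del: RT_sel self_alg_sel\<close>)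
      then show ?thesis by (simp only: RR.M.finsum_zero)
    qed
    have t2: "(\<Oplus>\<^bsub>RR\<^esub>k\<in>{1 - j..<length h}. a (E2f (ww f) (shf (ww (take j g)) (ww (take k h)))) \<otimes>\<^bsub>RR\<^esub>
           a (E2f (ww (drop j g)) (ww (drop k h)))) = \<zero>\<^bsub>RR\<^esub>" if j: "j < length g" for j
    proof -
      have "(\<Oplus>\<^bsub>RR\<^esub>k\<in>{1 - j..<length h}. a (E2f (ww f) (shf (ww (take j g)) (ww (take k h)))) \<otimes>\<^bsub>RR\<^esub>
           a (E2f (ww (drop j g)) (ww (drop k h)))) = (\<Oplus>\<^bsub>RR\<^esub>k\<in>{1 - j..<length h}. a (E2f (ww f) (shf (ww (take j g)) (ww (take k h)))) \<otimes>\<^bsub>RR\<^esub> \<zero>\<^bsub>RR\<^esub>)"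
      proof (rule RR.M.finsum_cong')
        have cl: "a (E2f (ww f) (shf (ww (take j g)) (ww (take k h)))) \<in> carrier RR" if "k \<in> {1 - j..<length h}" for k
          using J2_factors(3)[OF f g h, of k j] that j by (intro alg_homD(3)[OF a(1)]) simp
        then show "(\<lambda>k. a (E2f (ww f) (shf (ww (take j g)) (ww (take k h)))) \<otimes>\<^bsub>RR\<^esub> \<zero>\<^bsub>RR\<^esub>) \<in> {1 - j..<length h} \<rightarrow> carrier RR"
          by (auto simp del: self_alg_sel)
      qed (use g h j in \<open>auto simp: a0 drop_pos simp del: RT_sel self_alg_sel\<close>)
      also have "\<dots> = (\<Oplus>\<^bsub>RR\<^esub>k\<in>{1 - j..<length h}. \<zero>\<^bsub>RR\<^esub>)"
      proof (rule RR.M.finsum_cong')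
        show "a (E2f (ww f) (shf (ww (take j g)) (ww (take k h)))) \<otimes>\<^bsub>RR\<^esub> \<zero>\<^bsub>RR\<^esub> = \<zero>\<^bsub>RR\<^esub>" if "k \<in> {1 - j..<length h}" for k
          using J2_factors(3)[OF f g h, of k j] that j alg_homD(3)[OF a(1)] by (intro RR.r_null) auto
      qed auto
      finally show ?thesis by (simp only: RR.M.finsum_zero)
    qed
    have "(\<Oplus>\<^bsub>RR\<^esub>j\<in>{0..<length g}.
        (\<Oplus>\<^bsub>RR\<^esub>i\<in>{1 - j..<length f}. a (E2f (ww (drop i f)) (ww (drop j g))) \<otimes>\<^bsub>RR\<^esub>
           a (E2f (shf (ww (take i f)) (ww (take j g))) (ww h))) \<ominus>\<^bsub>RR\<^esub>
        (\<Oplus>\<^bsub>RR\<^esub>k\<in>{1 - j..<length h}. a (E2f (ww f) (shf (ww (take j g)) (ww (take k h)))) \<otimes>\<^bsub>RR\<^esub>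
           a (E2f (ww (drop j g)) (ww (drop k h))))) = (\<Oplus>\<^bsub>RR\<^esub>j\<in>{0..<length g}. \<zero>\<^bsub>RR\<^esub>)"
      by (rule RR.M.finsum_cong')
        (auto simp: t1[unfolded One_nat_def] t2[unfolded One_nat_def] RR.M.minus_self simp del: self_alg_sel)
    then have "a x = \<zero>\<^bsub>RR\<^esub>" unfolding x J2_generator_image[OF f g h algebra_RR a(1)]
      using p by (simp only: a0 RR.M.finsum_zero RR.M.minus_self RR.zero_closed RR.M.l_zero)
    then show "x \<in> {x \<in> carrier SM2. a x = \<zero>\<^bsub>RR\<^esub>}" unfolding x using J2_generator_closed[OF f g h] by blast
  qed
  then have "a x = \<zero>\<^bsub>RR\<^esub>" if "x \<in> J2 R der Q" for x using that by blast
  from quot_mod_lift[OF SM2.module_axioms sub module_RR alg_homD(1)[OF a(1)] this, folded C2_def]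
  obtain \<chi> where \<chi>: "\<chi> \<in> mod_hom C K2 RR" "\<And>x. x \<in> carrier SM2 \<Longrightarrow> \<chi> (\<pi>2 x) = a x" by blast
  have "\<chi> \<one>\<^bsub>K2\<^esub> = \<one>" using \<chi>(2)[OF SM2.one_closed] alg_homD(7)[OF a(1)] alg_homD(7)[OF pi2] by simp
  then show thesis using that \<chi>(1) by blast
qed

end

section \<open>The two closures\<close>

lemma ideal_gen_least:
  "\<lbrakk>integro_differential_ideal I S d i; G \<subseteq> I\<rbrakk> \<Longrightarrow> integro_differential_ideal_gen S d i G \<subseteq> I"
  unfolding integro_differential_ideal_gen_def by blast

lemma ideal_gen_superset: "G \<subseteq> integro_differential_ideal_gen S d i G"
  unfolding integro_differential_ideal_gen_def by blast

text \<open>The whole ring belongs to the intersected family, so the intersection is taken over a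
  nonempty set of ideals.\<close>

lemma ideal_gen_ideal:
  assumes "ring S" "\<And>x. x \<in> carrier S \<Longrightarrow> d x \<in> carrier S" "\<And>x. x \<in> carrier S \<Longrightarrow> i x \<in> carrier S" "G \<subseteq> carrier S"
  shows "integro_differential_ideal (integro_differential_ideal_gen S d i G) S d i"
proof -
  interpret S: ring S by fact
  have "integro_differential_ideal (carrier S) S d i"
    unfolding integro_differential_ideal_def using S.oneideal assms(2,3) by blast
  then have "ideal (\<Inter>{I. integro_differential_ideal I S d i \<and> G \<subseteq> I}) S"
    using assms(4) by (intro S.i_Intersect) (auto simp: integro_differential_ideal_def)
  then show ?thesis
    unfolding integro_differential_ideal_gen_def integro_differential_ideal_def by blast
qed

context qidr
begin

abbreviation "RJm \<equiv> RJ R Q"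
abbreviation "A1 \<equiv> C1 R der Q"
abbreviation "AQ \<equiv> C1Q R der Q"
abbreviation "N2 \<equiv> C2T R der Q"
abbreviation "E1 \<equiv> eps1 R der Q"

definition eQ where "eQ r t = eps1Q R der Q r (rho t)"

lemma A1_eq: "A1 = Sym C (tensor C RJm TC)" by (simp add: C1_def Tens_def)
lemma AQ_eq: "AQ = Sym C (tensor C RJm TP)" by (simp add: C1Q_def Tens_pos_def)
lemma E1_eq: "E1 r t = sym_emb C (tensor C RJm TC) (tens C RJm TC r t)" by (simp add: eps1_def Tens_def)
lemma EQ_eq: "eps1Q R der Q r t = sym_emb C (tensor C RJm TP) (tens C RJm TP r t)"
  by (simp add: eps1Q_def Tens_pos_def)

lemmas M1m = module_tensor[OF module_RJ TCm]
lemmas MQm = module_tensor[OF module_RJ TPm]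

lemma algebra_A1: "algebra C A1" unfolding A1_eq by (rule algebra_Sym[OF M1m])
lemma algebra_AQ: "algebra C AQ" unfolding AQ_eq by (rule algebra_Sym[OF MQm])

lemma E1_bihom: "E1 \<in> mod_bihom C RJm TC A1"
  unfolding A1_eq E1_eq[abs_def]
  by (intro mod_bihomI mod_hom_comp[OF sym_emb_hom[OF M1m] mod_bihom_left[OF tens_bihom[OF module_RJ TCm]]]
      mod_hom_comp[OF sym_emb_hom[OF M1m] mod_bihom_right[OF tens_bihom[OF module_RJ TCm]]])

lemma EQ_bihom: "eps1Q R der Q \<in> mod_bihom C RJm TP AQ"
  unfolding AQ_eq EQ_eq[abs_def]
  by (intro mod_bihomI mod_hom_comp[OF sym_emb_hom[OF MQm] mod_bihom_left[OF tens_bihom[OF module_RJ TPm]]]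
      mod_hom_comp[OF sym_emb_hom[OF MQm] mod_bihom_right[OF tens_bihom[OF module_RJ TPm]]])

lemma eQ_bihom: "eQ \<in> mod_bihom C RJm TC AQ"
  unfolding eQ_def[abs_def]
  by (intro mod_bihomI mod_bihom_left[OF EQ_bihom] mod_hom_comp[OF mod_bihom_right[OF EQ_bihom] rho(1)] rho_closed)

lemma eQ_Nil: "r \<in> carrier RJm \<Longrightarrow> eQ r (ww []) = \<zero>\<^bsub>AQ\<^esub>"
  unfolding eQ_def rho(2) zero_TP[symmetric]
  by (rule mod_hom_zero[OF TPm algebra_is_module[OF algebra_AQ] mod_bihom_right[OF EQ_bihom]])

lemma eQ_pos: "t \<in> carrier TP \<Longrightarrow> eQ r t = eps1Q R der Q r t"
  by (simp add: eQ_def rho(3))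

lemma closure0_A1: "closure0 R der Q K2 e2c N2 A1 E1"
  by (intro closure0.intro closure0_axioms.intro qidr_axioms deformed_shuffle_algebra_C2T algebra_A1 E1_bihom)

lemma closure0_AQ: "closure0 R der Q K2 e2c N2 AQ eQ"
  by (intro closure0.intro closure0_axioms.intro qidr_axioms deformed_shuffle_algebra_C2T algebra_AQ eQ_bihom)

lemma A1_generated:
  assumes "submodule H C A1" "\<one>\<^bsub>A1\<^esub> \<in> H"
    and "\<And>r w a. \<lbrakk>r \<in> carrier RJm; w \<in> WW; a \<in> H\<rbrakk> \<Longrightarrow> E1 r (ww w) \<otimes>\<^bsub>A1\<^esub> a \<in> H"
  shows "carrier A1 \<subseteq> H"
proof
  fix x assume "x \<in> carrier A1"
  then show "x \<in> H"
    unfolding A1_eq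
    by (rule Sym_generated[OF M1m spans_tensor[OF module_RJ TCm spans_carrier[OF module_RJ] spans_tpowers[OF module_RT]]
          assms(1,2)[unfolded A1_eq], rotated])
      (use assms(3) in \<open>auto simp: E1_eq A1_eq simp del: RJ_sel RT_sel\<close>)
qed

text \<open>In this encoding the tensor product with the positive part is not a subset of the one
  with all tensors, so even the inclusion \<open>s\<close> is obtained by lifting. That
  \<open>s\<close> is a section of \<open>p\<close> is checked on generators of \<open>AQ\<close>,
  where both maps preserve the pairing.\<close>

lemma A_maps:
  obtains p s where "p \<in> alg_hom C A1 AQ" "s \<in> alg_hom C AQ A1"
    "\<And>r w. \<lbrakk>r \<in> carrier RJm; w \<in> WW\<rbrakk> \<Longrightarrow> p (E1 r (ww w)) = eQ r (ww w)"
    "\<And>a. a \<in> carrier AQ \<Longrightarrow> p (s a) = a"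
    "\<And>r w. \<lbrakk>r \<in> carrier RJm; w \<in> WW; w \<noteq> []\<rbrakk> \<Longrightarrow> s (eQ r (ww w)) = E1 r (ww w)"
proof -
  interpret AQ: algebra C AQ by (rule algebra_AQ)
  obtain p0 where p0: "p0 \<in> mod_hom C (tensor C RJm TC) AQ"
    "\<And>r t. \<lbrakk>r \<in> carrier RJm; t \<in> carrier TC\<rbrakk> \<Longrightarrow> p0 (tens C RJm TC r t) = eQ r t"
    using tensor_lift[OF module_RJ TCm AQ.module_axioms eQ_bihom] by blast
  obtain p where p: "p \<in> alg_hom C A1 AQ" "\<And>x. x \<in> carrier (tensor C RJm TC) \<Longrightarrow> p (sym_emb C (tensor C RJm TC) x) = p0 x"
    using Sym_lift[OF M1m algebra_AQ p0(1)] unfolding A1_eq by blast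
  have pE: "p (E1 r t) = eQ r t" if "r \<in> carrier RJm" "t \<in> carrier TC" for r t
    unfolding E1_eq using that by (simp add: p(2) tens_closed[OF module_RJ TCm] p0(2) del: RJ_sel)
  have E1P: "E1 \<in> mod_bihom C RJm TP A1"
    by (intro mod_bihomI mod_bihom_left[OF E1_bihom] mod_hom_comp[OF mod_bihom_right[OF E1_bihom] tpowers_pos_incl[OF module_RT]]
        subsetD[OF tpowers_pos_subset[OF module_RT]])
  obtain s0 where s0: "s0 \<in> mod_hom C (tensor C RJm TP) A1"
    "\<And>r t. \<lbrakk>r \<in> carrier RJm; t \<in> carrier TP\<rbrakk> \<Longrightarrow> s0 (tens C RJm TP r t) = E1 r t"
    using tensor_lift[OF module_RJ TPm algebra_is_module[OF algebra_A1] E1P] by blast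
  obtain s where s: "s \<in> alg_hom C AQ A1" "\<And>x. x \<in> carrier (tensor C RJm TP) \<Longrightarrow> s (sym_emb C (tensor C RJm TP) x) = s0 x"
    using Sym_lift[OF MQm algebra_A1 s0(1)] unfolding AQ_eq by blast
  have sE: "s (eps1Q R der Q r t) = E1 r t" if "r \<in> carrier RJm" "t \<in> carrier TP" for r t
    unfolding EQ_eq using that by (simp add: s(2) tens_closed[OF module_RJ TPm] s0(2) del: RJ_sel)
  define H where "H = {a \<in> carrier AQ. p (s a) = a}"
  have ps: "(\<lambda>a. p (s a)) \<in> mod_hom C AQ AQ" by (rule mod_hom_comp[OF alg_homD(1)[OF p(1)] alg_homD(1)[OF s(1)]])
  have H: "submodule H C AQ"
    by (rule AQ.submoduleI_smult)
      (auto simp: H_def mod_hom_add[OF ps] mod_hom_smult[OF ps] mod_hom_zero[OF AQ.module_axioms AQ.module_axioms ps])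
  have psa: "p (s a) = a" if "a \<in> carrier AQ" for a
  proof -
    have "a \<in> H"
    proof (rule Sym_generated[OF MQm spans_tensor[OF module_RJ TPm spans_carrier[OF module_RJ] spans_carrier[OF TPm]]
          H[unfolded AQ_eq] _ _ that[unfolded AQ_eq]])
      show "\<one>\<^bsub>Sym C (tensor C RJm TP)\<^esub> \<in> H"
        unfolding AQ_eq[symmetric] by (simp add: H_def alg_homD(7)[OF s(1)] alg_homD(7)[OF p(1)])
      fix z y assume "z \<in> {tens C RJm TP x y |x y. x \<in> carrier RJm \<and> y \<in> carrier TP}" and y: "y \<in> H"
      then obtain r t where z: "r \<in> carrier RJm" "t \<in> carrier TP" "z = tens C RJm TP r t" by blast
      have e: "eps1Q R der Q r t \<in> carrier AQ" by (rule mod_bihom_closed[OF EQ_bihom z(1,2)])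
      have pse: "p (s (eps1Q R der Q r t)) = eps1Q R der Q r t"
        using sE[OF z(1,2)] pE[OF z(1) subsetD[OF tpowers_pos_subset[OF module_RT] z(2)]] eQ_pos[OF z(2)] by simp
      show "sym_emb C (tensor C RJm TP) z \<otimes>\<^bsub>Sym C (tensor C RJm TP)\<^esub> y \<in> H"
        unfolding AQ_eq[symmetric] z(3) EQ_eq[symmetric] using y e pse
        by (simp add: H_def alg_homD(4)[OF s(1)] alg_homD(4)[OF p(1)] alg_homD(3)[OF s(1)])
    qed
    then show ?thesis by (simp add: H_def)
  qed
  have seQ: "s (eQ r (ww w)) = E1 r (ww w)" if "r \<in> carrier RJm" "w \<in> WW" "w \<noteq> []" for r w
    using sE[OF that(1) ww_pos[OF that(2,3)]] eQ_pos[OF ww_pos[OF that(2,3)]] by simp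
  show thesis by (rule that[OF p(1) s(1) pE[OF _ ww_closed] psa seQ])
qed

text \<open>The homomorphism that sends every generator of the symmetric algebra to zero.\<close>

lemma AQ_augmentation:
  obtains \<chi> where "\<chi> \<in> mod_hom C AQ RR" "\<chi> \<one>\<^bsub>AQ\<^esub> = \<one>"
proof -
  obtain a where a: "a \<in> alg_hom C AQ RR"
    using Sym_lift[OF MQm algebra_RR mod_hom_const_zero[OF module_RR]] unfolding AQ_eq by blast
  show thesis using that[OF alg_homD(1)[OF a]] alg_homD(7)[OF a] by simp
qed

section \<open>Identification of the two instances with IDR and IDR_Q\<close>

interpretation X0: closure0 R der Q K2 e2c N2 A1 E1 by (rule closure0_A1)
interpretation Y0: closure0 R der Q K2 e2c N2 AQ eQ by (rule closure0_AQ)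

lemma IDR_eq: "IDR R der Q = X0.S" by (simp add: IDR_def closure_alg_def)
lemma IDRQ_eq: "IDRQ R der Q = Y0.S" by (simp add: IDRQ_def closure_alg_def)

lemma X_ct: "closure_tens R der Q A1 = X0.ct"
  by (intro ext) (simp add: closure_tens_def X0.ct_def Tens_def)
lemma Y_ct: "closure_tens R der Q AQ = Y0.ct"
  by (intro ext) (simp add: closure_tens_def Y0.ct_def Tens_def)

lemma X_iota: "IDR_iota R der Q = X0.io"
  by (intro ext) (simp add: IDR_iota_def closure_iota_def X_ct X0.ct_def X0.io_def
      tensor_alg_one[OF X0.A X0.algebra_N] X0.N_sel(5))
lemma Y_iota: "IDRQ_iota R der Q = Y0.io"
  by (intro ext) (simp add: IDRQ_iota_def closure_iota_def Y_ct Y0.ct_def Y0.io_def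
      tensor_alg_one[OF Y0.A X0.algebra_N] X0.N_sel(5))

text \<open>The map in the definition is chosen by exactly this specification, once the notations
  for pure tensors are identified.\<close>

lemma X_der: "X0.der_spec (IDR_der R der Q)"
proof -
  have "IDR_der R der Q = (SOME D. X0.der_spec D)"
    unfolding IDR_der_def closure_der_def X0.der_spec_def Let_def X_ct closure_alg_def ..
  then show ?thesis using someI_ex[OF X0.der_spec_exists] by simp
qed

lemma Y_der: "Y0.der_spec (IDRQ_der R der Q)"
proof -
  have "IDRQ_der R der Q = (SOME D. Y0.der_spec D)"
    unfolding IDRQ_der_def closure_der_def Y0.der_spec_def Let_def Y_ct closure_alg_def ..
  then show ?thesis using someI_ex[OF Y0.der_spec_exists] by simp
qed

lemma X_int: "X0.int_spec (IDR_int R der Q)"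
proof -
  have "IDR_int R der Q = (SOME I. X0.int_spec I)"
    unfolding IDR_int_def X0.int_spec_def Let_def X_ct IDR_eq ..
  then show ?thesis using someI_ex[OF X0.int_spec_exists] by simp
qed

text \<open>The integrals of the two closures have the same shape once the pairing \<open>eQ\<close> vanishes on the empty word.\<close>

lemma Y_int: "Y0.int_spec (IDRQ_int R der Q)"
proof -
  let ?P = "\<lambda>I. I \<in> mod_hom C Y0.S Y0.S \<and>
       (\<forall>f0\<in>carrier R. \<forall>c1\<in>carrier AQ. \<forall>c2\<in>carrier K2.
          I (Y0.ct f0 c1 c2 (ww [])) =
            Y0.ct (Q f0) c1 c2 (ww [])
            \<oplus>\<^bsub>Y0.S\<^esub> Y0.ct \<one> c1 c2 (ww [f0 \<ominus> der (Q f0)]) \<and>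
          (\<forall>x\<in>carrier (RT R Q). \<forall>f\<in>WW.
             I (Y0.ct f0 c1 c2 (ww (x # f))) =
               Y0.ct (Q f0) c1 c2 (ww (x # f))
               \<ominus>\<^bsub>Y0.S\<^esub> Y0.ct \<one> (c1 \<otimes>\<^bsub>AQ\<^esub> eps1Q R der Q (Q f0) (ww (x # f))) c2 (ww [])
               \<ominus>\<^bsub>Y0.S\<^esub> I (Y0.ct (Q f0 \<otimes> x) c1 c2 (ww f))
               \<oplus>\<^bsub>Y0.S\<^esub> Y0.ct \<one> c1 c2 (ww ((f0 \<ominus> der (Q f0)) # x # f))))"
  have e: "IDRQ_int R der Q = (SOME I. ?P I)"
    unfolding IDRQ_int_def Let_def Y_ct IDRQ_eq ..
  have nil: "Y0.ct (Q f0) c1 c2 (ww []) \<ominus>\<^bsub>Y0.S\<^esub> Y0.ct \<one> (c1 \<otimes>\<^bsub>AQ\<^esub> eQ (Q f0) (ww [])) c2 (ww []) = Y0.ct (Q f0) c1 c2 (ww [])"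
    if "f0 \<in> carrier R" "c1 \<in> carrier AQ" "c2 \<in> carrier K2" for f0 c1 c2
  proof -
    have "Y0.ct \<one> (c1 \<otimes>\<^bsub>AQ\<^esub> eQ (Q f0) (ww [])) c2 (ww []) = \<zero>\<^bsub>Y0.S\<^esub>"
      using that eQ_Nil[of "Q f0"] by (simp add: Y0.ct_eq Y0.gen_def)
    then show ?thesis using that by (simp add: Y0.ct_eq Y0.gen_closed Q_closed Y0.S.minus_eq)
  qed
  have cons: "eps1Q R der Q r (ww (x # f)) = eQ r (ww (x # f))" if "x \<in> carrier (RT R Q)" "f \<in> WW" for r x f
    using eQ_pos[OF ww_pos[of "x # f"]] that by simp
  have iff: "?P I \<longleftrightarrow> Y0.int_spec I" for I
    unfolding Y0.int_spec_def
    by (intro conj_cong ball_cong refl) (simp_all only: nil cons)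
  have "\<exists>I. ?P I" unfolding iff by (rule Y0.int_spec_exists)
  then have "?P (SOME I. ?P I)" by (rule someI_ex)
  then show ?thesis unfolding e iff .
qed

lemma closure_A1: "closure R der Q K2 e2c N2 A1 E1 (IDR_der R der Q) (IDR_int R der Q)"
  by (intro closure.intro closure0_A1 closure_axioms.intro X_der X_int)

lemma closure_AQ: "closure R der Q K2 e2c N2 AQ eQ (IDRQ_der R der Q) (IDRQ_int R der Q)"
  by (intro closure.intro closure0_AQ closure_axioms.intro Y_der Y_int)

interpretation X: closure R der Q K2 e2c N2 A1 E1 "IDR_der R der Q" "IDR_int R der Q" by (rule closure_A1)
interpretation Y: closure R der Q K2 e2c N2 AQ eQ "IDRQ_der R der Q" "IDRQ_int R der Q" by (rule closure_AQ)

lemma IDRQ_integro_differential: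
  "comm_integro_differential_ring (IDRQ R der Q) (IDRQ_der R der Q) (IDRQ_int R der Q)"
  unfolding IDRQ_eq by (rule Y.integro_differential)

lemma IDRQ_iota_hom: "differential_hom R der (IDRQ R der Q) (IDRQ_der R der Q) (IDRQ_iota R der Q)"
  unfolding IDRQ_eq Y_iota by (rule Y.io_differential_hom)

lemma IDRQ_iota_inj: "inj_on (IDRQ_iota R der Q) (carrier R)"
proof -
  obtain pA where pA: "pA \<in> mod_hom C AQ RR" "pA \<one>\<^bsub>AQ\<^esub> = \<one>" by (rule AQ_augmentation)
  obtain pK where pK: "pK \<in> mod_hom C K2 RR" "pK \<one>\<^bsub>K2\<^esub> = \<one>" by (rule K2_augmentation)
  show ?thesis unfolding Y_iota by (rule Y.io_inj[OF pA pK])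
qed

lemma IDRQ_int_iota:
  "f \<in> carrier R \<Longrightarrow> IDRQ_int R der Q (IDRQ_iota R der Q (der f)) = IDRQ_iota R der Q (Q (der f))"
  unfolding Y_iota by (rule Y.iS_io) (simp_all add: eQ_Nil der_closed)

section \<open>The ideal J_1 and the quotient by it\<close>

definition J1_set where
  "J1_set = {X0.ct c (E1 (Q (der r)) (ww [])) (c' \<odot>\<^bsub>K2\<^esub> \<one>\<^bsub>K2\<^esub>) (c'' \<odot>\<^bsub>TC\<^esub> ww []) |c r c' c''.
        c \<in> constants R der \<and> r \<in> carrier R \<and> c' \<in> constants R der \<and> c'' \<in> constants R der}"

lemma J1_generators_eq: "J1_generators R der Q = submodule_gen C X0.S J1_set"
  by (simp add: J1_generators_def J1_set_def IDR_eq X_ct Tens_def)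

lemma J1_eq: "J1 R der Q = integro_differential_ideal_gen X0.S (IDR_der R der Q) (IDR_int R der Q) (submodule_gen C X0.S J1_set)"
  by (simp add: J1_def J1_generators_eq IDR_eq)

text \<open>Displays the factor that \<open>phi\<close> annihilates; the multiples of the units of
  C_2 and of the tensors are collected into one element of \<open>N2\<close>.\<close>

lemma J1_set_form:
  assumes "x \<in> J1_set"
  obtains c r n where "c \<in> carrier R" "r \<in> carrier R" "n \<in> carrier N2"
    "x = X0.io c \<otimes>\<^bsub>X0.S\<^esub> (X0.al (E1 (Q (der r)) (ww [])) \<otimes>\<^bsub>X0.S\<^esub> X0.nu n)"
proof -
  obtain c r c' c'' where m: "c \<in> constants R der" "r \<in> carrier R" "c' \<in> constants R der" "c'' \<in> constants R der"
    and x: "x = X0.ct c (E1 (Q (der r)) (ww [])) (c' \<odot>\<^bsub>K2\<^esub> \<one>\<^bsub>K2\<^esub>) (c'' \<odot>\<^bsub>TC\<^esub> ww [])"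
    using assms unfolding J1_set_def by blast
  interpret TCi: module C TC by (rule TCm)
  have n: "X0.tn (c' \<odot>\<^bsub>K2\<^esub> \<one>\<^bsub>K2\<^esub>) (c'' \<odot>\<^bsub>TC\<^esub> ww []) \<in> carrier N2"
    using m ww_closed[of "[]"] by (intro X0.tn_closed_N X0.K.smult_closed TCi.smult_closed) simp_all
  have e: "E1 (Q (der r)) (ww []) \<in> carrier A1" using X0.e_closed[of "der r" "[]"] m by (simp add: der_closed)
  show thesis
  proof (rule that[OF _ m(2) n])
    show "c \<in> carrier R" using m by (simp add: constants_iff)
    then show "x = X0.io c \<otimes>\<^bsub>X0.S\<^esub> (X0.al (E1 (Q (der r)) (ww [])) \<otimes>\<^bsub>X0.S\<^esub> X0.nu (X0.tn (c' \<odot>\<^bsub>K2\<^esub> \<one>\<^bsub>K2\<^esub>) (c'' \<odot>\<^bsub>TC\<^esub> ww [])))"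
      unfolding x X0.ct_def using e n
      by (simp add: X0.tens_S tens_alg_closed[OF X0.A X0.algebra_N] X0.jb_tens)
  qed
qed

lemma J1_set_closed: "J1_set \<subseteq> carrier X0.S"
proof
  fix x assume "x \<in> J1_set"
  then obtain c r n where x: "c \<in> carrier R" "r \<in> carrier R" "n \<in> carrier N2"
    "x = X0.io c \<otimes>\<^bsub>X0.S\<^esub> (X0.al (E1 (Q (der r)) (ww [])) \<otimes>\<^bsub>X0.S\<^esub> X0.nu n)"
    by (rule J1_set_form)
  show "x \<in> carrier X0.S" unfolding x(4) using x X0.e_closed[of "der r" "[]"]
    by (intro X0.S.m_closed X0.io_closed X0.al_closed X0.nu_closed) (simp_all add: der_closed)
qed

text \<open>By \<open>quotient_iso\<close> two inclusions are to be shown: J_1 lies in the kernel of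
  \<open>phi\<close>, and J_1 contains the pairing of every element of \<open>RJ\<close> with the
  empty tensor.\<close>

lemma IDR_quotient:
  "\<exists>!\<psi>. \<psi> \<in> extensional (carrier (IDR R der Q Quot J1 R der Q))
       \<and> integro_differential_hom
           (IDR R der Q Quot J1 R der Q)
           (induced_map (IDR R der Q) (J1 R der Q) (IDR_der R der Q))
           (induced_map (IDR R der Q) (J1 R der Q) (IDR_int R der Q))
           (IDRQ R der Q) (IDRQ_der R der Q) (IDRQ_int R der Q) \<psi>
       \<and> bij_betw \<psi> (carrier (IDR R der Q Quot J1 R der Q)) (carrier (IDRQ R der Q))
       \<and> (\<forall>f \<in> carrier R.
            \<psi> (J1 R der Q +>\<^bsub>IDR R der Q\<^esub> IDR_iota R der Q f) = IDRQ_iota R der Q f)"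
proof -
  obtain p s where ps: "p \<in> alg_hom C A1 AQ" "s \<in> alg_hom C AQ A1"
    "\<And>r w. \<lbrakk>r \<in> carrier RJm; w \<in> WW\<rbrakk> \<Longrightarrow> p (E1 r (ww w)) = eQ r (ww w)"
    "\<And>a. a \<in> carrier AQ \<Longrightarrow> p (s a) = a"
    "\<And>r w. \<lbrakk>r \<in> carrier RJm; w \<in> WW; w \<noteq> []\<rbrakk> \<Longrightarrow> s (eQ r (ww w)) = E1 r (ww w)"
    by (rule A_maps) blast
  interpret P: closure_pair R der Q K2 e2c N2 A1 E1 "IDR_der R der Q" "IDR_int R der Q"
    AQ eQ "IDRQ_der R der Q" "IDRQ_int R der Q" p s
    by (intro closure_pair.intro closure_pair_axioms.intro closure_A1 closure_AQ ps eQ_Nil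
        A1_generated K2_generated)
  define I where "I = J1 R der Q"
  have gen_sub: "submodule_gen C X0.S J1_set \<subseteq> carrier X0.S"
    using module.submoduleE(1)[OF X0.Sm submodule_gen_submodule[OF X0.Sm J1_set_closed]] .
  have I: "integro_differential_ideal I X0.S (IDR_der R der Q) (IDR_int R der Q)"
    unfolding I_def J1_eq
    by (rule ideal_gen_ideal[OF X0.S.ring_axioms X.dS_closed X.iS_closed gen_sub])
  have ker: "ideal {u \<in> carrier X0.S. P.phi u = \<zero>\<^bsub>Y0.S\<^esub>} X0.S"
    by (rule alg_hom_kernel_ideal[OF X0.S.ring_axioms Y0.S.ring_axioms P.phi_D(2)])
  \<comment> \<open>Since \<open>phi\<close> commutes with derivation and integral, its kernel is
    closed under both; by minimality J_1 lies in it as soon as the generators do.\<close>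
  have "integro_differential_ideal {u \<in> carrier X0.S. P.phi u = \<zero>\<^bsub>Y0.S\<^esub>} X0.S (IDR_der R der Q) (IDR_int R der Q)"
    unfolding integro_differential_ideal_def
    using ker by (simp add: X.dS_closed X.iS_closed P.phi_dS P.phi_iS Y.dS_zero Y.iS_zero)
  moreover have "submodule_gen C X0.S J1_set \<subseteq> {u \<in> carrier X0.S. P.phi u = \<zero>\<^bsub>Y0.S\<^esub>}"
  proof (rule submodule_gen_least)
    show "submodule {u \<in> carrier X0.S. P.phi u = \<zero>\<^bsub>Y0.S\<^esub>} C X0.S"
      by (rule ideal_submodule[OF X0.Sm X0.S.ring_axioms algebra_bihom[OF X0.S] ker])
    show "J1_set \<subseteq> {u \<in> carrier X0.S. P.phi u = \<zero>\<^bsub>Y0.S\<^esub>}"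
    proof
      fix x assume xJ: "x \<in> J1_set"
      then obtain c r n where x: "c \<in> carrier R" "r \<in> carrier R" "n \<in> carrier N2"
        "x = X0.io c \<otimes>\<^bsub>X0.S\<^esub> (X0.al (E1 (Q (der r)) (ww [])) \<otimes>\<^bsub>X0.S\<^esub> X0.nu n)"
        by (rule J1_set_form)
      have q: "Q (der r) \<in> carrier RJm" using x by (simp add: der_closed)
      have e: "E1 (Q (der r)) (ww []) \<in> carrier A1" using X0.e_closed[of "der r" "[]"] x by (simp add: der_closed)
      have "P.phi (X0.al (E1 (Q (der r)) (ww []))) = \<zero>\<^bsub>Y0.S\<^esub>"
        using P.phi(3)[OF e] ps(3)[OF q, of "[]"] eQ_Nil[OF q] by simp
      then have "P.phi x = \<zero>\<^bsub>Y0.S\<^esub>" unfolding x(4) using x(1-3) e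
        by (simp add: P.phi_D(4) P.phi_D(3))
      then show "x \<in> {u \<in> carrier X0.S. P.phi u = \<zero>\<^bsub>Y0.S\<^esub>}" using xJ J1_set_closed by blast
    qed
  qed
  ultimately have I_ker: "P.phi u = \<zero>\<^bsub>Y0.S\<^esub>" if "u \<in> I" for u
    using that ideal_gen_least unfolding I_def J1_eq by blast
  have I_gen: "X0.al (E1 r (ww [])) \<in> I" if r0: "r \<in> carrier RJm" for r
  proof -
    obtain f where f: "f \<in> carrier R" "r = Q f" using r0 by auto
    \<comment> \<open>The generators contain Q\<partial>r only, but Q\<partial>Q = Q gives every
      element of \<open>RJ\<close> this form.\<close>
    have r: "r \<in> carrier R" "Q (der r) = r" using f by (simp_all add: Q_closed Q_der_Q)
    interpret TCi: module C TC by (rule TCm)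
    have e: "E1 r (ww []) \<in> carrier A1" using X0.e_closed[OF f(1), of "[]"] f(2) by simp
    have one: "\<one> \<in> constants R der" by (simp add: constants_iff der_one)
    have s: "\<one> \<odot>\<^bsub>K2\<^esub> \<one>\<^bsub>K2\<^esub> = \<one>\<^bsub>K2\<^esub>" "\<one> \<odot>\<^bsub>TC\<^esub> ww [] = ww []"
      using X0.K.smult_one[OF X0.K.one_closed] TCi.smult_one[OF ww_closed[of "[]"]] by simp_all
    have "X0.al (E1 r (ww [])) = X0.ct \<one> (E1 (Q (der r)) (ww [])) (\<one> \<odot>\<^bsub>K2\<^esub> \<one>\<^bsub>K2\<^esub>) (\<one> \<odot>\<^bsub>TC\<^esub> ww [])"
      unfolding s r(2) using e by (simp add: X0.ct_eq X0.gen_def)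
    also have "\<dots> \<in> J1_set" unfolding J1_set_def using one r(1) by blast
    finally show ?thesis
      unfolding I_def J1_eq by (rule subsetD[OF ideal_gen_superset, OF subsetD[OF submodule_gen_superset]])
  qed
  show ?thesis
    unfolding IDR_eq IDRQ_eq X_iota Y_iota I_def[symmetric]
    by (rule P.quotient_iso[OF I I_ker I_gen])
qed

end

theorem theorem44:
  fixes R :: "'a ring" and der :: "'a \<Rightarrow> 'a" and Q :: "'a \<Rightarrow> 'a"
  assumes "comm_quasi_integro_differential_ring R der Q"
  shows "comm_integro_differential_ring (IDRQ R der Q) (IDRQ_der R der Q) (IDRQ_int R der Q)
     \<and> (differential_hom R der (IDRQ R der Q) (IDRQ_der R der Q) (IDRQ_iota R der Q)
       \<and> inj_on (IDRQ_iota R der Q) (carrier R)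
       \<and> (\<forall>f \<in> der ` carrier R. IDRQ_int R der Q (IDRQ_iota R der Q f) = IDRQ_iota R der Q (Q f)))
     \<and> (\<exists>!\<psi>. \<psi> \<in> extensional (carrier (IDR R der Q Quot J1 R der Q))
       \<and> integro_differential_hom
           (IDR R der Q Quot J1 R der Q)
           (induced_map (IDR R der Q) (J1 R der Q) (IDR_der R der Q))
           (induced_map (IDR R der Q) (J1 R der Q) (IDR_int R der Q))
           (IDRQ R der Q) (IDRQ_der R der Q) (IDRQ_int R der Q) \<psi>
       \<and> bij_betw \<psi> (carrier (IDR R der Q Quot J1 R der Q)) (carrier (IDRQ R der Q))
       \<and> (\<forall>f \<in> carrier R.
            \<psi> (J1 R der Q +>\<^bsub>IDR R der Q\<^esub> IDR_iota R der Q f) = IDRQ_iota R der Q f))"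
proof -
  interpret qidr R der Q by (rule qidr.intro) fact
  show ?thesis
    using IDRQ_integro_differential IDRQ_iota_hom IDRQ_iota_inj IDRQ_int_iota IDR_quotient by blast
qed

end
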